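(* Let $k$ be a field, let $n$ be an even natural number $\geq 2$, and let $U$ be the associative $k$-algebra defined by generators $x_1, \ldots , x_n$ subject to the single relation $$\sum_{1\leq i \leq n/2} [x_i, x_{i+n/2}] = v + \lambda,$$ where the bracket stands for the commutator, $v$ is a $k$-linear combination of the $x_i$'s, and $\lambda \in k$. Then the filtered algebra $U$ is Koszul and $\mathrm{HH}^i(U, U\otimes U)=0$ whenever $i\neq 2$. Furthermore, $U$ is $2$-Calabi-Yau if and only if $v=0$.
   Context: Unadorned tensor products are over $k$. For a $k$-algebra $B$, $B^e=B\otimes B^{op}$, and $\mathrm{HH}^i(B,B\otimes B)=\mathrm{Ext}^i_{B^e}(B,B^e)$ is Hochschild cohomology with coefficients in the bimodule $B\otimes B$. A $k$-algebra $B$ having a finite projective $B$-bimodule resolution by bimodules of finite type is called $d$-Calabi-Yau ($d\ge1$) if $\mathrm{Ext}^i_{B^e}(B,B^e)=0$ for $i\ne d$ and $\mathrm{Ext}^d_{B^e}(B,B^e)\cong B$ as right $B^e$-modules. $N$-Koszul graded algebras: for a vector space $V$ (in degree $1$), $N\ge2$ and $R\subseteq V^{\otimes N}$, let $A=A(V,R)=T(V)/I(R)$, where $I(R)$ is the two-sided ideal generated by $R$. Put $\nu_N(2i)=Ni$, $\nu_N(2i+1)=Ni+1$, and $W_m=\bigcap_{i+N+j=m}V^{\otimes i}\otimes R\otimes V^{\otimes j}\subseteq V^{\otimes m}$ (with $W_m=V^{\otimes m}$ for $m<N$). The Koszul complex $K(A)$ has $K_i=A\otimes W_{\nu_N(i)}$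 and left $A$-linear differential $K_i\to K_{i-1}$ induced by the inclusion $W_{\nu_N(i)}\subseteq V^{\otimes(\nu_N(i)-\nu_N(i-1))}\otimes W_{\nu_N(i-1)}$ (followed by multiplication into $A$). $A$ is $N$-Koszul if $K(A)$ has zero homology in every degree $i>0$. Koszul filtered algebras: filter $T(V)$ by $F^n=k\oplus V\oplus\cdots\oplus V^{\otimes n}$. Let $P$ be a subspace of $T(V)$. The algebra $U=T(V)/I(P)$, with the induced filtration, is said to be Koszul if there is an integer $N\ge2$ such that $P\subseteq F^N$ and, with $\pi:F^N\to V^{\otimes N}$ the natural projection and $R=\pi(P)$, the graded algebra $A=A(V,R)$ is $N$-Koszul and $U$ is a PBW deformation of $A$; the latter means that $P=(\mathrm{Id}-\varphi)(R)$ for a $k$-linear map $\varphi:R\to F^{N-1}$ and the natural graded algebra morphism $A\to\mathrm{gr}(U)$ is an isomorphism. For the algebra $U$ of the claim, $V$ is the vector space with basis $x_1,\dots,x_n$ and $P$ is spanned by $\sum_{1\le i\le n/2}(x_i\otimes x_{i+n/2}-x_{i+n/2}\otimes x_i)-v-\lambda$. *)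

theory Defs
  imports HOL.Vector_Spaces "HOL-Library.Poly_Mapping" "HOL-Library.FuncSet"
    "HOL-Algebra.Module" "HOL-Algebra.QuotRing" "HOL-Algebra.Generated_Groups"
begin

section \<open>Tensor algebras\<close>

text \<open>
  Words form the free monoid, so that \<open>'x list \<Rightarrow>\<^sub>0 'k\<close> is the free \<open>'k\<close>-algebra on the letters
  of type \<open>'x\<close>. A vector space \<open>V\<close> is given by a basis \<open>X\<close> of letters; \<open>T(V)\<close> is then the subalgebra
  of those elements that only involve letters of \<open>X\<close>, and \<open>p \<otimes> q\<close> in \<open>T(V)\<close> is the product \<open>p * q\<close>.
\<close>

instantiation list :: (type) monoid_add
begin
definition zero_list_def: "0 = []"
definition plus_list_def: "xs + ys = xs @ ys"
instance by standard (simp_all add: zero_list_def plus_list_def)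
end

type_synonym ('x, 'k) tens = "'x list \<Rightarrow>\<^sub>0 'k"

definition scal :: "'k::field \<Rightarrow> ('x, 'k) tens"
  where "scal c = Poly_Mapping.single [] c"

definition gen :: "'x \<Rightarrow> ('x, 'k::field) tens"
  where "gen x = Poly_Mapping.single [x] 1"

definition tscale :: "'k::field \<Rightarrow> ('x, 'k) tens \<Rightarrow> ('x, 'k) tens"
  where "tscale c p = scal c * p"

global_interpretation tens: vector_space tscale
  defines tspan = tens.span
proof
  fix a b :: "'k::field" and x y :: "('x, 'k) tens"
  have e: "([] :: 'x list) = 0" by (simp add: zero_list_def)
  show "tscale a (x + y) = tscale a x + tscale a y"
    by (simp add: tscale_def distrib_left)
  show "tscale (a + b) x = tscale a x + tscale b x"
    by (simp add: tscale_def scal_def single_add distrib_right)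
  show "tscale a (tscale b x) = tscale (a * b) x"
    by (simp add: tscale_def scal_def mult.assoc[symmetric] mult_single zero_list_def plus_list_def)
  show "tscale 1 x = x"
    by (simp add: tscale_def scal_def e)
qed

definition tens_space :: "'x set \<Rightarrow> ('x, 'k::field) tens set"
  where "tens_space X = {p. \<forall>w\<in>Poly_Mapping.keys p. set w \<subseteq> X}"

definition tens_pow :: "'x set \<Rightarrow> nat \<Rightarrow> ('x, 'k::field) tens set"
  where "tens_pow X m = {p \<in> tens_space X. \<forall>w\<in>Poly_Mapping.keys p. length w = m}"

definition tens_filt :: "'x set \<Rightarrow> nat \<Rightarrow> ('x, 'k::field) tens set"
  where "tens_filt X m = {p \<in> tens_space X. \<forall>w\<in>Poly_Mapping.keys p. length w \<le> m}"

definition tens_proj :: "nat \<Rightarrow> ('x, 'k::field) tens \<Rightarrow> ('x, 'k) tens"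
  where "tens_proj m p =
    (\<Sum>w\<in>{w \<in> Poly_Mapping.keys p. length w = m}. Poly_Mapping.single w (Poly_Mapping.lookup p w))"

definition tens_alg :: "'x set \<Rightarrow> ('k::field, ('x, 'k) tens) module"
  where "tens_alg X = \<lparr>carrier = tens_space X, mult = (*), one = 1, zero = 0, add = (+),
    smult = tscale\<rparr>"

text \<open>\<open>T(V)/I(P)\<close>, whose elements are cosets of the two-sided ideal \<open>I(P)\<close>.\<close>

definition tens_ideal :: "'x set \<Rightarrow> ('x, 'k::field) tens set \<Rightarrow> ('x, 'k) tens set"
  where "tens_ideal X P = Idl\<^bsub>tens_alg X\<^esub> P"

definition tens_class :: "'x set \<Rightarrow> ('x, 'k::field) tens set \<Rightarrow> ('x, 'k) tens \<Rightarrow> ('x, 'k) tens set"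
  where "tens_class X P p = tens_ideal X P +>\<^bsub>tens_alg X\<^esub> p"

definition quot_alg ::
  "'x set \<Rightarrow> ('x, 'k::field) tens set \<Rightarrow> ('k, ('x, 'k) tens set) module"
  where "quot_alg X P = (let Q = tens_alg X Quot tens_ideal X P in
    \<lparr>carrier = carrier Q, mult = mult Q, one = one Q, zero = zero Q, add = add Q,
     smult = (\<lambda>c S. \<Union>p\<in>S. tens_class X P (tscale c p))\<rparr>)"


section \<open>Tensor products over \<open>k\<close>\<close>

text \<open>
  \<open>M \<otimes>\<^sub>k N\<close> is the free abelian group on \<open>M \<times> N\<close> modulo the subgroup generated by the usual balancing
  relations; \<open>k\<close> is the whole type of scalars of the two module records. The free abelian group is
  equipped with the product \<open>(a, b) (a', b') = (a a', b b')\<close>, so that for \<open>k\<close>-algebras \<open>M\<close> and \<open>N\<close>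
  the quotient ring is the tensor product algebra. If \<open>M\<close> or \<open>N\<close> is only a vector space, then only
  the additive structure of \<open>M \<otimes>\<^sub>k N\<close> is meaningful.
\<close>

definition pair_ring ::
  "('k, 'a) module \<Rightarrow> ('k, 'b) module \<Rightarrow> ('a \<times> 'b \<Rightarrow>\<^sub>0 int) ring"
  where "pair_ring M N =
    \<lparr>carrier = {f. Poly_Mapping.keys f \<subseteq> carrier M \<times> carrier N},
     mult = (\<lambda>f g. \<Sum>p\<in>Poly_Mapping.keys f. \<Sum>q\<in>Poly_Mapping.keys g.
       Poly_Mapping.single (fst p \<otimes>\<^bsub>M\<^esub> fst q, snd p \<otimes>\<^bsub>N\<^esub> snd q)
         (Poly_Mapping.lookup f p * Poly_Mapping.lookup g q)),
     one = Poly_Mapping.single (\<one>\<^bsub>M\<^esub>, \<one>\<^bsub>N\<^esub>) 1, zero = 0, add = (+)\<rparr>"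

abbreviation pair :: "'a \<Rightarrow> 'b \<Rightarrow> ('a \<times> 'b \<Rightarrow>\<^sub>0 int)"
  where "pair a b \<equiv> Poly_Mapping.single (a, b) 1"

definition balancing ::
  "('k, 'a) module \<Rightarrow> ('k, 'b) module \<Rightarrow> ('a \<times> 'b \<Rightarrow>\<^sub>0 int) set"
  where "balancing M N =
    {pair (a \<oplus>\<^bsub>M\<^esub> a') b - pair a b - pair a' b | a a' b.
      a \<in> carrier M \<and> a' \<in> carrier M \<and> b \<in> carrier N} \<union>
    {pair a (b \<oplus>\<^bsub>N\<^esub> b') - pair a b - pair a b' | a b b'.
      a \<in> carrier M \<and> b \<in> carrier N \<and> b' \<in> carrier N} \<union>
    {pair (c \<odot>\<^bsub>M\<^esub> a) b - pair a (c \<odot>\<^bsub>N\<^esub> b) | a b c. a \<in> carrier M \<and> b \<in> carrier N}"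

definition balancing_subgroup ::
  "('k, 'a) module \<Rightarrow> ('k, 'b) module \<Rightarrow> ('a \<times> 'b \<Rightarrow>\<^sub>0 int) set"
  where "balancing_subgroup M N = generate (add_monoid (pair_ring M N)) (balancing M N)"

definition tensor ::
  "('k, 'a) module \<Rightarrow> ('k, 'b) module \<Rightarrow> ('a \<times> 'b \<Rightarrow>\<^sub>0 int) set ring"
  where "tensor M N = pair_ring M N Quot balancing_subgroup M N"

definition pure_tensor ::
  "('k, 'a) module \<Rightarrow> ('k, 'b) module \<Rightarrow> 'a \<Rightarrow> 'b \<Rightarrow> ('a \<times> 'b \<Rightarrow>\<^sub>0 int) set"
  where "pure_tensor M N a b = balancing_subgroup M N +>\<^bsub>pair_ring M N\<^esub> pair a b"

text \<open>The additive map \<open>M \<otimes>\<^sub>k N \<rightarrow> G\<close> with \<open>a \<otimes> b \<mapsto> h a b\<close>, for a balanced biadditive \<open>h\<close>.\<close>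

definition tensor_lift ::
  "('g, 'z) ring_scheme \<Rightarrow> ('a \<Rightarrow> 'b \<Rightarrow> 'g) \<Rightarrow> ('a \<times> 'b \<Rightarrow>\<^sub>0 int) set \<Rightarrow> 'g"
  where "tensor_lift G h t = (THE y. \<exists>f\<in>t. y =
    (\<Oplus>\<^bsub>G\<^esub>p\<in>Poly_Mapping.keys f. [Poly_Mapping.lookup f p] \<cdot>\<^bsub>G\<^esub> h (fst p) (snd p)))"


section \<open>\<open>N\<close>-Koszul graded algebras\<close>

definition nu :: "nat \<Rightarrow> nat \<Rightarrow> nat"
  where "nu N i = (if even i then N * (i div 2) else N * (i div 2) + 1)"

definition koszul_W ::
  "'x set \<Rightarrow> nat \<Rightarrow> ('x, 'k::field) tens set \<Rightarrow> nat \<Rightarrow> ('x, 'k) tens set"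
  where "koszul_W X N R m = {w \<in> tens_pow X m. \<forall>i j. i + N + j = m \<longrightarrow>
    w \<in> tspan {p * r * q | p r q. p \<in> tens_pow X i \<and> r \<in> R \<and> q \<in> tens_pow X j}}"

abbreviation koszul_Wmod ::
  "'x set \<Rightarrow> nat \<Rightarrow> ('x, 'k::field) tens set \<Rightarrow> nat \<Rightarrow> ('k, ('x, 'k) tens) module"
  where "koszul_Wmod X N R i \<equiv> tens_alg X \<lparr>carrier := koszul_W X N R (nu N i)\<rparr>"

definition koszul_K ::
  "'x set \<Rightarrow> nat \<Rightarrow> ('x, 'k::field) tens set \<Rightarrow> nat \<Rightarrow>
    (('x, 'k) tens set \<times> ('x, 'k) tens \<Rightarrow>\<^sub>0 int) set ring"
  where "koszul_K X N R i = tensor (quot_alg X R) (koszul_Wmod X N R i)"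

text \<open>
  The differential \<open>K\<^sub>i \<rightarrow> K\<^sub>i\<^sub>-\<^sub>1\<close> for \<open>i \<ge> 1\<close>: if \<open>w \<in> W\<^bsub>\<nu>(i)\<^esub>\<close> is written as \<open>w = \<Sum>\<^sub>j p\<^sub>j \<otimes> q\<^sub>j\<close> with
  \<open>p\<^sub>j \<in> V\<^bsup>\<otimes>(\<nu>(i) - \<nu>(i-1))\<^esup>\<close> and \<open>q\<^sub>j \<in> W\<^bsub>\<nu>(i-1)\<^esub>\<close>, then \<open>a \<otimes> w \<mapsto> \<Sum>\<^sub>j a p\<^sub>j \<otimes> q\<^sub>j\<close>. On \<open>K\<^sub>i\<close> this
  determines the map uniquely.
\<close>

definition is_koszul_diff ::
  "'x set \<Rightarrow> nat \<Rightarrow> ('x, 'k::field) tens set \<Rightarrow> nat \<Rightarrow>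
    ((('x, 'k) tens set \<times> ('x, 'k) tens \<Rightarrow>\<^sub>0 int) set \<Rightarrow>
     (('x, 'k) tens set \<times> ('x, 'k) tens \<Rightarrow>\<^sub>0 int) set) \<Rightarrow> bool"
  where "is_koszul_diff X N R i D \<longleftrightarrow>
    D \<in> hom (add_monoid (koszul_K X N R i)) (add_monoid (koszul_K X N R (i - 1))) \<and>
    (\<forall>a\<in>carrier (quot_alg X R). \<forall>(m::nat) p q.
      (\<forall>j<m. p j \<in> tens_pow X (nu N i - nu N (i - 1)) \<and> q j \<in> koszul_W X N R (nu N (i - 1))) \<and>
      (\<Sum>j<m. p j * q j) \<in> koszul_W X N R (nu N i) \<longrightarrow>
      D (pure_tensor (quot_alg X R) (koszul_Wmod X N R i) a (\<Sum>j<m. p j * q j)) =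
      (\<Oplus>\<^bsub>koszul_K X N R (i - 1)\<^esub>j\<in>{..<m}.
        pure_tensor (quot_alg X R) (koszul_Wmod X N R (i - 1))
          (a \<otimes>\<^bsub>quot_alg X R\<^esub> tens_class X R (p j)) (q j)))"

definition koszul_diff ::
  "'x set \<Rightarrow> nat \<Rightarrow> ('x, 'k::field) tens set \<Rightarrow> nat \<Rightarrow>
    (('x, 'k) tens set \<times> ('x, 'k) tens \<Rightarrow>\<^sub>0 int) set \<Rightarrow>
    (('x, 'k) tens set \<times> ('x, 'k) tens \<Rightarrow>\<^sub>0 int) set"
  where "koszul_diff X N R i = (SOME D. is_koszul_diff X N R i D)"

definition N_koszul :: "'x set \<Rightarrow> nat \<Rightarrow> ('x, 'k::field) tens set \<Rightarrow> bool"
  where "N_koszul X N R \<longleftrightarrow> N \<ge> 2 \<and> tens.subspace R \<and> R \<subseteq> tens_pow X N \<and>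
    (\<forall>i>0. {t \<in> carrier (koszul_K X N R i). koszul_diff X N R i t = \<zero>\<^bsub>koszul_K X N R (i - 1)\<^esub>} =
      koszul_diff X N R (i + 1) ` carrier (koszul_K X N R (i + 1)))"


section \<open>Associated graded rings and PBW deformations\<close>

text \<open>\<open>F\<^bsup>m-1\<^esup>\<close>, with \<open>F\<^bsup>-1\<^esup> = 0\<close>.\<close>

definition filt_below :: "('a, 'z) ring_scheme \<Rightarrow> (nat \<Rightarrow> 'a set) \<Rightarrow> nat \<Rightarrow> 'a set"
  where "filt_below B F m = (if m = 0 then {\<zero>\<^bsub>B\<^esub>} else F (m - 1))"

text \<open>
  An element of \<open>gr(B) = \<Oplus>\<^sub>m F\<^sup>m/F\<^bsup>m-1\<^esup>\<close> is a sequence, almost everywhere zero, whose \<open>m\<close>-th member is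
  a coset of \<open>F\<^bsup>m-1\<^esup>\<close> in \<open>F\<^sup>m\<close>. As in \<^const>\<open>rcoset_mult\<close>, the product is formed by letting
  representatives vary.
\<close>

definition gr_ring :: "('a, 'z) ring_scheme \<Rightarrow> (nat \<Rightarrow> 'a set) \<Rightarrow> (nat \<Rightarrow> 'a set) ring"
  where "gr_ring B F =
    \<lparr>carrier = {s. (\<forall>m. \<exists>u\<in>F m. s m = filt_below B F m +>\<^bsub>B\<^esub> u) \<and>
       finite {m. s m \<noteq> filt_below B F m}},
     mult = (\<lambda>s t m. \<Union>u\<in>{u. \<forall>i\<le>m. u i \<in> s i}. \<Union>w\<in>{w. \<forall>i\<le>m. w i \<in> t i}.
       filt_below B F m +>\<^bsub>B\<^esub> (\<Oplus>\<^bsub>B\<^esub>i\<in>{..m}. u i \<otimes>\<^bsub>B\<^esub> w (m - i))),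
     one = (\<lambda>m. if m = 0 then filt_below B F 0 +>\<^bsub>B\<^esub> \<one>\<^bsub>B\<^esub> else filt_below B F m),
     zero = filt_below B F,
     add = (\<lambda>s t m. s m <+>\<^bsub>B\<^esub> t m)\<rparr>"

definition gr_symbol ::
  "('a, 'z) ring_scheme \<Rightarrow> (nat \<Rightarrow> 'a set) \<Rightarrow> nat \<Rightarrow> 'a \<Rightarrow> nat \<Rightarrow> 'a set"
  where "gr_symbol B F m u =
    (\<lambda>j. if j = m then filt_below B F m +>\<^bsub>B\<^esub> u else filt_below B F j)"

definition quot_filt ::
  "'x set \<Rightarrow> ('x, 'k::field) tens set \<Rightarrow> nat \<Rightarrow> ('x, 'k) tens set set"
  where "quot_filt X P m = tens_class X P ` tens_filt X m"

text \<open>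
  The natural morphism \<open>A(V,R) \<rightarrow> gr(U)\<close> is the ring homomorphism sending the class of
  \<open>p \<in> V\<^bsup>\<otimes>m\<^esup>\<close> to the class of \<open>p\<close> in \<open>F\<^sup>mU/F\<^bsup>m-1\<^esup>U\<close>.
\<close>

definition pbw_deformation ::
  "'x set \<Rightarrow> nat \<Rightarrow> ('x, 'k::field) tens set \<Rightarrow> ('x, 'k) tens set \<Rightarrow> bool"
  where "pbw_deformation X N R P \<longleftrightarrow>
    (\<exists>\<phi>. \<phi> \<in> R \<rightarrow> tens_filt X (N - 1) \<and>
      (\<forall>r\<in>R. \<forall>s\<in>R. \<phi> (r + s) = \<phi> r + \<phi> s) \<and>
      (\<forall>c. \<forall>r\<in>R. \<phi> (tscale c r) = tscale c (\<phi> r)) \<and>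
      P = (\<lambda>r. r - \<phi> r) ` R) \<and>
    (\<exists>\<Phi> \<in> ring_iso (quot_alg X R) (gr_ring (quot_alg X P) (quot_filt X P)).
      \<forall>m. \<forall>p\<in>tens_pow X m. \<Phi> (tens_class X R p) =
        gr_symbol (quot_alg X P) (quot_filt X P) m (tens_class X P p))"

definition koszul_filtered :: "'x set \<Rightarrow> ('x, 'k::field) tens set \<Rightarrow> bool"
  where "koszul_filtered X P \<longleftrightarrow> tens.subspace P \<and>
    (\<exists>N\<ge>2. P \<subseteq> tens_filt X N \<and> N_koszul X N (tens_proj N ` P) \<and>
      pbw_deformation X N (tens_proj N ` P) P)"


section \<open>Left modules over noncommutative rings\<close>

text \<open>
  The record fields \<open>mult\<close> and \<open>one\<close> of a module record are irrelevant here. Right modules over \<open>R\<close>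
  are left modules over \<open>opp R\<close>.
\<close>

definition opp :: "('a, 'z) monoid_scheme \<Rightarrow> ('a, 'z) monoid_scheme"
  where "opp R = R\<lparr>mult := (\<lambda>x y. y \<otimes>\<^bsub>R\<^esub> x)\<rparr>"

locale left_module = R?: ring R + M?: abelian_group M
  for R (structure) and M :: "('r, 'm) module" (structure) +
  assumes lsmult_closed:
      "\<lbrakk>r \<in> carrier R; x \<in> carrier M\<rbrakk> \<Longrightarrow> r \<odot>\<^bsub>M\<^esub> x \<in> carrier M"
    and lsmult_l_distr:
      "\<lbrakk>r \<in> carrier R; s \<in> carrier R; x \<in> carrier M\<rbrakk> \<Longrightarrow>
        (r \<oplus>\<^bsub>R\<^esub> s) \<odot>\<^bsub>M\<^esub> x = r \<odot>\<^bsub>M\<^esub> x \<oplus>\<^bsub>M\<^esub> s \<odot>\<^bsub>M\<^esub> x"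
    and lsmult_r_distr:
      "\<lbrakk>r \<in> carrier R; x \<in> carrier M; y \<in> carrier M\<rbrakk> \<Longrightarrow>
        r \<odot>\<^bsub>M\<^esub> (x \<oplus>\<^bsub>M\<^esub> y) = r \<odot>\<^bsub>M\<^esub> x \<oplus>\<^bsub>M\<^esub> r \<odot>\<^bsub>M\<^esub> y"
    and lsmult_assoc:
      "\<lbrakk>r \<in> carrier R; s \<in> carrier R; x \<in> carrier M\<rbrakk> \<Longrightarrow>
        (r \<otimes>\<^bsub>R\<^esub> s) \<odot>\<^bsub>M\<^esub> x = r \<odot>\<^bsub>M\<^esub> (s \<odot>\<^bsub>M\<^esub> x)"
    and lsmult_one: "x \<in> carrier M \<Longrightarrow> \<one>\<^bsub>R\<^esub> \<odot>\<^bsub>M\<^esub> x = x"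

definition lhom ::
  "('r, 'z) ring_scheme \<Rightarrow> ('r, 'm) module \<Rightarrow> ('r, 'n) module \<Rightarrow> ('m \<Rightarrow> 'n) set"
  where "lhom R M N = {f \<in> carrier M \<rightarrow>\<^sub>E carrier N.
    (\<forall>x\<in>carrier M. \<forall>y\<in>carrier M. f (x \<oplus>\<^bsub>M\<^esub> y) = f x \<oplus>\<^bsub>N\<^esub> f y) \<and>
    (\<forall>r\<in>carrier R. \<forall>x\<in>carrier M. f (r \<odot>\<^bsub>M\<^esub> x) = r \<odot>\<^bsub>N\<^esub> f x)}"

definition lmod_isomorphic ::
  "('r, 'z) ring_scheme \<Rightarrow> ('r, 'm) module \<Rightarrow> ('r, 'n) module \<Rightarrow> bool"
  where "lmod_isomorphic R M N \<longleftrightarrow> (\<exists>f\<in>lhom R M N. bij_betw f (carrier M) (carrier N))"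

definition lregular :: "('r, 'z) ring_scheme \<Rightarrow> ('r, 'r) module"
  where "lregular R = \<lparr>carrier = carrier R, mult = mult R, one = one R, zero = zero R, add = add R,
    smult = mult R\<rparr>"

definition free_lmod :: "('r, 'z) ring_scheme \<Rightarrow> 'b set \<Rightarrow> ('r, 'b \<Rightarrow> 'r) module"
  where "free_lmod R X =
    \<lparr>carrier = {f \<in> X \<rightarrow>\<^sub>E carrier R. finite {x \<in> X. f x \<noteq> \<zero>\<^bsub>R\<^esub>}},
     mult = undefined, one = undefined,
     zero = (\<lambda>x\<in>X. \<zero>\<^bsub>R\<^esub>), add = (\<lambda>f g. \<lambda>x\<in>X. f x \<oplus>\<^bsub>R\<^esub> g x),
     smult = (\<lambda>r f. \<lambda>x\<in>X. r \<otimes>\<^bsub>R\<^esub> f x)\<rparr>"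

text \<open>
  A projective module is a direct summand of a free module; bases indexed by elements of the module
  suffice.
\<close>

definition projective :: "('r, 'z) ring_scheme \<Rightarrow> ('r, 'm) module \<Rightarrow> bool"
  where "projective R M \<longleftrightarrow> left_module R M \<and>
    (\<exists>X :: 'm set. \<exists>s\<in>lhom R M (free_lmod R X). \<exists>p\<in>lhom R (free_lmod R X) M.
      \<forall>x\<in>carrier M. p (s x) = x)"

definition finite_type :: "('r, 'z) ring_scheme \<Rightarrow> ('r, 'm) module \<Rightarrow> bool"
  where "finite_type R M \<longleftrightarrow> (\<exists>S. finite S \<and> S \<subseteq> carrier M \<and>
    (\<forall>x\<in>carrier M. \<exists>c\<in>S \<rightarrow> carrier R. x = (\<Oplus>\<^bsub>M\<^esub>s\<in>S. c s \<odot>\<^bsub>M\<^esub> s)))"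

text \<open>\<open>\<dots> \<rightarrow> P\<^sub>2 \<rightarrow> P\<^sub>1 \<rightarrow> P\<^sub>0 \<rightarrow> M \<rightarrow> 0\<close>, where \<open>d i\<close> maps \<open>P (i + 1)\<close> to \<open>P i\<close>.\<close>

definition projective_resolution ::
  "('r, 'z) ring_scheme \<Rightarrow> ('r, 'm) module \<Rightarrow>
    (nat \<Rightarrow> ('r, 'p) module) \<Rightarrow> (nat \<Rightarrow> 'p \<Rightarrow> 'p) \<Rightarrow> ('p \<Rightarrow> 'm) \<Rightarrow> bool"
  where "projective_resolution R M P d \<epsilon> \<longleftrightarrow>
    (\<forall>i. projective R (P i)) \<and> (\<forall>i. d i \<in> lhom R (P (Suc i)) (P i)) \<and>
    \<epsilon> \<in> lhom R (P 0) M \<and> \<epsilon> ` carrier (P 0) = carrier M \<and>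
    {x \<in> carrier (P 0). \<epsilon> x = \<zero>\<^bsub>M\<^esub>} = d 0 ` carrier (P 1) \<and>
    (\<forall>i. {x \<in> carrier (P (Suc i)). d i x = \<zero>\<^bsub>P i\<^esub>} = d (Suc i) ` carrier (P (Suc (Suc i))))"

text \<open>
  A type in which resolutions are chosen. The index type \<open>('r + 'm) list\<close> is infinite and at least as
  large as \<open>'r\<close> and \<open>'m\<close>, hence so large that every \<open>R\<close>-module \<open>M\<close> has a resolution by free modules with
  bases in it; moreover every projective module of finite type is isomorphic to a submodule of some
  \<open>R\<^sup>m\<close> and thus has a copy in this type.
\<close>

type_synonym ('r, 'm) res = "('r + 'm) list \<Rightarrow> 'r"

definition chosen_resolution ::
  "('r, 'z) ring_scheme \<Rightarrow> ('r, 'm) module \<Rightarrow>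
    (nat \<Rightarrow> ('r, ('r, 'm) res) module) \<times> (nat \<Rightarrow> ('r, 'm) res \<Rightarrow> ('r, 'm) res)"
  where "chosen_resolution R M = (SOME (P, d). \<exists>\<epsilon>. projective_resolution R M P d \<epsilon>)"

text \<open>\<open>Hom\<^sub>R(P, R)\<close> as a right \<open>R\<close>-module.\<close>

definition ldual :: "('r, 'z) ring_scheme \<Rightarrow> ('r, 'p) module \<Rightarrow> ('r, 'p \<Rightarrow> 'r) module"
  where "ldual R P =
    \<lparr>carrier = lhom R P (lregular R), mult = undefined, one = undefined,
     zero = (\<lambda>x\<in>carrier P. \<zero>\<^bsub>R\<^esub>), add = (\<lambda>f g. \<lambda>x\<in>carrier P. f x \<oplus>\<^bsub>R\<^esub> g x),
     smult = (\<lambda>r f. \<lambda>x\<in>carrier P. f x \<otimes>\<^bsub>R\<^esub> r)\<rparr>"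

definition cocycles ::
  "('r, 'z) ring_scheme \<Rightarrow> (nat \<Rightarrow> ('r, 'p) module) \<Rightarrow> (nat \<Rightarrow> 'p \<Rightarrow> 'p) \<Rightarrow> nat \<Rightarrow> ('p \<Rightarrow> 'r) set"
  where "cocycles R P d i =
    {f \<in> carrier (ldual R (P i)). \<forall>x\<in>carrier (P (Suc i)). f (d i x) = \<zero>\<^bsub>R\<^esub>}"

definition coboundaries ::
  "('r, 'z) ring_scheme \<Rightarrow> (nat \<Rightarrow> ('r, 'p) module) \<Rightarrow> (nat \<Rightarrow> 'p \<Rightarrow> 'p) \<Rightarrow> nat \<Rightarrow> ('p \<Rightarrow> 'r) set"
  where "coboundaries R P d i = (case i of
    0 \<Rightarrow> {\<zero>\<^bsub>ldual R (P 0)\<^esub>} |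
    Suc j \<Rightarrow> (\<lambda>f. \<lambda>x\<in>carrier (P (Suc j)). f (d j x)) ` carrier (ldual R (P j)))"

definition dual_cohomology ::
  "('r, 'z) ring_scheme \<Rightarrow> (nat \<Rightarrow> ('r, 'p) module) \<Rightarrow> (nat \<Rightarrow> 'p \<Rightarrow> 'p) \<Rightarrow> nat \<Rightarrow>
    ('r, ('p \<Rightarrow> 'r) set) module"
  where "dual_cohomology R P d i =
    (let D = ldual R (P i); C = coboundaries R P d i in
    \<lparr>carrier = (\<lambda>f. C +>\<^bsub>D\<^esub> f) ` cocycles R P d i, mult = undefined, one = undefined,
     zero = C, add = set_add D, smult = (\<lambda>r S. \<Union>f\<in>S. C +>\<^bsub>D\<^esub> (r \<odot>\<^bsub>D\<^esub> f))\<rparr>)"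

text \<open>\<open>Ext\<^sup>i\<^sub>R(M, R)\<close> as a right \<open>R\<close>-module.\<close>

definition Ext_reg ::
  "('r, 'z) ring_scheme \<Rightarrow> ('r, 'm) module \<Rightarrow> nat \<Rightarrow> ('r, (('r, 'm) res \<Rightarrow> 'r) set) module"
  where "Ext_reg R M i = (case chosen_resolution R M of (P, d) \<Rightarrow> dual_cohomology R P d i)"

definition zero_module :: "('r, 'm) module \<Rightarrow> bool"
  where "zero_module M \<longleftrightarrow> carrier M = {\<zero>\<^bsub>M\<^esub>}"


section \<open>Hochschild cohomology and Calabi-Yau algebras\<close>

type_synonym 'b env = "('b \<times> 'b \<Rightarrow>\<^sub>0 int) set"

definition env_alg :: "('k, 'b) module \<Rightarrow> 'b env ring"
  where "env_alg B = tensor B (opp B)"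

text \<open>\<open>(x \<otimes> y) b = x b y\<close> and \<open>b (x \<otimes> y) = y b x\<close>.\<close>

definition env_left :: "('k, 'b) module \<Rightarrow> ('b env, 'b) module"
  where "env_left B = \<lparr>carrier = carrier B, mult = mult B, one = one B, zero = zero B, add = add B,
    smult = (\<lambda>t b. tensor_lift B (\<lambda>x y. x \<otimes>\<^bsub>B\<^esub> b \<otimes>\<^bsub>B\<^esub> y) t)\<rparr>"

definition env_right :: "('k, 'b) module \<Rightarrow> ('b env, 'b) module"
  where "env_right B = \<lparr>carrier = carrier B, mult = mult B, one = one B, zero = zero B, add = add B,
    smult = (\<lambda>t b. tensor_lift B (\<lambda>x y. y \<otimes>\<^bsub>B\<^esub> b \<otimes>\<^bsub>B\<^esub> x) t)\<rparr>"

text \<open>\<open>HH\<^sup>i(B, B \<otimes> B) = Ext\<^sup>i(B, B\<^sup>e)\<close>, with its structure of a right \<open>B\<^sup>e\<close>-module.\<close>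

definition HH_env ::
  "('k, 'b) module \<Rightarrow> nat \<Rightarrow> ('b env, (('b env, 'b) res \<Rightarrow> 'b env) set) module"
  where "HH_env B i = Ext_reg (env_alg B) (env_left B) i"

definition calabi_yau :: "nat \<Rightarrow> ('k, 'b) module \<Rightarrow> bool"
  where "calabi_yau d B \<longleftrightarrow> d \<ge> 1 \<and>
    (\<exists>(P :: nat \<Rightarrow> ('b env, ('b env, 'b) res) module) \<delta> \<epsilon> l.
      projective_resolution (env_alg B) (env_left B) P \<delta> \<epsilon> \<and>
      (\<forall>i. finite_type (env_alg B) (P i)) \<and> (\<forall>i>l. zero_module (P i))) \<and>
    (\<forall>i. i \<noteq> d \<longrightarrow> zero_module (HH_env B i)) \<and>
    lmod_isomorphic (opp (env_alg B)) (HH_env B d) (env_right B)"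


section \<open>The algebra \<open>U\<close>\<close>

definition relator :: "nat \<Rightarrow> (nat, 'k::field) tens \<Rightarrow> 'k \<Rightarrow> (nat, 'k) tens"
  where "relator n v l =
    (\<Sum>i\<in>{1..n div 2}. gen i * gen (i + n div 2) - gen (i + n div 2) * gen i) - v - scal l"

definition relator_space :: "nat \<Rightarrow> (nat, 'k::field) tens \<Rightarrow> 'k \<Rightarrow> (nat, 'k) tens set"
  where "relator_space n v l = tspan {relator n v l}"

definition U_alg :: "nat \<Rightarrow> (nat, 'k::field) tens \<Rightarrow> 'k \<Rightarrow> ('k, (nat, 'k) tens set) module"
  where "U_alg n v l = quot_alg {1..n} (relator_space n v l)"

end

theory Submission
  imports Defs
begin

text \<open>
  Write \<open>n = 2m\<close>, let \<open>j \<mapsto> j'\<close> be the involution \<open>j \<leftrightarrow> j + m\<close> of the indices and \<open>s\<^sub>j = \<plusminus> 1\<close> the sign with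
  \<open>s\<^sub>j = 1\<close> for \<open>j \<le> m\<close>. The relation then reads \<open>\<Sum>\<^sub>j s\<^sub>j x\<^sub>j x\<^sub>j\<^sub>' = \<Sum>\<^sub>j v\<^sub>j x\<^sub>j + \<lambda>\<close>, with leading term
  \<open>x\<^sub>1 x\<^sub>m\<^sub>+\<^sub>1\<close>, which has no overlap with itself. Everything rests on this.

  \<^item> \<^emph>\<open>Normal forms.\<close> Eliminating \<open>x\<^sub>1 x\<^sub>m\<^sub>+\<^sub>1\<close> is done by an action of the generators on words: all of them act
  by prefixing, except \<open>x\<^sub>1\<close>, whose action is forced by the relation (\<open>A1\<close>). The resulting linear map
  \<open>N\<close> vanishes exactly on the ideal (\<open>I_iff_N\<close>) and commutes with right multiplication by \<open>x\<^sub>1\<close>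
  (\<open>N_mult_gen1\<close>), so that \<open>x\<^sub>1\<close> can be cancelled on the right.

  \<^item> \<^emph>\<open>Koszulity.\<close> For the homogeneous relation \<open>r\<close> one has \<open>W\<^sub>2 = k r\<close> and \<open>W\<^sub>i = 0\<close> for \<open>i \<ge> 3\<close>, so the
  Koszul complex is \<open>A \<otimes> r \<rightarrow> A \<otimes> V \<rightarrow> A \<otimes> k\<close>. It is exact in degree 2 because \<open>a x\<^sub>1 = 0\<close> implies
  \<open>a = 0\<close>, and in degree 1 because stripping the last letter off an element of the ideal gives, up
  to the ideal, a left multiple of what it gives for \<open>r\<close> (\<open>ideal_rstrip\<close>).

  \<^item> \<^emph>\<open>PBW.\<close> The normal forms for \<open>U\<close> and for \<open>A\<close> differ by terms of lower degree (\<open>N_graded\<close>). So if a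
  homogeneous element is congruent in \<open>U\<close> to one of smaller degree, then its \<open>A\<close>-normal form is zero
  (\<open>homogeneous_in_graded_ideal\<close>); this is the injectivity of \<open>A \<rightarrow> gr(U)\<close>.

  \<^item> \<^emph>\<open>Hochschild cohomology.\<close> Let \<open>E = U \<otimes> U\<^sup>o\<^sup>p\<close> and \<open>y\<^sub>j = x\<^sub>j \<otimes> 1 - 1 \<otimes> x\<^sub>j\<close>,
  \<open>\<delta>\<^sub>j = - s\<^sub>j y\<^sub>j\<^sub>' - v\<^sub>j\<close>. Then \<open>0 \<rightarrow> E \<rightarrow> E\<^sup>n \<rightarrow> E \<rightarrow> U \<rightarrow> 0\<close> with maps \<open>t \<mapsto> (t \<delta>\<^sub>j)\<^sub>j\<close> and
  \<open>(s\<^sub>j)\<^sub>j \<mapsto> \<Sum>\<^sub>j s\<^sub>j y\<^sub>j\<close> is a free resolution of the bimodule \<open>U\<close>. Exactness in the middle comes from a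
  free derivation \<open>D\<close> with \<open>\<Sum>\<^sub>j D\<^sub>j(p) y\<^sub>j = p \<otimes> 1 - 1 \<otimes> p\<close> and \<open>D\<^sub>j(relation) = \<delta>\<^sub>j\<close>. The same argument,
  twisted by the substitution \<open>x\<^sub>j \<mapsto> x\<^sub>j + c\<^sub>j\<close> with \<open>c\<^sub>j = - s\<^sub>j v\<^sub>j\<^sub>'\<close> and carried over by the swap of the two
  factors of \<open>E\<close>, shows that the dual complex is exact in degrees 0 and 1
  (\<open>weyl_twist.middle_exact\<close>, \<open>y_exact\<close>, \<open>dual_exact\<close>). As the cohomology of the dual complex does not
  depend on the resolution (\<open>dual_cohomology_independent\<close>), it can be read off here.

  \<^item> \<^emph>\<open>Calabi-Yau.\<close> The second cohomology is \<open>E\<close> modulo \<open>\<Sum>\<^sub>j \<delta>\<^sub>j E\<close>. If \<open>v = 0\<close>, then up to signs the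
  \<open>\<delta>\<^sub>j\<close> are the \<open>y\<^sub>j\<^sub>'\<close>, and the quotient is \<open>U\<close>. Conversely an isomorphism with \<open>U\<close> yields an
  element \<open>u\<close> that generates \<open>U\<close> as a bimodule and satisfies
  \<open>s\<^sub>j [x\<^sub>j\<^sub>', u] = v\<^sub>j u\<close>. If some \<open>v\<^sub>j \<noteq> 0\<close>, then \<open>U\<close> has a character (\<open>x\<^sub>j \<mapsto> - \<lambda> / v\<^sub>j\<close>, the other
  generators to zero), which cannot kill the generator \<open>u\<close> but kills commutators, a contradiction
  (\<open>no_intertwiner\<close>).
\<close>

text \<open>The structure of an algebraic operation is written as a plain subscript.\<close>

syntax "_index" :: "logic \<Rightarrow> index" ("\<^sub>_" [1000] 1000)

abbreviation "coef \<equiv> Poly_Mapping.lookup"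
abbreviation "monomial \<equiv> Poly_Mapping.single"

abbreviation "supp \<equiv> Poly_Mapping.keys"

section \<open>Modules and homomorphisms\<close>

lemma (in abelian_subgroup) coset_eq_iff:
  assumes "x \<in> carrier G" "y \<in> carrier G"
  shows "H +> x = H +> y \<longleftrightarrow> x \<ominus> y \<in> H"
  using assms a_rcos_module[OF assms(2,1)] a_repr_independence'[of x y] a_rcos_self[of x]
  by (auto simp: a_minus_def)

lemma abelian_group_minus_eq_zero:
  assumes "abelian_group G" "x \<in> carrier G" "y \<in> carrier G"
  shows "x \<ominus>\<^sub>G y = \<zero>\<^sub>G \<longleftrightarrow> x = y"
proof -
  interpret abelian_group G by fact
  show ?thesis using assms(2,3)
    by (metis a_minus_def minus_equality minus_minus r_neg a_inv_closed)
qed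

context left_module
begin

lemma lsmult_r_null [simp]:
  assumes r: "r \<in> carrier R" shows "r \<odot>\<^sub>M \<zero>\<^sub>M = \<zero>\<^sub>M"
proof -
  have c: "r \<odot>\<^sub>M \<zero>\<^sub>M \<in> carrier M" using r by (simp add: lsmult_closed)
  have "r \<odot>\<^sub>M \<zero>\<^sub>M \<oplus>\<^sub>M r \<odot>\<^sub>M \<zero>\<^sub>M = r \<odot>\<^sub>M \<zero>\<^sub>M \<oplus>\<^sub>M \<zero>\<^sub>M"
    using lsmult_r_distr[OF r, of "\<zero>\<^sub>M" "\<zero>\<^sub>M"] c by simp
  then show ?thesis using c by simp
qed

lemma lsmult_l_null [simp]:
  assumes x: "x \<in> carrier M" shows "\<zero> \<odot>\<^sub>M x = \<zero>\<^sub>M"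
proof -
  have c: "\<zero> \<odot>\<^sub>M x \<in> carrier M" using x by (simp add: lsmult_closed)
  have "\<zero> \<odot>\<^sub>M x \<oplus>\<^sub>M \<zero> \<odot>\<^sub>M x = \<zero> \<odot>\<^sub>M x \<oplus>\<^sub>M \<zero>\<^sub>M"
    using lsmult_l_distr[OF R.zero_closed R.zero_closed x] c by simp
  then show ?thesis using c by simp
qed

lemma lsmult_r_minus:
  assumes "r \<in> carrier R" "x \<in> carrier M" "y \<in> carrier M"
  shows "r \<odot>\<^sub>M (x \<ominus>\<^sub>M y) = r \<odot>\<^sub>M x \<ominus>\<^sub>M r \<odot>\<^sub>M y"
proof -
  have "r \<odot>\<^sub>M (x \<ominus>\<^sub>M y) \<oplus>\<^sub>M r \<odot>\<^sub>M y = r \<odot>\<^sub>M ((x \<ominus>\<^sub>M y) \<oplus>\<^sub>M y)"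
    using assms by (simp add: lsmult_r_distr)
  also have "(x \<ominus>\<^sub>M y) \<oplus>\<^sub>M y = x"
    using assms by (simp add: a_minus_def M.a_assoc M.l_neg)
  finally have *: "r \<odot>\<^sub>M (x \<ominus>\<^sub>M y) \<oplus>\<^sub>M r \<odot>\<^sub>M y = r \<odot>\<^sub>M x" .
  have c: "r \<odot>\<^sub>M (x \<ominus>\<^sub>M y) \<in> carrier M" "r \<odot>\<^sub>M y \<in> carrier M"
    using assms by (simp_all add: lsmult_closed)
  show ?thesis unfolding *[symmetric] using c by (simp add: a_minus_def M.a_assoc M.r_neg)
qed

lemma lsmult_l_minus:
  assumes "r \<in> carrier R" "x \<in> carrier M"
  shows "(\<ominus> r) \<odot>\<^sub>M x = \<ominus>\<^sub>M (r \<odot>\<^sub>M x)"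
proof -
  have "(\<ominus> r) \<odot>\<^sub>M x \<oplus>\<^sub>M r \<odot>\<^sub>M x = \<zero>\<^sub>M"
    using lsmult_l_distr[of "\<ominus> r" r x] assms by (simp add: R.l_neg)
  then show ?thesis using assms by (metis M.minus_equality R.a_inv_closed lsmult_closed)
qed

lemma lsmult_finsum:
  assumes r: "r \<in> carrier R" and f: "f \<in> A \<rightarrow> carrier M"
  shows "r \<odot>\<^sub>M (\<Oplus>\<^sub>M i\<in>A. f i) = (\<Oplus>\<^sub>M i\<in>A. r \<odot>\<^sub>M f i)"
  using f
proof (induction A rule: infinite_finite_induct)
  case (insert x F)
  then have "f x \<in> carrier M" "f \<in> F \<rightarrow> carrier M" by auto
  with insert r show ?case
    by (simp add: Pi_iff lsmult_r_distr lsmult_closed)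
qed (use r in simp_all)

end

lemma lhomI:
  assumes "left_module R M"
    and "!!x. x \<in> carrier M ==> f x \<in> carrier N"
    and "!!x y. [|x \<in> carrier M; y \<in> carrier M|] ==> f (x \<oplus>\<^sub>M y) = f x \<oplus>\<^sub>N f y"
    and "!!r x. [|r \<in> carrier R; x \<in> carrier M|] ==> f (r \<odot>\<^sub>M x) = r \<odot>\<^sub>N f x"
  shows "restrict f (carrier M) \<in> lhom R M N"
proof -
  interpret M: left_module R M by fact
  show ?thesis unfolding lhom_def using assms(2-) by (auto simp: M.lsmult_closed)
qed

lemma lhom_closed: "f \<in> lhom R M N ==> x \<in> carrier M ==> f x \<in> carrier N"
  by (auto simp: lhom_def)

lemma lhom_add: "f \<in> lhom R M N ==> x \<in> carrier M ==> y \<in> carrier M ==>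
    f (x \<oplus>\<^sub>M y) = f x \<oplus>\<^sub>N f y"
  by (auto simp: lhom_def)

lemma lhom_smult: "f \<in> lhom R M N ==> r \<in> carrier R ==> x \<in> carrier M ==>
    f (r \<odot>\<^sub>M x) = r \<odot>\<^sub>N f x"
  by (auto simp: lhom_def)

lemma lhom_eqI: "f \<in> lhom R M N ==> g \<in> lhom R M N ==> (!!x. x \<in> carrier M ==> f x = g x) ==> f = g"
  unfolding lhom_def by (blast intro: PiE_ext)

lemma lhom_zero:
  assumes "left_module R M" "left_module R N" "f \<in> lhom R M N"
  shows "f \<zero>\<^sub>M = \<zero>\<^sub>N"
proof -
  interpret M: left_module R M by fact
  interpret N: left_module R N by fact
  have "f \<zero>\<^sub>M = \<zero>\<^sub>R \<odot>\<^sub>N f \<zero>\<^sub>M"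
    using lhom_smult[OF assms(3), of "\<zero>\<^sub>R" "\<zero>\<^sub>M"] by simp
  then show ?thesis using lhom_closed[OF assms(3), of "\<zero>\<^sub>M"] by simp
qed

lemma lhom_minus:
  assumes "left_module R M" "left_module R N" "f \<in> lhom R M N" "x \<in> carrier M" "y \<in> carrier M"
  shows "f (x \<ominus>\<^sub>M y) = f x \<ominus>\<^sub>N f y"
proof -
  interpret M: left_module R M by fact
  interpret N: left_module R N by fact
  note c = lhom_closed[OF assms(3)]
  have "f (x \<ominus>\<^sub>M y) \<oplus>\<^sub>N f y = f ((x \<ominus>\<^sub>M y) \<oplus>\<^sub>M y)"
    using assms by (simp add: lhom_add)
  also have "(x \<ominus>\<^sub>M y) \<oplus>\<^sub>M y = x"
    using assms by (simp add: a_minus_def M.M.a_assoc M.M.l_neg)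
  finally have *: "f (x \<ominus>\<^sub>M y) \<oplus>\<^sub>N f y = f x" .
  show ?thesis unfolding *[symmetric] using assms(4,5) c
    by (simp add: a_minus_def N.M.a_assoc N.M.r_neg)
qed

lemma lhom_comp:
  assumes "left_module R M" "f \<in> lhom R M N" "g \<in> lhom R N L"
  shows "(\<lambda>x\<in>carrier M. g (f x)) \<in> lhom R M L"
  by (rule lhomI) (use assms in \<open>auto simp: lhom_closed lhom_add lhom_smult\<close>)

lemma lhom_sub:
  assumes "left_module R M" "left_module R N" "f \<in> lhom R M N" "g \<in> lhom R M N"
  shows "(\<lambda>x\<in>carrier M. f x \<ominus>\<^sub>N g x) \<in> lhom R M N"
proof -
  interpret N: left_module R N by fact
  note c = lhom_closed[OF assms(3)] lhom_closed[OF assms(4)]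
  show ?thesis
  proof (rule lhomI)
    fix x y assume "x \<in> carrier M" "y \<in> carrier M"
    then show "f (x \<oplus>\<^sub>M y) \<ominus>\<^sub>N g (x \<oplus>\<^sub>M y) = f x \<ominus>\<^sub>N g x \<oplus>\<^sub>N (f y \<ominus>\<^sub>N g y)"
      using c assms by (simp add: lhom_add a_minus_def N.M.minus_add N.M.a_ac)
  next
    fix r x assume "r \<in> carrier R" "x \<in> carrier M"
    then show "f (r \<odot>\<^sub>M x) \<ominus>\<^sub>N g (r \<odot>\<^sub>M x) = r \<odot>\<^sub>N (f x \<ominus>\<^sub>N g x)"
      using c assms by (simp add: lhom_smult N.lsmult_r_minus)
  qed (use c assms in auto)
qed

lemma lhom_finsum:
  assumes "left_module R M" "left_module R N" "f \<in> lhom R M N" "h \<in> A \<rightarrow> carrier M"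
  shows "f (\<Oplus>\<^sub>M i\<in>A. h i) = (\<Oplus>\<^sub>N i\<in>A. f (h i))"
  using assms(4)
proof (induction A rule: infinite_finite_induct)
  case (infinite A)
  interpret M: left_module R M by fact
  interpret N: left_module R N by fact
  show ?case using infinite lhom_zero[OF assms(1-3)] by simp
next
  case empty
  interpret M: left_module R M by fact
  interpret N: left_module R N by fact
  show ?case using lhom_zero[OF assms(1-3)] by simp
next
  case (insert x F)
  interpret M: left_module R M by fact
  interpret N: left_module R N by fact
  have "h x \<in> carrier M" "h \<in> F \<rightarrow> carrier M" using insert by auto
  with insert show ?case using assms
    by (simp add: Pi_iff lhom_add lhom_closed)
qed

section \<open>Free modules\<close>

definition funit :: "('r, 'z) ring_scheme => 'b set => 'b => 'b => 'r"
  where "funit R X x = (\<lambda>y\<in>X. if y = x then \<one>\<^sub>R else \<zero>\<^sub>R)"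

lemma funit_apply [simp]: "y \<in> X ==> funit R X x y = (if y = x then \<one>\<^sub>R else \<zero>\<^sub>R)"
  by (simp add: funit_def)

lemma free_lmod_simps [simp]:
  "carrier (free_lmod R X) = {f \<in> X \<rightarrow>\<^sub>E carrier R. finite {x \<in> X. f x \<noteq> \<zero>\<^sub>R}}"
  "zero (free_lmod R X) = (\<lambda>x\<in>X. \<zero>\<^sub>R)"
  "add (free_lmod R X) = (\<lambda>f g. \<lambda>x\<in>X. f x \<oplus>\<^sub>R g x)"
  "smult (free_lmod R X) = (\<lambda>r f. \<lambda>x\<in>X. r \<otimes>\<^sub>R f x)"
  by (simp_all add: free_lmod_def)

lemma free_lmod_left_module:
  fixes R (structure)
  assumes "ring R" shows "left_module R (free_lmod R X)"
proof -
  interpret ring R by fact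
  have sup: "finite {x \<in> X. h x \<noteq> \<zero>}" if "finite {x \<in> X. f x \<noteq> \<zero>}" "finite {x \<in> X. g x \<noteq> \<zero>}"
    "!!x. x \<in> X ==> f x = \<zero> ==> g x = \<zero> ==> h x = \<zero>" for f g h :: "'c => 'a"
    by (rule finite_subset[OF _ finite_UnI[OF that(1,2)]]) (use that(3) in auto)
  show ?thesis
  proof (intro left_module.intro left_module_axioms.intro)
    show "ring R" by fact
    show "abelian_group (free_lmod R X)"
    proof (rule abelian_groupI)
      fix f g assume fg: "f \<in> carrier (free_lmod R X)" "g \<in> carrier (free_lmod R X)"
      show "f \<oplus>\<^sub>(free_lmod R X) g \<in> carrier (free_lmod R X)"
        using fg sup[of f g "\<lambda>x\<in>X. f x \<oplus> g x"] by (auto simp: PiE_iff)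
      show "f \<oplus>\<^sub>(free_lmod R X) g = g \<oplus>\<^sub>(free_lmod R X) f"
        using fg by (auto simp: PiE_iff intro!: restrict_ext a_comm)
      fix h assume h: "h \<in> carrier (free_lmod R X)"
      show "f \<oplus>\<^sub>(free_lmod R X) g \<oplus>\<^sub>(free_lmod R X) h = f \<oplus>\<^sub>(free_lmod R X) (g \<oplus>\<^sub>(free_lmod R X) h)"
        using fg h by (auto simp: PiE_iff intro!: restrict_ext a_assoc)
    next
      show "\<zero>\<^sub>(free_lmod R X) \<in> carrier (free_lmod R X)" by auto
    next
      fix f assume f: "f \<in> carrier (free_lmod R X)"
      show "\<zero>\<^sub>(free_lmod R X) \<oplus>\<^sub>(free_lmod R X) f = f"
        using f by (auto simp: PiE_iff extensional_def)
      have "(\<lambda>x\<in>X. \<ominus> f x) \<in> carrier (free_lmod R X)"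
        using f sup[of f f "\<lambda>x\<in>X. \<ominus> f x"] by (auto simp: PiE_iff)
      moreover have "(\<lambda>x\<in>X. \<ominus> f x) \<oplus>\<^sub>(free_lmod R X) f = \<zero>\<^sub>(free_lmod R X)"
        using f by (auto simp: PiE_iff l_neg intro!: restrict_ext)
      ultimately show "\<exists>g\<in>carrier (free_lmod R X). g \<oplus>\<^sub>(free_lmod R X) f = \<zero>\<^sub>(free_lmod R X)"
        by blast
    qed
    fix f assume f: "f \<in> carrier (free_lmod R X)"
    show "\<one> \<odot>\<^sub>(free_lmod R X) f = f" using f by (auto simp: PiE_iff extensional_def)
    fix r assume r: "r \<in> carrier R"
    show "r \<odot>\<^sub>(free_lmod R X) f \<in> carrier (free_lmod R X)"
      using f r sup[of f f "\<lambda>x\<in>X. r \<otimes> f x"] by (auto simp: PiE_iff)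
    { fix s assume s: "s \<in> carrier R"
      show "(r \<oplus> s) \<odot>\<^sub>(free_lmod R X) f = r \<odot>\<^sub>(free_lmod R X) f \<oplus>\<^sub>(free_lmod R X) s \<odot>\<^sub>(free_lmod R X) f"
        using f r s by (auto simp: PiE_iff intro!: restrict_ext l_distr)
      show "(r \<otimes> s) \<odot>\<^sub>(free_lmod R X) f = r \<odot>\<^sub>(free_lmod R X) (s \<odot>\<^sub>(free_lmod R X) f)"
        using f r s by (auto simp: PiE_iff intro!: restrict_ext m_assoc) }
    fix g assume g: "g \<in> carrier (free_lmod R X)"
    show "r \<odot>\<^sub>(free_lmod R X) (f \<oplus>\<^sub>(free_lmod R X) g) = r \<odot>\<^sub>(free_lmod R X) f \<oplus>\<^sub>(free_lmod R X) r \<odot>\<^sub>(free_lmod R X) g"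
      using f r g by (auto simp: PiE_iff intro!: restrict_ext r_distr)
  qed
qed

lemma funit_in_free [simp]:
  assumes "ring R" shows "funit R X x \<in> carrier (free_lmod R X)"
proof -
  interpret ring R by fact
  have "finite {y \<in> X. funit R X x y \<noteq> \<zero>\<^sub>R}" by (rule finite_subset[of _ "{x}"]) (auto split: if_splits)
  then show ?thesis by (auto simp: PiE_iff funit_def)
qed

lemma free_lmod_induct [consumes 2, case_names zero step]:
  fixes R (structure)
  assumes "ring R" and c: "c \<in> carrier (free_lmod R X)"
    and zero: "P \<zero>\<^sub>(free_lmod R X)"
    and step: "!!c r x. [|c \<in> carrier (free_lmod R X); P c; r \<in> carrier R; x \<in> X|] ==>
      P (c \<oplus>\<^sub>(free_lmod R X) r \<odot>\<^sub>(free_lmod R X) funit R X x)"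
  shows "P c"
proof -
  interpret ring R by fact
  have "finite S ==> c \<in> carrier (free_lmod R X) ==> {x \<in> X. c x \<noteq> \<zero>} \<subseteq> S ==> P c" for S c
  proof (induction S arbitrary: c rule: finite_induct)
    case empty
    then have "c = \<zero>\<^sub>(free_lmod R X)" by (auto simp: PiE_iff extensional_def fun_eq_iff)
    then show ?case using zero by metis
  next
    case (insert s S)
    show ?case
    proof (cases "s \<in> X")
      case False
      then show ?thesis using insert by (intro insert.IH) auto
    next
      case True
      let ?c = "\<lambda>x\<in>X. if x = s then \<zero> else c x"
      have fin: "finite {x \<in> X. ?c x \<noteq> \<zero>}"
        by (rule finite_subset[of _ S]) (use insert in auto)
      have c': "?c \<in> carrier (free_lmod R X)" using insert.prems fin by (auto simp: PiE_iff)
      have "P ?c" by (rule insert.IH[OF c']) (use insert.prems in auto)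
      then have "P (?c \<oplus>\<^sub>(free_lmod R X) c s \<odot>\<^sub>(free_lmod R X) funit R X s)"
        using True insert.prems by (intro step[OF c']) (auto simp: PiE_iff)
      also have "?c \<oplus>\<^sub>(free_lmod R X) c s \<odot>\<^sub>(free_lmod R X) funit R X s = c"
        using insert.prems True by (auto simp: PiE_iff extensional_def fun_eq_iff)
      finally show ?thesis .
    qed
  qed
  from this[of "{x \<in> X. c x \<noteq> \<zero>}" c] c show ?thesis by auto
qed

lemma lhom_free_eqI:
  fixes R (structure)
  assumes R: "ring R" and "left_module R N" "f \<in> lhom R (free_lmod R X) N" "g \<in> lhom R (free_lmod R X) N"
    and "!!x. x \<in> X ==> f (funit R X x) = g (funit R X x)"
    and c: "c \<in> carrier (free_lmod R X)"
  shows "f c = g c"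
proof -
  interpret F: left_module R "free_lmod R X" by (rule free_lmod_left_module[OF R])
  from R c show ?thesis
  proof (induction rule: free_lmod_induct)
    case zero
    then show ?case using lhom_zero[OF F.left_module_axioms] assms by metis
  next
    case (step c r x)
    have u: "funit R X x \<in> carrier (free_lmod R X)" using R by (rule funit_in_free)
    show ?case
      using step assms u F.lsmult_closed[OF \<open>r \<in> carrier R\<close> u]
      by (simp add: lhom_add lhom_smult del: free_lmod_simps)
  qed
qed

definition flift :: "('r, 'z) ring_scheme => ('r, 'm) module => 'b set => ('b => 'm) => ('b => 'r) => 'm"
  where "flift R N X b =
    (\<lambda>c\<in>carrier (free_lmod R X). \<Oplus>\<^sub>N x\<in>{x \<in> X. c x \<noteq> \<zero>\<^sub>R}. c x \<odot>\<^sub>N b x)"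

lemma flift_superset:
  assumes "left_module R N" "b \<in> X \<rightarrow> carrier N" "c \<in> carrier (free_lmod R X)"
    and "finite K" "{x \<in> X. c x \<noteq> \<zero>\<^sub>R} \<subseteq> K" "K \<subseteq> X"
  shows "flift R N X b c = (\<Oplus>\<^sub>N x\<in>K. c x \<odot>\<^sub>N b x)"
proof -
  interpret N: left_module R N by fact
  have "(\<Oplus>\<^sub>N x\<in>{x \<in> X. c x \<noteq> \<zero>\<^sub>R}. c x \<odot>\<^sub>N b x) = (\<Oplus>\<^sub>N x\<in>K. c x \<odot>\<^sub>N b x)"
    by (rule N.M.add.finprod_mono_neutral_cong_left)
      (use assms in \<open>auto simp: PiE_iff Pi_iff subset_iff N.lsmult_closed\<close>)
  then show ?thesis using assms(3) by (simp add: flift_def)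
qed

lemma flift_lhom:
  assumes "left_module R N" "b \<in> X \<rightarrow> carrier N"
  shows "flift R N X b \<in> lhom R (free_lmod R X) N"
proof -
  interpret N: left_module R N by fact
  have R: "ring R" ..
  interpret F: left_module R "free_lmod R X" by (rule free_lmod_left_module[OF R])
  note sup = flift_superset[OF assms]
  let ?s = "\<lambda>c. {x \<in> X. c x \<noteq> \<zero>\<^sub>R}"
  have fin: "finite (?s c)" if "c \<in> carrier (free_lmod R X)" for c using that by auto
  have cl: "c x \<odot>\<^sub>N b x \<in> carrier N" if "c \<in> carrier (free_lmod R X)" "x \<in> X" for c x
    using that assms(2) by (auto simp: PiE_iff Pi_iff N.lsmult_closed)
  have val: "c x \<in> carrier R" if "c \<in> carrier (free_lmod R X)" "x \<in> X" for c x
    using that by (auto simp: PiE_iff)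
  have "restrict (flift R N X b) (carrier (free_lmod R X)) \<in> lhom R (free_lmod R X) N"
  proof (rule lhomI)
    fix c assume c: "c \<in> carrier (free_lmod R X)"
    show "flift R N X b c \<in> carrier N"
      unfolding sup[OF c fin[OF c] order.refl Collect_restrict]
      using cl[OF c] by (intro N.M.finsum_closed) auto
    { fix d assume d: "d \<in> carrier (free_lmod R X)"
      let ?K = "?s c \<union> ?s d"
      have K: "finite ?K" "?K \<subseteq> X" using fin c d by auto
      have bx: "b x \<in> carrier N" if "x \<in> X" for x using assms(2) that by auto
      have "flift R N X b (c \<oplus>\<^sub>(free_lmod R X) d) = (\<Oplus>\<^sub>N x\<in>?K. (c \<oplus>\<^sub>(free_lmod R X) d) x \<odot>\<^sub>N b x)"
        by (rule sup[OF F.M.a_closed[OF c d] K(1) _ K(2)]) auto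
      also have "\<dots> = (\<Oplus>\<^sub>N x\<in>?K. c x \<odot>\<^sub>N b x \<oplus>\<^sub>N d x \<odot>\<^sub>N b x)"
      proof (rule N.M.finsum_cong'[OF refl])
        show "(\<lambda>x. c x \<odot>\<^sub>N b x \<oplus>\<^sub>N d x \<odot>\<^sub>N b x) \<in> ?K \<rightarrow> carrier N"
          using cl[OF c] cl[OF d] by auto
        fix x assume "x \<in> ?K"
        then have x: "x \<in> X" using K(2) by blast
        have "(c \<oplus>\<^sub>(free_lmod R X) d) x = c x \<oplus>\<^sub>R d x" using x by simp
        then show "(c \<oplus>\<^sub>(free_lmod R X) d) x \<odot>\<^sub>N b x = c x \<odot>\<^sub>N b x \<oplus>\<^sub>N d x \<odot>\<^sub>N b x"
          using N.lsmult_l_distr[OF val[OF c x] val[OF d x] bx[OF x]] by simp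
      qed
      also have "\<dots> = (\<Oplus>\<^sub>N x\<in>?K. c x \<odot>\<^sub>N b x) \<oplus>\<^sub>N (\<Oplus>\<^sub>N x\<in>?K. d x \<odot>\<^sub>N b x)"
        by (rule N.M.finsum_addf) (use cl[OF c] cl[OF d] in auto)
      also have "(\<Oplus>\<^sub>N x\<in>?K. c x \<odot>\<^sub>N b x) = flift R N X b c"
        by (rule sup[OF c K(1) _ K(2), symmetric]) blast
      also have "(\<Oplus>\<^sub>N x\<in>?K. d x \<odot>\<^sub>N b x) = flift R N X b d"
        by (rule sup[OF d K(1) _ K(2), symmetric]) blast
      finally show "flift R N X b (c \<oplus>\<^sub>(free_lmod R X) d) = flift R N X b c \<oplus>\<^sub>N flift R N X b d" . }
    fix r assume r: "r \<in> carrier R"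
    have "flift R N X b (r \<odot>\<^sub>(free_lmod R X) c) = (\<Oplus>\<^sub>N x\<in>?s c. (r \<odot>\<^sub>(free_lmod R X) c) x \<odot>\<^sub>N b x)"
      by (rule sup[OF F.lsmult_closed[OF r c] fin[OF c] _ Collect_restrict]) (use r in auto)
    also have "\<dots> = (\<Oplus>\<^sub>N x\<in>?s c. r \<odot>\<^sub>N (c x \<odot>\<^sub>N b x))"
    proof (rule N.M.finsum_cong'[OF refl])
      show "(\<lambda>x. r \<odot>\<^sub>N (c x \<odot>\<^sub>N b x)) \<in> ?s c \<rightarrow> carrier N"
        using cl[OF c] r by (auto intro: N.lsmult_closed)
      fix x assume "x \<in> ?s c"
      then have x: "x \<in> X" by blast
      have "(r \<odot>\<^sub>(free_lmod R X) c) x = r \<otimes>\<^sub>R c x" using x by simp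
      then show "(r \<odot>\<^sub>(free_lmod R X) c) x \<odot>\<^sub>N b x = r \<odot>\<^sub>N (c x \<odot>\<^sub>N b x)"
        using N.lsmult_assoc[OF r val[OF c x]] assms(2) x by auto
    qed
    also have "\<dots> = r \<odot>\<^sub>N (\<Oplus>\<^sub>N x\<in>?s c. c x \<odot>\<^sub>N b x)"
      by (rule N.lsmult_finsum[OF r, symmetric]) (use cl[OF c] in auto)
    also have "(\<Oplus>\<^sub>N x\<in>?s c. c x \<odot>\<^sub>N b x) = flift R N X b c"
      by (rule sup[OF c fin[OF c] order.refl Collect_restrict, symmetric])
    finally show "flift R N X b (r \<odot>\<^sub>(free_lmod R X) c) = r \<odot>\<^sub>N flift R N X b c" .
  qed (rule F.left_module_axioms)
  then show ?thesis by (simp add: flift_def restrict_def cong: if_cong)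
qed

lemma flift_funit:
  assumes "left_module R N" "b \<in> X \<rightarrow> carrier N" "x \<in> X"
  shows "flift R N X b (funit R X x) = b x"
proof -
  interpret N: left_module R N by fact
  have R: "ring R" ..
  have "flift R N X b (funit R X x) = (\<Oplus>\<^sub>N y\<in>{x}. funit R X x y \<odot>\<^sub>N b y)"
    by (rule flift_superset[OF assms(1,2) funit_in_free[OF R]])
      (use assms(3) in \<open>auto split: if_splits\<close>)
  also have "\<dots> = b x" using assms
    by (simp add: Pi_iff N.lsmult_one)
  finally show ?thesis .
qed

lemma free_lmod_expand:
  fixes R (structure)
  assumes "ring R" "finite X" and c: "c \<in> carrier (free_lmod R X)"
  shows "c = (\<Oplus>\<^sub>(free_lmod R X)x\<in>X. c x \<odot>\<^sub>(free_lmod R X) funit R X x)"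
proof -
  interpret F: left_module R "free_lmod R X" by (rule free_lmod_left_module[OF assms(1)])
  let ?i = "\<lambda>c\<in>carrier (free_lmod R X). c"
  have i: "?i \<in> lhom R (free_lmod R X) (free_lmod R X)"
    by (rule lhomI[OF F.left_module_axioms]) (rule refl | assumption)+
  have u: "(\<lambda>x. funit R X x) \<in> X \<rightarrow> carrier (free_lmod R X)"
    by (intro funcsetI funit_in_free assms(1))
  note l = F.left_module_axioms
  have "c = ?i c" using c by (simp del: free_lmod_simps)
  also have "\<dots> = flift R (free_lmod R X) X (\<lambda>x. funit R X x) c"
    by (rule lhom_free_eqI[OF assms(1) l i flift_lhom[OF l u] _ c])
      (simp add: funit_in_free[OF assms(1)] flift_funit[OF l u] del: free_lmod_simps)
  also have "\<dots> = (\<Oplus>\<^sub>(free_lmod R X)x\<in>X. c x \<odot>\<^sub>(free_lmod R X) funit R X x)"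
    by (rule flift_superset[OF l u c assms(2)]) auto
  finally show ?thesis .
qed

lemma finite_type_free_lmod:
  fixes R (structure)
  assumes R: "ring R" and nz: "\<one> \<noteq> \<zero>" and "finite X"
  shows "finite_type R (free_lmod R X)"
proof -
  interpret ring R by fact
  interpret F: left_module R "free_lmod R X" by (rule free_lmod_left_module[OF R])
  let ?u = "\<lambda>x. funit R X x"
  have inj: "inj_on ?u X"
  proof (rule inj_onI)
    fix x y assume x: "x \<in> X" and eq: "?u x = ?u y"
    from fun_cong[OF eq[symmetric], of x] x nz show "x = y" by (simp split: if_splits)
  qed
  have "\<exists>k\<in>?u ` X \<rightarrow> carrier R. c = (\<Oplus>\<^sub>(free_lmod R X)s\<in>?u ` X. k s \<odot>\<^sub>(free_lmod R X) s)"
    if c: "c \<in> carrier (free_lmod R X)" for c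
  proof
    let ?k = "\<lambda>s. c (the_inv_into X ?u s)"
    have k: "?k (?u x) = c x" if "x \<in> X" for x by (simp only: the_inv_into_f_f[OF inj that])
    have cx: "x \<in> X ==> c x \<in> carrier R" for x using c by (auto simp: PiE_iff)
    show kc: "?k \<in> ?u ` X \<rightarrow> carrier R" by (rule funcsetI, erule imageE) (simp only: k cx)
    have sc: "s \<in> ?u ` X ==> s \<in> carrier (free_lmod R X)" for s
      by (erule imageE) (simp only: funit_in_free[OF R])
    have "(\<Oplus>\<^sub>(free_lmod R X)s\<in>?u ` X. ?k s \<odot>\<^sub>(free_lmod R X) s) =
        (\<Oplus>\<^sub>(free_lmod R X)x\<in>X. ?k (?u x) \<odot>\<^sub>(free_lmod R X) ?u x)"
      by (rule F.M.finsum_reindex[OF _ inj])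
        (rule funcsetI, rule F.lsmult_closed[OF funcset_mem[OF kc] sc], assumption+)
    also have "\<dots> = (\<Oplus>\<^sub>(free_lmod R X)x\<in>X. c x \<odot>\<^sub>(free_lmod R X) ?u x)"
    proof (rule F.M.finsum_cong'[OF refl])
      show "(\<lambda>x. c x \<odot>\<^sub>(free_lmod R X) ?u x) \<in> X \<rightarrow> carrier (free_lmod R X)"
        by (intro funcsetI F.lsmult_closed cx funit_in_free[OF R])
    qed (simp only: k)
    also have "\<dots> = c" using free_lmod_expand[OF R \<open>finite X\<close> c] by simp
    finally show "c = (\<Oplus>\<^sub>(free_lmod R X)s\<in>?u ` X. ?k s \<odot>\<^sub>(free_lmod R X) s)" by simp
  qed
  moreover have "?u ` X \<subseteq> carrier (free_lmod R X)"
    by (rule image_subsetI) (rule funit_in_free[OF R])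
  ultimately show ?thesis unfolding finite_type_def
    by (intro exI[of _ "?u ` X"] conjI ballI finite_imageI \<open>finite X\<close>)
qed

lemma projective_free_lmod:
  fixes R (structure) and X :: "'b set" and e :: "'b => 'b => 'r"
  assumes R: "ring (R :: ('r, 'z) ring_scheme)" and e: "inj e"
  shows "projective R (free_lmod R X)"
proof -
  interpret ring R by fact
  let ?F = "free_lmod R X" and ?Y = "e ` X"
  let ?G = "free_lmod R ?Y :: ('r, ('b => 'r) => 'r) module"
  have F: "left_module R ?F" and G: "left_module R ?G"
    by (rule free_lmod_left_module[OF R])+
  define s where "s = flift R ?G X (\<lambda>x. funit R ?Y (e x))"
  define p where "p = flift R ?F ?Y (\<lambda>y. funit R X (inv_into UNIV e y))"
  have bs: "(\<lambda>x. funit R ?Y (e x)) \<in> X \<rightarrow> carrier ?G"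
    by (intro funcsetI funit_in_free R)
  have bp: "(\<lambda>y. funit R X (inv_into UNIV e y)) \<in> ?Y \<rightarrow> carrier ?F"
    by (intro funcsetI funit_in_free R)
  have s: "s \<in> lhom R ?F ?G" unfolding s_def by (rule flift_lhom[OF G bs])
  have p: "p \<in> lhom R ?G ?F" unfolding p_def by (rule flift_lhom[OF F bp])
  have i: "(\<lambda>c\<in>carrier ?F. c) \<in> lhom R ?F ?F"
    by (rule lhomI[OF F]) (rule refl | assumption)+
  have ps: "p (s c) = c" if c: "c \<in> carrier ?F" for c
  proof -
    have "(\<lambda>c\<in>carrier ?F. p (s c)) c = (\<lambda>c\<in>carrier ?F. c) c"
    proof (rule lhom_free_eqI[OF R F lhom_comp[OF F s p] i _ c])
      fix x assume x: "x \<in> X"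
      have "p (s (funit R X x)) = p (funit R ?Y (e x))"
        unfolding s_def by (simp add: flift_funit[OF G bs x])
      also have "\<dots> = funit R X x"
        unfolding p_def using x e by (simp add: flift_funit[OF F bp] inv_f_f)
      finally show "(\<lambda>c\<in>carrier ?F. p (s c)) (funit R X x) = (\<lambda>c\<in>carrier ?F. c) (funit R X x)"
        by (simp add: funit_in_free[OF R] del: free_lmod_simps)
    qed
    then show ?thesis using c by (simp del: free_lmod_simps)
  qed
  show ?thesis unfolding projective_def
    by (intro conjI F exI[of _ ?Y] bexI[OF _ s] bexI[OF _ p] ballI ps)
qed

text \<open>Only the values of \<open>h\<close> have to lie in the image of \<open>g\<close>: in the comparison of resolutions \<open>g\<close>
  is a differential and \<open>h\<close> takes values in its cycles.\<close>

lemma projective_lift: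
  fixes P :: "('r, 'p) module"
  assumes P: "projective R P" and N: "left_module R N" and N': "left_module R N'"
    and g: "g \<in> lhom R N N'" and h: "h \<in> lhom R P N'"
    and im: "!!x. x \<in> carrier P ==> h x \<in> g ` carrier N"
  obtains f where "f \<in> lhom R P N" "!!x. x \<in> carrier P ==> g (f x) = h x"
proof -
  interpret N: left_module R N by fact
  have R: "ring R" ..
  from P obtain X :: "'p set" and s p where LP: "left_module R P"
    and s: "s \<in> lhom R P (free_lmod R X)" and p: "p \<in> lhom R (free_lmod R X) P"
    and ps: "!!x. x \<in> carrier P ==> p (s x) = x"
    unfolding projective_def by blast
  let ?F = "free_lmod R X"
  have F: "left_module R ?F" by (rule free_lmod_left_module[OF R])
  have "\<forall>x. \<exists>y\<in>carrier N. g y = h (p (funit R X x))"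
    using im lhom_closed[OF p funit_in_free[OF R]] by (metis (no_types, lifting) imageE)
  then obtain b where b: "!!x. b x \<in> carrier N" "!!x. g (b x) = h (p (funit R X x))" by metis
  have bX: "b \<in> X \<rightarrow> carrier N" using b by blast
  define k where "k = flift R N X b"
  have k: "k \<in> lhom R ?F N" unfolding k_def by (rule flift_lhom[OF N bX])
  have gk: "g (k c) = h (p c)" if c: "c \<in> carrier ?F" for c
  proof -
    have "(\<lambda>c\<in>carrier ?F. g (k c)) c = (\<lambda>c\<in>carrier ?F. h (p c)) c"
    proof (rule lhom_free_eqI[OF R N' lhom_comp[OF F k g] lhom_comp[OF F p h] _ c])
      fix x assume "x \<in> X"
      then show "(\<lambda>c\<in>carrier ?F. g (k c)) (funit R X x) = (\<lambda>c\<in>carrier ?F. h (p c)) (funit R X x)"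
        using b by (simp add: funit_in_free[OF R] k_def flift_funit[OF N bX] del: free_lmod_simps)
    qed
    then show ?thesis using c by (simp del: free_lmod_simps)
  qed
  show thesis
  proof (rule that)
    show "(\<lambda>x\<in>carrier P. k (s x)) \<in> lhom R P N" by (rule lhom_comp[OF LP s k])
    fix x assume "x \<in> carrier P"
    then show "g ((\<lambda>x\<in>carrier P. k (s x)) x) = h x"
      using gk[OF lhom_closed[OF s]] ps by simp
  qed
qed

section \<open>Comparison of projective resolutions\<close>

definition bdry_ker :: "('r, 'm) module => (nat => ('r, 'p) module) => (nat => 'p => 'p) => ('p => 'm) =>
    nat => 'p set"
  where "bdry_ker M P d \<epsilon> i = (case i of
    0 => {x \<in> carrier (P 0). \<epsilon> x = \<zero>\<^sub>M} |
    Suc j => {x \<in> carrier (P (Suc j)). d j x = \<zero>\<^sub>(P j)})"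

lemma projective_resolutionD:
  assumes "projective_resolution R M P d \<epsilon>"
  shows "projective R (P i)" "left_module R (P i)" "d i \<in> lhom R (P (Suc i)) (P i)"
    "\<epsilon> \<in> lhom R (P 0) M" "\<epsilon> ` carrier (P 0) = carrier M"
    "bdry_ker M P d \<epsilon> i = d i ` carrier (P (Suc i))"
proof -
  show "projective R (P i)" "d i \<in> lhom R (P (Suc i)) (P i)"
    "\<epsilon> \<in> lhom R (P 0) M" "\<epsilon> ` carrier (P 0) = carrier M"
    using assms by (auto simp: projective_resolution_def)
  then show "left_module R (P i)" by (simp add: projective_def)
  show "bdry_ker M P d \<epsilon> i = d i ` carrier (P (Suc i))"
    using assms unfolding projective_resolution_def bdry_ker_def
    by (cases i) (simp_all add: One_nat_def)
qed

lemma resolution_dd: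
  assumes "projective_resolution R M P d \<epsilon>" "x \<in> carrier (P (Suc (Suc i)))"
  shows "d i (d (Suc i) x) = \<zero>\<^sub>(P i)"
proof -
  have "d (Suc i) x \<in> bdry_ker M P d \<epsilon> (Suc i)"
    using assms(2) projective_resolutionD(6)[OF assms(1)] by blast
  then show ?thesis by (simp add: bdry_ker_def)
qed

lemma resolution_ed:
  assumes "projective_resolution R M P d \<epsilon>" "x \<in> carrier (P (Suc 0))"
  shows "\<epsilon> (d 0 x) = \<zero>\<^sub>M"
proof -
  have "d 0 x \<in> bdry_ker M P d \<epsilon> 0"
    using assms(2) projective_resolutionD(6)[OF assms(1)] by blast
  then show ?thesis by (simp add: bdry_ker_def)
qed

definition chain_map where
  "chain_map R P d Q e f \<longleftrightarrow> (\<forall>i. f i \<in> lhom R (P i) (Q i)) \<and>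
    (\<forall>i. \<forall>x\<in>carrier (P (Suc i)). e i (f (Suc i) x) = f i (d i x))"

text \<open>The first half of the comparison theorem: at each step \<open>f (d x)\<close> is a cycle of the exact
  complex \<open>Q\<close>, so projectivity lifts it through the differential.\<close>

lemma chain_map_exists:
  assumes P: "projective_resolution R M P d \<epsilon>" and Q: "projective_resolution R M Q e \<eta>"
    and M: "left_module R M"
  obtains f where "chain_map R P d Q e f" "!!x. x \<in> carrier (P 0) ==> \<eta> (f 0 x) = \<epsilon> x"
proof -
  note p = projective_resolutionD[OF P] and q = projective_resolutionD[OF Q]
  let ?A = "\<lambda>n f. f \<in> lhom R (P n) (Q n) \<and> (n = 0 --> (\<forall>x\<in>carrier (P 0). \<eta> (f x) = \<epsilon> x)) \<and>
    (\<forall>x\<in>carrier (P (Suc n)). f (d n x) \<in> bdry_ker M Q e \<eta> n)"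
  let ?B = "\<lambda>n f g. \<forall>x\<in>carrier (P (Suc n)). e n (g x) = f (d n x)"
  have "\<exists>f. \<forall>n. ?A n (f n) \<and> ?B n (f n) (f (Suc n))"
  proof (rule dependent_nat_choice)
    obtain f where f: "f \<in> lhom R (P 0) (Q 0)" "!!x. x \<in> carrier (P 0) ==> \<eta> (f x) = \<epsilon> x"
      using projective_lift[OF p(1) q(2) M q(4) p(4)] lhom_closed[OF p(4)] q(5) by metis
    have "f (d 0 x) \<in> bdry_ker M Q e \<eta> 0" if x: "x \<in> carrier (P (Suc 0))" for x
      using lhom_closed[OF f(1) lhom_closed[OF p(3) x]] f(2)[OF lhom_closed[OF p(3) x]]
        resolution_ed[OF P x] by (simp add: bdry_ker_def)
    then show "\<exists>f. ?A 0 f" using f by blast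
  next
    fix f n assume f: "?A n f"
    let ?h = "\<lambda>x\<in>carrier (P (Suc n)). f (d n x)"
    have fn: "f \<in> lhom R (P n) (Q n)" using f by blast
    have h: "?h \<in> lhom R (P (Suc n)) (Q n)" by (rule lhom_comp[OF p(2) p(3) fn])
    have im: "?h x \<in> e n ` carrier (Q (Suc n))" if "x \<in> carrier (P (Suc n))" for x
      using f that q(6)[of n] by simp
    obtain g where g: "g \<in> lhom R (P (Suc n)) (Q (Suc n))"
      "!!x. x \<in> carrier (P (Suc n)) ==> e n (g x) = ?h x"
      by (rule projective_lift[OF p(1) q(2) q(2) q(3) h im], blast+)
    have "g (d (Suc n) x) \<in> bdry_ker M Q e \<eta> (Suc n)" if x: "x \<in> carrier (P (Suc (Suc n)))" for x
    proof -
      have dx: "d (Suc n) x \<in> carrier (P (Suc n))" by (rule lhom_closed[OF p(3) x])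
      have "e n (g (d (Suc n) x)) = f (d n (d (Suc n) x))" using g(2)[OF dx] dx by simp
      also have "\<dots> = \<zero>\<^sub>(Q n)" using resolution_dd[OF P x] lhom_zero[OF p(2) q(2) fn] by simp
      finally show ?thesis using lhom_closed[OF g(1) dx] by (simp add: bdry_ker_def)
    qed
    then show "\<exists>g. ?A (Suc n) g \<and> ?B n f g" using g by auto
  qed
  then obtain f where f: "\<forall>n. ?A n (f n) \<and> ?B n (f n) (f (Suc n))" by blast
  show thesis by (rule that[of f]) (use f in \<open>auto simp: chain_map_def\<close>)
qed

text \<open>A chain map over the zero map of \<open>M\<close> is null-homotopic.\<close>

lemma null_homotopy_exists:
  assumes P: "projective_resolution R M P d \<epsilon>" and M: "left_module R M"
    and \<phi>: "chain_map R P d P d \<phi>" and \<epsilon>0: "!!x. x \<in> carrier (P 0) ==> \<epsilon> (\<phi> 0 x) = \<zero>\<^sub>M"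
  obtains s where "!!i. s i \<in> lhom R (P i) (P (Suc i))"
    "!!x. x \<in> carrier (P 0) ==> \<phi> 0 x = d 0 (s 0 x)"
    "!!i x. x \<in> carrier (P (Suc i)) ==> \<phi> (Suc i) x = d (Suc i) (s (Suc i) x) \<oplus>\<^sub>(P (Suc i)) s i (d i x)"
proof -
  note p = projective_resolutionD[OF P]
  have \<phi>l: "\<phi> i \<in> lhom R (P i) (P i)" and \<phi>d: "x \<in> carrier (P (Suc i)) ==> d i (\<phi> (Suc i) x) = \<phi> i (d i x)"
    for i x using \<phi> by (auto simp: chain_map_def)
  let ?A = "\<lambda>n s. s \<in> lhom R (P n) (P (Suc n)) \<and>
    (n = 0 --> (\<forall>x\<in>carrier (P 0). \<phi> 0 x = d 0 (s x))) \<and>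
    (\<forall>x\<in>carrier (P (Suc n)). d n (s (d n x)) = d n (\<phi> (Suc n) x))"
  let ?B = "\<lambda>n s t. \<forall>x\<in>carrier (P (Suc n)). \<phi> (Suc n) x = d (Suc n) (t x) \<oplus>\<^sub>(P (Suc n)) s (d n x)"
  have "\<exists>s. \<forall>n. ?A n (s n) \<and> ?B n (s n) (s (Suc n))"
  proof (rule dependent_nat_choice)
    have im: "\<phi> 0 x \<in> d 0 ` carrier (P (Suc 0))" if "x \<in> carrier (P 0)" for x
      using p(6)[of 0] \<epsilon>0[OF that] lhom_closed[OF \<phi>l that] by (auto simp: bdry_ker_def)
    obtain s where s: "s \<in> lhom R (P 0) (P (Suc 0))" "!!x. x \<in> carrier (P 0) ==> d 0 (s x) = \<phi> 0 x"
      by (rule projective_lift[OF p(1) p(2) p(2) p(3) \<phi>l im], blast+)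
    have "?A 0 s" using s \<phi>d lhom_closed[OF p(3)] by simp
    then show "\<exists>s. ?A 0 s" by blast
  next
    fix s n assume A: "?A n s"
    then have s: "s \<in> lhom R (P n) (P (Suc n))" by blast
    interpret P1: left_module R "P (Suc n)" by (rule p(2))
    interpret P0: left_module R "P n" by (rule p(2))
    let ?sd = "\<lambda>x\<in>carrier (P (Suc n)). s (d n x)"
    let ?h = "\<lambda>x\<in>carrier (P (Suc n)). \<phi> (Suc n) x \<ominus>\<^sub>(P (Suc n)) ?sd x"
    have sd: "?sd \<in> lhom R (P (Suc n)) (P (Suc n))" by (rule lhom_comp[OF p(2,3) s])
    have h: "?h \<in> lhom R (P (Suc n)) (P (Suc n))" by (rule lhom_sub[OF p(2) p(2) \<phi>l sd])
    have im: "?h x \<in> d (Suc n) ` carrier (P (Suc (Suc n)))" if x: "x \<in> carrier (P (Suc n))" for x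
    proof -
      have c: "\<phi> (Suc n) x \<in> carrier (P (Suc n))" "s (d n x) \<in> carrier (P (Suc n))"
        using lhom_closed[OF \<phi>l x] lhom_closed[OF sd x] x by auto
      have "d n (?h x) = d n (\<phi> (Suc n) x) \<ominus>\<^sub>(P n) d n (s (d n x))"
        using x c lhom_minus[OF p(2) p(2) p(3) c] by simp
      also have "\<dots> = \<zero>\<^sub>(P n)" using A x lhom_closed[OF p(3) c(1)] by (simp add: P0.M.r_neg a_minus_def)
      finally have "?h x \<in> {y \<in> carrier (P (Suc n)). d n y = \<zero>\<^sub>(P n)}"
        by (intro CollectI conjI lhom_closed[OF h x])
      then show ?thesis unfolding p(6)[symmetric] bdry_ker_def nat.case .
    qed
    obtain t where t: "t \<in> lhom R (P (Suc n)) (P (Suc (Suc n)))"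
      "!!x. x \<in> carrier (P (Suc n)) ==> d (Suc n) (t x) = ?h x"
      by (rule projective_lift[OF p(1) p(2) p(2) p(3) h im], blast+)
    have B: "\<phi> (Suc n) x = d (Suc n) (t x) \<oplus>\<^sub>(P (Suc n)) s (d n x)" if x: "x \<in> carrier (P (Suc n))" for x
      using t(2)[OF x] x lhom_closed[OF \<phi>l x] lhom_closed[OF sd x]
      by (simp add: a_minus_def P1.M.a_assoc P1.M.l_neg)
    have "d (Suc n) (t (d (Suc n) x)) = d (Suc n) (\<phi> (Suc (Suc n)) x)"
      if x: "x \<in> carrier (P (Suc (Suc n)))" for x
    proof -
      have dx: "d (Suc n) x \<in> carrier (P (Suc n))" by (rule lhom_closed[OF p(3) x])
      have "s (d n (d (Suc n) x)) = \<zero>\<^sub>(P (Suc n))"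
        using resolution_dd[OF P x] lhom_zero[OF p(2) p(2) s] by simp
      then show ?thesis
        using B[OF dx] \<phi>d[OF x] lhom_closed[OF p(3) lhom_closed[OF t(1) dx]] by simp
    qed
    then show "\<exists>t. ?A (Suc n) t \<and> ?B n s t" using t(1) B by auto
  qed
  then obtain s where s: "\<forall>n. ?A n (s n) \<and> ?B n (s n) (s (Suc n))" by blast
  show thesis by (rule that[of s]) (use s in auto)
qed

text \<open>The homotopy uniqueness of comparison maps, in the form used below: a chain endomorphism over
  the identity of \<open>M\<close> is homotopic to the identity.\<close>

lemma homotopic_to_identity:
  assumes P: "projective_resolution R M P d \<epsilon>" and M: "left_module R M"
    and f: "chain_map R P d P d f" and \<epsilon>f: "!!x. x \<in> carrier (P 0) ==> \<epsilon> (f 0 x) = \<epsilon> x"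
  obtains s where "!!i. s i \<in> lhom R (P i) (P (Suc i))"
    "!!x. x \<in> carrier (P 0) ==> f 0 x = d 0 (s 0 x) \<oplus>\<^sub>(P 0) x"
    "!!i x. x \<in> carrier (P (Suc i)) ==>
      f (Suc i) x = d (Suc i) (s (Suc i) x) \<oplus>\<^sub>(P (Suc i)) s i (d i x) \<oplus>\<^sub>(P (Suc i)) x"
proof -
  note p = projective_resolutionD[OF P]
  have fl: "f i \<in> lhom R (P i) (P i)" and fd: "x \<in> carrier (P (Suc i)) ==> d i (f (Suc i) x) = f i (d i x)"
    for i x using f by (auto simp: chain_map_def)
  interpret M: left_module R M by fact
  let ?\<phi> = "\<lambda>i. \<lambda>x\<in>carrier (P i). f i x \<ominus>\<^sub>(P i) (\<lambda>x\<in>carrier (P i). x) x"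
  have id: "(\<lambda>x\<in>carrier (P i). x) \<in> lhom R (P i) (P i)" for i
    by (rule lhomI[OF p(2)]) (rule refl | assumption)+
  have \<phi>: "?\<phi> i \<in> lhom R (P i) (P i)" for i by (rule lhom_sub[OF p(2) p(2) fl id])
  have ch: "chain_map R P d P d ?\<phi>"
    unfolding chain_map_def
  proof (intro conjI allI ballI \<phi>)
    fix i x assume x: "x \<in> carrier (P (Suc i))"
    show "d i (?\<phi> (Suc i) x) = ?\<phi> i (d i x)"
      using x lhom_closed[OF p(3) x] lhom_closed[OF fl x] fd[OF x]
        lhom_minus[OF p(2) p(2) p(3) lhom_closed[OF fl x] x] by simp
  qed
  have \<epsilon>0: "\<epsilon> (?\<phi> 0 x) = \<zero>\<^sub>M" if x: "x \<in> carrier (P 0)" for x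
    using x lhom_minus[OF p(2) M p(4) lhom_closed[OF fl x] x] \<epsilon>f[OF x] lhom_closed[OF p(4) x]
    by (simp add: a_minus_def M.M.r_neg)
  obtain s where s: "!!i. s i \<in> lhom R (P i) (P (Suc i))"
    "!!x. x \<in> carrier (P 0) ==> ?\<phi> 0 x = d 0 (s 0 x)"
    "!!i x. x \<in> carrier (P (Suc i)) ==> ?\<phi> (Suc i) x = d (Suc i) (s (Suc i) x) \<oplus>\<^sub>(P (Suc i)) s i (d i x)"
    by (rule null_homotopy_exists[OF P M ch \<epsilon>0], blast+)
  have f_eq: "f i x = ?\<phi> i x \<oplus>\<^sub>(P i) x" if x: "x \<in> carrier (P i)" for i x
  proof -
    interpret Pi: left_module R "P i" by (rule p(2))
    show ?thesis using x lhom_closed[OF fl x] by (simp add: a_minus_def Pi.M.a_assoc Pi.M.l_neg)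
  qed
  show thesis
  proof (rule that[of s])
    show "f 0 x = d 0 (s 0 x) \<oplus>\<^sub>(P 0) x" if x: "x \<in> carrier (P 0)" for x
      using f_eq[OF x] s(2)[OF x] by simp
    show "f (Suc i) x = d (Suc i) (s (Suc i) x) \<oplus>\<^sub>(P (Suc i)) s i (d i x) \<oplus>\<^sub>(P (Suc i)) x"
      if x: "x \<in> carrier (P (Suc i))" for i x
      using f_eq[OF x] s(3)[OF x] by simp
  qed (rule s)
qed

lemma chain_map_comp:
  assumes P: "projective_resolution R M P d \<epsilon>"
    and f: "chain_map R P d Q e f" and g: "chain_map R Q e L k g"
  shows "chain_map R P d L k (\<lambda>i. \<lambda>x\<in>carrier (P i). g i (f i x))"
proof -
  note p = projective_resolutionD[OF P]
  have fl: "f i \<in> lhom R (P i) (Q i)" and gl: "g i \<in> lhom R (Q i) (L i)" for i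
    using f g by (auto simp: chain_map_def)
  show ?thesis
    unfolding chain_map_def
  proof (intro conjI allI ballI)
    show "(\<lambda>x\<in>carrier (P i). g i (f i x)) \<in> lhom R (P i) (L i)" for i
      by (rule lhom_comp[OF p(2) fl gl])
    fix i x assume x: "x \<in> carrier (P (Suc i))"
    have "k i (g (Suc i) (f (Suc i) x)) = g i (f i (d i x))"
      using f g x lhom_closed[OF fl x] by (auto simp: chain_map_def)
    then show "k i ((\<lambda>x\<in>carrier (P (Suc i)). g (Suc i) (f (Suc i) x)) x) =
        (\<lambda>x\<in>carrier (P i). g i (f i x)) (d i x)"
      using x lhom_closed[OF p(3) x] by simp
  qed
qed

section \<open>Independence of the cohomology of the dual complex\<close>

lemma opp_simps [simp]:
  fixes R :: "('a, 'z) ring_scheme"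
  shows "carrier (opp R) = carrier R" "mult (opp R) = (\<lambda>x y. y \<otimes>\<^sub>R x)" "one (opp R) = one R"
    "zero (opp R) = zero R" "add (opp R) = add R"
  by (simp_all add: opp_def)

lemma abelian_group_cong:
  assumes "abelian_group G" "carrier H = carrier G" "add H = add G" "zero H = zero G"
  shows "abelian_group H"
proof -
  interpret abelian_group G by fact
  show ?thesis
    by (rule abelian_groupI) (use assms(2-4) l_neg in \<open>auto simp: a_ac intro!: bexI[of _ "\<ominus>\<^sub>G _"]\<close>)
qed

lemma opp_ring:
  fixes R :: "('a, 'z) ring_scheme"
  assumes "ring R" shows "ring (opp R)"
proof -
  interpret ring R by fact
  show ?thesis
    by (rule ringI, rule abelian_group_cong[OF abelian_group_axioms])
      (auto simp: m_assoc l_distr r_distr intro!: monoidI)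
qed

lemma lregular_simps [simp]:
  "carrier (lregular R) = carrier R" "add (lregular R) = add R" "zero (lregular R) = zero R"
  "smult (lregular R) = mult R"
  by (simp_all add: lregular_def)

lemma lregular_left_module:
  assumes "ring R" shows "left_module R (lregular R)"
proof -
  interpret ring R by fact
  show ?thesis
    by (intro left_module.intro left_module_axioms.intro ring_axioms
        abelian_group_cong[OF abelian_group_axioms])
      (auto simp: m_assoc l_distr r_distr)
qed

lemma ldual_simps [simp]:
  "carrier (ldual R P) = lhom R P (lregular R)" "zero (ldual R P) = (\<lambda>x\<in>carrier P. \<zero>\<^sub>R)"
  "add (ldual R P) = (\<lambda>f g. \<lambda>x\<in>carrier P. f x \<oplus>\<^sub>R g x)"
  "smult (ldual R P) = (\<lambda>r f. \<lambda>x\<in>carrier P. f x \<otimes>\<^sub>R r)"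
  by (simp_all add: ldual_def)

lemma lhom_lregular_closed: "f \<in> lhom R P (lregular R) ==> x \<in> carrier P ==> f x \<in> carrier R"
  using lhom_closed by fastforce

lemma ldual_closed:
  fixes R (structure)
  assumes P: "left_module R P"
  shows "(\<lambda>x\<in>carrier P. \<zero>) \<in> lhom R P (lregular R)"
    and "f \<in> lhom R P (lregular R) ==> g \<in> lhom R P (lregular R) ==>
      (\<lambda>x\<in>carrier P. f x \<oplus> g x) \<in> lhom R P (lregular R)"
    and "f \<in> lhom R P (lregular R) ==> (\<lambda>x\<in>carrier P. \<ominus> f x) \<in> lhom R P (lregular R)"
    and "f \<in> lhom R P (lregular R) ==> r \<in> carrier R ==>
      (\<lambda>x\<in>carrier P. f x \<otimes> r) \<in> lhom R P (lregular R)"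
proof -
  interpret P: left_module R P by fact
  show "(\<lambda>x\<in>carrier P. \<zero>) \<in> lhom R P (lregular R)"
    by (rule lhomI[OF P]) auto
  assume f: "f \<in> lhom R P (lregular R)"
  note fc = lhom_lregular_closed[OF f]
  have fa: "x \<in> carrier P ==> y \<in> carrier P ==> f (x \<oplus>\<^sub>P y) = f x \<oplus> f y" for x y
    using lhom_add[OF f] by simp
  have fs: "r \<in> carrier R ==> x \<in> carrier P ==> f (r \<odot>\<^sub>P x) = r \<otimes> f x" for r x
    using lhom_smult[OF f] by simp
  show "(\<lambda>x\<in>carrier P. \<ominus> f x) \<in> lhom R P (lregular R)"
    by (rule lhomI[OF P]) (auto simp: fc fa fs P.R.minus_add P.R.r_minus)
  { assume g: "g \<in> lhom R P (lregular R)"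
    note gc = lhom_lregular_closed[OF g]
    have ga: "x \<in> carrier P ==> y \<in> carrier P ==> g (x \<oplus>\<^sub>P y) = g x \<oplus> g y" for x y
      using lhom_add[OF g] by simp
    have gs: "r \<in> carrier R ==> x \<in> carrier P ==> g (r \<odot>\<^sub>P x) = r \<otimes> g x" for r x
      using lhom_smult[OF g] by simp
    show "(\<lambda>x\<in>carrier P. f x \<oplus> g x) \<in> lhom R P (lregular R)"
      by (rule lhomI[OF P]) (auto simp: fc fa fs gc ga gs P.R.a_ac P.R.r_distr) }
  assume r: "r \<in> carrier R"
  show "(\<lambda>x\<in>carrier P. f x \<otimes> r) \<in> lhom R P (lregular R)"
    by (rule lhomI[OF P]) (auto simp: r fc fa fs P.R.m_assoc P.R.l_distr)
qed

lemma ldual_left_module: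
  fixes R (structure)
  assumes P: "left_module R P" shows "left_module (opp R) (ldual R P)"
proof -
  interpret P: left_module R P by fact
  note c = ldual_closed[OF P] and v = lhom_lregular_closed
  have ext: "f \<in> lhom R P (lregular R) ==> f \<in> extensional (carrier P)" for f
    by (auto simp: lhom_def PiE_iff)
  show ?thesis
  proof (intro left_module.intro left_module_axioms.intro)
    show "ring (opp R)" by (rule opp_ring) (rule P.R.ring_axioms)
    show "abelian_group (ldual R P)"
    proof (rule abelian_groupI)
      fix f assume f: "f \<in> carrier (ldual R P)"
      then show "\<zero>\<^sub>(ldual R P) \<oplus>\<^sub>(ldual R P) f = f"
        using ext[of f] v[of f R P] by (auto simp: fun_eq_iff extensional_def)
      have "(\<lambda>x\<in>carrier P. \<ominus> f x) \<oplus>\<^sub>(ldual R P) f = \<zero>\<^sub>(ldual R P)"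
        using f v[of f R P] by (auto simp: P.R.l_neg)
      then show "\<exists>g\<in>carrier (ldual R P). g \<oplus>\<^sub>(ldual R P) f = \<zero>\<^sub>(ldual R P)"
        using c(3)[of f] f by (intro bexI[of _ "\<lambda>x\<in>carrier P. \<ominus> f x"]) simp_all
      fix g assume g: "g \<in> carrier (ldual R P)"
      show "f \<oplus>\<^sub>(ldual R P) g = g \<oplus>\<^sub>(ldual R P) f"
        using f g v[of f R P] v[of g R P] by (auto intro!: restrict_ext P.R.a_comm)
      fix h assume h: "h \<in> carrier (ldual R P)"
      show "f \<oplus>\<^sub>(ldual R P) g \<oplus>\<^sub>(ldual R P) h = f \<oplus>\<^sub>(ldual R P) (g \<oplus>\<^sub>(ldual R P) h)"
        using f g h v[of f R P] v[of g R P] v[of h R P] by (auto intro!: restrict_ext P.R.a_assoc)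
    qed (use c in auto)
    fix f assume f: "f \<in> carrier (ldual R P)"
    then show "\<one>\<^sub>(opp R) \<odot>\<^sub>(ldual R P) f = f"
      using ext[of f] v[of f R P] by (auto simp: fun_eq_iff extensional_def)
    fix r assume r: "r \<in> carrier (opp R)"
    show "r \<odot>\<^sub>(ldual R P) f \<in> carrier (ldual R P)" using c(4) f r by simp
    { fix s assume s: "s \<in> carrier (opp R)"
      show "(r \<oplus>\<^sub>(opp R) s) \<odot>\<^sub>(ldual R P) f = r \<odot>\<^sub>(ldual R P) f \<oplus>\<^sub>(ldual R P) s \<odot>\<^sub>(ldual R P) f"
        using f r s v[of f R P] by (auto intro!: restrict_ext P.R.r_distr)
      show "(r \<otimes>\<^sub>(opp R) s) \<odot>\<^sub>(ldual R P) f = r \<odot>\<^sub>(ldual R P) (s \<odot>\<^sub>(ldual R P) f)"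
        using f r s v[of f R P] by (auto intro!: restrict_ext P.R.m_assoc[symmetric]) }
    fix g assume g: "g \<in> carrier (ldual R P)"
    show "r \<odot>\<^sub>(ldual R P) (f \<oplus>\<^sub>(ldual R P) g) = r \<odot>\<^sub>(ldual R P) f \<oplus>\<^sub>(ldual R P) r \<odot>\<^sub>(ldual R P) g"
      using f g r v[of f R P] v[of g R P] by (auto intro!: restrict_ext P.R.l_distr)
  qed
qed

lemma ldual_minus:
  fixes R (structure)
  assumes P: "left_module R P" and f: "f \<in> carrier (ldual R P)" and g: "g \<in> carrier (ldual R P)"
    and x: "x \<in> carrier P"
  shows "(f \<ominus>\<^sub>(ldual R P) g) x = f x \<ominus> g x"
proof -
  interpret P: left_module R P by fact
  interpret D: left_module "opp R" "ldual R P" by (rule ldual_left_module[OF P])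
  let ?n = "\<lambda>x\<in>carrier P. \<ominus> g x"
  have n: "?n \<in> carrier (ldual R P)" using ldual_closed(3)[OF P] g by simp
  have "?n \<oplus>\<^sub>(ldual R P) g = \<zero>\<^sub>(ldual R P)"
    using g lhom_lregular_closed[of g R P] by (auto simp: P.R.l_neg)
  then have "\<ominus>\<^sub>(ldual R P) g = ?n" by (rule D.M.minus_equality[OF _ g n])
  then show ?thesis using x by (simp add: a_minus_def)
qed

definition submod :: "('r, 'z) ring_scheme => ('r, 'm) module => 'm set => bool"
  where "submod S D C \<longleftrightarrow> C \<subseteq> carrier D \<and> \<zero>\<^sub>D \<in> C \<and> (\<forall>x\<in>C. \<forall>y\<in>C. x \<oplus>\<^sub>D y \<in> C) \<and>
    (\<forall>r\<in>carrier S. \<forall>x\<in>C. r \<odot>\<^sub>D x \<in> C)"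

definition subquot :: "('r, 'm) module => 'm set => 'm set => ('r, 'm set) module"
  where "subquot D Z C =
    \<lparr>carrier = (\<lambda>f. C +>\<^sub>D f) ` Z, mult = undefined, one = undefined,
     zero = C, add = set_add D, smult = (\<lambda>r S. \<Union>f\<in>S. C +>\<^sub>D (r \<odot>\<^sub>D f))\<rparr>"

lemma dual_cohomology_subquot:
  "dual_cohomology R P d i = subquot (ldual R (P i)) (cocycles R P d i) (coboundaries R P d i)"
  by (simp add: dual_cohomology_def subquot_def Let_def)

lemma submod_minus:
  assumes "left_module S D" "submod S D C" "x \<in> C" "y \<in> C"
  shows "x \<ominus>\<^sub>D y \<in> C"
proof -
  interpret D: left_module S D by fact
  have xy: "x \<in> carrier D" "y \<in> carrier D" using assms(2-4) by (auto simp: submod_def)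
  have "\<ominus>\<^sub>D y = (\<ominus>\<^sub>S \<one>\<^sub>S) \<odot>\<^sub>D y" using D.lsmult_l_minus[of "\<one>\<^sub>S" y] xy by (simp add: D.lsmult_one)
  moreover have "(\<ominus>\<^sub>S \<one>\<^sub>S) \<odot>\<^sub>D y \<in> C" using assms(2,4) by (auto simp: submod_def)
  ultimately show ?thesis using assms(2,3) by (simp add: a_minus_def submod_def)
qed

lemma submod_abelian_subgroup:
  assumes "left_module S D" "submod S D C"
  shows "abelian_subgroup C D"
proof -
  interpret D: left_module S D by fact
  show ?thesis
  proof (intro abelian_subgroupI3 additive_subgroupI)
    show "subgroup C (add_monoid D)"
    proof (rule group.subgroupI[OF D.M.a_group])
      fix a assume a: "a \<in> C"
      have "\<zero>\<^sub>D \<ominus>\<^sub>D a \<in> C" using submod_minus[OF assms _ a] assms(2) by (auto simp: submod_def)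
      then show "inv\<^sub>(add_monoid D) a \<in> C"
        using a assms(2) unfolding a_inv_def[symmetric] by (auto simp: submod_def a_minus_def)
    qed (use assms(2) in \<open>auto simp: submod_def\<close>)
  qed (rule D.M.abelian_group_axioms)
qed

context
  fixes S :: "('r, 'z) ring_scheme" and D :: "('r, 'm) module" and C Z :: "'m set"
  assumes D: "left_module S D" and C: "submod S D C" and Z: "submod S D Z"
begin

lemma subquot_coset_eq:
  assumes "f \<in> Z" "g \<in> Z"
  shows "C +>\<^sub>D f = C +>\<^sub>D g \<longleftrightarrow> f \<ominus>\<^sub>D g \<in> C"
proof -
  interpret abelian_subgroup C D by (rule submod_abelian_subgroup[OF D C])
  show ?thesis using Z assms by (intro coset_eq_iff) (auto simp: submod_def)
qed

lemma subquot_add: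
  assumes "f \<in> Z" "g \<in> Z"
  shows "(C +>\<^sub>D f) \<oplus>\<^sub>(subquot D Z C) (C +>\<^sub>D g) = C +>\<^sub>D (f \<oplus>\<^sub>D g)"
proof -
  interpret abelian_subgroup C D by (rule submod_abelian_subgroup[OF D C])
  show ?thesis using Z assms by (auto simp: subquot_def submod_def intro!: a_rcos_sum)
qed

lemma subquot_smult:
  assumes f: "f \<in> Z" and r: "r \<in> carrier S"
  shows "r \<odot>\<^sub>(subquot D Z C) (C +>\<^sub>D f) = C +>\<^sub>D (r \<odot>\<^sub>D f)"
proof -
  interpret abelian_subgroup C D by (rule submod_abelian_subgroup[OF D C])
  interpret D: left_module S D by (rule D)
  have fD: "f \<in> carrier D" using f Z by (auto simp: submod_def)
  have eq: "C +>\<^sub>D (r \<odot>\<^sub>D g) = C +>\<^sub>D (r \<odot>\<^sub>D f)" if g: "g \<in> C +>\<^sub>D f" for g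
  proof -
    have gD: "g \<in> carrier D" using g fD a_elemrcos_carrier by blast
    have "g \<ominus>\<^sub>D f \<in> C" using a_rcos_module_imp[OF fD g] by (simp add: a_minus_def)
    then have "r \<odot>\<^sub>D (g \<ominus>\<^sub>D f) \<in> C" using C r by (simp add: submod_def)
    then have "r \<odot>\<^sub>D g \<ominus>\<^sub>D r \<odot>\<^sub>D f \<in> C" by (simp add: D.lsmult_r_minus[OF r gD fD])
    then show ?thesis by (subst coset_eq_iff) (use D.lsmult_closed r fD gD in auto)
  qed
  have "(\<Union>g\<in>C +>\<^sub>D f. C +>\<^sub>D (r \<odot>\<^sub>D g)) = C +>\<^sub>D (r \<odot>\<^sub>D f)"
  proof (rule equalityI)
    show "(\<Union>g\<in>C +>\<^sub>D f. C +>\<^sub>D (r \<odot>\<^sub>D g)) \<subseteq> C +>\<^sub>D (r \<odot>\<^sub>D f)"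
      by (rule UN_least) (simp only: eq order.refl)
    show "C +>\<^sub>D (r \<odot>\<^sub>D f) \<subseteq> (\<Union>g\<in>C +>\<^sub>D f. C +>\<^sub>D (r \<odot>\<^sub>D g))"
      by (rule UN_upper[OF a_rcos_self[OF fD]])
  qed
  then show ?thesis by (simp only: subquot_def module.simps)
qed

text \<open>The first isomorphism theorem for \<open>Z / C\<close>, stated on representatives so that cosets need not
  be mentioned when it is applied.\<close>

lemma subquot_isoI:
  assumes G: "!!f. f \<in> Z ==> G f \<in> carrier N"
    and Ga: "!!f g. f \<in> Z ==> g \<in> Z ==> G (f \<oplus>\<^sub>D g) = G f \<oplus>\<^sub>N G g"
    and Gs: "!!r f. r \<in> carrier S ==> f \<in> Z ==> G (r \<odot>\<^sub>D f) = r \<odot>\<^sub>N G f"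
    and Gi: "!!f g. f \<in> Z ==> g \<in> Z ==> G f = G g \<longleftrightarrow> f \<ominus>\<^sub>D g \<in> C"
    and Gsurj: "!!y. y \<in> carrier N ==> \<exists>f\<in>Z. G f = y"
  shows "lmod_isomorphic S (subquot D Z C) N"
proof -
  define H where "H = (\<lambda>T\<in>carrier (subquot D Z C). G (SOME f. f \<in> Z \<and> C +>\<^sub>D f = T))"
  have car: "carrier (subquot D Z C) = (\<lambda>f. C +>\<^sub>D f) ` Z" by (simp add: subquot_def)
  have H: "H (C +>\<^sub>D f) = G f" if f: "f \<in> Z" for f
  proof -
    let ?g = "SOME g. g \<in> Z \<and> C +>\<^sub>D g = C +>\<^sub>D f"
    have "?g \<in> Z \<and> C +>\<^sub>D ?g = C +>\<^sub>D f" by (rule someI[of _ f]) (use f in simp)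
    then have "G ?g = G f" using Gi[OF _ f, of ?g] subquot_coset_eq[OF _ f, of ?g] by blast
    then show ?thesis using f by (simp add: H_def car)
  qed
  have add: "f \<oplus>\<^sub>D g \<in> Z" if "f \<in> Z" "g \<in> Z" for f g using Z that by (auto simp: submod_def)
  have sm: "r \<odot>\<^sub>D f \<in> Z" if "r \<in> carrier S" "f \<in> Z" for f r using Z that by (auto simp: submod_def)
  have "H \<in> lhom S (subquot D Z C) N"
    unfolding lhom_def
  proof (intro CollectI conjI ballI)
    show "H \<in> carrier (subquot D Z C) \<rightarrow>\<^sub>E carrier N"
    proof (rule PiE_I)
      fix T assume "T \<in> carrier (subquot D Z C)"
      then show "H T \<in> carrier N" using H G by (auto simp: car)
    qed (simp add: H_def)
    fix T assume T: "T \<in> carrier (subquot D Z C)"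
    then obtain f where f: "f \<in> Z" "T = C +>\<^sub>D f" by (auto simp: car)
    { fix T' assume "T' \<in> carrier (subquot D Z C)"
      then obtain g where g: "g \<in> Z" "T' = C +>\<^sub>D g" by (auto simp: car)
      show "H (T \<oplus>\<^sub>(subquot D Z C) T') = H T \<oplus>\<^sub>N H T'"
        using f g by (simp add: subquot_add H add Ga) }
    fix r assume r: "r \<in> carrier S"
    show "H (r \<odot>\<^sub>(subquot D Z C) T) = r \<odot>\<^sub>N H T"
      using f r by (simp add: subquot_smult H sm Gs)
  qed
  moreover have "bij_betw H (carrier (subquot D Z C)) (carrier N)"
    unfolding bij_betw_def
  proof
    show "inj_on H (carrier (subquot D Z C))"
    proof (rule inj_onI)
      fix T T' assume "T \<in> carrier (subquot D Z C)" "T' \<in> carrier (subquot D Z C)" and HT: "H T = H T'"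
      then obtain f g where f: "f \<in> Z" "T = C +>\<^sub>D f" and g: "g \<in> Z" "T' = C +>\<^sub>D g"
        by (auto simp: car)
      then show "T = T'" using HT Gi[OF f(1) g(1)] subquot_coset_eq[OF f(1) g(1)] by (simp add: H)
    qed
    show "H ` carrier (subquot D Z C) = carrier N"
    proof
      show "H ` carrier (subquot D Z C) \<subseteq> carrier N" using H G by (auto simp: car)
      show "carrier N \<subseteq> H ` carrier (subquot D Z C)"
      proof
        fix y assume "y \<in> carrier N"
        then obtain f where "f \<in> Z" "G f = y" using Gsurj by blast
        then show "y \<in> H ` carrier (subquot D Z C)" using H by (force simp: car)
      qed
    qed
  qed
  ultimately show ?thesis unfolding lmod_isomorphic_def by blast
qed

end

lemma cocycles_submod:
  fixes R (structure)
  assumes P: "!!i. left_module R (P i)" and d: "!!i. d i \<in> lhom R (P (Suc i)) (P i)"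
  shows "submod (opp R) (ldual R (P i)) (cocycles R P d i)"
proof -
  interpret P: left_module R "P i" by (rule P)
  note c = ldual_closed[OF P]
  show ?thesis unfolding submod_def cocycles_def
    using c lhom_closed[OF d] by (auto simp: lhom_lregular_closed)
qed

lemma coboundaries_submod:
  fixes R (structure)
  assumes P: "!!i. left_module R (P i)" and d: "!!i. d i \<in> lhom R (P (Suc i)) (P i)"
  shows "submod (opp R) (ldual R (P i)) (coboundaries R P d i)"
proof (cases i)
  case 0
  interpret P: left_module R "P i" by (rule P)
  interpret D: left_module "opp R" "ldual R (P i)" by (rule ldual_left_module[OF P])
  have "submod (opp R) (ldual R (P i)) {\<zero>\<^sub>(ldual R (P i))}"
    unfolding submod_def using D.lsmult_r_null D.M.zero_closed D.M.l_zero[OF D.M.zero_closed] by simp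
  then show ?thesis using 0 by (simp add: coboundaries_def)
next
  case (Suc j)
  interpret P: left_module R "P j" by (rule P)
  note c = ldual_closed[OF P] and dc = lhom_closed[OF d]
  let ?B = "(\<lambda>f. \<lambda>x\<in>carrier (P (Suc j)). f (d j x)) ` carrier (ldual R (P j))"
  have "submod (opp R) (ldual R (P (Suc j))) ?B"
    unfolding submod_def
  proof (intro conjI ballI)
    show "?B \<subseteq> carrier (ldual R (P (Suc j)))"
      using lhom_comp[OF P d] by auto
    show "\<zero>\<^sub>(ldual R (P (Suc j))) \<in> ?B"
      by (rule image_eqI[of _ _ "\<lambda>x\<in>carrier (P j). \<zero>"]) (use c dc in auto)
    fix f assume "f \<in> ?B"
    then obtain f' where f: "f' \<in> lhom R (P j) (lregular R)" "f = (\<lambda>x\<in>carrier (P (Suc j)). f' (d j x))"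
      by auto
    { fix g assume "g \<in> ?B"
      then obtain g' where g: "g' \<in> lhom R (P j) (lregular R)" "g = (\<lambda>x\<in>carrier (P (Suc j)). g' (d j x))"
        by auto
      show "f \<oplus>\<^sub>(ldual R (P (Suc j))) g \<in> ?B"
        by (rule image_eqI[of _ _ "\<lambda>x\<in>carrier (P j). f' x \<oplus> g' x"])
          (use c(2)[OF f(1) g(1)] dc f g in \<open>auto intro!: restrict_ext\<close>) }
    fix r assume "r \<in> carrier (opp R)"
    then show "r \<odot>\<^sub>(ldual R (P (Suc j))) f \<in> ?B"
      by (intro image_eqI[of _ _ "\<lambda>x\<in>carrier (P j). f' x \<otimes> r"])
          (use c(4)[OF f(1), of r] dc f in \<open>auto intro!: restrict_ext\<close>)
  qed
  then show ?thesis using Suc by (simp add: coboundaries_def)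
qed

definition pull :: "('r, 'q) module => ('q => 'p) => ('p => 'r) => 'q => 'r"
  where "pull Q g z = (\<lambda>y\<in>carrier Q. z (g y))"

lemma pull_cocycle:
  fixes R (structure)
  assumes Q: "projective_resolution R M Q e \<eta>" and g: "chain_map R Q e P d g"
    and z: "z \<in> cocycles R P d i"
  shows "pull (Q i) (g i) z \<in> cocycles R Q e i"
proof -
  note q = projective_resolutionD[OF Q]
  have gl: "g i \<in> lhom R (Q i) (P i)" for i using g by (simp add: chain_map_def)
  have zl: "z \<in> lhom R (P i) (lregular R)" using z by (simp add: cocycles_def)
  have "pull (Q i) (g i) z (e i y) = \<zero>" if y: "y \<in> carrier (Q (Suc i))" for y
  proof -
    have "g i (e i y) = d i (g (Suc i) y)" using g y by (simp add: chain_map_def)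
    then show ?thesis using z lhom_closed[OF gl y] lhom_closed[OF q(3) y]
      by (simp add: pull_def cocycles_def)
  qed
  then show ?thesis using lhom_comp[OF q(2) gl zl] by (simp add: cocycles_def pull_def)
qed

lemma pull_coboundary:
  fixes R (structure)
  assumes P: "projective_resolution R M P d \<epsilon>"
    and Q: "projective_resolution R M Q e \<eta>" and g: "chain_map R Q e P d g"
    and z: "z \<in> coboundaries R P d i"
  shows "pull (Q i) (g i) z \<in> coboundaries R Q e i"
proof (cases i)
  case 0
  have gl: "g 0 \<in> lhom R (Q 0) (P 0)" using g by (simp add: chain_map_def)
  show ?thesis using z 0 lhom_closed[OF gl] by (auto simp: coboundaries_def pull_def)
next
  case (Suc j)
  note q = projective_resolutionD[OF Q]
  have gl: "g i \<in> lhom R (Q i) (P i)" for i using g by (simp add: chain_map_def)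
  obtain w where w: "w \<in> lhom R (P j) (lregular R)" "z = (\<lambda>x\<in>carrier (P (Suc j)). w (d j x))"
    using z Suc by (auto simp: coboundaries_def)
  have "pull (Q (Suc j)) (g (Suc j)) z = (\<lambda>y\<in>carrier (Q (Suc j)). pull (Q j) (g j) w (e j y))"
    using g lhom_closed[OF gl] lhom_closed[OF q(3)]
    by (auto simp: pull_def w(2) chain_map_def intro!: restrict_ext)
  moreover have "pull (Q j) (g j) w \<in> lhom R (Q j) (lregular R)"
    unfolding pull_def by (rule lhom_comp[OF q(2) gl w(1)])
  ultimately show ?thesis using Suc by (auto simp: coboundaries_def)
qed

lemma pull_pull:
  fixes R (structure)
  assumes P: "projective_resolution R M P d \<epsilon>" and M: "left_module R M"
    and Q: "projective_resolution R M Q e \<eta>"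
    and f: "chain_map R P d Q e f" and g: "chain_map R Q e P d g"
    and \<eta>f: "!!x. x \<in> carrier (P 0) ==> \<eta> (f 0 x) = \<epsilon> x"
    and \<epsilon>g: "!!x. x \<in> carrier (Q 0) ==> \<epsilon> (g 0 x) = \<eta> x"
    and z: "z \<in> cocycles R P d i"
  shows "pull (P i) (f i) (pull (Q i) (g i) z) \<ominus>\<^sub>(ldual R (P i)) z \<in> coboundaries R P d i"
    (is "?FG \<ominus>\<^sub>(ldual R (P i)) z \<in> _")
proof -
  note p = projective_resolutionD[OF P]
  interpret Pi: left_module R "P i" by (rule p(2))
  interpret D: left_module "opp R" "ldual R (P i)" by (rule ldual_left_module[OF p(2)])
  have fl: "f i \<in> lhom R (P i) (Q i)" for i using f by (simp add: chain_map_def)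
  have zl: "z \<in> lhom R (P i) (lregular R)" using z by (simp add: cocycles_def)
  have zz: "x \<in> carrier (P (Suc i)) ==> z (d i x) = \<zero>" for x using z by (simp add: cocycles_def)
  have gf: "chain_map R P d P d (\<lambda>i. \<lambda>x\<in>carrier (P i). g i (f i x))"
    by (rule chain_map_comp[OF P f g])
  obtain s where s: "!!i. s i \<in> lhom R (P i) (P (Suc i))"
    "!!x. x \<in> carrier (P 0) ==> g 0 (f 0 x) = d 0 (s 0 x) \<oplus>\<^sub>(P 0) x"
    "!!i x. x \<in> carrier (P (Suc i)) ==>
      g (Suc i) (f (Suc i) x) = d (Suc i) (s (Suc i) x) \<oplus>\<^sub>(P (Suc i)) s i (d i x) \<oplus>\<^sub>(P (Suc i)) x"
  proof (rule homotopic_to_identity[OF P M gf])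
    show "\<epsilon> ((\<lambda>x\<in>carrier (P 0). g 0 (f 0 x)) x) = \<epsilon> x" if "x \<in> carrier (P 0)" for x
      using that \<eta>f \<epsilon>g lhom_closed[OF fl] by simp
  next
    fix s
    assume "!!i. s i \<in> lhom R (P i) (P (Suc i))"
      "!!x. x \<in> carrier (P 0) ==> (\<lambda>x\<in>carrier (P 0). g 0 (f 0 x)) x = d 0 (s 0 x) \<oplus>\<^sub>(P 0) x"
      "!!i x. x \<in> carrier (P (Suc i)) ==> (\<lambda>x\<in>carrier (P (Suc i)). g (Suc i) (f (Suc i) x)) x =
        d (Suc i) (s (Suc i) x) \<oplus>\<^sub>(P (Suc i)) s i (d i x) \<oplus>\<^sub>(P (Suc i)) x"
    then show thesis by (intro that[of s]) (simp_all only: restrict_apply' cong: if_cong)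
  qed
  have FG: "?FG \<in> carrier (ldual R (P i))"
    using pull_cocycle[OF P f pull_cocycle[OF Q g z]] by (simp add: cocycles_def)
  have zc: "z \<in> carrier (ldual R (P i))" using zl by simp
  note ds = lhom_closed[OF p(3) lhom_closed[OF s(1)]] and sd = lhom_closed[OF s(1) lhom_closed[OF p(3)]]
  have za: "z (x \<oplus>\<^sub>(P i) y) = z x \<oplus> z y" if "x \<in> carrier (P i)" "y \<in> carrier (P i)" for x y
    using lhom_add[OF zl that] by simp
  note zcl = lhom_lregular_closed[OF zl]
  have ext: "?FG \<ominus>\<^sub>(ldual R (P i)) z \<in> extensional (carrier (P i))"
    using D.M.minus_closed[OF FG zc] by (auto simp: lhom_def PiE_iff)
  show ?thesis
  proof (cases i)
    case 0
    have "?FG \<ominus>\<^sub>(ldual R (P i)) z = \<zero>\<^sub>(ldual R (P i))"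
    proof (rule extensionalityI[OF ext])
      fix x assume x: "x \<in> carrier (P i)"
      have "?FG x = z (d i (s i x) \<oplus>\<^sub>(P i) x)"
        using x s(2) 0 lhom_closed[OF fl] by (simp add: pull_def)
      also have "\<dots> = z x" using za[OF ds x, OF x] x zz[OF lhom_closed[OF s(1) x]] zcl by simp
      finally show "(?FG \<ominus>\<^sub>(ldual R (P i)) z) x = \<zero>\<^sub>(ldual R (P i)) x"
        using ldual_minus[OF p(2) FG zc x] x zcl[OF x] by (simp add: a_minus_def Pi.R.r_neg)
    qed simp
    then show ?thesis using 0 by (simp add: coboundaries_def)
  next
    case (Suc j)
    have w: "(\<lambda>x\<in>carrier (P j). z (s j x)) \<in> lhom R (P j) (lregular R)"
      by (rule lhom_comp[OF p(2) s(1)]) (use zl Suc in simp)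
    have "?FG \<ominus>\<^sub>(ldual R (P i)) z = (\<lambda>x\<in>carrier (P (Suc j)). (\<lambda>x\<in>carrier (P j). z (s j x)) (d j x))"
    proof (rule extensionalityI[OF ext])
      fix x assume x: "x \<in> carrier (P i)"
      then have xj: "x \<in> carrier (P (Suc j))" using Suc by simp
      have c: "d i (s i x) \<in> carrier (P i)" "s j (d j x) \<in> carrier (P i)"
        using ds[OF x] sd[OF xj] Suc by auto
      have "?FG x = z (d i (s i x) \<oplus>\<^sub>(P i) s j (d j x) \<oplus>\<^sub>(P i) x)"
        using x s(3)[OF xj] Suc lhom_closed[OF fl] by (simp add: pull_def)
      also have "\<dots> = z (s j (d j x)) \<oplus> z x"
        using za[OF Pi.M.a_closed[OF c] x] za[OF c] x c zz[OF lhom_closed[OF s(1) x]] zcl by simp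
      finally show "(?FG \<ominus>\<^sub>(ldual R (P i)) z) x =
          (\<lambda>x\<in>carrier (P (Suc j)). (\<lambda>x\<in>carrier (P j). z (s j x)) (d j x)) x"
        using ldual_minus[OF p(2) FG zc x] x xj zcl[OF x] zcl[OF c(2)] lhom_closed[OF p(3) xj]
        by (simp add: a_minus_def Pi.R.a_assoc Pi.R.r_neg)
    qed (simp add: Suc)
    moreover have "\<dots> \<in> coboundaries R P d (Suc j)" using w unfolding coboundaries_def nat.case
      by (intro imageI) (simp only: ldual_simps)
    ultimately show ?thesis using Suc by simp
  qed
qed

text \<open>Comparison maps in both directions exist, and both composites are homotopic to the identity.
  Dualizing turns a homotopy \<open>d s + s d\<close> into maps that send cocycles to coboundaries, so the
  pullbacks are mutually inverse on cohomology.\<close>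

theorem dual_cohomology_independent:
  fixes R :: "('r, 'z) ring_scheme" and M :: "('r, 'm) module"
  assumes P: "projective_resolution R M P d \<epsilon>" and Q: "projective_resolution R M Q e \<eta>"
    and M: "left_module R M"
  shows "lmod_isomorphic (opp R) (dual_cohomology R P d i) (dual_cohomology R Q e i)"
proof -
  obtain f where f: "chain_map R P d Q e f" "!!x. x \<in> carrier (P 0) ==> \<eta> (f 0 x) = \<epsilon> x"
    by (rule chain_map_exists[OF P Q M]) blast
  obtain g where g: "chain_map R Q e P d g" "!!x. x \<in> carrier (Q 0) ==> \<epsilon> (g 0 x) = \<eta> x"
    by (rule chain_map_exists[OF Q P M]) blast
  note p = projective_resolutionD[OF P] and q = projective_resolutionD[OF Q]
  let ?D = "ldual R (P i)" and ?E = "ldual R (Q i)"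
  let ?Z = "cocycles R P d i" and ?C = "coboundaries R P d i"
  let ?Z' = "cocycles R Q e i" and ?C' = "coboundaries R Q e i"
  have D: "left_module (opp R) ?D" and E: "left_module (opp R) ?E"
    by (rule ldual_left_module, rule p q)+
  interpret D: left_module "opp R" ?D by (rule D)
  interpret E: left_module "opp R" ?E by (rule E)
  have Z: "submod (opp R) ?D ?Z" and C: "submod (opp R) ?D ?C"
    by (rule cocycles_submod coboundaries_submod, rule p, rule p)+
  have Z': "submod (opp R) ?E ?Z'" and C': "submod (opp R) ?E ?C'"
    by (rule cocycles_submod coboundaries_submod, rule q, rule q)+
  have Zc: "z \<in> carrier ?D" if "z \<in> ?Z" for z using that Z by (auto simp: submod_def)
  have Zc': "z \<in> carrier ?E" if "z \<in> ?Z'" for z using that Z' by (auto simp: submod_def)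
  have gl: "g i \<in> lhom R (Q i) (P i)" using g by (simp add: chain_map_def)
  have fl: "f i \<in> lhom R (P i) (Q i)" using f by (simp add: chain_map_def)
  let ?g = "pull (Q i) (g i)" and ?f = "pull (P i) (f i)"
  have ga: "?g (z \<oplus>\<^sub>(?D) w) = ?g z \<oplus>\<^sub>(?E) ?g w" for z w
    using lhom_closed[OF gl] by (auto simp: pull_def intro!: restrict_ext)
  have gs: "?g (r \<odot>\<^sub>(?D) z) = r \<odot>\<^sub>(?E) ?g z" for r z
    using lhom_closed[OF gl] by (auto simp: pull_def intro!: restrict_ext)
  have gZ: "?g z \<in> ?Z'" if "z \<in> ?Z" for z by (rule pull_cocycle[OF Q g(1) that])
  have fZ: "?f z \<in> ?Z" if "z \<in> ?Z'" for z by (rule pull_cocycle[OF P f(1) that])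
  have gm: "?g (z \<ominus>\<^sub>(?D) w) = ?g z \<ominus>\<^sub>(?E) ?g w" if zw: "z \<in> ?Z" "w \<in> ?Z" for z w
  proof (rule extensionalityI)
    show "?g (z \<ominus>\<^sub>(?D) w) \<in> extensional (carrier (Q i))" by (simp add: pull_def)
    have "?g z \<ominus>\<^sub>(?E) ?g w \<in> carrier ?E" using Zc'[OF gZ[OF zw(1)]] Zc'[OF gZ[OF zw(2)]] by (rule E.M.minus_closed)
    then show "?g z \<ominus>\<^sub>(?E) ?g w \<in> extensional (carrier (Q i))" by (auto simp: lhom_def PiE_iff)
    fix x assume x: "x \<in> carrier (Q i)"
    show "?g (z \<ominus>\<^sub>(?D) w) x = (?g z \<ominus>\<^sub>(?E) ?g w) x"
      using ldual_minus[OF p(2) Zc[OF zw(1)] Zc[OF zw(2)] lhom_closed[OF gl x]]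
        ldual_minus[OF q(2) Zc'[OF gZ[OF zw(1)]] Zc'[OF gZ[OF zw(2)]] x] x
      by (simp add: pull_def)
  qed
  have Zm: "z \<ominus>\<^sub>(?D) w \<in> ?Z" if "z \<in> ?Z" "w \<in> ?Z" for z w by (rule submod_minus[OF D Z that])
  have gC: "?g z \<in> ?C' \<longleftrightarrow> z \<in> ?C" if z: "z \<in> ?Z" for z
  proof
    assume "?g z \<in> ?C'"
    then have a: "?f (?g z) \<in> ?C" by (rule pull_coboundary[OF Q P f(1)])
    have b: "?f (?g z) \<ominus>\<^sub>(?D) z \<in> ?C" by (rule pull_pull[OF P M Q f(1) g(1) f(2) g(2) z])
    have zc: "z \<in> carrier ?D" "?f (?g z) \<in> carrier ?D" using Zc[OF z] Zc[OF fZ[OF gZ[OF z]]] by auto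
    have "?f (?g z) \<ominus>\<^sub>(?D) (?f (?g z) \<ominus>\<^sub>(?D) z) \<in> ?C" by (rule submod_minus[OF D C a b])
    also have "?f (?g z) \<ominus>\<^sub>(?D) (?f (?g z) \<ominus>\<^sub>(?D) z) = z"
      using zc D.M.a_inv_closed[OF zc(2)] D.M.a_inv_closed[OF zc(1)] unfolding a_minus_def
      by (simp only: D.M.minus_add D.M.minus_minus D.M.a_assoc[symmetric] D.M.r_neg D.M.l_zero)
    finally show "z \<in> ?C" .
  qed (rule pull_coboundary[OF P Q g(1)])
  have eq: "?C' +>\<^sub>(?E) ?g z = ?C' +>\<^sub>(?E) ?g w \<longleftrightarrow> z \<ominus>\<^sub>(?D) w \<in> ?C" if "z \<in> ?Z" "w \<in> ?Z" for z w
    using subquot_coset_eq[OF E C' Z' gZ[OF that(1)] gZ[OF that(2)]] gm[OF that] gC[OF Zm[OF that]]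
    by simp
  show ?thesis
    unfolding dual_cohomology_subquot
  proof (rule subquot_isoI[OF D C Z, where G = "\<lambda>z. ?C' +>\<^sub>(?E) ?g z"])
    let ?H = "subquot ?E ?Z' ?C'"
    fix z assume z: "z \<in> ?Z"
    show "?C' +>\<^sub>(?E) ?g z \<in> carrier ?H" using gZ[OF z] by (auto simp: subquot_def)
    show "r \<in> carrier (opp R) ==> ?C' +>\<^sub>(?E) ?g (r \<odot>\<^sub>(?D) z) = r \<odot>\<^sub>(?H) (?C' +>\<^sub>(?E) ?g z)" for r
      unfolding gs by (rule subquot_smult[OF E C' Z' gZ[OF z], symmetric])
    fix w assume w: "w \<in> ?Z"
    show "?C' +>\<^sub>(?E) ?g (z \<oplus>\<^sub>(?D) w) = (?C' +>\<^sub>(?E) ?g z) \<oplus>\<^sub>(?H) (?C' +>\<^sub>(?E) ?g w)"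
      unfolding ga by (rule subquot_add[OF E C' Z' gZ[OF z] gZ[OF w], symmetric])
    show "?C' +>\<^sub>(?E) ?g z = ?C' +>\<^sub>(?E) ?g w \<longleftrightarrow> z \<ominus>\<^sub>(?D) w \<in> ?C" by (rule eq[OF z w])
  next
    fix T assume "T \<in> carrier (subquot ?E ?Z' ?C')"
    then obtain w where w: "w \<in> ?Z'" "T = ?C' +>\<^sub>(?E) w" by (auto simp: subquot_def)
    have "?g (?f w) \<ominus>\<^sub>(?E) w \<in> ?C'" by (rule pull_pull[OF Q M P g(1) f(1) g(2) f(2) w(1)])
    then have "?C' +>\<^sub>(?E) ?g (?f w) = T"
      unfolding w(2) using subquot_coset_eq[OF E C' Z' gZ[OF fZ[OF w(1)]] w(1)] by blast
    then show "\<exists>z\<in>?Z. ?C' +>\<^sub>(?E) ?g z = T" using fZ[OF w(1)] by blast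
  qed
qed

section \<open>Complexes of length two\<close>

lemma finsum_lregular [simp]: "finsum (lregular R) f A = finsum R f A"
  by (simp add: finsum_def finprod_def)

lemma free_lmod_carrier_finite: "finite X ==> carrier (free_lmod R X) = (X \<rightarrow>\<^sub>E carrier R)"
  by auto

lemma free_lmod_eval:
  fixes R (structure)
  assumes R: "ring R" and x: "x \<in> X"
  shows "(\<lambda>c\<in>carrier (free_lmod R X). c x) \<in> lhom R (free_lmod R X) (lregular R)"
  by (rule lhomI[OF free_lmod_left_module[OF R]]) (use x in \<open>auto simp: PiE_iff\<close>)

lemma flift_free_apply:
  fixes R (structure)
  assumes R: "ring R" and X: "finite X" and b: "b \<in> X \<rightarrow> carrier (free_lmod R Y)"
    and c: "c \<in> carrier (free_lmod R X)" and y: "y \<in> Y"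
  shows "flift R (free_lmod R Y) X b c y = (\<Oplus>x\<in>X. c x \<otimes> b x y)"
proof -
  note F = free_lmod_left_module[OF R] and L = lregular_left_module[OF R]
  interpret FY: left_module R "free_lmod R Y" by (rule F)
  let ?ev = "\<lambda>c\<in>carrier (free_lmod R Y). c y"
  have cx: "c x \<in> carrier R" if "x \<in> X" for x using c that by (auto simp: PiE_iff)
  have sc: "c x \<odot>\<^sub>(free_lmod R Y) b x \<in> carrier (free_lmod R Y)" if "x \<in> X" for x
    by (rule FY.lsmult_closed[OF cx[OF that] funcset_mem[OF b that]])
  have bxy: "b x y \<in> carrier R" if "x \<in> X" for x
    using funcset_mem[OF b that] y by (auto simp: PiE_iff)
  have "flift R (free_lmod R Y) X b c = (\<Oplus>\<^sub>(free_lmod R Y)x\<in>X. c x \<odot>\<^sub>(free_lmod R Y) b x)"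
    by (rule flift_superset[OF F b c X]) auto
  moreover have "(\<Oplus>\<^sub>(free_lmod R Y)x\<in>X. c x \<odot>\<^sub>(free_lmod R Y) b x) \<in> carrier (free_lmod R Y)"
    by (rule FY.M.finsum_closed) (use sc in blast)
  ultimately have "flift R (free_lmod R Y) X b c y = ?ev (\<Oplus>\<^sub>(free_lmod R Y)x\<in>X. c x \<odot>\<^sub>(free_lmod R Y) b x)"
    by (simp del: free_lmod_simps)
  also have "\<dots> = (\<Oplus>\<^sub>(lregular R)x\<in>X. ?ev (c x \<odot>\<^sub>(free_lmod R Y) b x))"
    by (rule lhom_finsum[OF F L free_lmod_eval[OF R y]]) (use sc in blast)
  also have "\<dots> = (\<Oplus>x\<in>X. c x \<otimes> b x y)"
    unfolding finsum_lregular
  proof (rule FY.R.finsum_cong'[OF refl])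
    show "(\<lambda>x. c x \<otimes> b x y) \<in> X \<rightarrow> carrier R" using cx bxy by auto
    fix x assume x: "x \<in> X"
    have "?ev (c x \<odot>\<^sub>(free_lmod R Y) b x) = (c x \<odot>\<^sub>(free_lmod R Y) b x) y"
      using sc[OF x] by (simp del: free_lmod_simps)
    then show "?ev (c x \<odot>\<^sub>(free_lmod R Y) b x) = c x \<otimes> b x y" using y by simp
  qed
  finally show ?thesis .
qed

lemma zero_module_subquotI:
  assumes D: "left_module S D" and C: "submod S D C" and Z: "submod S D Z" and ZC: "Z \<subseteq> C"
  shows "zero_module (subquot D Z C)"
proof -
  interpret abelian_subgroup C D by (rule submod_abelian_subgroup[OF D C])
  have "C +>\<^sub>D f = C" if "f \<in> Z" for f using a_rcos_const ZC that by blast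
  moreover have "\<zero>\<^sub>D \<in> Z" using Z by (simp add: submod_def)
  ultimately have "(\<lambda>f. C +>\<^sub>D f) ` Z = {C}" by blast
  then show ?thesis by (simp add: zero_module_def subquot_def)
qed

lemma lmod_isomorphic_zero_module:
  assumes "lmod_isomorphic S H K" "zero_module K" and z: "\<zero>\<^sub>H \<in> carrier H"
  shows "zero_module H"
proof -
  obtain f where "bij_betw f (carrier H) {\<zero>\<^sub>K}"
    using assms(1,2) unfolding lmod_isomorphic_def zero_module_def by auto
  then have "card (carrier H) = 1" using bij_betw_same_card by fastforce
  then show ?thesis using z by (auto simp: zero_module_def card_1_singleton_iff)
qed

text \<open>The data of a complex \<open>0 \<rightarrow> R \<rightarrow> R\<^sup>J \<rightarrow> R \<rightarrow> M \<rightarrow> 0\<close> of free left modules and of its dual \<open>R \<rightarrow>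
  R\<^sup>J \<rightarrow> R\<close> of right modules, in coordinates. The premises say that the first is exact and that the
  second is exact except at its last place. The label \<open>pt\<close> is the index of the basis vector of
  \<open>R\<close>.\<close>

locale two_step = left_module R M
  for R :: "('r, 'z) ring_scheme" (structure) and M :: "('r, 'm) module" (structure) +
  fixes m0 :: 'm and J :: "'b set" and pt :: 'b and y \<delta> :: "'b => 'r"
  assumes nontriv: "\<one>\<^sub>R \<noteq> \<zero>\<^sub>R" and m0: "m0 \<in> carrier M" and J: "finite J"
    and y: "!!j. j \<in> J ==> y j \<in> carrier R" and \<delta>: "!!j. j \<in> J ==> \<delta> j \<in> carrier R"
    and gen: "!!x. x \<in> carrier M ==> \<exists>r\<in>carrier R. x = r \<odot>\<^sub>M m0"
    and ker0: "!!r. r \<in> carrier R ==>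
      r \<odot>\<^sub>M m0 = \<zero>\<^sub>M \<longleftrightarrow> (\<exists>s\<in>J \<rightarrow> carrier R. r = (\<Oplus>\<^sub>R j\<in>J. s j \<otimes>\<^sub>R y j))"
    and ker1: "!!s. s \<in> J \<rightarrow> carrier R ==>
      (\<Oplus>\<^sub>R j\<in>J. s j \<otimes>\<^sub>R y j) = \<zero>\<^sub>R \<longleftrightarrow> (\<exists>t\<in>carrier R. \<forall>j\<in>J. s j = t \<otimes>\<^sub>R \<delta> j)"
    and ker2: "!!t. t \<in> carrier R ==> (!!j. j \<in> J ==> t \<otimes>\<^sub>R \<delta> j = \<zero>\<^sub>R) ==> t = \<zero>\<^sub>R"
    and dual0: "!!t. t \<in> carrier R ==> (!!j. j \<in> J ==> y j \<otimes>\<^sub>R t = \<zero>\<^sub>R) ==> t = \<zero>\<^sub>R"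
    and dual1: "!!s. s \<in> J \<rightarrow> carrier R ==> (\<Oplus>\<^sub>R j\<in>J. \<delta> j \<otimes>\<^sub>R s j) = \<zero>\<^sub>R ==>
      \<exists>t\<in>carrier R. \<forall>j\<in>J. s j = y j \<otimes>\<^sub>R t"
begin

abbreviation F :: "'b set => ('r, 'b => 'r) module" where "F \<equiv> free_lmod R"

definition Q :: "nat => ('r, 'b => 'r) module"
  where "Q i = F (if i = 0 \<or> i = 2 then {pt} else if i = 1 then J else {})"

abbreviation e :: "'b => 'r" where "e \<equiv> funit R {pt} pt"
abbreviation "d0 \<equiv> flift R (F {pt}) J (\<lambda>j. y j \<odot>\<^sub>(F {pt}) e)"
abbreviation "d1 \<equiv> flift R (F J) {pt} (\<lambda>_. \<lambda>j\<in>J. \<delta> j)"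
abbreviation "\<epsilon> \<equiv> flift R M {pt} (\<lambda>_. m0)"

definition d :: "nat => ('b => 'r) => ('b => 'r)"
  where "d i = (if i = 0 then d0 else if i = 1 then d1 else (\<lambda>x\<in>carrier (F {}). \<zero>\<^sub>(Q i)))"

lemma ring: "ring R" ..

lemmas FL = free_lmod_left_module[OF ring] and LR = lregular_left_module[OF ring]

lemma Q_simps: "Q 0 = F {pt}" "Q 1 = F J" "Q (Suc 0) = F J" "Q 2 = F {pt}" "Q (Suc (Suc 0)) = F {pt}"
  "Q (Suc (Suc (Suc i))) = F {}"
  by (simp_all add: Q_def)

lemma d_simps: "d 0 = d0" "d 1 = d1" "d (Suc 0) = d1"
  by (simp_all add: d_def)

lemma d_ge: "d (Suc (Suc i)) = (\<lambda>x\<in>carrier (F {}). \<zero>\<^sub>(Q (Suc (Suc i))))"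
  by (simp add: d_def)

lemma restrict_const_image: "A \<noteq> {} ==> (\<lambda>x\<in>A. c) ` A = {c}"
  by auto

lemma Collect_eqI: "[|!!x. x \<in> A ==> P x \<longleftrightarrow> x \<in> B; B \<subseteq> A|] ==> {x \<in> A. P x} = B"
  by blast

lemma Q_left_module: "left_module R (Q i)" unfolding Q_def by (rule FL)

lemma QX: "finite X ==> carrier (F X) = (X \<rightarrow>\<^sub>E carrier R)"
  by (rule free_lmod_carrier_finite)

lemma e_in: "e \<in> carrier (F {pt})" by (rule funit_in_free[OF ring])

lemma b0: "(\<lambda>j. y j \<odot>\<^sub>(F {pt}) e) \<in> J \<rightarrow> carrier (F {pt})"
  using left_module.lsmult_closed[OF FL y e_in] by blast

lemma b1: "(\<lambda>_. \<lambda>j\<in>J. \<delta> j) \<in> {pt} \<rightarrow> carrier (F J)"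
  using \<delta> QX[OF J] by (auto simp del: free_lmod_simps)

lemma b\<epsilon>: "(\<lambda>_. m0) \<in> {pt} \<rightarrow> carrier M" using m0 by simp

lemma d0: "d0 \<in> lhom R (F J) (F {pt})" by (rule flift_lhom[OF FL b0])
lemma d1: "d1 \<in> lhom R (F {pt}) (F J)" by (rule flift_lhom[OF FL b1])
lemma \<epsilon>: "\<epsilon> \<in> lhom R (F {pt}) M" by (rule flift_lhom[OF left_module_axioms b\<epsilon>])

lemma d0_unit: "j \<in> J ==> d0 (funit R J j) = y j \<odot>\<^sub>(F {pt}) e" by (rule flift_funit[OF FL b0])
lemma d1_unit: "d1 e = (\<lambda>j\<in>J. \<delta> j)" by (rule flift_funit[OF FL b1]) simp

lemma Fo_val: "c \<in> carrier (F {pt}) ==> c pt \<in> carrier R" by (auto simp: PiE_iff)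
lemma FJ_val: "c \<in> carrier (F J) ==> j \<in> J ==> c j \<in> carrier R" by (auto simp: PiE_iff)

lemma d0_apply: "c \<in> carrier (F J) ==> d0 c pt = (\<Oplus>\<^sub>R j\<in>J. c j \<otimes>\<^sub>R y j)"
proof -
  assume c: "c \<in> carrier (F J)"
  have "d0 c pt = (\<Oplus>\<^sub>R j\<in>J. c j \<otimes>\<^sub>R (y j \<odot>\<^sub>(F {pt}) e) pt)"
    by (rule flift_free_apply[OF ring J b0 c]) simp
  also have "\<dots> = (\<Oplus>\<^sub>R j\<in>J. c j \<otimes>\<^sub>R y j)"
    by (rule R.finsum_cong'[OF refl]) (use y FJ_val[OF c] in auto)
  finally show ?thesis .
qed

lemma d1_apply: "c \<in> carrier (F {pt}) ==> j \<in> J ==> d1 c j = c pt \<otimes>\<^sub>R \<delta> j"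
proof -
  assume c: "c \<in> carrier (F {pt})" and j: "j \<in> J"
  have "d1 c j = (\<Oplus>\<^sub>R x\<in>{pt}. c x \<otimes>\<^sub>R (\<lambda>j\<in>J. \<delta> j) j)"
    by (rule flift_free_apply[OF ring _ b1 c j]) simp
  then show ?thesis using Fo_val[OF c] \<delta>[OF j] j by simp
qed

lemma \<epsilon>_apply: "c \<in> carrier (F {pt}) ==> \<epsilon> c = c pt \<odot>\<^sub>M m0"
proof -
  assume c: "c \<in> carrier (F {pt})"
  have "\<epsilon> c = (\<Oplus>\<^sub>M x\<in>{pt}. c x \<odot>\<^sub>M m0)"
    by (rule flift_superset[OF left_module_axioms b\<epsilon> c]) auto
  then show ?thesis using lsmult_closed[OF Fo_val[OF c] m0] by simp
qed

lemma Fo_eqI: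
  assumes "c \<in> carrier (F {pt})" "c' \<in> carrier (F {pt})" "c pt = c' pt" shows "c = c'"
  using assms unfolding QX[OF finite.insertI[OF finite.emptyI]] by (intro PiE_ext) auto

lemma Fo_const: "r \<in> carrier R ==> (\<lambda>x\<in>{pt}. r) \<in> carrier (F {pt})"
  by (simp add: QX del: free_lmod_simps)

lemma F_empty: "carrier (F {}) = {\<zero>\<^sub>(F {})}"
  by auto

lemma Fo_zero: "c \<in> carrier (F {pt}) ==> c = \<zero>\<^sub>(F {pt}) \<longleftrightarrow> c pt = \<zero>\<^sub>R"
proof
  assume "c \<in> carrier (F {pt})" "c pt = \<zero>\<^sub>R"
  moreover have "\<zero>\<^sub>(F {pt}) \<in> carrier (F {pt})" by auto
  ultimately show "c = \<zero>\<^sub>(F {pt})" by (intro Fo_eqI) auto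
qed auto

theorem resolution: "projective_resolution R M Q d \<epsilon>"
proof -
  have "inj (\<lambda>(x::'b) z. if z = x then \<one>\<^sub>R else \<zero>\<^sub>R)"
  proof (rule injI)
    fix a b :: 'b
    assume "(\<lambda>z. if z = a then \<one>\<^sub>R else \<zero>\<^sub>R) = (\<lambda>z. if z = b then \<one>\<^sub>R else \<zero>\<^sub>R)"
    from fun_cong[OF this[symmetric], of a] nontriv show "a = b" by (simp split: if_splits)
  qed
  then have proj: "projective R (Q i)" for i
    unfolding Q_def by (rule projective_free_lmod[OF ring])
  have dl: "d i \<in> lhom R (Q (Suc i)) (Q i)" for i
  proof -
    consider "i = 0" | "i = 1" | k where "i = Suc (Suc k)"
      by (metis One_nat_def not0_implies_Suc)
    then show ?thesis
    proof cases
      case 3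
      interpret Qi: left_module R "Q i" by (rule Q_left_module)
      have "(\<lambda>x\<in>carrier (F {}). \<zero>\<^sub>(Q i)) \<in> lhom R (F {}) (Q i)"
        by (rule lhomI[OF FL]) (simp_all del: free_lmod_simps)
      then show ?thesis using 3 by (simp add: d_def Q_simps del: free_lmod_simps)
    qed (simp_all add: d_def Q_simps d0 d1 numeral_2_eq_2 del: free_lmod_simps)
  qed
  have surj: "\<epsilon> ` carrier (Q 0) = carrier M"
  proof
    show "\<epsilon> ` carrier (Q 0) \<subseteq> carrier M" using lhom_closed[OF \<epsilon>] by (auto simp only: Q_simps)
    show "carrier M \<subseteq> \<epsilon> ` carrier (Q 0)"
    proof
      fix x assume "x \<in> carrier M"
      then obtain r where r: "r \<in> carrier R" "x = r \<odot>\<^sub>M m0" using gen by blast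
      then have "x = \<epsilon> (\<lambda>x\<in>{pt}. r)" by (simp add: \<epsilon>_apply[OF Fo_const])
      then show "x \<in> \<epsilon> ` carrier (Q 0)" unfolding Q_simps using Fo_const[OF r(1)] by blast
    qed
  qed
  have k0: "{x \<in> carrier (Q 0). \<epsilon> x = \<zero>\<^sub>M} = d 0 ` carrier (Q 1)"
  proof -
    have "\<epsilon> x = \<zero>\<^sub>M \<longleftrightarrow> x \<in> d0 ` carrier (F J)" if x: "x \<in> carrier (F {pt})" for x
    proof -
      have "\<epsilon> x = \<zero>\<^sub>M \<longleftrightarrow> (\<exists>s\<in>J \<rightarrow> carrier R. x pt = (\<Oplus>\<^sub>R j\<in>J. s j \<otimes>\<^sub>R y j))"
        using \<epsilon>_apply[OF x] ker0[OF Fo_val[OF x]] by simp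
      also have "\<dots> \<longleftrightarrow> x \<in> d0 ` carrier (F J)"
      proof
        assume "\<exists>s\<in>J \<rightarrow> carrier R. x pt = (\<Oplus>\<^sub>R j\<in>J. s j \<otimes>\<^sub>R y j)"
        then obtain s where s: "s \<in> J \<rightarrow> carrier R" "x pt = (\<Oplus>\<^sub>R j\<in>J. s j \<otimes>\<^sub>R y j)" by blast
        have sJ: "restrict s J \<in> carrier (F J)" using s(1) QX[OF J] by auto
        have "d0 (restrict s J) pt = x pt"
          unfolding d0_apply[OF sJ] s(2) by (rule R.finsum_cong'[OF refl]) (use s(1) y in auto)
        then have "x = d0 (restrict s J)" using Fo_eqI[OF x lhom_closed[OF d0 sJ]] by simp
        then show "x \<in> d0 ` carrier (F J)" using sJ by (rule image_eqI)
      next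
        assume "x \<in> d0 ` carrier (F J)"
        then obtain s where s: "s \<in> carrier (F J)" "x = d0 s" by blast
        show "\<exists>s\<in>J \<rightarrow> carrier R. x pt = (\<Oplus>\<^sub>R j\<in>J. s j \<otimes>\<^sub>R y j)"
          by (rule bexI[of _ s]) (use d0_apply[OF s(1)] s FJ_val[OF s(1)] in auto)
      qed
      finally show ?thesis .
    qed
    moreover have "d0 ` carrier (F J) \<subseteq> carrier (F {pt})" using lhom_closed[OF d0] by blast
    ultimately show ?thesis unfolding Q_simps d_simps by (rule Collect_eqI)
  qed
  have k1: "{x \<in> carrier (Q (Suc 0)). d 0 x = \<zero>\<^sub>(Q 0)} = d (Suc 0) ` carrier (Q (Suc (Suc 0)))"
  proof -
    have "d0 x = \<zero>\<^sub>(F {pt}) \<longleftrightarrow> x \<in> d1 ` carrier (F {pt})" if x: "x \<in> carrier (F J)" for x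
    proof -
      have xJ: "x \<in> J \<rightarrow> carrier R" using FJ_val[OF x] by blast
      have "d0 x = \<zero>\<^sub>(F {pt}) \<longleftrightarrow> (\<exists>t\<in>carrier R. \<forall>j\<in>J. x j = t \<otimes>\<^sub>R \<delta> j)"
        using Fo_zero[OF lhom_closed[OF d0 x]] d0_apply[OF x] ker1[OF xJ] by simp
      also have "\<dots> \<longleftrightarrow> x \<in> d1 ` carrier (F {pt})"
      proof
        assume "\<exists>t\<in>carrier R. \<forall>j\<in>J. x j = t \<otimes>\<^sub>R \<delta> j"
        then obtain t where t: "t \<in> carrier R" "\<forall>j\<in>J. x j = t \<otimes>\<^sub>R \<delta> j" by blast
        have c: "(\<lambda>x\<in>{pt}. t) \<in> carrier (F {pt})" by (rule Fo_const[OF t(1)])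
        have "x = d1 (\<lambda>x\<in>{pt}. t)"
        proof (rule PiE_ext)
          show "x \<in> J \<rightarrow>\<^sub>E carrier R" "d1 (\<lambda>x\<in>{pt}. t) \<in> J \<rightarrow>\<^sub>E carrier R"
            using x lhom_closed[OF d1 c] unfolding QX[OF J] by blast+
          show "x j = d1 (\<lambda>x\<in>{pt}. t) j" if "j \<in> J" for j
            using t(2) d1_apply[OF c that] that by simp
        qed
        then show "x \<in> d1 ` carrier (F {pt})" using c by (rule image_eqI)
      next
        assume "x \<in> d1 ` carrier (F {pt})"
        then obtain s where s: "s \<in> carrier (F {pt})" "x = d1 s" by blast
        show "\<exists>t\<in>carrier R. \<forall>j\<in>J. x j = t \<otimes>\<^sub>R \<delta> j"
          by (rule bexI[of _ "s pt"]) (use d1_apply[OF s(1)] s Fo_val[OF s(1)] in auto)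
      qed
      finally show ?thesis .
    qed
    moreover have "d1 ` carrier (F {pt}) \<subseteq> carrier (F J)" using lhom_closed[OF d1] by blast
    ultimately show ?thesis unfolding Q_simps d_simps by (rule Collect_eqI)
  qed
  have zero_im: "d (Suc (Suc i)) ` carrier (Q (Suc (Suc (Suc i)))) = {\<zero>\<^sub>(Q (Suc (Suc i)))}" for i
    unfolding Q_simps(6) d_ge by (rule restrict_const_image) (use F_empty in blast)
  have k2: "{x \<in> carrier (Q 2). d 1 x = \<zero>\<^sub>(Q 1)} = {\<zero>\<^sub>(Q 2)}"
  proof -
    have "x = \<zero>\<^sub>(F {pt})" if x: "x \<in> carrier (F {pt})" and dx: "d1 x = \<zero>\<^sub>(F J)" for x
    proof -
      have "x pt \<otimes>\<^sub>R \<delta> j = \<zero>\<^sub>R" if "j \<in> J" for j using d1_apply[OF x that] dx that by simp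
      then show ?thesis using ker2[OF Fo_val[OF x]] Fo_zero[OF x] by blast
    qed
    moreover have "\<zero>\<^sub>(F {pt}) \<in> carrier (F {pt})" by auto
    moreover have "d1 \<zero>\<^sub>(F {pt}) = \<zero>\<^sub>(F J)" by (rule lhom_zero[OF FL FL d1])
    ultimately show ?thesis unfolding Q_simps d_simps by blast
  qed
  have "{x \<in> carrier (Q (Suc i)). d i x = \<zero>\<^sub>(Q i)} = d (Suc i) ` carrier (Q (Suc (Suc i)))" for i
  proof -
    consider "i = 0" | "i = 1" | k where "i = Suc (Suc k)"
      by (metis One_nat_def not0_implies_Suc)
    then show ?thesis
    proof cases
      case 1
      then show ?thesis using k1 by simp
    next
      case 2
      then show ?thesis using k2 zero_im[of 0] by (simp add: numeral_2_eq_2 del: free_lmod_simps)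
    next
      case (3 k)
      have "{x \<in> carrier (Q (Suc i)). d i x = \<zero>\<^sub>(Q i)} = {\<zero>\<^sub>(Q (Suc i))}"
        unfolding 3 Q_simps(6) d_ge
        by (rule trans[OF Collect_eqI[where B = "carrier (F {})"] F_empty]) (auto simp del: free_lmod_simps)
      then show ?thesis using zero_im[of "Suc k"] 3 by simp
    qed
  qed
  then show ?thesis unfolding projective_resolution_def
    using proj dl surj k0 \<epsilon> by (simp add: Q_simps(1) del: free_lmod_simps)
qed

lemma resolution_finite:
  "finite_type R (Q i)" "i > 2 ==> zero_module (Q i)"
proof -
  show "finite_type R (Q i)"
    unfolding Q_def by (rule finite_type_free_lmod[OF ring nontriv]) (use J in auto)
  show "zero_module (Q i)" if "i > 2"
    using that F_empty by (simp add: Q_def zero_module_def)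
qed

abbreviation "D X \<equiv> ldual R (F X)"

lemma dual_delta:
  assumes f: "f \<in> lhom R (F J) (lregular R)"
  shows "f (\<lambda>j\<in>J. \<delta> j) = (\<Oplus>\<^sub>R j\<in>J. \<delta> j \<otimes>\<^sub>R f (funit R J j))"
proof -
  have dJ: "(\<lambda>j\<in>J. \<delta> j) \<in> carrier (F J)" using b1 by blast
  have sc: "\<delta> j \<odot>\<^sub>(F J) funit R J j \<in> carrier (F J)" if "j \<in> J" for j
    by (rule left_module.lsmult_closed[OF FL \<delta>[OF that] funit_in_free[OF ring]])
  have "(\<lambda>j\<in>J. \<delta> j) = (\<Oplus>\<^sub>(F J)j\<in>J. (\<lambda>j\<in>J. \<delta> j) j \<odot>\<^sub>(F J) funit R J j)"
    by (rule free_lmod_expand[OF ring J dJ])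
  also have "\<dots> = (\<Oplus>\<^sub>(F J)j\<in>J. \<delta> j \<odot>\<^sub>(F J) funit R J j)"
  proof -
    interpret FJ: left_module R "F J" by (rule FL)
    show ?thesis by (rule FJ.M.finsum_cong'[OF refl]) (use sc in \<open>auto simp del: free_lmod_simps\<close>)
  qed
  finally have "f (\<lambda>j\<in>J. \<delta> j) = f (\<Oplus>\<^sub>(F J)j\<in>J. \<delta> j \<odot>\<^sub>(F J) funit R J j)" by simp
  also have "\<dots> = (\<Oplus>\<^sub>(lregular R)j\<in>J. f (\<delta> j \<odot>\<^sub>(F J) funit R J j))"
    by (rule lhom_finsum[OF FL LR f]) (use sc in blast)
  also have "\<dots> = (\<Oplus>\<^sub>R j\<in>J. \<delta> j \<otimes>\<^sub>R f (funit R J j))"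
    unfolding finsum_lregular
  proof (rule R.finsum_cong'[OF refl])
    show "(\<lambda>j. \<delta> j \<otimes>\<^sub>R f (funit R J j)) \<in> J \<rightarrow> carrier R"
      using \<delta> lhom_lregular_closed[OF f funit_in_free[OF ring]] by simp
    show "f (\<delta> j \<odot>\<^sub>(F J) funit R J j) = \<delta> j \<otimes>\<^sub>R f (funit R J j)" if "j \<in> J" for j
      using lhom_smult[OF f \<delta>[OF that] funit_in_free[OF ring]] by simp
  qed
  finally show ?thesis .
qed

lemma functional:
  assumes "b \<in> X \<rightarrow> carrier R"
  obtains f where "f \<in> lhom R (F X) (lregular R)" "!!x. x \<in> X ==> f (funit R X x) = b x"
proof -
  have b: "b \<in> X \<rightarrow> carrier (lregular R)" using assms by simp
  show thesis by (rule that[OF flift_lhom[OF LR b] flift_funit[OF LR b]])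
qed

lemma functional_eqI:
  assumes "f \<in> lhom R (F X) (lregular R)" "g \<in> lhom R (F X) (lregular R)"
    "!!x. x \<in> X ==> f (funit R X x) = g (funit R X x)"
  shows "f = g"
  by (rule lhom_eqI[OF assms(1,2)], rule lhom_free_eqI[OF ring LR assms(1,2)])
    (use assms(3) in auto)

lemma dl: "d i \<in> lhom R (Q (Suc i)) (Q i)"
  using projective_resolutionD(3)[OF resolution] .

lemma Z: "submod (opp R) (ldual R (Q i)) (cocycles R Q d i)"
  by (rule cocycles_submod) (rule Q_left_module dl)+

text \<open>The coefficient at \<open>w\<close> of the normal form of the left tensor factor. As \<open>k\<close>-linear
  functionals these separate the elements of \<open>E\<close> and avoid choosing a basis of \<open>U\<close>.\<close>

lemma C: "submod (opp R) (ldual R (Q i)) (coboundaries R Q d i)"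
  by (rule coboundaries_submod) (rule Q_left_module dl)+

lemma DL: "left_module (opp R) (ldual R (Q i))"
  by (rule ldual_left_module[OF Q_left_module])

theorem cohomology_zero:
  assumes "i \<noteq> 2" shows "zero_module (dual_cohomology R Q d i)"
  unfolding dual_cohomology_subquot
proof (rule zero_module_subquotI[OF DL C Z], rule subsetI)
  fix f assume f: "f \<in> cocycles R Q d i"
  consider "i = 0" | "i = 1" | k where "i = Suc (Suc (Suc k))"
    using assms by (metis One_nat_def not0_implies_Suc numeral_2_eq_2)
  then show "f \<in> coboundaries R Q d i"
  proof cases
    case 1
    have fl: "f \<in> lhom R (F {pt}) (lregular R)" and f0: "!!x. x \<in> carrier (F J) ==> f (d0 x) = \<zero>\<^sub>R"
      using f by (simp_all add: 1 cocycles_def Q_simps d_def del: free_lmod_simps)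
    have fe: "f e \<in> carrier R" by (rule lhom_lregular_closed[OF fl e_in])
    have "y j \<otimes>\<^sub>R f e = \<zero>\<^sub>R" if "j \<in> J" for j
      using f0[OF funit_in_free[OF ring], of j] d0_unit[OF that] lhom_smult[OF fl y[OF that] e_in] by simp
    then have "f e = \<zero>\<^sub>R" by (rule dual0[OF fe])
    moreover have "(\<lambda>x\<in>carrier (F {pt}). \<zero>\<^sub>R) e = \<zero>\<^sub>R" using e_in by (simp del: free_lmod_simps)
    ultimately have "f = (\<lambda>x\<in>carrier (F {pt}). \<zero>\<^sub>R)"
      by (intro functional_eqI[OF fl ldual_closed(1)[OF FL]]) simp
    then show ?thesis by (simp add: 1 coboundaries_def Q_simps del: free_lmod_simps)
  next
    case 2
    have fl: "f \<in> lhom R (F J) (lregular R)" and f0: "!!x. x \<in> carrier (F {pt}) ==> f (d1 x) = \<zero>\<^sub>R"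
      using f by (simp_all add: 2 cocycles_def Q_simps d_def del: free_lmod_simps)
    have fe: "(\<lambda>j. f (funit R J j)) \<in> J \<rightarrow> carrier R"
      using lhom_lregular_closed[OF fl funit_in_free[OF ring]] by simp
    have "(\<Oplus>\<^sub>R j\<in>J. \<delta> j \<otimes>\<^sub>R f (funit R J j)) = \<zero>\<^sub>R"
      using f0[OF e_in] dual_delta[OF fl] by (simp add: d1_unit)
    then obtain t where t: "t \<in> carrier R" "\<forall>j\<in>J. f (funit R J j) = y j \<otimes>\<^sub>R t"
      using dual1[OF fe] by blast
    obtain w where w: "w \<in> lhom R (F {pt}) (lregular R)" "w e = t"
      by (rule functional[of "\<lambda>_. t" "{pt}"]) (use t(1) in auto)
    have "f = (\<lambda>x\<in>carrier (F J). w (d0 x))"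
    proof (rule functional_eqI[OF fl lhom_comp[OF FL d0 w(1)]])
      fix j assume j: "j \<in> J"
      show "f (funit R J j) = (\<lambda>x\<in>carrier (F J). w (d0 x)) (funit R J j)"
        unfolding restrict_apply'[OF funit_in_free[OF ring]]
        using t(2) j d0_unit[OF j] lhom_smult[OF w(1) y[OF j] e_in] w(2)
        by (simp del: free_lmod_simps)
    qed
    then show ?thesis using w(1)
      by (simp add: 2 coboundaries_def Q_simps d_def image_iff del: free_lmod_simps) blast
  next
    case (3 k)
    have fl: "f \<in> lhom R (F {}) (lregular R)"
      using f by (simp add: 3 cocycles_def Q_simps del: free_lmod_simps)
    have "f = (\<lambda>x\<in>carrier (F {}). \<zero>\<^sub>R)"
      by (rule functional_eqI[OF fl ldual_closed(1)[OF FL]]) simp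
    then have "f = \<zero>\<^sub>(ldual R (Q i))" by (simp add: 3 Q_simps del: free_lmod_simps)
    then show ?thesis using C[of i] by (simp only: submod_def)
  qed
qed

lemma Z2: "cocycles R Q d 2 = lhom R (F {pt}) (lregular R)"
proof -
  have "f (d 2 x) = \<zero>\<^sub>R" if "f \<in> lhom R (F {pt}) (lregular R)" "x \<in> carrier (F {})" for f x
    using lhom_zero[OF FL LR that(1)] that(2) by (simp add: d_def Q_simps del: free_lmod_simps)
  then show ?thesis by (auto simp: cocycles_def Q_simps numeral_2_eq_2 simp del: free_lmod_simps)
qed

lemma C2:
  assumes h: "h \<in> lhom R (F {pt}) (lregular R)"
  shows "h \<in> coboundaries R Q d 2 \<longleftrightarrow> (\<exists>s\<in>J \<rightarrow> carrier R. h e = (\<Oplus>\<^sub>R j\<in>J. \<delta> j \<otimes>\<^sub>R s j))"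
proof
  assume "h \<in> coboundaries R Q d 2"
  then obtain w where w: "w \<in> lhom R (F J) (lregular R)" "h = (\<lambda>x\<in>carrier (F {pt}). w (d1 x))"
    by (auto simp: numeral_2_eq_2 coboundaries_def Q_simps d_def simp del: free_lmod_simps)
  have "h e = (\<Oplus>\<^sub>R j\<in>J. \<delta> j \<otimes>\<^sub>R w (funit R J j))"
    unfolding w(2) using e_in d1_unit dual_delta[OF w(1)] by (simp del: free_lmod_simps)
  moreover have "(\<lambda>j. w (funit R J j)) \<in> J \<rightarrow> carrier R"
    using lhom_lregular_closed[OF w(1) funit_in_free[OF ring]] by simp
  ultimately show "\<exists>s\<in>J \<rightarrow> carrier R. h e = (\<Oplus>\<^sub>R j\<in>J. \<delta> j \<otimes>\<^sub>R s j)" by (intro bexI)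
next
  assume "\<exists>s\<in>J \<rightarrow> carrier R. h e = (\<Oplus>\<^sub>R j\<in>J. \<delta> j \<otimes>\<^sub>R s j)"
  then obtain s where s: "s \<in> J \<rightarrow> carrier R" "h e = (\<Oplus>\<^sub>R j\<in>J. \<delta> j \<otimes>\<^sub>R s j)" by blast
  obtain w where w: "w \<in> lhom R (F J) (lregular R)" "!!j. j \<in> J ==> w (funit R J j) = s j"
    by (rule functional[OF s(1)]) blast
  have "(\<Oplus>\<^sub>R j\<in>J. \<delta> j \<otimes>\<^sub>R w (funit R J j)) = (\<Oplus>\<^sub>R j\<in>J. \<delta> j \<otimes>\<^sub>R s j)"
    by (rule R.finsum_cong'[OF refl]) (use s(1) \<delta> w(2) in auto)
  then have "w (d1 e) = h e" using dual_delta[OF w(1)] s(2) by (simp add: d1_unit)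
  then have "h = (\<lambda>x\<in>carrier (F {pt}). w (d1 x))"
    using e_in by (intro functional_eqI[OF h lhom_comp[OF FL d1 w(1)]]) (simp del: free_lmod_simps)
  then show "h \<in> coboundaries R Q d 2" using w(1)
    by (auto simp: numeral_2_eq_2 coboundaries_def Q_simps d_def simp del: free_lmod_simps)
qed

text \<open>The second cohomology is \<open>R / \<Sum>\<^sub>j \<delta>\<^sub>j R\<close>, a cocycle being determined by its value on the
  basis vector; so any surjection from \<open>R\<close> with this kernel describes it.\<close>

theorem cohomology_two_iso:
  assumes N: "abelian_group N"
    and G: "!!r. r \<in> carrier R ==> G r \<in> carrier N"
    and Ga: "!!r s. r \<in> carrier R ==> s \<in> carrier R ==> G (r \<oplus>\<^sub>R s) = G r \<oplus>\<^sub>N G s"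
    and Gs: "!!r s. r \<in> carrier R ==> s \<in> carrier R ==> G (r \<otimes>\<^sub>R s) = s \<odot>\<^sub>N G r"
    and surj: "!!z. z \<in> carrier N ==> \<exists>r\<in>carrier R. G r = z"
    and kernel: "!!r. r \<in> carrier R ==> G r = \<zero>\<^sub>N \<longleftrightarrow> (\<exists>s\<in>J \<rightarrow> carrier R. r = (\<Oplus>\<^sub>R j\<in>J. \<delta> j \<otimes>\<^sub>R s j))"
  shows "lmod_isomorphic (opp R) (dual_cohomology R Q d 2) N"
  unfolding dual_cohomology_subquot
proof (rule subquot_isoI[OF DL C Z, where G = "\<lambda>f. G (f e)"])
  interpret N: abelian_group N by fact
  fix f assume "f \<in> cocycles R Q d 2"
  then have f: "f \<in> lhom R (F {pt}) (lregular R)" by (simp add: Z2)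
  note fe = lhom_lregular_closed[OF f e_in]
  show "G (f e) \<in> carrier N" by (rule G[OF fe])
  show "G ((r \<odot>\<^sub>(ldual R (Q 2)) f) e) = r \<odot>\<^sub>N G (f e)" if "r \<in> carrier (opp R)" for r
    using Gs[OF fe] that e_in by (simp add: Q_simps del: free_lmod_simps)
  fix g assume "g \<in> cocycles R Q d 2"
  then have g: "g \<in> lhom R (F {pt}) (lregular R)" by (simp add: Z2)
  note ge = lhom_lregular_closed[OF g e_in]
  show "G ((f \<oplus>\<^sub>(ldual R (Q 2)) g) e) = G (f e) \<oplus>\<^sub>N G (g e)"
    using Ga[OF fe ge] e_in by (simp add: Q_simps del: free_lmod_simps)
  interpret D: left_module "opp R" "D {pt}" by (rule ldual_left_module[OF FL])
  have m: "f \<ominus>\<^sub>(D {pt}) g \<in> lhom R (F {pt}) (lregular R)" using D.M.minus_closed f g by simp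
  have "(f \<ominus>\<^sub>(D {pt}) g) e = f e \<ominus>\<^sub>R g e" by (rule ldual_minus[OF FL _ _ e_in]) (use f g in simp_all)
  moreover have "G (f e \<ominus>\<^sub>R g e) = G (f e) \<ominus>\<^sub>N G (g e)"
  proof -
    have "G (f e \<ominus>\<^sub>R g e) \<oplus>\<^sub>N G (g e) = G (f e)"
      using Ga[of "f e \<ominus>\<^sub>R g e" "g e"] fe ge by (simp add: a_minus_def R.a_assoc R.l_neg)
    then show ?thesis using G[OF ge] G[of "f e \<ominus>\<^sub>R g e"] fe ge
      by (metis N.a_assoc N.a_inv_closed N.r_neg N.r_zero R.minus_closed a_minus_def)
  qed
  ultimately have "f \<ominus>\<^sub>(D {pt}) g \<in> coboundaries R Q d 2 \<longleftrightarrow> G (f e) \<ominus>\<^sub>N G (g e) = \<zero>\<^sub>N"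
    using C2[OF m] kernel[of "f e \<ominus>\<^sub>R g e"] fe ge by simp
  then show "G (f e) = G (g e) \<longleftrightarrow> f \<ominus>\<^sub>(ldual R (Q 2)) g \<in> coboundaries R Q d 2"
    using abelian_group_minus_eq_zero[OF N G[OF fe] G[OF ge]] by (simp add: Q_simps del: free_lmod_simps)
next
  fix z assume "z \<in> carrier N"
  then obtain r where r: "r \<in> carrier R" "G r = z" using surj by blast
  obtain w where "w \<in> lhom R (F {pt}) (lregular R)" "w e = r"
    by (rule functional[of "\<lambda>_. r" "{pt}"]) (use r(1) in auto)
  then show "\<exists>f\<in>cocycles R Q d 2. G (f e) = z" using r(2) by (auto simp: Z2)
qed

text \<open>Conversely, under an isomorphism of the second cohomology with \<open>N\<close> the class of \<open>1\<close> becomes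
  a generator of \<open>N\<close> that is annihilated by all \<open>\<delta>\<^sub>j\<close>.\<close>

theorem cohomology_two_generator:
  assumes N: "left_module (opp R) N"
    and iso: "lmod_isomorphic (opp R) (dual_cohomology R Q d 2) N"
  obtains u where "u \<in> carrier N" "!!j. j \<in> J ==> \<delta> j \<odot>\<^sub>N u = \<zero>\<^sub>N"
    "!!z. z \<in> carrier N ==> \<exists>t\<in>carrier R. z = t \<odot>\<^sub>N u"
proof -
  let ?C = "coboundaries R Q d 2" and ?D = "ldual R (Q 2)"
  let ?H = "subquot ?D (cocycles R Q d 2) ?C"
  let ?c = "\<lambda>f. ?C +>\<^sub>(?D) f"
  interpret N: left_module "opp R" N by fact
  interpret D: left_module "opp R" ?D by (rule DL)
  obtain \<Theta> where \<Theta>: "\<Theta> \<in> lhom (opp R) ?H N" and bij: "bij_betw \<Theta> (carrier ?H) (carrier N)"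
    using iso unfolding dual_cohomology_subquot lmod_isomorphic_def by blast
  have carH: "carrier ?H = ?c ` lhom R (F {pt}) (lregular R)" by (simp add: subquot_def Z2)
  obtain w where w: "w \<in> lhom R (F {pt}) (lregular R)" "w e = \<one>\<^sub>R"
    by (rule functional[of "\<lambda>_. \<one>\<^sub>R" "{pt}"]) auto
  have wZ: "w \<in> cocycles R Q d 2" using w by (simp add: Z2)
  have cw: "?c w \<in> carrier ?H" using w(1) carH by blast
  have rw: "r \<odot>\<^sub>(?D) w \<in> lhom R (F {pt}) (lregular R)" "(r \<odot>\<^sub>(?D) w) e = r" if r: "r \<in> carrier R" for r
    using D.lsmult_closed[of r w] w r e_in by (simp_all add: Q_simps del: free_lmod_simps)
  have \<Theta>r: "\<Theta> (?c (r \<odot>\<^sub>(?D) w)) = r \<odot>\<^sub>N \<Theta> (?c w)" if r: "r \<in> carrier R" for r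
    using lhom_smult[OF \<Theta> _ cw, of r] subquot_smult[OF DL C Z wZ, of r] r by simp
  show thesis
  proof (rule that[of "\<Theta> (?c w)"])
    show u: "\<Theta> (?c w) \<in> carrier N" by (rule lhom_closed[OF \<Theta> cw])
    fix j assume j: "j \<in> J"
    let ?s = "\<lambda>i. if i = j then \<one>\<^sub>R else \<zero>\<^sub>R"
    have "(\<Oplus>\<^sub>R i\<in>J. \<delta> i \<otimes>\<^sub>R ?s i) = (\<Oplus>\<^sub>R i\<in>J. if j = i then \<delta> i else \<zero>\<^sub>R)"
      by (rule R.finsum_cong'[OF refl]) (use \<delta> in auto)
    also have "\<dots> = \<delta> j" by (rule R.add.finprod_singleton[OF j J]) (use \<delta> in blast)
    finally have "\<delta> j = (\<Oplus>\<^sub>R i\<in>J. \<delta> i \<otimes>\<^sub>R ?s i)" by simp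
    moreover have "?s \<in> J \<rightarrow> carrier R" by simp
    ultimately have dw: "\<delta> j \<odot>\<^sub>(?D) w \<in> ?C"
      unfolding C2[OF rw(1)[OF \<delta>[OF j]]] rw(2)[OF \<delta>[OF j]] by (rule bexI)
    interpret C: abelian_subgroup ?C ?D by (rule submod_abelian_subgroup[OF DL C])
    have z: "\<zero>\<^sub>(?D) \<in> ?C" by (rule C.zero_closed)
    have zw: "\<zero>\<^sub>R \<odot>\<^sub>(?D) w = \<zero>\<^sub>(?D)"
      using D.lsmult_l_null[of w] w(1) by (simp add: Q_simps del: free_lmod_simps)
    have "?c (\<delta> j \<odot>\<^sub>(?D) w) = ?c (\<zero>\<^sub>R \<odot>\<^sub>(?D) w)"
      unfolding zw C.a_rcos_const[OF dw] C.a_rcos_const[OF z] ..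
    then have "\<delta> j \<odot>\<^sub>N \<Theta> (?c w) = \<zero>\<^sub>R \<odot>\<^sub>N \<Theta> (?c w)"
      using \<Theta>r[OF \<delta>[OF j]] \<Theta>r[OF R.zero_closed] by simp
    then show "\<delta> j \<odot>\<^sub>N \<Theta> (?c w) = \<zero>\<^sub>N" using N.lsmult_l_null[OF u] by simp
  next
    fix z assume "z \<in> carrier N"
    then have "z \<in> \<Theta> ` ?c ` lhom R (F {pt}) (lregular R)"
      unfolding bij_betw_imp_surj_on[OF bij, symmetric] carH .
    then obtain f where f: "f \<in> lhom R (F {pt}) (lregular R)" "\<Theta> (?c f) = z" by blast
    have fe: "f e \<in> carrier R" by (rule lhom_lregular_closed[OF f(1) e_in])
    have "f = f e \<odot>\<^sub>(?D) w" by (rule functional_eqI[OF f(1) rw(1)[OF fe]]) (simp only: singleton_iff rw(2)[OF fe])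
    then have "z = f e \<odot>\<^sub>N \<Theta> (?c w)" using \<Theta>r[OF fe] f(2) by metis
    then show "\<exists>t\<in>carrier R. z = t \<odot>\<^sub>N \<Theta> (?c w)" using fe by blast
  qed
qed

end

section \<open>Linear extension from a basis\<close>

lemma pm_sum_singles:
  fixes f :: "'p \<Rightarrow>\<^sub>0 'c::comm_monoid_add"
  shows "f = (\<Sum>p\<in>supp f. monomial p (coef f p))"
proof (rule poly_mapping_eqI)
  fix q
  have "(\<Sum>p\<in>supp f. coef (monomial p (coef f p)) q) =
      (\<Sum>p\<in>supp f. if p = q then coef f p else 0)"
    by (rule sum.cong) (auto simp: lookup_single when_def)
  also have "\<dots> = coef f q"
    by (auto simp: sum.delta in_keys_iff)
  finally show "coef f q =
      coef (\<Sum>p\<in>supp f. monomial p (coef f p)) q"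
    by (simp add: lookup_sum)
qed

lemma pm_induct [consumes 1, case_names zero single add]:
  fixes f :: "'p \<Rightarrow>\<^sub>0 'c::comm_monoid_add"
  assumes "supp f \<subseteq> X" and zero: "P 0"
    and single: "!!p c. p \<in> X ==> P (monomial p c)"
    and add: "!!f g. [|supp f \<subseteq> X; supp g \<subseteq> X; P f; P g|] ==> P (f + g)"
  shows "P f"
proof -
  have "finite K ==> K \<subseteq> X ==> supp (\<Sum>p\<in>K. monomial p (c p)) \<subseteq> X \<and>
      P (\<Sum>p\<in>K. monomial p (c p))" for K and c :: "'p => 'c"
  proof (induction K rule: finite_induct)
    case empty
    then show ?case using zero by simp
  next
    case (insert p K)
    have s: "supp (monomial p (c p)) \<subseteq> X" using insert.prems by simp
    have "supp (monomial p (c p) + (\<Sum>p\<in>K. monomial p (c p))) \<subseteq> X"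
      by (rule order.trans[OF keys_add]) (use s insert in auto)
    then show ?case using insert s by (auto intro!: add single)
  qed
  from this[of "supp f" "coef f"] assms(1)
  show ?thesis unfolding pm_sum_singles[of f, symmetric] by simp
qed

definition pm_ext :: "('g, 'z) ring_scheme => ('c => 'g => 'g) => ('p => 'g) => ('p \<Rightarrow>\<^sub>0 'c::zero) => 'g"
  where "pm_ext G s h f = (\<Oplus>\<^sub>G p\<in>supp f. s (coef f p) (h p))"

locale scalar_action = abelian_group G for G (structure) +
  fixes s :: "'c::ab_group_add => 'a => 'a"
  assumes s_closed: "x \<in> carrier G ==> s c x \<in> carrier G"
    and s_add: "x \<in> carrier G ==> s (a + b) x = s a x \<oplus> s b x"
begin

lemma s_zero: "x \<in> carrier G ==> s 0 x = \<zero>"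
  using s_add[of x 0 0] s_closed[of x 0] by simp

lemma pm_ext_superset:
  assumes "finite K" "supp f \<subseteq> K" "!!p. p \<in> K ==> h p \<in> carrier G"
  shows "pm_ext G s h f = (\<Oplus>p\<in>K. s (coef f p) (h p))"
  unfolding pm_ext_def
  by (rule add.finprod_mono_neutral_cong_left)
    (use assms in \<open>auto simp: s_zero s_closed in_keys_iff\<close>)

lemma pm_ext_zero [simp]: "pm_ext G s h 0 = \<zero>"
  by (simp add: pm_ext_def)

lemma pm_ext_single:
  assumes "h p \<in> carrier G" shows "pm_ext G s h (monomial p c) = s c (h p)"
proof -
  have "pm_ext G s h (monomial p c) =
      (\<Oplus>q\<in>{p}. s (coef (monomial p c) q) (h q))"
    by (rule pm_ext_superset) (use assms in auto)
  then show ?thesis using s_closed[OF assms] by simp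
qed

lemma pm_ext_add:
  assumes "!!p. p \<in> X ==> h p \<in> carrier G" "supp f \<subseteq> X" "supp g \<subseteq> X"
  shows "pm_ext G s h (f + g) = pm_ext G s h f \<oplus> pm_ext G s h g"
proof -
  let ?K = "supp f \<union> supp g"
  have h: "!!p. p \<in> ?K ==> h p \<in> carrier G" using assms by blast
  have "pm_ext G s h (f + g) = (\<Oplus>p\<in>?K. s (coef (f + g) p) (h p))"
    by (rule pm_ext_superset) (use h keys_add[of f g] in auto)
  also have "\<dots> = (\<Oplus>p\<in>?K. s (coef f p) (h p) \<oplus> s (coef g p) (h p))"
    by (rule add.finprod_cong') (use h s_closed in \<open>auto simp: lookup_add s_add\<close>)
  also have "\<dots> = (\<Oplus>p\<in>?K. s (coef f p) (h p)) \<oplus> (\<Oplus>p\<in>?K. s (coef g p) (h p))"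
    by (rule finsum_addf) (use h s_closed in auto)
  also have "(\<Oplus>p\<in>?K. s (coef f p) (h p)) = pm_ext G s h f"
    by (rule pm_ext_superset[symmetric]) (use h in auto)
  also have "(\<Oplus>p\<in>?K. s (coef g p) (h p)) = pm_ext G s h g"
    by (rule pm_ext_superset[symmetric]) (use h in auto)
  finally show ?thesis .
qed

lemma pm_ext_closed:
  assumes "!!p. p \<in> X ==> h p \<in> carrier G" "supp f \<subseteq> X"
  shows "pm_ext G s h f \<in> carrier G"
  unfolding pm_ext_def using assms by (intro finsum_closed) (auto intro!: s_closed)

end

lemma (in abelian_group) int_action: "scalar_action G (\<lambda>(k::int) x. [k] \<cdot> x)"
  by unfold_locales (auto simp: add.int_pow_mult)

section \<open>Vector spaces and algebras over a field\<close>

locale kspace = abelian_group M for M :: "('k::field, 'a) module" (structure) +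
  assumes smult_closed [simp, intro]: "x \<in> carrier M ==> c \<odot> x \<in> carrier M"
    and smult_l_distr: "x \<in> carrier M ==> (c + c') \<odot> x = c \<odot> x \<oplus> c' \<odot> x"
    and smult_r_distr: "x \<in> carrier M ==> x' \<in> carrier M ==> c \<odot> (x \<oplus> x') = c \<odot> x \<oplus> c \<odot> x'"
    and smult_assoc: "x \<in> carrier M ==> c \<odot> (c' \<odot> x) = (c * c') \<odot> x"
    and smult_one [simp]: "x \<in> carrier M ==> 1 \<odot> x = x"
begin

lemma action: "scalar_action M (smult M)"
  by unfold_locales (auto simp: smult_l_distr)

lemma smult_zero_l [simp]: "x \<in> carrier M ==> 0 \<odot> x = \<zero>"
  by (rule scalar_action.s_zero[OF action])

lemma smult_zero_r [simp]: "c \<odot> \<zero> = \<zero>"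
  using smult_r_distr[of \<zero> \<zero> c] smult_closed[of \<zero> c] by simp

end

locale kalg = ring B + kspace B for B :: "('k::field, 'b) module" (structure) +
  assumes smult_mult_l: "x \<in> carrier B ==> z \<in> carrier B ==> (c \<odot> x) \<otimes> z = c \<odot> (x \<otimes> z)"
    and smult_mult_r: "x \<in> carrier B ==> z \<in> carrier B ==> x \<otimes> (c \<odot> z) = c \<odot> (x \<otimes> z)"

lemma opp_smult [simp]:
  fixes B :: "('k, 'b) module" shows "smult (opp B) = smult B"
  by (simp add: opp_def)

lemma opp_kalg:
  assumes "kalg B" shows "kalg (opp B)"
proof -
  interpret kalg B by fact
  interpret O: ring "opp B" by (rule opp_ring) (rule ring_axioms)
  show ?thesis
    by unfold_locales (auto simp: smult_l_distr smult_r_distr smult_assoc smult_mult_l smult_mult_r)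
qed

section \<open>The tensor product of two vector spaces\<close>

lemma pair_ring_simps [simp]:
  "carrier (pair_ring M N) = {f. supp f \<subseteq> carrier M \<times> carrier N}"
  "zero (pair_ring M N) = 0" "add (pair_ring M N) = (+)"
  "one (pair_ring M N) = pair \<one>\<^sub>M \<one>\<^sub>N"
  by (simp_all add: pair_ring_def)

lemma pair_ring_abelian_group: "abelian_group (pair_ring M N)"
proof (rule abelian_groupI)
  fix f g assume "f \<in> carrier (pair_ring M N)" "g \<in> carrier (pair_ring M N)"
  then show "f \<oplus>\<^sub>(pair_ring M N) g \<in> carrier (pair_ring M N)"
    using keys_add[of f g] by auto
next
  fix f assume "f \<in> carrier (pair_ring M N)"
  then show "\<exists>g\<in>carrier (pair_ring M N). g \<oplus>\<^sub>(pair_ring M N) f = \<zero>\<^sub>(pair_ring M N)"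
    by (intro bexI[of _ "- f"]) auto
qed (auto simp: add.assoc add.commute)

lemma pair_ring_uminus:
  assumes "f \<in> carrier (pair_ring M N)" shows "\<ominus>\<^sub>(pair_ring M N) f = - f"
proof -
  interpret abelian_group "pair_ring M N" by (rule pair_ring_abelian_group)
  show ?thesis by (rule minus_equality) (use assms in auto)
qed

lemma pair_ring_minus:
  assumes "g \<in> carrier (pair_ring M N)" shows "f \<ominus>\<^sub>(pair_ring M N) g = f - g"
  using pair_ring_uminus[OF assms] by (simp add: a_minus_def)

definition balanced :: "('k, 'a) module => ('k, 'b) module => ('g, 'z) ring_scheme => ('a => 'b => 'g) => bool"
  where "balanced M N G h \<longleftrightarrow>
    (\<forall>a\<in>carrier M. \<forall>b\<in>carrier N. h a b \<in> carrier G) \<and>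
    (\<forall>a\<in>carrier M. \<forall>a'\<in>carrier M. \<forall>b\<in>carrier N. h (a \<oplus>\<^sub>M a') b = h a b \<oplus>\<^sub>G h a' b) \<and>
    (\<forall>a\<in>carrier M. \<forall>b\<in>carrier N. \<forall>b'\<in>carrier N. h a (b \<oplus>\<^sub>N b') = h a b \<oplus>\<^sub>G h a b') \<and>
    (\<forall>c. \<forall>a\<in>carrier M. \<forall>b\<in>carrier N. h (c \<odot>\<^sub>M a) b = h a (c \<odot>\<^sub>N b))"

locale tensor_spaces = M: kspace M + N: kspace N
  for M :: "('k::field, 'a) module" and N :: "('k, 'b) module"
begin

abbreviation "PR \<equiv> pair_ring M N"
abbreviation "S \<equiv> balancing_subgroup M N"
abbreviation "MN \<equiv> tensor M N"
abbreviation "pt \<equiv> pure_tensor M N"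

definition tc :: "('a \<times> 'b \<Rightarrow>\<^sub>0 int) => ('a \<times> 'b \<Rightarrow>\<^sub>0 int) set"
  where "tc f = S +>\<^sub>PR f"

sublocale PR: abelian_group PR by (rule pair_ring_abelian_group)

lemma pair_in: "a \<in> carrier M ==> b \<in> carrier N ==> pair a b \<in> carrier PR"
  by auto

lemma PR_add: "f \<in> carrier PR ==> g \<in> carrier PR ==> f + g \<in> carrier PR"
  using PR.a_closed[of f g] by simp

lemma PR_uminus: "f \<in> carrier PR ==> - f \<in> carrier PR" by simp

lemma PR_diff: "f \<in> carrier PR ==> g \<in> carrier PR ==> f - g \<in> carrier PR"
  using PR_add[of f "- g"] by simp

lemma balancing_in: "balancing M N \<subseteq> carrier PR"
  unfolding balancing_def by (intro Un_least subsetI; elim CollectE exE conjE; hypsubst)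
    (intro PR_diff pair_in; simp)+

lemma balancing_cases:
  assumes "f \<in> balancing M N"
  obtains (add_l) a a' b where "a \<in> carrier M" "a' \<in> carrier M" "b \<in> carrier N"
      "f = pair (a \<oplus>\<^sub>M a') b - pair a b - pair a' b"
    | (add_r) a b b' where "a \<in> carrier M" "b \<in> carrier N" "b' \<in> carrier N"
      "f = pair a (b \<oplus>\<^sub>N b') - pair a b - pair a b'"
    | (smult) a b c where "a \<in> carrier M" "b \<in> carrier N"
      "f = pair (c \<odot>\<^sub>M a) b - pair a (c \<odot>\<^sub>N b)"
  using assms unfolding balancing_def
  apply (elim UnE CollectE exE conjE)
    apply (rule add_l; assumption)
   apply (rule add_r; assumption)
  apply (rule smult; assumption)
  done

lemma S_subgroup: "abelian_subgroup S PR"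
proof (intro abelian_subgroupI3 additive_subgroupI PR.abelian_group_axioms)
  show "subgroup S (add_monoid PR)"
    unfolding balancing_subgroup_def
    by (rule group.generate_is_subgroup[OF PR.a_group]) (use balancing_in in simp)
qed

sublocale S: abelian_subgroup S PR by (rule S_subgroup)

lemma S_induct [consumes 1, case_names zero incl uminus add]:
  assumes "f \<in> S" "P 0" and incl: "!!f. f \<in> balancing M N ==> P f"
    and neg: "!!f. f \<in> carrier PR ==> P f ==> P (- f)"
    and add: "!!f g. f \<in> S ==> g \<in> S ==> P f ==> P g ==> P (f + g)"
  shows "P f"
  using assms(1) unfolding balancing_subgroup_def
proof (induction rule: generate.induct)
  case one
  then show ?case using \<open>P 0\<close> by simp
next
  case (incl h)
  then show ?case using assms(3) by blast
next
  case (inv h)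
  then have "h \<in> carrier PR" using balancing_in by blast
  then show ?case using neg[of h] assms(3)[OF inv] pair_ring_uminus[of h M N] by (simp add: a_inv_def)
next
  case (eng f g)
  then show ?case using add[of f g] by (simp add: balancing_subgroup_def)
qed

lemma S_incl: "f \<in> balancing M N ==> f \<in> S"
  unfolding balancing_subgroup_def by (rule generate.incl)

lemma S_in: "f \<in> S ==> f \<in> carrier PR" by (rule S.a_Hcarr)

lemma S_add: "f \<in> S ==> g \<in> S ==> f + g \<in> S" using S.a_closed[of f g] by simp

lemma S_zero: "0 \<in> S" using S.zero_closed by simp

lemma S_uminus: "f \<in> S ==> - f \<in> S"
  using S.a_inv_closed[of f] pair_ring_uminus[OF S_in, of f] by simp

lemma S_diff: "f \<in> S ==> g \<in> S ==> f - g \<in> S"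
  using S_add[OF _ S_uminus, of f g] by simp

lemma S_balance:
  assumes "a \<in> carrier M" "a' \<in> carrier M" "b \<in> carrier N" "b' \<in> carrier N"
  shows "pair (a \<oplus>\<^sub>M a') b - pair a b - pair a' b \<in> S"
    "pair a (b \<oplus>\<^sub>N b') - pair a b - pair a b' \<in> S"
    "pair (c \<odot>\<^sub>M a) b - pair a (c \<odot>\<^sub>N b) \<in> S"
  unfolding balancing_def by (rule S_incl, unfold balancing_def, use assms in blast)+

lemma tc_eq_iff: "f \<in> carrier PR ==> g \<in> carrier PR ==> tc f = tc g \<longleftrightarrow> f - g \<in> S"
  unfolding tc_def by (subst S.coset_eq_iff) (auto simp: pair_ring_minus)

lemma tensor_carrier: "carrier MN = tc ` carrier PR"
  by (auto simp: tensor_def FactRing_def A_RCOSETS_def' tc_def a_r_coset_def)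

lemma tc_closed: "f \<in> carrier PR ==> tc f \<in> carrier MN"
  by (simp only: tensor_carrier) (rule imageI)

lemma tensor_add: "f \<in> carrier PR ==> g \<in> carrier PR ==> tc f \<oplus>\<^sub>MN tc g = tc (f + g)"
  unfolding tensor_def FactRing_def tc_def using S.a_rcos_sum[of f g] by simp

lemma tensor_zero: "\<zero>\<^sub>MN = tc 0"
  unfolding tensor_def FactRing_def tc_def using S.a_rcos_const[OF S_zero] by simp

lemma pure_tc: "pt a b = tc (pair a b)"
  by (simp add: pure_tensor_def tc_def)

lemma tensor_abelian_group: "abelian_group MN"
proof (rule abelian_groupI)
  fix x assume "x \<in> carrier MN"
  then obtain f where f: "x = tc f" "f \<in> carrier PR" unfolding tensor_carrier by blast
  have "tc (- f) \<oplus>\<^sub>MN x = \<zero>\<^sub>MN"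
    unfolding f tensor_zero using tensor_add[OF PR_uminus[OF f(2)] f(2)] by simp
  then show "\<exists>y\<in>carrier MN. y \<oplus>\<^sub>MN x = \<zero>\<^sub>MN" using tc_closed[OF PR_uminus[OF f(2)]] by blast
  show "\<zero>\<^sub>MN \<oplus>\<^sub>MN x = x" unfolding f tensor_zero
    using tensor_add[of 0 f] f(2) by simp
  fix y assume "y \<in> carrier MN"
  then obtain g where g: "y = tc g" "g \<in> carrier PR" unfolding tensor_carrier by blast
  show "x \<oplus>\<^sub>MN y = y \<oplus>\<^sub>MN x" "x \<oplus>\<^sub>MN y \<in> carrier MN"
    unfolding f g tensor_add[OF f(2) g(2)] tensor_add[OF g(2) f(2)]
    by (simp_all only: add.commute tc_closed PR_add f(2) g(2))
  fix z assume "z \<in> carrier MN"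
  then obtain h where h: "z = tc h" "h \<in> carrier PR" unfolding tensor_carrier by blast
  show "x \<oplus>\<^sub>MN y \<oplus>\<^sub>MN z = x \<oplus>\<^sub>MN (y \<oplus>\<^sub>MN z)"
    by (simp only: f g h tensor_add PR_add add.assoc)
next
  show "\<zero>\<^sub>MN \<in> carrier MN" unfolding tensor_zero by (rule tc_closed) simp
qed

sublocale MN: abelian_group MN by (rule tensor_abelian_group)

lemma pure_closed: "a \<in> carrier M ==> b \<in> carrier N ==> pt a b \<in> carrier MN"
  unfolding pure_tc by (rule tc_closed) (rule pair_in)

lemma pure_add_l:
  assumes "a \<in> carrier M" "a' \<in> carrier M" "b \<in> carrier N"
  shows "pt (a \<oplus>\<^sub>M a') b = pt a b \<oplus>\<^sub>MN pt a' b"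
proof -
  have "tc (pair (a \<oplus>\<^sub>M a') b) = tc (pair a b + pair a' b)"
    using S_balance(1)[OF assms assms(3)] assms
    by (subst tc_eq_iff) (auto intro!: PR_add pair_in simp: algebra_simps simp del: pair_ring_simps)
  then show ?thesis unfolding pure_tc using assms by (subst tensor_add) (auto simp del: pair_ring_simps intro!: pair_in)
qed

lemma pure_add_r:
  assumes "a \<in> carrier M" "b \<in> carrier N" "b' \<in> carrier N"
  shows "pt a (b \<oplus>\<^sub>N b') = pt a b \<oplus>\<^sub>MN pt a b'"
proof -
  have "tc (pair a (b \<oplus>\<^sub>N b')) = tc (pair a b + pair a b')"
    using S_balance(2)[OF assms(1,1,2,3)] assms
    by (subst tc_eq_iff) (auto intro!: PR_add pair_in simp: algebra_simps simp del: pair_ring_simps)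
  then show ?thesis unfolding pure_tc using assms by (subst tensor_add) (auto simp del: pair_ring_simps intro!: pair_in)
qed

lemma pure_smult:
  assumes "a \<in> carrier M" "b \<in> carrier N"
  shows "pt (c \<odot>\<^sub>M a) b = pt a (c \<odot>\<^sub>N b)"
  unfolding pure_tc using S_balance(3)[OF assms(1,1,2,2)] assms
  by (subst tc_eq_iff) (auto simp del: pair_ring_simps intro!: pair_in)

lemma pure_zero_l: "b \<in> carrier N ==> pt \<zero>\<^sub>M b = \<zero>\<^sub>MN"
  using pure_add_l[of "\<zero>\<^sub>M" "\<zero>\<^sub>M" b] pure_closed[of "\<zero>\<^sub>M" b] by simp

lemma pure_zero_r: "a \<in> carrier M ==> pt a \<zero>\<^sub>N = \<zero>\<^sub>MN"
  using pure_add_r[of a "\<zero>\<^sub>N" "\<zero>\<^sub>N"] pure_closed[of a "\<zero>\<^sub>N"] by simp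

lemma pure_uminus_l:
  assumes "a \<in> carrier M" "b \<in> carrier N" shows "pt (\<ominus>\<^sub>M a) b = \<ominus>\<^sub>MN pt a b"
  using pure_add_l[of "\<ominus>\<^sub>M a" a b] assms
  by (intro MN.minus_equality[symmetric]) (auto simp: M.l_neg pure_zero_l pure_closed)

lemma tensor_induct [consumes 1, case_names pure add]:
  assumes t: "t \<in> carrier MN"
    and pure: "!!a b. a \<in> carrier M ==> b \<in> carrier N ==> P (pt a b)"
    and add: "!!s t. [|s \<in> carrier MN; t \<in> carrier MN; P s; P t|] ==> P (s \<oplus>\<^sub>MN t)"
  shows "P t"
proof -
  have tadd: "P (tc (f + g))" if "f \<in> carrier PR" "g \<in> carrier PR" "P (tc f)" "P (tc g)" for f g
    using add[OF tc_closed[OF that(1)] tc_closed[OF that(2)] that(3,4)] tensor_add[OF that(1,2)] by simp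
  have zero: "P (tc 0)"
    using pure[OF M.zero_closed N.zero_closed] pure_zero_l[OF N.zero_closed] tensor_zero by simp
  have neg: "P (tc (- pair a b))" if ab: "a \<in> carrier M" "b \<in> carrier N" for a b
  proof -
    have "tc (- pair a b) \<oplus>\<^sub>MN tc (pair a b) = \<zero>\<^sub>MN"
      using tensor_add[OF PR_uminus[OF pair_in[OF ab]] pair_in[OF ab]] tensor_zero by simp
    then have "\<ominus>\<^sub>MN pt a b = tc (- pair a b)"
      unfolding pure_tc by (rule MN.minus_equality[OF _ tc_closed[OF pair_in[OF ab]] tc_closed[OF PR_uminus[OF pair_in[OF ab]]]])
    then show ?thesis using pure[OF M.a_inv_closed[OF ab(1)] ab(2)] pure_uminus_l[OF ab] by simp
  qed
  have single: "P (tc (monomial (a, b) k))" if ab: "a \<in> carrier M" "b \<in> carrier N" for a b k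
  proof (induction k rule: int_induct[of _ 0])
    case base
    then show ?case using zero by simp
  next
    case (step1 k)
    have "P (tc (monomial (a, b) k + pair a b))"
      by (rule tadd) (use ab step1(2) pure[OF ab] in \<open>auto simp: pure_tc\<close>)
    then show ?case by (simp add: single_add)
  next
    case (step2 k)
    have "P (tc (monomial (a, b) k + - pair a b))"
      by (rule tadd) (use ab step2(2) neg[OF ab] in auto)
    then show ?case by (simp add: single_diff)
  qed
  obtain f where f: "t = tc f" "f \<in> carrier PR" using t unfolding tensor_carrier by blast
  have "supp f \<subseteq> carrier M \<times> carrier N" using f(2) by simp
  then have "P (tc f)"
    by (induction rule: pm_induct) (use zero single tadd in auto)
  then show ?thesis using f(1) by simp
qed

text \<open>The lift is defined through an arbitrary representative; it is well defined because the
  linear extension of a balanced map vanishes on the balancing relations.\<close>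

lemma tensor_lift_tc:
  fixes G (structure)
  assumes G: "abelian_group G" and h: "balanced M N G h" and f: "f \<in> carrier PR"
  shows "tensor_lift G h (tc f) = pm_ext G (\<lambda>(k::int) x. [k] \<cdot>\<^sub>G x) (\<lambda>p. h (fst p) (snd p)) f"
proof -
  interpret G: abelian_group G by fact
  interpret I: scalar_action G "\<lambda>(k::int) x. [k] \<cdot>\<^sub>G x" by (rule G.int_action)
  let ?e = "pm_ext G (\<lambda>(k::int) x. [k] \<cdot>\<^sub>G x) (\<lambda>p. h (fst p) (snd p))"
  have hc: "!!p. p \<in> carrier M \<times> carrier N ==> h (fst p) (snd p) \<in> carrier G"
    using h by (auto simp: balanced_def)
  have ec: "?e f \<in> carrier G" if "f \<in> carrier PR" for f
    by (rule I.pm_ext_closed[where X = "carrier M \<times> carrier N"]) (use hc that in auto)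
  have ea: "?e (f + g) = ?e f \<oplus> ?e g" if "f \<in> carrier PR" "g \<in> carrier PR" for f g
    by (rule I.pm_ext_add[where X = "carrier M \<times> carrier N"]) (use hc that in auto)
  have en: "?e (- f) = \<ominus> ?e f" if "f \<in> carrier PR" for f
    using ea[OF PR_uminus[OF that] that] ec[OF PR_uminus[OF that]] ec[OF that]
    by (intro G.minus_equality[symmetric]) auto
  have ed: "?e (f - g) = ?e f \<ominus> ?e g" if "f \<in> carrier PR" "g \<in> carrier PR" for f g
    using ea[OF that(1) PR_uminus[OF that(2)]] en[OF that(2)] by (simp add: a_minus_def)
  have ep: "?e (pair a b) = h a b" if "a \<in> carrier M" "b \<in> carrier N" for a b
    using hc[of "(a, b)"] that by (subst I.pm_ext_single) (auto simp: G.add.int_pow_1)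
  have eS: "?e f = \<zero>" if "f \<in> S" for f
    using that
  proof (induction rule: S_induct)
    case (incl f)
    then show ?case
    proof (cases rule: balancing_cases)
      case (add_l a a' b)
      then show ?thesis using h hc[of "(a, b)"] hc[of "(a', b)"]
        by (simp add: ed ep PR_diff pair_in balanced_def a_minus_def G.a_ac G.r_neg G.r_neg1 G.r_neg2 del: pair_ring_simps)
    next
      case (add_r a b b')
      then show ?thesis using h hc[of "(a, b)"] hc[of "(a, b')"]
        by (simp add: ed ep PR_diff pair_in balanced_def a_minus_def G.a_ac G.r_neg G.r_neg1 G.r_neg2 del: pair_ring_simps)
    next
      case (smult a b c)
      then show ?thesis using h hc[of "(a, c \<odot>\<^sub>N b)"]
        by (simp add: ed ep pair_in balanced_def a_minus_def G.r_neg del: pair_ring_simps)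
    qed
  next
    case (uminus f)
    then show ?case by (simp add: en del: pair_ring_simps)
  next
    case (add f g)
    then show ?case by (simp add: ea S_in del: pair_ring_simps)
  qed simp
  have mem: "g \<in> tc f ==> ?e g = ?e f" for g
  proof -
    assume g: "g \<in> tc f"
    have gP: "g \<in> carrier PR" using g f S.a_elemrcos_carrier unfolding tc_def by blast
    have gS: "g - f \<in> S" using S.a_rcos_module_imp[OF f, of g] g pair_ring_minus[OF f]
      by (simp add: tc_def a_minus_def)
    have "?e (f + (g - f)) = ?e f \<oplus> \<zero>" using ea[OF f S_in[OF gS]] eS[OF gS] by (simp only:)
    moreover have "f + (g - f) = g" by simp
    ultimately show ?thesis using ec[OF f] by simp
  qed
  have self: "f \<in> tc f" unfolding tc_def by (rule S.a_rcos_self[OF f])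
  show ?thesis
    unfolding tensor_lift_def
  proof (rule the_equality)
    let ?s = "\<lambda>g. \<Oplus>p\<in>supp g. [coef g p] \<cdot>\<^sub>G h (fst p) (snd p)"
    show "\<exists>g\<in>tc f. ?e f = ?s g" using self unfolding pm_ext_def by blast
    show "y = ?e f" if "\<exists>g\<in>tc f. y = ?s g" for y using that mem unfolding pm_ext_def by blast
  qed
qed

lemma tensor_lift_pure:
  fixes G (structure)
  assumes G: "abelian_group G" and h: "balanced M N G h" and ab: "a \<in> carrier M" "b \<in> carrier N"
  shows "tensor_lift G h (pt a b) = h a b"
proof -
  interpret G: abelian_group G by fact
  interpret I: scalar_action G "\<lambda>(k::int) x. [k] \<cdot>\<^sub>G x" by (rule G.int_action)
  show ?thesis unfolding pure_tc tensor_lift_tc[OF G h pair_in[OF ab]]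
    using h ab by (subst I.pm_ext_single) (auto simp: balanced_def G.add.int_pow_1)
qed

lemma tensor_lift_closed:
  fixes G (structure)
  assumes G: "abelian_group G" and h: "balanced M N G h" and t: "t \<in> carrier MN"
  shows "tensor_lift G h t \<in> carrier G"
proof -
  interpret G: abelian_group G by fact
  interpret I: scalar_action G "\<lambda>(k::int) x. [k] \<cdot>\<^sub>G x" by (rule G.int_action)
  obtain f where f: "t = tc f" "f \<in> carrier PR" using t unfolding tensor_carrier by blast
  show ?thesis unfolding f(1) tensor_lift_tc[OF G h f(2)]
    by (rule I.pm_ext_closed[where X = "carrier M \<times> carrier N"]) (use h f(2) in \<open>auto simp: balanced_def\<close>)
qed

lemma tensor_lift_add:
  fixes G (structure)
  assumes G: "abelian_group G" and h: "balanced M N G h" and t: "t \<in> carrier MN" "u \<in> carrier MN"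
  shows "tensor_lift G h (t \<oplus>\<^sub>MN u) = tensor_lift G h t \<oplus> tensor_lift G h u"
proof -
  interpret G: abelian_group G by fact
  interpret I: scalar_action G "\<lambda>(k::int) x. [k] \<cdot>\<^sub>G x" by (rule G.int_action)
  obtain f where f: "t = tc f" "f \<in> carrier PR" using t unfolding tensor_carrier by blast
  obtain g where g: "u = tc g" "g \<in> carrier PR" using t unfolding tensor_carrier by blast
  show ?thesis
    unfolding f(1) g(1) tensor_add[OF f(2) g(2)] tensor_lift_tc[OF G h f(2)]
      tensor_lift_tc[OF G h g(2)] tensor_lift_tc[OF G h PR_add[OF f(2) g(2)]]
    by (rule I.pm_ext_add[where X = "carrier M \<times> carrier N"])
      (use h f(2) g(2) in \<open>auto simp: balanced_def\<close>)
qed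

lemma tensor_lift_zero:
  fixes G (structure)
  assumes G: "abelian_group G" and h: "balanced M N G h"
  shows "tensor_lift G h \<zero>\<^sub>MN = \<zero>"
proof -
  interpret G: abelian_group G by fact
  show ?thesis using tensor_lift_add[OF G h MN.zero_closed MN.zero_closed]
    tensor_lift_closed[OF G h MN.zero_closed] by simp
qed

end

section \<open>The tensor product of two algebras\<close>

locale tensor_algs = M: kalg M + N: kalg N
  for M :: "('k::field, 'a) module" and N :: "('k, 'b) module"
begin

sublocale tensor_spaces M N ..

lemma PR_mult_superset:
  assumes "finite K" "finite L" "supp f \<subseteq> K" "supp g \<subseteq> L"
  shows "f \<otimes>\<^sub>PR g = (\<Sum>p\<in>K. \<Sum>q\<in>L.
       monomial (fst p \<otimes>\<^sub>M fst q, snd p \<otimes>\<^sub>N snd q)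
         (coef f p * coef g q))"
proof -
  have "f \<otimes>\<^sub>PR g = (\<Sum>p\<in>supp f. \<Sum>q\<in>L.
       monomial (fst p \<otimes>\<^sub>M fst q, snd p \<otimes>\<^sub>N snd q)
         (coef f p * coef g q))"
    unfolding pair_ring_def by (simp, intro sum.cong refl sum.mono_neutral_left)
      (use assms in \<open>auto simp: in_keys_iff\<close>)
  also have "\<dots> = (\<Sum>p\<in>K. \<Sum>q\<in>L.
       monomial (fst p \<otimes>\<^sub>M fst q, snd p \<otimes>\<^sub>N snd q)
         (coef f p * coef g q))"
    by (rule sum.mono_neutral_left) (use assms in \<open>auto simp: in_keys_iff\<close>)
  finally show ?thesis .
qed

lemma PR_l_distr: "(f + g) \<otimes>\<^sub>PR h = f \<otimes>\<^sub>PR h + g \<otimes>\<^sub>PR h"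
proof -
  let ?K = "supp f \<union> supp g" and ?L = "supp h"
  have K: "supp (f + g) \<subseteq> ?K" by (rule keys_add)
  show ?thesis
    using PR_mult_superset[of ?K ?L "f + g" h] PR_mult_superset[of ?K ?L f h]
      PR_mult_superset[of ?K ?L g h] K
    by (simp add: lookup_add distrib_right single_add sum.distrib)
qed

lemma PR_r_distr: "h \<otimes>\<^sub>PR (f + g) = h \<otimes>\<^sub>PR f + h \<otimes>\<^sub>PR g"
proof -
  let ?K = "supp f \<union> supp g" and ?L = "supp h"
  have K: "supp (f + g) \<subseteq> ?K" by (rule keys_add)
  show ?thesis
    using PR_mult_superset[of ?L ?K h "f + g"] PR_mult_superset[of ?L ?K h f]
      PR_mult_superset[of ?L ?K h g] K
    by (simp add: lookup_add distrib_left single_add sum.distrib)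
qed

lemma PR_single:
  "monomial (a, b) i \<otimes>\<^sub>PR monomial (a', b') j =
    monomial (a \<otimes>\<^sub>M a', b \<otimes>\<^sub>N b') (i * j)"
  using PR_mult_superset[of "{(a, b)}" "{(a', b')}" "monomial (a, b) i" "monomial (a', b') j"]
  by simp

lemma PR_mult_zero: "0 \<otimes>\<^sub>PR f = 0" "f \<otimes>\<^sub>PR 0 = 0"
  by (simp_all add: pair_ring_def)

lemma PR_mult_uminus: "(- f) \<otimes>\<^sub>PR g = - (f \<otimes>\<^sub>PR g)" "g \<otimes>\<^sub>PR (- f) = - (g \<otimes>\<^sub>PR f)"
  using PR_l_distr[of "- f" f g] PR_r_distr[of g "- f" f]
  by (simp_all add: PR_mult_zero eq_neg_iff_add_eq_0)

lemma PR_mult_diff: "(f - g) \<otimes>\<^sub>PR h = f \<otimes>\<^sub>PR h - g \<otimes>\<^sub>PR h" "h \<otimes>\<^sub>PR (f - g) = h \<otimes>\<^sub>PR f - h \<otimes>\<^sub>PR g"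
  using PR_l_distr[of f "- g" h] PR_r_distr[of h f "- g"] by (simp_all add: PR_mult_uminus)

lemma PR_ring: "ring PR"
proof (rule ringI)
  have keys_iff: "f \<in> carrier PR \<longleftrightarrow> supp f \<subseteq> carrier M \<times> carrier N" for f by simp
  show "abelian_group PR" by (rule pair_ring_abelian_group)
  show "monoid PR"
  proof (rule monoidI)
    fix f g assume f: "f \<in> carrier PR" and g: "g \<in> carrier PR"
    show "f \<otimes>\<^sub>PR g \<in> carrier PR"
      using f[unfolded keys_iff]
    proof (induction rule: pm_induct)
      case (single p c)
      show ?case using g[unfolded keys_iff]
      proof (induction rule: pm_induct)
        case (single q d)
        then show ?case using \<open>p \<in> _\<close> by (cases p; cases q) (simp add: PR_single)
      qed (simp_all only: PR_mult_zero PR_r_distr PR_add PR.zero_closed[simplified pair_ring_simps(2)])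
    qed (simp_all only: PR_mult_zero PR_l_distr PR_add PR.zero_closed[simplified pair_ring_simps(2)])
    fix h assume h: "h \<in> carrier PR"
    show "f \<otimes>\<^sub>PR g \<otimes>\<^sub>PR h = f \<otimes>\<^sub>PR (g \<otimes>\<^sub>PR h)"
      using f[unfolded keys_iff]
    proof (induction rule: pm_induct)
      case (single p c)
      show ?case using g[unfolded keys_iff]
      proof (induction rule: pm_induct)
        case (single q d)
        show ?case using h[unfolded keys_iff]
        proof (induction rule: pm_induct)
          case (single r e)
          then show ?case using \<open>p \<in> _\<close> \<open>q \<in> _\<close>
            by (cases p; cases q; cases r) (simp add: PR_single M.m_assoc N.m_assoc mult.assoc)
        qed (simp_all only: PR_mult_zero PR_r_distr)
      qed (simp_all only: PR_mult_zero PR_r_distr PR_l_distr)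
    qed (simp_all only: PR_mult_zero PR_l_distr)
  next
    fix f assume f: "f \<in> carrier PR"
    show "\<one>\<^sub>PR \<otimes>\<^sub>PR f = f"
      using f[unfolded keys_iff]
      by (induction rule: pm_induct) (auto simp: PR_mult_zero PR_single PR_r_distr)
    show "f \<otimes>\<^sub>PR \<one>\<^sub>PR = f"
      using f[unfolded keys_iff]
      by (induction rule: pm_induct) (auto simp: PR_mult_zero PR_single PR_l_distr)
  qed auto
qed (simp_all only: pair_ring_simps(3) PR_l_distr PR_r_distr)

lemma pair_mult: "pair a b \<otimes>\<^sub>PR pair a' b' = pair (a \<otimes>\<^sub>M a') (b \<otimes>\<^sub>N b')"
  by (simp add: PR_single)

text \<open>The balancing subgroup absorbs products because multiplying a balancing relation by a pair
  gives a balancing relation for the multiplied entries, by bilinearity of both products.\<close>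

lemma S_ideal: "ideal S PR"
proof (rule idealI[OF PR_ring S.a_subgroup])
  fix f g assume f: "f \<in> S" and g: "g \<in> carrier PR"
  have gk: "supp g \<subseteq> carrier M \<times> carrier N" using g by simp
  have smul: "x \<in> S ==> (\<Sum>i<n. x) \<in> S" for x and n :: nat
    by (induction n) (auto intro: S_add S_zero)
  have single: "monomial (a, b) k \<otimes>\<^sub>PR f \<in> S \<and> f \<otimes>\<^sub>PR monomial (a, b) k \<in> S"
    if ab: "a \<in> carrier M" "b \<in> carrier N" for a b k
  proof -
    have one: "pair a b \<otimes>\<^sub>PR f \<in> S \<and> f \<otimes>\<^sub>PR pair a b \<in> S"
      using f
    proof (induction rule: S_induct)
      case (incl f)
      then show ?case
      proof (cases rule: balancing_cases)
        case (add_l c c' d)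
        then show ?thesis using ab
          S_balance(1)[of "a \<otimes>\<^sub>M c" "a \<otimes>\<^sub>M c'" "b \<otimes>\<^sub>N d" "b \<otimes>\<^sub>N d"]
          S_balance(1)[of "c \<otimes>\<^sub>M a" "c' \<otimes>\<^sub>M a" "d \<otimes>\<^sub>N b" "d \<otimes>\<^sub>N b"]
          by (simp add: PR_mult_diff pair_mult M.l_distr M.r_distr)
      next
        case (add_r c d d')
        then show ?thesis using ab
          S_balance(2)[of "a \<otimes>\<^sub>M c" "a \<otimes>\<^sub>M c" "b \<otimes>\<^sub>N d" "b \<otimes>\<^sub>N d'"]
          S_balance(2)[of "c \<otimes>\<^sub>M a" "c \<otimes>\<^sub>M a" "d \<otimes>\<^sub>N b" "d' \<otimes>\<^sub>N b"]
          by (simp add: PR_mult_diff pair_mult N.l_distr N.r_distr)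
      next
        case (smult c d l)
        then show ?thesis using ab
          S_balance(3)[of "a \<otimes>\<^sub>M c" "a \<otimes>\<^sub>M c" "b \<otimes>\<^sub>N d" "b \<otimes>\<^sub>N d" l]
          S_balance(3)[of "c \<otimes>\<^sub>M a" "c \<otimes>\<^sub>M a" "d \<otimes>\<^sub>N b" "d \<otimes>\<^sub>N b" l]
          by (simp add: PR_mult_diff pair_mult M.smult_mult_l M.smult_mult_r N.smult_mult_l N.smult_mult_r)
      qed
    qed (auto simp: PR_mult_zero PR_l_distr PR_r_distr PR_mult_uminus S_zero intro: S_add S_uminus)
    show ?thesis
    proof (induction k rule: int_induct[of _ 0])
      case (step1 k)
      then show ?case using one by (auto simp: single_add PR_l_distr PR_r_distr intro: S_add)
    next
      case (step2 k)
      then show ?case using one by (auto simp: single_diff PR_mult_diff intro: S_diff)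
    qed (simp add: PR_mult_zero S_zero)
  qed
  show "g \<otimes>\<^sub>PR f \<in> S" using gk
    by (induction rule: pm_induct) (use single in \<open>auto simp: PR_mult_zero PR_l_distr S_zero intro: S_add\<close>)
  show "f \<otimes>\<^sub>PR g \<in> S" using gk
    by (induction rule: pm_induct) (use single in \<open>auto simp: PR_mult_zero PR_r_distr S_zero intro: S_add\<close>)
qed

sublocale SI: ideal S PR by (rule S_ideal)

lemma tensor_ring: "ring MN"
  unfolding tensor_def by (rule SI.quotient_is_ring)

sublocale MN: ring MN by (rule tensor_ring)

lemma pure_mult:
  assumes "a \<in> carrier M" "a' \<in> carrier M" "b \<in> carrier N" "b' \<in> carrier N"
  shows "pt a b \<otimes>\<^sub>MN pt a' b' = pt (a \<otimes>\<^sub>M a') (b \<otimes>\<^sub>N b')"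
proof -
  have "pt a b \<otimes>\<^sub>MN pt a' b' = rcoset_mult PR S (S +>\<^sub>PR pair a b) (S +>\<^sub>PR pair a' b')"
    by (simp add: tensor_def FactRing_def pure_tensor_def)
  also have "\<dots> = S +>\<^sub>PR (pair a b \<otimes>\<^sub>PR pair a' b')"
    by (rule SI.rcoset_mult_add) (use assms in auto)
  finally show ?thesis by (simp add: pair_mult pure_tensor_def)
qed

lemma tensor_one: "\<one>\<^sub>MN = pt \<one>\<^sub>M \<one>\<^sub>N"
  by (simp add: tensor_def FactRing_def pure_tensor_def)

end

declare One_nat_def [simp del]

section \<open>The free algebra\<close>

abbreviation wd :: "'x list => ('x, 'k::field) tens" where "wd w \<equiv> monomial w 1"

lemma mult_wd [simp]:
  "monomial u (a::'k::field) * monomial w b = monomial (u @ w) (a * b)"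
  by (simp add: mult_single plus_list_def)

lemma scal_wd [simp]: "scal c * wd w = monomial w c"
  by (simp add: scal_def)

lemma one_wd: "(1 :: ('x, 'k::field) tens) = wd []"
  by (metis single_one zero_list_def)

lemma scal_simps [simp]: "scal 0 = 0" "scal 1 = 1" "scal (- c) = - scal c"
  by (simp_all add: scal_def one_wd single_uminus)

lemma scal_add: "scal (a + b) = scal a + scal b"
  and scal_diff: "scal (a - b) = scal a - scal b"
  and scal_mult: "scal (a * b) = scal a * scal b"
  by (simp_all add: scal_def single_add single_diff)

lemma tens_induct [case_names single add]:
  fixes p :: "('x, 'k::field) tens"
  assumes "!!w c. P (monomial w c)" "!!p q. P p ==> P q ==> P (p + q)"
  shows "P p"
proof -
  have "supp p \<subseteq> UNIV" by simp
  then show ?thesis by (induction rule: pm_induct) (use assms assms(1)[of "[]" 0] in auto)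
qed

lemma scal_central: "p * scal c = scal c * p"
  by (induction p rule: tens_induct) (simp_all add: scal_def algebra_simps)

lemma scal_left_commute: "p * (scal c * q) = scal c * (p * q)"
  by (metis mult.assoc scal_central)

lemma scal_scal_commute: "scal a * (scal b * q) = scal b * (scal a * q)"
  by (rule scal_left_commute)

lemma lookup_scal [simp]: "coef (scal c * p) w = c * coef p w"
  by (induction p rule: tens_induct)
    (simp_all add: scal_def lookup_single lookup_add algebra_simps when_def)

lemma gen_wd [simp]: "gen x * monomial w c = monomial (x # w) c"
  "monomial w c * gen x = monomial (w @ [x]) c"
  by (simp_all add: gen_def)

lemma lookup_gen_mult [simp]:
  "coef (gen x * p) [] = 0"
  "coef (gen x * p) (y # w) = (if y = x then coef p w else 0)"
  by (induction p rule: tens_induct)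
    (auto simp: gen_def lookup_single lookup_add algebra_simps when_def)

lemma lookup_mult_gen [simp]:
  "coef (p * gen x) [] = 0"
  "coef (p * gen x) (w @ [y]) = (if y = x then coef p w else 0)"
  by (induction p rule: tens_induct)
    (auto simp: gen_def lookup_single lookup_add algebra_simps when_def)

definition lin :: "('x list => ('y, 'k::field) tens) => ('x, 'k) tens => ('y, 'k) tens"
  where "lin f p = (\<Sum>w\<in>supp p. scal (coef p w) * f w)"

lemma lin_superset:
  "finite K ==> supp p \<subseteq> K ==> lin f p = (\<Sum>w\<in>K. scal (coef p w) * f w)"
  unfolding lin_def by (rule sum.mono_neutral_left) (auto simp: in_keys_iff)

lemma lin_single [simp]: "lin f (monomial w c) = scal c * f w"
  by (simp add: lin_superset[of "{w}"])

lemma lin_zero [simp]: "lin f 0 = 0"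
  by (simp add: lin_def)

lemma lin_add: "lin f (p + q) = lin f p + lin f q"
proof -
  let ?K = "supp p \<union> supp q"
  have "supp (p + q) \<subseteq> ?K" by (rule keys_add)
  then show ?thesis
    by (simp add: lin_superset[of ?K] lookup_add scal_add distrib_right sum.distrib)
qed

lemma lin_uminus: "lin f (- p) = - lin f p"
  using lin_add[of f p "- p"] by (simp add: eq_neg_iff_add_eq_0 add.commute)

lemma lin_diff: "lin f (p - q) = lin f p - lin f q"
  using lin_add[of f p "- q"] by (simp add: lin_uminus)

lemma lin_scal: "lin f (scal c * p) = scal c * lin f p"
proof (induction p rule: tens_induct)
  case (single w d)
  have "scal c * monomial w d = monomial w (c * d)" by (simp add: scal_def)
  then show ?case by (simp add: scal_mult mult.assoc)
qed (simp add: lin_add distrib_left)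

lemma lin_sum: "lin f (\<Sum>i\<in>A. g i) = (\<Sum>i\<in>A. lin f (g i))"
  by (induction A rule: infinite_finite_induct) (simp_all add: lin_add)

lemma lin_wd: "lin wd p = p"
  by (induction p rule: tens_induct) (simp_all add: lin_add)

subsection \<open>Subspaces of the free algebra\<close>

lemma tens_space_zero [simp]: "0 \<in> tens_space X"
  and tens_space_add: "p \<in> tens_space X ==> q \<in> tens_space X ==> p + q \<in> tens_space X"
  and tens_space_uminus: "p \<in> tens_space X ==> - p \<in> tens_space X"
  and tens_space_single: "set w \<subseteq> X ==> monomial w c \<in> tens_space X"
  using keys_add[of p q] by (auto simp: tens_space_def dest!: subsetD)

lemma tens_space_diff: "p \<in> tens_space X ==> q \<in> tens_space X ==> p - q \<in> tens_space X"
  using tens_space_add[of p X "- q"] tens_space_uminus[of q X] by simp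

lemma tens_space_mult: "p \<in> tens_space X ==> q \<in> tens_space X ==> p * q \<in> tens_space X"
  using keys_mult[of p q] by (fastforce simp: tens_space_def plus_list_def)

lemma tens_space_scal [simp]: "scal c \<in> tens_space X"
  unfolding scal_def by (rule tens_space_single) simp

lemma tens_space_one [simp]: "1 \<in> tens_space X"
  using tens_space_scal[of 1 X] by simp

lemma tens_space_gen [simp]: "gen x \<in> tens_space X \<longleftrightarrow> x \<in> X"
  by (simp add: tens_space_def gen_def)

lemma tens_space_sum: "(!!i. i \<in> A ==> f i \<in> tens_space X) ==> (\<Sum>i\<in>A. f i) \<in> tens_space X"
  by (induction A rule: infinite_finite_induct) (auto intro: tens_space_add)

lemma tens_space_lin:
  "p \<in> tens_space X ==> (!!w. set w \<subseteq> X ==> f w \<in> tens_space Y) ==> lin f p \<in> tens_space Y"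
  unfolding lin_def tens_space_def[of X]
  by (intro tens_space_sum tens_space_mult tens_space_scal) auto

lemma tens_space_induct [consumes 1, case_names single add]:
  assumes "p \<in> tens_space X" "!!w c. set w \<subseteq> X ==> P (monomial w c)"
    "!!p q. p \<in> tens_space X ==> q \<in> tens_space X ==> P p ==> P q ==> P (p + q)"
  shows "P p"
proof -
  have "supp p \<subseteq> {w. set w \<subseteq> X}" using assms(1) by (auto simp: tens_space_def)
  then show ?thesis
  proof (induction rule: pm_induct)
    case (add f g)
    then show ?case by (intro assms(3)) (auto simp: tens_space_def)
  qed (use assms(2)[of "[]" 0] assms(2) in auto)
qed

subsection \<open>Substitution\<close>

definition evalT :: "('x => ('y, 'k::field) tens) => ('x, 'k) tens => ('y, 'k) tens"
  where "evalT f = lin (\<lambda>w. prod_list (map f w))"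

lemma evalT_simps [simp]:
  "evalT f 0 = 0" "evalT f 1 = 1" "evalT f (gen x) = f x" "evalT f (scal c) = scal c"
proof -
  show s: "evalT f (scal c) = scal c" for c
  proof -
    have "evalT f (monomial [] c) = scal c" by (simp add: evalT_def)
    then show ?thesis by (simp add: scal_def)
  qed
  show "evalT f 1 = 1" using s[of 1] by simp
qed (simp_all add: evalT_def gen_def)

lemma evalT_add: "evalT f (p + q) = evalT f p + evalT f q"
  and evalT_diff: "evalT f (p - q) = evalT f p - evalT f q"
  and evalT_uminus: "evalT f (- p) = - evalT f p"
  and evalT_sum: "evalT f (\<Sum>i\<in>A. g i) = (\<Sum>i\<in>A. evalT f (g i))"
  and evalT_scal: "evalT f (scal c * p) = scal c * evalT f p"
  by (simp_all add: evalT_def lin_add lin_diff lin_uminus lin_sum lin_scal)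

lemma evalT_mult: "evalT f (p * q) = evalT f p * evalT f q"
proof (induction p rule: tens_induct)
  case (single w c)
  show ?case
  proof (induction q rule: tens_induct)
    case (single u d)
    have "scal (c * d) * (prod_list (map f w) * prod_list (map f u)) =
        (scal c * prod_list (map f w)) * (scal d * prod_list (map f u))"
      by (simp only: scal_mult mult.assoc scal_left_commute[of "prod_list (map f w)"])
    then show ?case by (simp add: evalT_def)
  qed (simp add: distrib_left evalT_add)
qed (simp add: distrib_right evalT_add)

lemma tens_space_evalT:
  assumes "p \<in> tens_space X" "!!x. x \<in> X ==> f x \<in> tens_space Y"
  shows "evalT f p \<in> tens_space Y"
proof -
  have "set w \<subseteq> X ==> prod_list (map f w) \<in> tens_space Y" for w
    by (induction w) (auto intro: tens_space_mult assms(2))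
  then show ?thesis unfolding evalT_def by (intro tens_space_lin[OF assms(1)])
qed

text \<open>Words are built up from the left, which is the direction in which normal forms and
  derivations are computed.\<close>

lemma tens_space_gen_induct [consumes 1, case_names zero add scal one gen]:
  fixes p :: "('x, 'k::field) tens"
  assumes "p \<in> tens_space X" and "P 0"
    "!!p q. p \<in> tens_space X ==> q \<in> tens_space X ==> P p ==> P q ==> P (p + q)"
    "!!c p. p \<in> tens_space X ==> P p ==> P (scal c * p)" "P 1"
    "!!x p. x \<in> X ==> p \<in> tens_space X ==> P p ==> P (gen x * p)"
  shows "P p"
  using assms(1)
proof (induction rule: tens_space_induct)
  case (single w c)
  then have "P (wd w) \<and> (wd w :: ('x, 'k) tens) \<in> tens_space X"
  proof (induction w)
    case Nil
    then show ?case using assms(5) by (simp flip: one_wd)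
  next
    case (Cons x w)
    then have IH: "P (wd w)" "(wd w :: ('x, 'k) tens) \<in> tens_space X" "x \<in> X" by auto
    have "P (wd (x # w))" using assms(6)[OF IH(3,2,1)] by simp
    then show ?case using Cons.prems by (intro conjI tens_space_single) auto
  qed
  then have "P (scal c * wd w)" using assms(4) by blast
  then show ?case by simp
qed (use assms(3) in blast)

section \<open>Normal forms modulo the relation\<close>

locale weyl =
  fixes m :: nat and vc :: "nat => 'k::field" and l :: 'k
  assumes m: "m \<ge> 1"
begin

abbreviation X :: "nat set" where "X \<equiv> {1..2 * m}"

definition pa :: "nat => nat" where "pa j = (if j \<le> m then j + m else j - m)"
definition sg :: "nat => 'k" where "sg j = (if j \<le> m then 1 else - 1)"

lemma pa: "j \<in> X ==> pa j \<in> X" "j \<in> X ==> pa (pa j) = j" "j \<in> X ==> sg (pa j) = - sg j"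
  "sg j * sg j = 1" "pa 1 = m + 1" "pa (m + 1) = 1" "j \<in> X ==> pa j \<noteq> j" "pa (Suc 0) = Suc m"
  "pa (Suc m) = Suc 0"
  using m by (auto simp: pa_def sg_def)

lemma pa_eq_iff: "j \<in> X ==> i \<in> X ==> pa j = i \<longleftrightarrow> j = pa i"
  using pa by metis

lemma bij_pa: "bij_betw pa X X"
  by (rule bij_betwI[of _ _ _ pa]) (use pa in auto)

lemma one_X: "1 \<in> X" "Suc 0 \<in> X" "Suc m \<in> X" "m + 1 \<in> X" using m by auto

definition vec :: "(nat, 'k) tens" where "vec = (\<Sum>j\<in>X. scal (vc j) * gen j)"

definition rel0 :: "(nat, 'k) tens" where "rel0 = (\<Sum>j\<in>X. scal (sg j) * (gen j * gen (pa j)))"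

definition rel :: "(nat, 'k) tens" where "rel = rel0 - vec - scal l"

lemma vec_in: "vec \<in> tens_space X" and rel0_in: "rel0 \<in> tens_space X" and rel_in: "rel \<in> tens_space X"
proof -
  show v: "vec \<in> tens_space X"
    unfolding vec_def by (intro tens_space_sum tens_space_mult) auto
  show r: "rel0 \<in> tens_space X"
    unfolding rel0_def by (intro tens_space_sum tens_space_mult) (use pa in auto)
  show "rel \<in> tens_space X" unfolding rel_def by (intro tens_space_diff v r) simp
qed

lemma rel0_alt: "rel0 = (\<Sum>i\<in>{1..m}. gen i * gen (i + m) - gen (i + m) * gen i)"
proof -
  have "X = {1..m} \<union> (\<lambda>i. i + m) ` {1..m}" "{1..m} \<inter> (\<lambda>i. i + m) ` {1..m} = {}"
    unfolding image_add_atLeastAtMost' by auto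
  then have "rel0 = (\<Sum>j\<in>{1..m}. scal (sg j) * (gen j * gen (pa j))) +
      (\<Sum>j\<in>(\<lambda>i. i + m) ` {1..m}. scal (sg j) * (gen j * gen (pa j)))"
    unfolding rel0_def by (simp add: sum.union_disjoint)
  also have "(\<Sum>j\<in>(\<lambda>i. i + m) ` {1..m}. scal (sg j) * (gen j * gen (pa j)) :: (nat, 'k) tens) =
      (\<Sum>i\<in>{1..m}. - (gen (i + m) * gen i))"
    by (subst sum.reindex) (auto simp: inj_on_def sg_def pa_def intro!: sum.cong)
  also have "(\<Sum>j\<in>{1..m}. scal (sg j) * (gen j * gen (pa j)) :: (nat, 'k) tens) = (\<Sum>i\<in>{1..m}. gen i * gen (i + m))"
    by (rule sum.cong) (auto simp: sg_def pa_def)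
  finally show ?thesis by (simp add: sum_subtractf sum_negf)
qed

text \<open>The action of the first generator on words, forced by the relation.\<close>

primrec A1 :: "nat list => (nat, 'k) tens" where
  "A1 [] = wd [1]"
| "A1 (a # w) = (if a = m + 1 then
      (\<Sum>j\<in>X. scal (vc j) * (if j = 1 then A1 w else wd (j # w))) + scal l * wd w +
      gen (m + 1) * A1 w - (\<Sum>j\<in>X - {1, m + 1}. scal (sg j) * wd (j # pa j # w))
    else wd (1 # a # w))"

definition act :: "nat => (nat, 'k) tens => (nat, 'k) tens"
  where "act j p = (if j = 1 then lin A1 p else gen j * p)"

lemma act_add: "act j (p + q) = act j p + act j q"
  and act_scal: "act j (scal c * p) = scal c * act j p"
  and act_zero [simp]: "act j 0 = 0"
  by (simp_all add: act_def lin_add lin_scal distrib_left scal_left_commute)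

text \<open>The image of \<open>(m + 1) # w\<close> under the action of the first generator is defined by solving
  this identity on the word \<open>w\<close>; so the operators satisfy the relation and the free algebra acts
  through the quotient.\<close>

lemma act_relation:
  "(\<Sum>j\<in>X. scal (sg j) * act j (act (pa j) p)) = (\<Sum>j\<in>X. scal (vc j) * act j p) + scal l * p"
proof (induction p rule: tens_induct)
  case (single w c)
  have "(\<Sum>j\<in>X. scal (sg j) * act j (act (pa j) (wd w))) = (\<Sum>j\<in>X. scal (vc j) * act j (wd w)) + scal l * wd w"
  proof -
    let ?f = "\<lambda>j. scal (sg j) * act j (act (pa j) (wd w))"
    have X: "X = insert 1 (insert (m + 1) (X - {1, m + 1}))" using m by auto
    have "sum ?f X = ?f 1 + (?f (m + 1) + sum ?f (X - {1, m + 1}))"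
      by (subst X, subst sum.insert, use m in auto)
    also have "?f 1 = A1 ((m + 1) # w)"
      using m by (simp add: act_def pa sg_def del: A1.simps)
    also have "?f (m + 1) = - (gen (m + 1) * A1 w)"
      using m by (simp add: act_def pa sg_def del: A1.simps)
    also have "sum ?f (X - {1, m + 1}) = (\<Sum>j\<in>X - {1, m + 1}. scal (sg j) * wd (j # pa j # w))"
    proof (rule sum.cong[OF refl])
      fix j assume j: "j \<in> X - {1, m + 1}"
      then have "pa j \<noteq> 1" using pa_eq_iff[of j 1] one_X pa by auto
      then show "?f j = scal (sg j) * wd (j # pa j # w)" using j by (simp add: act_def)
    qed
    also have "A1 ((m + 1) # w) + (- (gen (m + 1) * A1 w) +
        (\<Sum>j\<in>X - {1, m + 1}. scal (sg j) * wd (j # pa j # w))) =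
      (\<Sum>j\<in>X. scal (vc j) * (if j = 1 then A1 w else wd (j # w))) + scal l * wd w"
      by simp
    also have "(\<Sum>j\<in>X. scal (vc j) * (if j = 1 then A1 w else wd (j # w))) = (\<Sum>j\<in>X. scal (vc j) * act j (wd w))"
      by (rule sum.cong) (auto simp: act_def)
    finally show ?thesis .
  qed
  then have "scal c * (\<Sum>j\<in>X. scal (sg j) * act j (act (pa j) (wd w))) =
      scal c * ((\<Sum>j\<in>X. scal (vc j) * act j (wd w)) + scal l * wd w)" by simp
  then show ?case
    unfolding scal_wd[of c w, symmetric] act_scal sum_distrib_left distrib_left
    by (simp only: scal_left_commute[of "scal _" c])
next
  case (add p q)
  then show ?case by (simp add: act_add distrib_left sum.distrib algebra_simps)
qed

definition actp :: "(nat, 'k) tens => (nat, 'k) tens => (nat, 'k) tens"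
  where "actp p q = lin (\<lambda>w. foldr act w q) p"

definition N :: "(nat, 'k) tens => (nat, 'k) tens" where "N p = actp p 1"

lemma foldr_act_add: "foldr act w (p + q) = foldr act w p + foldr act w q"
  and foldr_act_scal: "foldr act w (scal c * p) = scal c * foldr act w p"
  and foldr_act_zero [simp]: "foldr act w 0 = 0"
  by (induction w) (simp_all add: act_add act_scal)

lemma actp_add_r: "actp p (q + q') = actp p q + actp p q'"
  and actp_scal_r: "actp p (scal c * q) = scal c * actp p q"
  and actp_zero_r [simp]: "actp p 0 = 0"
  by (induction p rule: tens_induct)
    (simp_all add: actp_def lin_add foldr_act_add foldr_act_scal distrib_left distrib_right
      add_ac scal_scal_commute)

lemma actp_add: "actp (p + p') q = actp p q + actp p' q"
  and actp_diff: "actp (p - p') q = actp p q - actp p' q"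
  and actp_scal: "actp (scal c * p) q = scal c * actp p q"
  and actp_sum: "actp (\<Sum>i\<in>A. g i) q = (\<Sum>i\<in>A. actp (g i) q)"
  and actp_zero [simp]: "actp 0 q = 0"
  by (simp_all add: actp_def lin_add lin_diff lin_scal lin_sum)

lemma actp_mult: "actp (p * p') q = actp p (actp p' q)"
proof (induction p rule: tens_induct)
  case (single w c)
  show ?case
  proof (induction p' rule: tens_induct)
    case (single u d)
    then show ?case
      by (simp add: actp_def scal_mult mult.assoc foldr_act_scal)
  qed (simp add: distrib_left actp_add actp_add_r)
qed (simp add: distrib_right actp_add)

lemma actp_gen: "actp (gen j) q = act j q"
  by (simp add: actp_def gen_def)

lemma actp_scal_one: "actp (scal c) q = scal c * q"
proof -
  have "actp (monomial [] c) q = scal c * q" by (simp add: actp_def)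
  then show ?thesis by (simp add: scal_def)
qed

lemma actp_one: "actp 1 q = q"
  using actp_scal_one[of 1] by simp

lemma actp_rel: "actp rel q = 0"
  by (simp add: rel_def rel0_def vec_def actp_diff actp_sum actp_scal actp_mult actp_gen
      actp_scal_one act_relation)

lemma N_add: "N (p + q) = N p + N q" and N_diff: "N (p - q) = N p - N q"
  and N_scal: "N (scal c * p) = scal c * N p" and N_zero [simp]: "N 0 = 0" and N_one [simp]: "N 1 = 1"
  by (simp_all add: N_def actp_add actp_diff actp_scal actp_one)

lemma N_mult: "N (p * q) = actp p (N q)"
  by (simp add: N_def actp_mult)

lemma N_rel: "N (p * rel * q) = 0"
  by (simp add: N_mult actp_mult actp_rel)

lemma A1_in: "set w \<subseteq> X ==> A1 w \<in> tens_space X"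
proof (induction w)
  case Nil
  then show ?case using m by (simp add: tens_space_single)
next
  case (Cons a w)
  have "(\<Sum>j\<in>X. scal (vc j) * (if j = 1 then A1 w else wd (j # w))) \<in> tens_space X"
    using Cons by (intro tens_space_sum tens_space_mult) (auto intro!: tens_space_single)
  moreover have "(\<Sum>j\<in>X - {1, m + 1}. scal (sg j) * wd (j # pa j # w)) \<in> tens_space X"
    using Cons pa(1) by (intro tens_space_sum tens_space_mult tens_space_scal tens_space_single) simp
  moreover have "scal l * wd w \<in> tens_space X"
    using Cons by (intro tens_space_mult) (auto intro!: tens_space_single)
  moreover have "gen (m + 1) * A1 w \<in> tens_space X"
    using Cons m by (intro tens_space_mult) auto
  moreover have "(wd (1 # a # w) :: (nat, 'k) tens) \<in> tens_space X"
    using Cons m by (intro tens_space_single) auto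
  ultimately show ?case by (simp add: tens_space_add tens_space_diff)
qed

lemma act_in: "j \<in> X ==> p \<in> tens_space X ==> act j p \<in> tens_space X"
  by (simp add: act_def tens_space_lin A1_in tens_space_mult)

lemma N_in: "p \<in> tens_space X ==> N p \<in> tens_space X"
proof -
  have "set w \<subseteq> X ==> foldr act w 1 \<in> tens_space X" for w
    by (induction w) (simp_all add: act_in)
  then show "p \<in> tens_space X ==> N p \<in> tens_space X"
    unfolding N_def actp_def by (intro tens_space_lin)
qed

text \<open>Stated for any set closed under sums and left multiples that contains the right multiples of
  the relator, as the ideal is not yet available. The first generator is the only one whose action
  differs from the product, and there the difference is a combination of such elements by
  induction on the word.\<close>

lemma N_congr:
  assumes zero: "0 \<in> J" and add: "!!p q. p \<in> J ==> q \<in> J ==> p + q \<in> J"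
    and left: "!!p q. p \<in> tens_space X ==> q \<in> J ==> p * q \<in> J"
    and rl: "!!q. q \<in> tens_space X ==> rel * q \<in> J"
    and p: "p \<in> tens_space X"
  shows "p - N p \<in> J"
proof -
  have w: "set w \<subseteq> X ==> wd (1 # w) - A1 w \<in> J" for w
  proof (induction w)
    case (Cons a w)
    show ?case
    proof (cases "a = m + 1")
      case True
      have X: "X = insert 1 (insert (m + 1) (X - {1, m + 1}))" using m by auto
      let ?f = "\<lambda>j. scal (sg j) * wd (j # pa j # w)"
      have "rel * wd w = sum ?f X - (\<Sum>j\<in>X. scal (vc j) * wd (j # w)) - scal l * wd w"
        by (simp add: rel_def rel0_def vec_def left_diff_distrib sum_distrib_right mult.assoc)
      also have "sum ?f X = ?f 1 + (?f (m + 1) + sum ?f (X - {1, m + 1}))"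
        by (subst X, subst sum.insert, use m in auto)
      also have "?f 1 = wd (1 # (m + 1) # w)" using m by (simp add: pa sg_def)
      also have "?f (m + 1) = - wd ((m + 1) # 1 # w)" using m by (simp add: pa sg_def single_uminus)
      finally have 1: "wd (1 # (m + 1) # w) = rel * wd w + (\<Sum>j\<in>X. scal (vc j) * wd (j # w)) +
          scal l * wd w + wd ((m + 1) # 1 # w) - sum ?f (X - {1, m + 1})"
        by (simp add: algebra_simps)
      have 2: "(\<Sum>j\<in>X. scal (vc j) * wd (j # w)) - (\<Sum>j\<in>X. scal (vc j) * (if j = 1 then A1 w else wd (j # w))) =
          scal (vc 1) * (wd (1 # w) - A1 w)"
      proof -
        have "(\<Sum>j\<in>X. scal (vc j) * wd (j # w)) - (\<Sum>j\<in>X. scal (vc j) * (if j = 1 then A1 w else wd (j # w))) =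
          (\<Sum>j\<in>X. if j = 1 then scal (vc 1) * (wd (1 # w) - A1 w) else 0)"
          unfolding sum_subtractf[symmetric] by (rule sum.cong) (auto simp: right_diff_distrib)
        then show ?thesis using m by (simp add: sum.delta)
      qed
      have 3: "wd (1 # (m + 1) # w) - A1 ((m + 1) # w) =
          rel * wd w + scal (vc 1) * (wd (1 # w) - A1 w) + gen (m + 1) * (wd (1 # w) - A1 w)"
        unfolding 1 2[symmetric] by (simp add: right_diff_distrib)
      have "wd (1 # w) - A1 w \<in> J" using Cons by auto
      then show ?thesis unfolding True 3
        using Cons.prems m by (intro add rl left) (auto intro: tens_space_single)
    qed (simp add: zero)
  qed (simp add: zero)
  have act: "gen j * q - act j q \<in> J" if j: "j \<in> X" and q: "q \<in> tens_space X" for j q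
  proof (cases "j = 1")
    case True
    have "gen 1 * q - lin A1 q \<in> J" using q
    proof (induction rule: tens_space_induct)
      case (single u c)
      have "scal c * (wd (1 # u) - A1 u) \<in> J" using w[OF single] by (intro left) auto
      moreover have "gen 1 * monomial u c = scal c * wd (1 # u)" by (simp add: gen_def)
      ultimately show ?case by (simp only: right_diff_distrib lin_single)
    next
      case (add p q)
      have eq: "gen 1 * (p + q) - lin A1 (p + q) = (gen 1 * p - lin A1 p) + (gen 1 * q - lin A1 q)"
        by (simp add: lin_add distrib_left)
      show ?case unfolding eq using add by (intro assms(2))
    qed
    then show ?thesis using True by (simp add: act_def)
  qed (simp add: act_def zero)
  show ?thesis using p
  proof (induction rule: tens_space_gen_induct)
    case (add p q)
    have eq: "(p + q) - N (p + q) = (p - N p) + (q - N q)" by (simp add: N_add)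
    show ?case unfolding eq using add by (intro assms(2))
  next
    case (scal c p)
    have "scal c * p - N (scal c * p) = scal c * (p - N p)" by (simp add: N_scal right_diff_distrib)
    then show ?case using scal left by simp
  next
    case (gen x p)
    have "gen x * p - N (gen x * p) = gen x * (p - N p) + (gen x * N p - act x (N p))"
      by (simp add: N_mult actp_gen right_diff_distrib)
    then show ?case using gen by (auto intro!: assms(2) left act N_in)
  qed (simp_all add: zero)
qed

text \<open>Right multiplication by the first generator commutes with passing to normal forms.\<close>

lemma A1_snoc: "A1 (w @ [1]) = A1 w * gen 1"
proof (induction w)
  case Nil
  then show ?case using m by (simp add: gen_def)
next
  case (Cons a w)
  have "(\<Sum>j\<in>X. scal (vc j) * (if j = 1 then A1 w else wd (j # w))) * gen 1 =
      (\<Sum>j\<in>X. scal (vc j) * (if j = 1 then A1 (w @ [1]) else wd (j # w @ [1])))"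
    unfolding Cons sum_distrib_right by (rule sum.cong) (auto simp: mult.assoc)
  then show ?case
    using Cons
    by (simp add: distrib_right left_diff_distrib mult.assoc sum_distrib_right)
qed

lemma act_gen1: "act j (q * gen 1) = act j q * gen 1"
proof (cases "j = 1")
  case True
  have "lin A1 (q * gen 1) = lin A1 q * gen 1"
    by (induction q rule: tens_induct)
      (simp_all add: gen_def lin_add distrib_right A1_snoc mult.assoc)
  then show ?thesis using True by (simp add: act_def)
qed (simp add: act_def mult.assoc)

lemma N_mult_gen1: "N (p * gen 1) = N p * gen 1"
proof (induction p rule: tens_induct)
  case (single w c)
  have "foldr act w (gen 1) = foldr act w 1 * gen 1"
    by (induction w) (simp_all add: act_gen1)
  moreover have "N (gen 1) = gen 1" by (simp add: N_def actp_gen) (simp add: act_def one_wd gen_def)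
  then have "N (monomial w c * gen 1) = actp (monomial w c) (gen 1)"
    by (simp only: N_mult)
  ultimately have "N (monomial w c * gen 1) = scal c * (foldr act w 1 * gen 1)"
    by (simp add: actp_def)
  moreover have "N (monomial w c) = scal c * foldr act w 1" by (simp add: N_def actp_def)
  ultimately show ?case by (simp only: mult.assoc)
qed (simp add: distrib_right N_add)

end

section \<open>Quotients of the free algebra\<close>

lemma tscale_scal: "tscale c p = scal c * p"
  by (simp add: tscale_def)

lemma tens_alg_simps [simp]:
  "carrier (tens_alg X) = tens_space X" "mult (tens_alg X) = (*)" "one (tens_alg X) = 1"
  "zero (tens_alg X) = 0" "add (tens_alg X) = (+)" "smult (tens_alg X) = tscale"
  by (simp_all add: tens_alg_def)

lemma tens_alg_abelian_group: "abelian_group (tens_alg X)"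
proof (rule abelian_groupI)
  fix p assume "p \<in> carrier (tens_alg X)"
  then show "\<exists>q\<in>carrier (tens_alg X). q \<oplus>\<^sub>(tens_alg X) p = \<zero>\<^sub>(tens_alg X)"
    by (intro bexI[of _ "- p"]) (auto intro: tens_space_uminus)
qed (auto simp: add_ac intro: tens_space_add)

lemma tens_alg_ring: "ring (tens_alg X)"
  by (rule ringI[OF tens_alg_abelian_group])
    (auto simp: mult.assoc distrib_left distrib_right intro!: monoidI tens_space_mult)

lemma tens_alg_minus:
  assumes "q \<in> tens_space X" shows "p \<ominus>\<^sub>(tens_alg X) q = p - q"
proof -
  interpret ring "tens_alg X" by (rule tens_alg_ring)
  have "\<ominus>\<^sub>(tens_alg X) q = - q"
    by (rule minus_equality) (use assms in \<open>auto intro: tens_space_uminus\<close>)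
  then show ?thesis by (simp add: a_minus_def)
qed

locale tens_quot =
  fixes X :: "'x set" and P :: "('x, 'k::field) tens set"
  assumes P: "P \<subseteq> tens_space X"
begin

abbreviation "I \<equiv> tens_ideal X P"
abbreviation "cls \<equiv> tens_class X P"
abbreviation "A \<equiv> quot_alg X P"

lemma I_ideal: "ideal I (tens_alg X)"
  unfolding tens_ideal_def by (rule ring.genideal_ideal[OF tens_alg_ring]) (use P in simp)

sublocale I: ideal I "tens_alg X" by (rule I_ideal)

lemma P_I: "P \<subseteq> I"
  unfolding tens_ideal_def using ring.genideal_self[OF tens_alg_ring, of P X] P by simp

lemma I_in: "p \<in> I ==> p \<in> tens_space X" using I.a_Hcarr[of p] by simp
lemma I_zero [simp]: "0 \<in> I" using additive_subgroup.zero_closed[OF I.is_additive_subgroup] by simp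
lemma I_add: "p \<in> I ==> q \<in> I ==> p + q \<in> I" using additive_subgroup.a_closed[OF I.is_additive_subgroup, of p q] by simp
lemma I_left: "q \<in> I ==> p \<in> tens_space X ==> p * q \<in> I" using I.I_l_closed[of q p] by simp
lemma I_right: "q \<in> I ==> p \<in> tens_space X ==> q * p \<in> I" using I.I_r_closed[of q p] by simp
lemma I_uminus: "p \<in> I ==> - p \<in> I" using I_left[OF _ tens_space_scal, of p "- 1"] by simp
lemma I_diff: "p \<in> I ==> q \<in> I ==> p - q \<in> I" using I_add[OF _ I_uminus, of p q] by simp

text \<open>Induction over the ideal generated by \<open>P\<close>, without a description of its elements as sums of
  products.\<close>

lemma I_subset:
  assumes "J \<subseteq> tens_space X" "P \<subseteq> J" "0 \<in> J" "!!p q. p \<in> J ==> q \<in> J ==> p + q \<in> J"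
    "!!p q. p \<in> tens_space X ==> q \<in> J ==> p * q \<in> J" "!!p q. p \<in> tens_space X ==> q \<in> J ==> q * p \<in> J"
  shows "I \<subseteq> J"
  unfolding tens_ideal_def
proof (rule ring.genideal_minimal[OF tens_alg_ring])
  interpret ring "tens_alg X" by (rule tens_alg_ring)
  have neg: "- p \<in> J" if "p \<in> J" for p using assms(5)[OF tens_space_scal that, of "- 1"] by simp
  have a_inv: "\<ominus>\<^sub>(tens_alg X) p = - p" if "p \<in> J" for p
    by (rule minus_equality) (use assms(1) that in \<open>auto intro: tens_space_uminus\<close>)
  show "ideal J (tens_alg X)"
  proof (rule idealI[OF tens_alg_ring])
    show "subgroup J (add_monoid (tens_alg X))"
    proof (rule group.subgroupI[OF a_group])
      fix p assume p: "p \<in> J"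
      show "inv\<^sub>(add_monoid (tens_alg X)) p \<in> J"
        using neg[OF p] a_inv[OF p] by (simp add: a_inv_def)
    qed (use assms in auto)
  qed (use assms in auto)
qed (use assms in simp)

lemma cls_def: "cls p = I +>\<^sub>(tens_alg X) p" by (simp add: tens_class_def)

lemma cls_eq_iff: "p \<in> tens_space X ==> q \<in> tens_space X ==> cls p = cls q \<longleftrightarrow> p - q \<in> I"
  unfolding cls_def by (subst I.coset_eq_iff) (simp_all add: tens_alg_minus)

lemma cls_mem_iff: "p \<in> tens_space X ==> q \<in> cls p \<longleftrightarrow> q \<in> tens_space X \<and> q - p \<in> I"
proof -
  assume p: "p \<in> tens_space X"
  show ?thesis
  proof
    assume q: "q \<in> cls p"
    then have "q \<in> tens_space X" using I.a_elemrcos_carrier[of p q] p by (simp add: cls_def)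
    moreover have "q - p \<in> I"
      using I.a_rcos_module_imp[of p q] q p tens_alg_minus[OF p, of q] by (simp add: cls_def a_minus_def)
    ultimately show "q \<in> tens_space X \<and> q - p \<in> I" ..
  next
    assume q: "q \<in> tens_space X \<and> q - p \<in> I"
    then show "q \<in> cls p"
      using I.a_rcos_module_rev[of p q] p tens_alg_minus[OF p, of q] by (simp add: cls_def a_minus_def)
  qed
qed

lemma A_simps:
  "carrier A = cls ` tens_space X" "zero A = cls 0" "one A = cls 1"
proof -
  show "carrier A = cls ` tens_space X"
    by (auto simp: quot_alg_def FactRing_def A_RCOSETS_def' a_r_coset_def' cls_def Let_def)
  show "zero A = cls 0"
    using I.a_rcos_const[of 0] by (simp add: quot_alg_def FactRing_def Let_def cls_def)
  show "one A = cls 1"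
    by (simp add: quot_alg_def FactRing_def Let_def cls_def)
qed

lemma cls_closed [simp, intro]: "p \<in> tens_space X ==> cls p \<in> carrier A"
  by (simp add: A_simps)

lemma A_obtain:
  assumes "a \<in> carrier A" obtains p where "p \<in> tens_space X" "a = cls p"
  using assms unfolding A_simps by blast

lemma cls_add: "p \<in> tens_space X ==> q \<in> tens_space X ==> cls p \<oplus>\<^sub>A cls q = cls (p + q)"
  using I.a_rcos_sum[of p q] by (simp add: quot_alg_def FactRing_def Let_def cls_def)

lemma cls_mult: "p \<in> tens_space X ==> q \<in> tens_space X ==> cls p \<otimes>\<^sub>A cls q = cls (p * q)"
  using I.rcoset_mult_add[of p q] by (simp add: quot_alg_def FactRing_def Let_def cls_def)

lemma cls_smult:
  assumes p: "p \<in> tens_space X" shows "c \<odot>\<^sub>A cls p = cls (scal c * p)"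
proof -
  have in_X: "scal c * q \<in> tens_space X" if "q \<in> tens_space X" for q
    using that by (intro tens_space_mult) auto
  have eq: "cls (tscale c q) = cls (scal c * p)" if "q \<in> cls p" for q
  proof -
    have q: "q \<in> tens_space X" "q - p \<in> I" using that cls_mem_iff[OF p] by auto
    have "scal c * (q - p) \<in> I" by (rule I_left[OF q(2)]) simp
    then show ?thesis using in_X[OF q(1)] in_X[OF p]
      by (simp add: tscale_scal cls_eq_iff right_diff_distrib)
  qed
  have "p \<in> cls p" using cls_mem_iff[OF p] p by simp
  have "(\<Union>q\<in>cls p. cls (tscale c q)) = cls (scal c * p)"
  proof (rule equalityI)
    show "(\<Union>q\<in>cls p. cls (tscale c q)) \<subseteq> cls (scal c * p)"
      by (rule UN_least) (simp only: eq order.refl)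
    show "cls (scal c * p) \<subseteq> (\<Union>q\<in>cls p. cls (tscale c q))"
      using UN_upper[OF \<open>p \<in> cls p\<close>, of "\<lambda>q. cls (tscale c q)"] eq[OF \<open>p \<in> cls p\<close>] by (simp only:)
  qed
  then show ?thesis by (simp add: quot_alg_def Let_def)
qed

lemma A_ring: "ring A"
proof -
  have Q: "ring (tens_alg X Quot I)" by (rule I.quotient_is_ring)
  interpret Q: ring "tens_alg X Quot I" by (rule Q)
  have simps: "carrier A = carrier (tens_alg X Quot I)" "mult A = mult (tens_alg X Quot I)"
    "one A = one (tens_alg X Quot I)" "zero A = zero (tens_alg X Quot I)"
    "add A = add (tens_alg X Quot I)"
    by (simp_all add: quot_alg_def Let_def)
  show ?thesis
    by (rule ringI[OF abelian_group_cong[OF Q.abelian_group_axioms]])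
      (auto simp: simps Q.m_assoc Q.l_distr Q.r_distr intro!: monoidI)
qed

lemma A_kalg: "kalg A"
proof -
  interpret ring A by (rule A_ring)
  have sc: "scal c * p \<in> tens_space X" if "p \<in> tens_space X" for c p
    using that by (intro tens_space_mult) auto
  note [simp] = cls_add cls_mult cls_smult sc tens_space_add tens_space_mult
  show ?thesis
  proof (unfold_locales, goal_cases)
    case (7 x z c)
    then show ?case by (elim A_obtain) (simp, rule arg_cong[of _ _ cls], rule scal_left_commute)
  qed (erule A_obtain, (erule A_obtain)?, simp add: scal_add distrib_right distrib_left scal_mult mult.assoc)+
qed

sublocale A: kalg A by (rule A_kalg)

lemma cls_uminus: "p \<in> tens_space X ==> \<ominus>\<^sub>A cls p = cls (- p)"
  by (rule A.minus_equality) (simp_all only: cls_add cls_closed tens_space_uminus A_simps(2) left_minus)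

lemma cls_minus: "p \<in> tens_space X ==> q \<in> tens_space X ==> cls p \<ominus>\<^sub>A cls q = cls (p - q)"
  by (simp add: a_minus_def cls_uminus cls_add tens_space_uminus)

lemma cls_zero_iff: "p \<in> tens_space X ==> cls p = \<zero>\<^sub>A \<longleftrightarrow> p \<in> I"
  unfolding A_simps using cls_eq_iff[of p 0] by simp

lemma cls_sum: "(!!i. i \<in> K ==> f i \<in> tens_space X) ==> cls (\<Sum>i\<in>K. f i) = (\<Oplus>\<^sub>A i\<in>K. cls (f i))"
proof (induction K rule: infinite_finite_induct)
  case (insert i K)
  then have "f i \<in> tens_space X" "(\<Sum>i\<in>K. f i) \<in> tens_space X" "(\<lambda>i. cls (f i)) \<in> K \<rightarrow> carrier A"
    by (auto intro!: tens_space_sum)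
  then show ?case using insert by (simp add: cls_add[symmetric])
qed (simp_all add: A_simps(2))

end

context weyl
begin

abbreviation "Prel \<equiv> tspan {rel}"

lemma P_range: "Prel = range (\<lambda>c. scal c * rel)"
  by (simp add: tens.span_singleton tscale_scal)

sublocale tens_quot X Prel
  by unfold_locales (auto simp: P_range intro!: tens_space_mult rel_in)

abbreviation "U \<equiv> A"

lemma rel_I: "rel \<in> I"
  using P_I unfolding P_range by (metis (no_types, lifting) mult_1 range_eqI scal_simps(2) subsetD)

lemma I_subset_rel:
  assumes "J \<subseteq> tens_space X" "rel \<in> J" "0 \<in> J" "!!p q. p \<in> J ==> q \<in> J ==> p + q \<in> J"
    "!!p q. p \<in> tens_space X ==> q \<in> J ==> p * q \<in> J" "!!p q. p \<in> tens_space X ==> q \<in> J ==> q * p \<in> J"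
  shows "I \<subseteq> J"
  by (rule I_subset) (use assms in \<open>auto simp: P_range\<close>)

lemma N_I: "p \<in> I ==> N p = 0"
proof -
  have sub: "I \<subseteq> {p \<in> tens_space X. \<forall>p'\<in>tens_space X. \<forall>q\<in>tens_space X. N (p' * p * q) = 0}"
  proof (rule I_subset_rel, goal_cases)
    case (5 p q)
    then show ?case by (auto simp: mult.assoc[symmetric] intro: tens_space_mult)
  next
    case (6 p q)
    then show ?case by (auto simp: mult.assoc intro: tens_space_mult)
  qed (auto simp: N_rel rel_in distrib_left distrib_right N_add intro: tens_space_add)
  show "N p = 0" if "p \<in> I" 
  proof -
    have "\<forall>p'\<in>tens_space X. \<forall>q\<in>tens_space X. N (p' * p * q) = 0" using that sub by blast
    from this[rule_format, OF tens_space_one tens_space_one] show ?thesis by simp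
  qed
qed

lemma diff_N_I: "p \<in> tens_space X ==> p - N p \<in> I"
  by (rule N_congr[OF I_zero I_add I_left I_right[OF rel_I]])

text \<open>Normal forms decide membership in the ideal: the action kills the relator, and every element
  is congruent to its normal form.\<close>

lemma I_iff_N: "p \<in> tens_space X ==> p \<in> I \<longleftrightarrow> N p = 0"
  using N_I diff_N_I[of p] by auto

lemma cls_eq_N: "p \<in> tens_space X ==> q \<in> tens_space X ==> cls p = cls q \<longleftrightarrow> N p = N q"
  by (simp add: cls_eq_iff I_iff_N tens_space_diff N_diff)

lemma cls_N: "p \<in> tens_space X ==> cls (N p) = cls p"
  using cls_eq_iff[of "N p" p] N_in[of p] I_uminus[OF diff_N_I[of p]] by simp

lemma U_nontrivial: "\<one>\<^sub>U \<noteq> \<zero>\<^sub>U"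
  unfolding A_simps using cls_eq_N[of 1 0] by simp

end

section \<open>The Koszul complex of the graded algebra\<close>

lemma lookup_one_Nil [simp]: "coef (1 :: ('x, 'k::field) tens) w = (if w = [] then 1 else 0)"
  by (simp add: one_wd lookup_single when_def)

definition lstrip :: "'x => ('x, 'k::field) tens => ('x, 'k) tens"
  where "lstrip x = lin (\<lambda>w. if w \<noteq> [] \<and> hd w = x then wd (tl w) else 0)"

definition rstrip :: "'x => ('x, 'k::field) tens => ('x, 'k) tens"
  where "rstrip x = lin (\<lambda>w. if w \<noteq> [] \<and> last w = x then wd (butlast w) else 0)"

lemma lstrip_linear:
  "lstrip x 0 = 0" "lstrip x (p + q) = lstrip x p + lstrip x q" "lstrip x (p - q) = lstrip x p - lstrip x q"
  "lstrip x (scal c * p) = scal c * lstrip x p" "lstrip x (\<Sum>i\<in>K. f i) = (\<Sum>i\<in>K. lstrip x (f i))"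
  by (simp_all add: lstrip_def lin_add lin_diff lin_scal lin_sum)

lemma rstrip_linear:
  "rstrip x 0 = 0" "rstrip x (p + q) = rstrip x p + rstrip x q" "rstrip x (p - q) = rstrip x p - rstrip x q"
  "rstrip x (scal c * p) = scal c * rstrip x p" "rstrip x (\<Sum>i\<in>K. f i) = (\<Sum>i\<in>K. rstrip x (f i))"
  by (simp_all add: rstrip_def lin_add lin_diff lin_scal lin_sum)

lemma lookup_lstrip: "coef (lstrip x p) w = coef p (x # w)"
proof (induction p rule: tens_induct)
  case (single u c)
  show ?case by (cases u) (auto simp: lstrip_def lookup_single when_def)
qed (simp add: lstrip_linear lookup_add)

lemma lstrip_gen_mult [simp]: "lstrip x (gen y * p) = (if y = x then p else 0)"
  by (rule poly_mapping_eqI) (simp add: lookup_lstrip)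

lemma rstrip_mult_gen [simp]: "rstrip x (p * gen y) = (if y = x then p else 0)"
  by (induction p rule: tens_induct) (auto simp: rstrip_def lin_add distrib_right)

lemma rstrip_mult:
  "rstrip x (p * q) = p * rstrip x q + scal (coef q []) * rstrip x p"
proof (induction p rule: tens_induct)
  case (single w c)
  show ?case
  proof (induction q rule: tens_induct)
    case (single u d)
    have c: "scal (c * d) * (wd v :: ('a, 'b) tens) = monomial v (c * d)" for v by simp
    show ?case
    proof (cases "u = []")
      case True
      then show ?thesis by (simp add: rstrip_def lookup_single scal_def mult.commute[of c])
    next
      case False
      then show ?thesis by (simp add: rstrip_def lookup_single butlast_append)
    qed
  qed (simp add: rstrip_linear lookup_add scal_add algebra_simps)
qed (simp add: rstrip_linear algebra_simps)

lemma lookup_mult_Nil: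
  "coef (p * q :: ('x, 'k::field) tens) [] = coef p [] * coef q []"
proof (induction p rule: tens_induct)
  case (single w c)
  show ?case
    by (induction q rule: tens_induct) (auto simp: lookup_single when_def lookup_add algebra_simps)
qed (simp add: lookup_add algebra_simps)

subsection \<open>Homogeneous elements\<close>

lemma tens_pow_space: "p \<in> tens_pow X i ==> p \<in> tens_space X"
  by (simp add: tens_pow_def)

lemma tens_pow_zero [simp]: "0 \<in> tens_pow X i"
  by (simp add: tens_pow_def)

lemma tens_pow_add: "p \<in> tens_pow X i ==> q \<in> tens_pow X i ==> p + q \<in> tens_pow X i"
  using keys_add[of p q] by (auto simp: tens_pow_def intro: tens_space_add)

lemma tens_pow_single: "set w \<subseteq> X ==> length w = i ==> monomial w c \<in> tens_pow X i"
  by (simp add: tens_pow_def tens_space_single)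

lemma tens_pow_induct [consumes 1, case_names single add]:
  fixes p :: "('x, 'k::field) tens"
  assumes "p \<in> tens_pow X i"
    "!!w c. set w \<subseteq> X ==> length w = i ==> P (monomial w c)"
    "!!p q. p \<in> tens_pow X i ==> q \<in> tens_pow X i ==> P p ==> P q ==> P (p + q)" and "P 0"
  shows "P p"
proof -
  have "supp p \<subseteq> {w. set w \<subseteq> X \<and> length w = i}"
    using assms(1) by (auto simp: tens_pow_def tens_space_def)
  then show ?thesis
  proof (induction rule: pm_induct)
    case (add f g)
    then show ?case by (intro assms(3)) (auto simp: tens_space_def tens_pow_def)
  qed (use assms(2,4) in auto)
qed

lemma tens_pow_scal: "p \<in> tens_pow X i ==> scal c * p \<in> tens_pow X i"
proof (induction rule: tens_pow_induct)
  case (single w d)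
  then show ?case unfolding scal_def mult_wd by (intro tens_pow_single) auto
qed (auto simp: distrib_left intro: tens_pow_add)

lemma tens_pow_sum: "(!!i. i \<in> K ==> f i \<in> tens_pow X n) ==> (\<Sum>i\<in>K. f i) \<in> tens_pow X n"
  by (induction K rule: infinite_finite_induct) (auto intro: tens_pow_add)

lemma tens_pow_mult: "p \<in> tens_pow X i ==> q \<in> tens_pow X j ==> p * q \<in> tens_pow X (i + j)"
proof (induction rule: tens_pow_induct)
  case (single w c)
  show ?case using single(3)
  proof (induction rule: tens_pow_induct)
    case (single u d)
    then show ?case unfolding mult_wd using \<open>set w \<subseteq> X\<close> \<open>length w = i\<close> by (intro tens_pow_single) auto
  qed (auto simp: distrib_left intro: tens_pow_add)
qed (auto simp: distrib_right intro: tens_pow_add)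

lemma tens_pow_gen [simp]: "x \<in> X ==> gen x \<in> tens_pow X 1"
  unfolding gen_def by (rule tens_pow_single) auto

lemma lstrip_pow: "p \<in> tens_pow X (Suc i) ==> lstrip x p \<in> tens_pow X i"
proof (induction rule: tens_pow_induct)
  case (single w c)
  then show ?case by (cases w) (auto simp: lstrip_def intro: tens_pow_single)
qed (auto simp: lstrip_linear intro: tens_pow_add)

lemma lstrip_sum:
  assumes "p \<in> tens_pow X (Suc i)" "finite X"
  shows "(\<Sum>x\<in>X. gen x * lstrip x p) = p"
  using assms(1)
proof (induction rule: tens_pow_induct)
  case (single w c)
  then obtain y u where w: "w = y # u" "y \<in> X" by (cases w) auto
  have "(\<Sum>x\<in>X. gen x * lstrip x (monomial w c)) =
      (\<Sum>x\<in>X. if x = y then monomial w c else 0)"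
    by (rule sum.cong) (auto simp: lstrip_def w)
  then show ?case using w(2) assms(2) by (simp add: sum.delta)
qed (simp_all add: lstrip_linear distrib_left sum.distrib)

lemma tens_pow_1:
  assumes "p \<in> tens_pow X 1" "finite X"
  shows "p = (\<Sum>x\<in>X. scal (coef p [x]) * gen x)"
  using assms(1)
proof (induction rule: tens_pow_induct)
  case (single w c)
  then obtain y where w: "w = [y]" "y \<in> X" by (cases w) auto
  have "(\<Sum>x\<in>X. scal (coef (monomial w c) [x]) * gen x) =
      (\<Sum>x\<in>X. if x = y then monomial w c else 0)"
    by (rule sum.cong) (auto simp: w lookup_single gen_def)
  then show ?case using w(2) assms(2) by (simp add: sum.delta)
qed (simp_all add: lookup_add scal_add distrib_right sum.distrib)

lemma tens_pow_0: "p \<in> tens_pow X 0 ==> p = scal (coef p [])"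
proof (induction rule: tens_pow_induct)
  case (add p q)
  then show ?case by (simp add: lookup_add scal_add)
qed (simp_all add: scal_def)

lemma lstrip_mult_1: "p \<in> tens_pow X 1 ==> lstrip x (p * q) = scal (coef p [x]) * q"
proof (induction rule: tens_pow_induct)
  case (single w c)
  then obtain y where w: "w = [y]" "y \<in> X" by (cases w) auto
  have s: "monomial [y] c = scal c * gen y" by (simp add: gen_def)
  have l: "coef (monomial [y] c) [x] = (if y = x then c else 0)"
    by (simp add: lookup_single when_def)
  show ?case
    unfolding w l unfolding s mult.assoc lstrip_linear by auto
qed (simp_all add: lookup_add lstrip_linear scal_add distrib_right)

lemma lookup_pow_mult:
  assumes "p \<in> tens_pow X (length u)"
  shows "coef (p * q) (u @ v) = coef p u * coef q v"
  using assms
proof (induction rule: tens_pow_induct)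
  case (single w c)
  then show ?case
    by (induction q rule: tens_induct) (auto simp: lookup_single when_def lookup_add algebra_simps)
qed (simp_all add: lookup_add distrib_right)

lemma tens_subspaceI:
  assumes "0 \<in> S" "!!p q. p \<in> S ==> q \<in> S ==> p + q \<in> S" "!!c p. p \<in> S ==> scal c * p \<in> S"
  shows "tens.subspace S"
  by (rule tens.subspaceI) (use assms in \<open>auto simp: tscale_scal\<close>)

text \<open>Members of \<open>V\<^sup>i \<otimes> R \<otimes> V\<^sup>j\<close> for a one-dimensional \<open>R\<close>: every slice is a multiple of the generator.\<close>

lemma span_slice:
  fixes r :: "('x, 'k::field) tens"
  assumes w: "w \<in> tspan {p * r' * q | p r' q. p \<in> tens_pow X i \<and> r' \<in> tspan {r} \<and> q \<in> tens_pow X j}"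
    and r: "r \<in> tens_pow X 2" and u: "length u = i"
  shows "\<exists>c. \<forall>a b. coef w (u @ [a, b] @ v) = c * coef r [a, b]"
proof -
  let ?S = "{w :: ('x, 'k) tens. \<exists>c. \<forall>a b. coef w (u @ [a, b] @ v) = c * coef r [a, b]}"
  have "tspan {p * r' * q | p r' q. p \<in> tens_pow X i \<and> r' \<in> tspan {r} \<and> q \<in> tens_pow X j} \<subseteq> ?S"
  proof (rule tens.span_minimal)
    show "tens.subspace ?S"
    proof (rule tens_subspaceI)
      fix p q assume "p \<in> ?S" "q \<in> ?S"
      then obtain c d where "\<forall>a b. coef p (u @ [a, b] @ v) = c * coef r [a, b]"
        "\<forall>a b. coef q (u @ [a, b] @ v) = d * coef r [a, b]" by auto
      then show "p + q \<in> ?S" by (auto simp: lookup_add distrib_right[symmetric])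
    next
      fix k p assume "p \<in> ?S"
      then obtain c where "\<forall>a b. coef p (u @ [a, b] @ v) = c * coef r [a, b]"
        by auto
      then show "scal k * p \<in> ?S" by (auto simp: intro!: exI[of _ "k * c"])
    qed (auto intro!: exI[of _ 0])
    show "{p * r' * q | p r' q. p \<in> tens_pow X i \<and> r' \<in> tspan {r} \<and> q \<in> tens_pow X j} \<subseteq> ?S"
    proof safe
      fix p r' q :: "('x, 'k) tens" assume p: "p \<in> tens_pow X i" and r': "r' \<in> tspan {r}"
      obtain c where c: "r' = scal c * r" using r' by (auto simp: tens.span_singleton tscale_scal)
      have r2: "r \<in> tens_pow X (length [a, b])" for a b using r by (simp add: numeral_2_eq_2 One_nat_def)
      have "coef (p * r' * q) (u @ [a, b] @ v) =
          (coef p u * c * coef q v) * coef r [a, b]" for a b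
        unfolding mult.assoc
        by (subst lookup_pow_mult, use p u in simp, unfold c mult.assoc lookup_scal,
          subst lookup_pow_mult[OF r2], simp)
      then show "\<exists>c. \<forall>a b. coef (p * r' * q) (u @ [a, b] @ v) = c * coef r [a, b]"
        by blast
    qed
  qed
  then show ?thesis using w by blast
qed


locale symplectic = weyl m vc l for m and vc :: "nat => 'k::field" and l +
  assumes vc_zero: "vc = (\<lambda>_. 0)" and l_zero: "l = 0"
begin

lemma rel_rel0: "rel = rel0" unfolding rel_def vec_def by (simp add: vc_zero l_zero)

lemma rel0_pow: "rel0 \<in> tens_pow X 2"
proof -
  have "gen j * gen (pa j) \<in> tens_pow X (1 + 1)" if "j \<in> X" for j
    using that pa(1)[OF that] by (intro tens_pow_mult tens_pow_gen)
  then show ?thesis unfolding rel0_def by (intro tens_pow_sum tens_pow_scal) simp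
qed

lemma lookup_rel0: "coef rel0 [a, b] = (if a \<in> X \<and> b = pa a then sg a else 0)"
proof -
  have "coef rel0 [a, b] = (\<Sum>j\<in>X. if j = a then (if b = pa a then sg a else 0) else 0)"
    unfolding rel0_def lookup_sum
    by (rule sum.cong) (auto simp: gen_def lookup_single when_def)
  then show ?thesis by (simp add: sum.delta)
qed

lemma rstrip_rel0: "j \<in> X ==> rstrip j rel0 = scal (- sg j) * gen (pa j)"
proof -
  assume j: "j \<in> X"
  have "rstrip j rel0 = (\<Sum>x\<in>X. if x = pa j then scal (- sg j) * gen (pa j) else 0)"
    unfolding rel0_def rstrip_linear
    by (rule sum.cong) (use j pa in \<open>auto simp: mult.assoc[symmetric] rstrip_linear(4)[of _ _ "_ * _"] pa_eq_iff mult.assoc\<close>)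
  then show ?thesis using pa(1)[OF j] by (simp add: sum.delta)
qed

abbreviation W :: "nat => (nat, 'k) tens set" where "W i \<equiv> koszul_W X 2 Prel (nu 2 i)"
abbreviation Wm :: "nat => ('k, (nat, 'k) tens) module" where "Wm i \<equiv> koszul_Wmod X 2 Prel i"

lemma nu_2 [simp]: "nu 2 i = i" by (auto simp: nu_def elim!: oddE)

lemma W_pow: "w \<in> W i ==> w \<in> tens_pow X i"
  by (simp add: koszul_W_def)

lemma W_low: "i < 2 ==> W i = tens_pow X i"
  by (auto simp: koszul_W_def)

lemma Prel_iff: "w \<in> Prel \<longleftrightarrow> (\<exists>c. w = scal c * rel0)"
  unfolding P_range unfolding rel_rel0 by auto

lemma W_2: "W 2 = Prel"
proof (intro equalityI subsetI)
  fix w assume w: "w \<in> W 2"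
  then have "w \<in> tspan {p * r * q | p r q. p \<in> tens_pow X 0 \<and> r \<in> Prel \<and> q \<in> tens_pow X 0}"
    by (simp add: koszul_W_def)
  moreover have "tspan {p * r * q | p r q. p \<in> tens_pow X 0 \<and> r \<in> Prel \<and> q \<in> tens_pow X 0} \<subseteq> Prel"
  proof (rule tens.span_minimal[OF _ tens.subspace_span], safe)
    fix p r q :: "(nat, 'k) tens" assume p: "p \<in> tens_pow X 0" and q: "q \<in> tens_pow X 0" and r: "r \<in> Prel"
    obtain a where a: "r = scal a * rel0" using r unfolding Prel_iff by blast
    obtain b c where bc: "p = scal b" "q = scal c" using tens_pow_0[OF p] tens_pow_0[OF q] by blast
    have "p * r * q = scal (b * a * c) * rel0"
      unfolding a bc scal_mult mult.assoc by (simp only: scal_central)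
    then show "p * r * q \<in> Prel" unfolding Prel_iff by blast
  qed
  ultimately show "w \<in> Prel" by (rule subsetD[rotated])
next
  fix w assume w: "w \<in> Prel"
  have one: "(1 :: (nat, 'k) tens) \<in> tens_pow X 0" unfolding one_wd by (rule tens_pow_single) auto
  have "w \<in> tens_pow X 2" using w rel0_pow unfolding Prel_iff by (auto intro: tens_pow_scal)
  moreover have "w \<in> tspan {p * r * q | p r q. p \<in> tens_pow X 0 \<and> r \<in> Prel \<and> q \<in> tens_pow X 0}"
    by (rule tens.span_base) (use one w in \<open>force\<close>)
  ultimately show "w \<in> W 2" by (auto simp: koszul_W_def)
qed

text \<open>A word of length at least 3 meets two overlapping slices. The first makes the coefficient a
  multiple \<open>k\<close> of the relator in the first two letters; moving to a first letter \<open>a'\<close> different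
  from the third one, the second slice shows \<open>k = 0\<close>. It is here that at least two generators are
  needed.\<close>

lemma W_high:
  assumes "i \<ge> 3" "w \<in> W i" shows "w = 0"
proof (rule poly_mapping_eqI)
  fix t
  have wp: "w \<in> tens_pow X i" by (rule W_pow[OF assms(2)])
  have sp: "w \<in> tspan {p * r * q | p r q. p \<in> tens_pow X i' \<and> r \<in> tspan {rel0} \<and> q \<in> tens_pow X j}"
    if "i' + 2 + j = i" for i' j
    using assms(2) that by (simp add: koszul_W_def rel_rel0)
  show "coef w t = coef 0 t"
  proof (cases "length t = i")
    case False
    then have "t \<notin> supp w" using wp by (auto simp: tens_pow_def)
    then show ?thesis by (simp add: in_keys_iff)
  next
    case True
    then obtain a b c u where t: "t = a # b # c # u"
      using assms(1) by (cases t; cases "tl t"; cases "tl (tl t)") auto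
    have i: "0 + 2 + (i - 2) = i" "1 + 2 + (i - 3) = i" using assms(1) by auto
    obtain k where k: "!!a b. coef w (a # b # c # u) = k * coef rel0 [a, b]"
      using span_slice[OF sp[OF i(1)] rel0_pow, of "[]" "c # u"] by auto
    define a' where "a' = (if c = 1 then m + 1 else 1)"
    have a': "a' \<in> X" "a' \<noteq> c" using m by (auto simp: a'_def)
    obtain k' where k': "!!b c. coef w (a' # b # c # u) = k' * coef rel0 [b, c]"
      using span_slice[OF sp[OF i(2)] rel0_pow, of "[a']" u] by (auto simp: One_nat_def)
    have "k * sg a' = coef w (a' # pa a' # c # u)"
      unfolding k lookup_rel0 using a' by simp
    also have "\<dots> = 0" unfolding k' lookup_rel0 using a' pa(2) by auto
    finally have "k = 0" by (auto simp: sg_def split: if_splits)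
    then show ?thesis unfolding t k by simp
  qed
qed

lemma W_subspace: "0 \<in> W i" "p \<in> W i ==> q \<in> W i ==> p + q \<in> W i" "p \<in> W i ==> scal c * p \<in> W i"
proof -
  show "0 \<in> W i" by (auto simp: koszul_W_def tens.span_zero)
  show "p + q \<in> W i" if p: "p \<in> W i" and q: "q \<in> W i"
    unfolding koszul_W_def mem_Collect_eq
    by (intro conjI allI impI tens_pow_add tens.span_add)
      (use p q in \<open>simp_all only: koszul_W_def mem_Collect_eq\<close>)
  show "scal c * p \<in> W i" if p: "p \<in> W i"
    unfolding koszul_W_def mem_Collect_eq tscale_scal[symmetric]
    by (intro conjI allI impI tens.span_scale)
      (use p tens_pow_scal[of p X i c] in \<open>simp_all only: koszul_W_def mem_Collect_eq tscale_scal nu_2\<close>)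
qed

lemma Wm_kspace: "kspace (Wm i)"
proof -
  have uminus: "- p \<in> W i" if "p \<in> W i" for p using W_subspace(3)[OF that, of "- 1"] by simp
  have "abelian_group (Wm i)"
  proof (rule abelian_groupI)
    fix p assume "p \<in> carrier (Wm i)"
    then show "\<exists>q\<in>carrier (Wm i). q \<oplus>\<^sub>(Wm i) p = \<zero>\<^sub>(Wm i)"
      by (intro bexI[of _ "- p"]) (use uminus in simp_all)
  qed (use W_subspace in \<open>auto simp: add_ac\<close>)
  then interpret abelian_group "Wm i" .
  show ?thesis
    by unfold_locales
      (use W_subspace in \<open>auto simp: tscale_scal scal_add scal_mult distrib_left distrib_right mult.assoc\<close>)
qed

sublocale K: tensor_spaces U "Wm i" for i
  by (intro tensor_spaces.intro Wm_kspace) unfold_locales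

lemma K_eq: "koszul_K X 2 Prel i = K.MN i" by (simp add: koszul_K_def)

end

context tensor_spaces begin

lemma pure_finsum_l:
  assumes "finite J" "f \<in> J \<rightarrow> carrier M" "b \<in> carrier N"
  shows "pt (\<Oplus>\<^sub>M j\<in>J. f j) b = (\<Oplus>\<^sub>MN j\<in>J. pt (f j) b)"
  using assms(1,2)
proof (induction J)
  case empty
  then show ?case using assms(3) by (simp add: pure_zero_l)
next
  case (insert j J)
  then have f: "f \<in> J \<rightarrow> carrier M" "f j \<in> carrier M" by auto
  then have g: "(\<lambda>j. pt (f j) b) \<in> J \<rightarrow> carrier MN" "pt (f j) b \<in> carrier MN"
    using assms(3) by (auto intro!: pure_closed)
  have "pt (\<Oplus>\<^sub>M j\<in>insert j J. f j) b = pt (f j) b \<oplus>\<^sub>MN pt (\<Oplus>\<^sub>M j\<in>J. f j) b"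
    using insert(1,2) f assms(3) by (simp add: M.finsum_insert pure_add_l)
  then show ?case using insert f g by (simp add: MN.finsum_insert)
qed

end

context symplectic
begin

declare nu_2 [simp del]

lemma Wm_simps [simp]:
  "carrier (Wm i) = W i" "zero (Wm i) = 0" "add (Wm i) = (+)" "smult (Wm i) = tscale"
  by simp_all

lemma gen_T: "x \<in> X ==> gen x \<in> tens_space X" by simp

lemma cls_gen: "x \<in> X ==> cls (gen x) \<in> carrier U" by (rule cls_closed, rule gen_T)

lemma lstrip_W: "w \<in> W (Suc i) ==> lstrip x w \<in> W i"
proof (cases "i < 2")
  case True
  assume "w \<in> W (Suc i)"
  then show ?thesis using True by (simp only: W_low) (rule lstrip_pow, rule W_pow)
next
  case False
  assume "w \<in> W (Suc i)"
  then have "w = 0" using False by (intro W_high[of "Suc i"]) auto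
  then show ?thesis using W_subspace(1)[of i] by (simp only: lstrip_linear)
qed

definition bd :: "nat => (nat, 'k) tens set => (nat, 'k) tens => ((nat, 'k) tens set \<times> (nat, 'k) tens \<Rightarrow>\<^sub>0 int) set"
  where "bd i a w = (\<Oplus>\<^sub>(K.MN i)x\<in>X. K.pt i (a \<otimes>\<^sub>U cls (gen x)) (lstrip x w))"

lemma bd_term: "a \<in> carrier U ==> lstrip x w \<in> W i ==> x \<in> X ==>
    K.pt i (a \<otimes>\<^sub>U cls (gen x)) (lstrip x w) \<in> carrier (K.MN i)"
  by (intro K.pure_closed A.m_closed cls_gen) simp_all

lemma bd_closed: "a \<in> carrier U ==> (!!x. lstrip x w \<in> W i) ==> bd i a w \<in> carrier (K.MN i)"
  unfolding bd_def by (intro K.MN.finsum_closed funcsetI bd_term)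

lemma bd_add_l:
  assumes a: "a \<in> carrier U" "b \<in> carrier U" and w: "!!x. lstrip x w \<in> W i"
  shows "bd i (a \<oplus>\<^sub>U b) w = bd i a w \<oplus>\<^sub>(K.MN i) bd i b w"
proof -
  have "bd i (a \<oplus>\<^sub>U b) w = (\<Oplus>\<^sub>(K.MN i)x\<in>X.
      K.pt i (a \<otimes>\<^sub>U cls (gen x)) (lstrip x w) \<oplus>\<^sub>(K.MN i) K.pt i (b \<otimes>\<^sub>U cls (gen x)) (lstrip x w))"
    unfolding bd_def
  proof (intro K.MN.finsum_cong' refl funcsetI K.MN.a_closed bd_term a w)
    fix x assume x: "x \<in> X"
    show "K.pt i ((a \<oplus>\<^sub>U b) \<otimes>\<^sub>U cls (gen x)) (lstrip x w) =
        K.pt i (a \<otimes>\<^sub>U cls (gen x)) (lstrip x w) \<oplus>\<^sub>(K.MN i) K.pt i (b \<otimes>\<^sub>U cls (gen x)) (lstrip x w)"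
      unfolding A.l_distr[OF a cls_gen[OF x]]
      by (intro K.pure_add_l A.m_closed a cls_gen x) (simp add: w)
  qed
  also have "\<dots> = bd i a w \<oplus>\<^sub>(K.MN i) bd i b w"
    unfolding bd_def by (intro K.MN.finsum_addf funcsetI bd_term a w)
  finally show ?thesis .
qed

lemma bd_add_r:
  assumes a: "a \<in> carrier U" and w: "!!x. lstrip x w \<in> W i" and w': "!!x. lstrip x w' \<in> W i"
  shows "bd i a (w + w') = bd i a w \<oplus>\<^sub>(K.MN i) bd i a w'"
proof -
  have "bd i a (w + w') = (\<Oplus>\<^sub>(K.MN i)x\<in>X.
      K.pt i (a \<otimes>\<^sub>U cls (gen x)) (lstrip x w) \<oplus>\<^sub>(K.MN i) K.pt i (a \<otimes>\<^sub>U cls (gen x)) (lstrip x w'))"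
    unfolding bd_def
  proof (intro K.MN.finsum_cong' refl funcsetI K.MN.a_closed bd_term a w w')
    fix x assume x: "x \<in> X"
    show "K.pt i (a \<otimes>\<^sub>U cls (gen x)) (lstrip x (w + w')) =
        K.pt i (a \<otimes>\<^sub>U cls (gen x)) (lstrip x w) \<oplus>\<^sub>(K.MN i) K.pt i (a \<otimes>\<^sub>U cls (gen x)) (lstrip x w')"
      using K.pure_add_r[of "a \<otimes>\<^sub>U cls (gen x)" "lstrip x w" i "lstrip x w'"]
        A.m_closed[OF a cls_gen[OF x]] w w' by (simp add: lstrip_linear)
  qed
  also have "\<dots> = bd i a w \<oplus>\<^sub>(K.MN i) bd i a w'"
    unfolding bd_def by (intro K.MN.finsum_addf funcsetI bd_term a w w')
  finally show ?thesis .
qed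

lemma bd_smult:
  assumes a: "a \<in> carrier U" and w: "!!x. lstrip x w \<in> W i"
  shows "bd i (c \<odot>\<^sub>U a) w = bd i a (scal c * w)"
  unfolding bd_def
proof (intro K.MN.finsum_cong' refl funcsetI bd_term a)
  fix x assume x: "x \<in> X"
  show "lstrip x (scal c * w) \<in> W i" unfolding lstrip_linear by (rule W_subspace(3)[OF w])
  show "K.pt i (c \<odot>\<^sub>U a \<otimes>\<^sub>U cls (gen x)) (lstrip x w) = K.pt i (a \<otimes>\<^sub>U cls (gen x)) (lstrip x (scal c * w))"
    using K.pure_smult[of "a \<otimes>\<^sub>U cls (gen x)" "lstrip x w" i c]
      A.m_closed[OF a cls_gen[OF x]] w a cls_gen[OF x]
    by (simp add: lstrip_linear tscale_scal A.smult_mult_l)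
qed

lemma bd_balanced: "balanced U (Wm (Suc i)) (K.MN i) (bd i)"
  unfolding balanced_def Wm_simps tscale_scal
  by (intro conjI ballI allI bd_closed bd_add_l bd_add_r bd_smult lstrip_W; assumption)

lemma bd_mult:
  assumes a: "a \<in> carrier U" and p: "p \<in> tens_pow X 1" and q: "q \<in> W i"
  shows "bd i a (p * q) = K.pt i (a \<otimes>\<^sub>U cls p) q" "lstrip x (p * q) \<in> W i"
proof -
  let ?c = "\<lambda>x. coef p [x]"
  show "lstrip x (p * q) \<in> W i"
    unfolding lstrip_mult_1[OF p] by (rule W_subspace(3)[OF q])
  have q': "q \<in> carrier (Wm i)" using q by simp
  have cl: "cls (scal (?c x) * gen x) \<in> carrier U" if "x \<in> X" for x
    by (intro cls_closed tens_space_mult tens_space_scal gen_T that)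
  have "bd i a (p * q) = (\<Oplus>\<^sub>(K.MN i)x\<in>X. K.pt i (a \<otimes>\<^sub>U cls (scal (?c x) * gen x)) q)"
    unfolding bd_def lstrip_mult_1[OF p]
  proof (intro K.MN.finsum_cong' refl funcsetI K.pure_closed A.m_closed a cl q')
    fix x assume x: "x \<in> X"
    have "cls (scal (?c x) * gen x) = ?c x \<odot>\<^sub>U cls (gen x)" by (rule cls_smult[OF gen_T[OF x], symmetric])
    then show "K.pt i (a \<otimes>\<^sub>U cls (gen x)) (scal (?c x) * q) = K.pt i (a \<otimes>\<^sub>U cls (scal (?c x) * gen x)) q"
      using K.pure_smult[of "a \<otimes>\<^sub>U cls (gen x)" q i "?c x"]
        A.m_closed[OF a cls_gen[OF x]] q a cls_gen[OF x]
      by (simp add: tscale_scal A.smult_mult_r)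
  qed
  also have "\<dots> = K.pt i (\<Oplus>\<^sub>U x\<in>X. a \<otimes>\<^sub>U cls (scal (?c x) * gen x)) q"
    by (rule K.pure_finsum_l[symmetric]) (use q' a cl in auto)
  also have "(\<Oplus>\<^sub>U x\<in>X. a \<otimes>\<^sub>U cls (scal (?c x) * gen x)) = a \<otimes>\<^sub>U (\<Oplus>\<^sub>U x\<in>X. cls (scal (?c x) * gen x))"
    by (rule A.finsum_rdistr[symmetric]) (use a cl in auto)
  also have "(\<Oplus>\<^sub>U x\<in>X. cls (scal (?c x) * gen x)) = cls (\<Sum>x\<in>X. scal (?c x) * gen x)"
    by (rule cls_sum[symmetric]) (intro tens_space_mult tens_space_scal gen_T)
  also have "(\<Sum>x\<in>X. scal (?c x) * gen x) = p" by (rule tens_pow_1[OF p, symmetric]) simp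
  finally show "bd i a (p * q) = K.pt i (a \<otimes>\<^sub>U cls p) q" .
qed

text \<open>The value on \<open>\<Sum> p\<^sub>j q\<^sub>j\<close> has to be computed for an arbitrary such presentation. Partial sums
  may leave \<open>W\<close>, so the induction runs over all elements whose letterwise left quotients lie in
  the previous \<open>W\<close>.\<close>

lemma bd_sum:
  fixes n :: nat
  assumes a: "a \<in> carrier U" and "!!j. j < n ==> p j \<in> tens_pow X 1" "!!j. j < n ==> q j \<in> W i"
  shows "bd i a (\<Sum>j<n. p j * q j) = (\<Oplus>\<^sub>(K.MN i)j\<in>{..<n}. K.pt i (a \<otimes>\<^sub>U cls (p j)) (q j)) \<and>
    (\<forall>x. lstrip x (\<Sum>j<n. p j * q j) \<in> W i)"
  using assms(2,3)
proof (induction n)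
  case 0
  have "bd i a 0 = \<zero>\<^sub>(K.MN i)"
  proof -
    have "bd i a 0 = (\<Oplus>\<^sub>(K.MN i)x\<in>X. \<zero>\<^sub>(K.MN i))"
      unfolding bd_def lstrip_linear
    proof (intro K.MN.finsum_cong' refl funcsetI K.MN.zero_closed)
      fix x assume x: "x \<in> X"
      show "K.pt i (a \<otimes>\<^sub>U cls (gen x)) 0 = \<zero>\<^sub>(K.MN i)"
        using K.pure_zero_r[OF A.m_closed[OF a cls_gen[OF x]], of i] by simp
    qed
    then show ?thesis by simp
  qed
  then show ?case using W_subspace(1)[of i] by (simp add: lstrip_linear)
next
  case (Suc n)
  have pn: "p n \<in> tens_pow X 1" "q n \<in> W i" using Suc.prems by auto
  have IH: "bd i a (\<Sum>j<n. p j * q j) = (\<Oplus>\<^sub>(K.MN i)j\<in>{..<n}. K.pt i (a \<otimes>\<^sub>U cls (p j)) (q j))"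
    "!!x. lstrip x (\<Sum>j<n. p j * q j) \<in> W i"
    using Suc.IH Suc.prems by auto
  have cl: "K.pt i (a \<otimes>\<^sub>U cls (p j)) (q j) \<in> carrier (K.MN i)" if "j < Suc n" for j
    using Suc.prems[OF that] a by (intro K.pure_closed A.m_closed a cls_closed)
      (auto simp del: nu_2 dest: tens_pow_space)
  have "bd i a (\<Sum>j<Suc n. p j * q j) = bd i a (\<Sum>j<n. p j * q j) \<oplus>\<^sub>(K.MN i) bd i a (p n * q n)"
    unfolding sum.lessThan_Suc by (intro bd_add_r a IH bd_mult(2)[OF a pn])
  also have "\<dots> = (\<Oplus>\<^sub>(K.MN i)j\<in>{..<n}. K.pt i (a \<otimes>\<^sub>U cls (p j)) (q j)) \<oplus>\<^sub>(K.MN i)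
      K.pt i (a \<otimes>\<^sub>U cls (p n)) (q n)"
    unfolding IH(1) bd_mult(1)[OF a pn] ..
  also have "\<dots> = (\<Oplus>\<^sub>(K.MN i)j\<in>{..<Suc n}. K.pt i (a \<otimes>\<^sub>U cls (p j)) (q j))"
    unfolding lessThan_Suc
    by (subst K.MN.finsum_insert) (use cl in \<open>auto intro!: K.MN.a_comm K.MN.finsum_closed\<close>)
  finally show ?case
    using IH(2) bd_mult(2)[OF a pn] by (auto simp: lstrip_linear intro: W_subspace(2))
qed

definition dK :: "nat => ((nat, 'k) tens set \<times> (nat, 'k) tens \<Rightarrow>\<^sub>0 int) set =>
    ((nat, 'k) tens set \<times> (nat, 'k) tens \<Rightarrow>\<^sub>0 int) set"
  where "dK i = tensor_lift (K.MN i) (bd i)"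

lemma dK_closed: "t \<in> carrier (K.MN (Suc i)) ==> dK i t \<in> carrier (K.MN i)"
  and dK_add: "s \<in> carrier (K.MN (Suc i)) ==> t \<in> carrier (K.MN (Suc i)) ==>
    dK i (s \<oplus>\<^sub>(K.MN (Suc i)) t) = dK i s \<oplus>\<^sub>(K.MN i) dK i t"
  and dK_zero: "dK i \<zero>\<^sub>(K.MN (Suc i)) = \<zero>\<^sub>(K.MN i)"
  and dK_pure: "a \<in> carrier U ==> w \<in> W (Suc i) ==> dK i (K.pt (Suc i) a w) = bd i a w"
proof -
  note bb = K.MN.abelian_group_axioms[of i] bd_balanced[of i]
  show "t \<in> carrier (K.MN (Suc i)) ==> dK i t \<in> carrier (K.MN i)"
    unfolding dK_def by (rule K.tensor_lift_closed[OF bb])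
  show "s \<in> carrier (K.MN (Suc i)) ==> t \<in> carrier (K.MN (Suc i)) ==>
      dK i (s \<oplus>\<^sub>(K.MN (Suc i)) t) = dK i s \<oplus>\<^sub>(K.MN i) dK i t"
    unfolding dK_def by (rule K.tensor_lift_add[OF bb])
  show "dK i \<zero>\<^sub>(K.MN (Suc i)) = \<zero>\<^sub>(K.MN i)"
    unfolding dK_def by (rule K.tensor_lift_zero[OF bb])
  show "a \<in> carrier U ==> w \<in> W (Suc i) ==> dK i (K.pt (Suc i) a w) = bd i a w"
    unfolding dK_def by (rule K.tensor_lift_pure[OF bb]) simp_all
qed

lemma dK_is_koszul_diff: "is_koszul_diff X 2 Prel (Suc i) (dK i)"
  unfolding is_koszul_diff_def
proof (intro conjI ballI allI impI)
  show "dK i \<in> hom (add_monoid (koszul_K X 2 Prel (Suc i))) (add_monoid (koszul_K X 2 Prel (Suc i - 1)))"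
    by (rule homI) (simp_all add: K_eq dK_closed dK_add)
  fix a and n :: nat and p q :: "nat => (nat, 'k) tens"
  assume a: "a \<in> carrier U"
    and "(\<forall>j<n. p j \<in> tens_pow X (nu 2 (Suc i) - nu 2 (Suc i - 1)) \<and> q j \<in> W (Suc i - 1)) \<and>
      (\<Sum>j<n. p j * q j) \<in> W (Suc i)"
  then have "!!j. j < n ==> p j \<in> tens_pow X 1" "!!j. j < n ==> q j \<in> W i" "(\<Sum>j<n. p j * q j) \<in> W (Suc i)"
    by (simp_all add: One_nat_def nu_2)
  then show "dK i (pure_tensor U (Wm (Suc i)) a (\<Sum>j<n. p j * q j)) =
      (\<Oplus>\<^sub>(koszul_K X 2 Prel (Suc i - 1))j\<in>{..<n}. pure_tensor U (Wm (Suc i - 1)) (a \<otimes>\<^sub>U cls (p j)) (q j))"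
    using bd_sum[OF a, of n p q i] dK_pure[OF a] by (simp add: K_eq)
qed

text \<open>The defining property determines the differential, since every \<open>w\<close> is \<open>\<Sum>x. gen x * lstrip x w\<close>.\<close>

lemma koszul_diff_eq:
  assumes t: "t \<in> carrier (K.MN (Suc i))"
  shows "koszul_diff X 2 Prel (Suc i) t = dK i t"
proof -
  let ?D = "koszul_diff X 2 Prel (Suc i)"
  have D: "is_koszul_diff X 2 Prel (Suc i) ?D"
    unfolding koszul_diff_def by (rule someI[of _ "dK i"]) (rule dK_is_koszul_diff)
  then have hom: "?D \<in> hom (add_monoid (K.MN (Suc i))) (add_monoid (K.MN i))"
    by (simp add: is_koszul_diff_def K_eq)
  have val: "D (K.pt (Suc i) a w) =
      (\<Oplus>\<^sub>(K.MN i)j\<in>{..<2 * m}. K.pt i (a \<otimes>\<^sub>U cls (gen (Suc j))) (lstrip (Suc j) w))"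
    if D: "is_koszul_diff X 2 Prel (Suc i) D" and a: "a \<in> carrier U" and w: "w \<in> W (Suc i)" for D a w
  proof -
    have "(\<Sum>j<2*m. gen (Suc j) * lstrip (Suc j) w) = (\<Sum>x\<in>X. gen x * lstrip x w)"
      by (rule sum.reindex_bij_witness[of _ "\<lambda>x. x - 1" Suc]) auto
    then have s: "(\<Sum>j<2*m. gen (Suc j) * lstrip (Suc j) w) = w"
      using lstrip_sum[OF W_pow[OF w]] by simp
    note imp = conjunct2[OF D[unfolded is_koszul_diff_def], THEN bspec, OF a, THEN spec[of _ "2 * m"],
        THEN spec[of _ "\<lambda>j. gen (Suc j)"], THEN spec[of _ "\<lambda>j. lstrip (Suc j) w"], unfolded s]
    have "gen (Suc j) \<in> tens_pow X (nu 2 (Suc i) - nu 2 (Suc i - 1))" if "j < 2 * m" for j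
      using tens_pow_gen[of "Suc j" X] that by (simp add: One_nat_def nu_2)
    then show ?thesis using imp lstrip_W[OF w] w by (simp add: K_eq) blast
  qed
  show ?thesis using t
  proof (induction rule: K.tensor_induct)
    case (pure a w)
    then show ?case using val[OF D] val[OF dK_is_koszul_diff] by simp
  next
    case (add s t)
    then show ?case using hom dK_add[of s i t] by (simp add: hom_def)
  qed
qed

subsection \<open>Coordinates\<close>

definition coord :: "nat list => nat => ((nat, 'k) tens set \<times> (nat, 'k) tens \<Rightarrow>\<^sub>0 int) set => (nat, 'k) tens set"
  where "coord u i = tensor_lift U (\<lambda>a w. coef w u \<odot>\<^sub>U a)"

lemma coord_balanced: "balanced U (Wm i) U (\<lambda>a w. coef w u \<odot>\<^sub>U a)"
  unfolding balanced_def Wm_simps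
  by (auto simp: lookup_add tscale_scal A.smult_l_distr A.smult_r_distr A.smult_assoc mult.commute[where 'a = 'k])

lemma coord_closed: "t \<in> carrier (K.MN i) ==> coord u i t \<in> carrier U"
  and coord_add: "s \<in> carrier (K.MN i) ==> t \<in> carrier (K.MN i) ==>
    coord u i (s \<oplus>\<^sub>(K.MN i) t) = coord u i s \<oplus>\<^sub>U coord u i t"
  and coord_zero: "coord u i \<zero>\<^sub>(K.MN i) = \<zero>\<^sub>U"
  and coord_pure: "a \<in> carrier U ==> w \<in> W i ==> coord u i (K.pt i a w) = coef w u \<odot>\<^sub>U a"
proof -
  note bb = A.abelian_group_axioms coord_balanced[of i u]
  show "t \<in> carrier (K.MN i) ==> coord u i t \<in> carrier U"
    unfolding coord_def by (rule K.tensor_lift_closed[OF bb])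
  show "s \<in> carrier (K.MN i) ==> t \<in> carrier (K.MN i) ==>
      coord u i (s \<oplus>\<^sub>(K.MN i) t) = coord u i s \<oplus>\<^sub>U coord u i t"
    unfolding coord_def by (rule K.tensor_lift_add[OF bb])
  show "coord u i \<zero>\<^sub>(K.MN i) = \<zero>\<^sub>U"
    unfolding coord_def by (rule K.tensor_lift_zero[OF bb])
  show "a \<in> carrier U ==> w \<in> W i ==> coord u i (K.pt i a w) = coef w u \<odot>\<^sub>U a"
    unfolding coord_def by (rule K.tensor_lift_pure[OF bb]) simp_all
qed

lemma coord_finsum:
  assumes "finite J" "f \<in> J \<rightarrow> carrier (K.MN i)"
  shows "coord u i (\<Oplus>\<^sub>(K.MN i)j\<in>J. f j) = (\<Oplus>\<^sub>U j\<in>J. coord u i (f j))"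
  using assms
proof (induction J)
  case (insert j J)
  then have f: "f \<in> J \<rightarrow> carrier (K.MN i)" "f j \<in> carrier (K.MN i)" by auto
  then have g: "(\<lambda>j. coord u i (f j)) \<in> J \<rightarrow> carrier U" "coord u i (f j) \<in> carrier U"
    by (auto intro!: coord_closed)
  show ?case
    using insert f g coord_add[OF f(2) K.MN.finsum_closed[OF f(1)]]
    by (simp add: K.MN.finsum_insert A.finsum_insert)
qed (simp add: coord_zero)

lemma gen_W1: "x \<in> X ==> gen x \<in> W 1"
  using tens_pow_gen[of x X] W_low[of 1] by simp

lemma one_W0: "scal c \<in> W 0"
proof -
  have "scal c \<in> tens_pow X 0" unfolding scal_def by (rule tens_pow_single) auto
  then show ?thesis using W_low[of 0] by simp
qed

lemma K0_coord: "t \<in> carrier (K.MN 0) ==> t = K.pt 0 (coord [] 0 t) 1"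
proof (induction rule: K.tensor_induct)
  case (pure a w)
  have "w = scal (coef w [])"
    by (rule tens_pow_0) (use W_pow[of w 0] pure(2) in simp)
  moreover have "K.pt 0 (coef w [] \<odot>\<^sub>U a) 1 = K.pt 0 a (scal (coef w []))"
    using K.pure_smult[of a 1 0] pure(1) one_W0[of 1] by (simp add: tscale_scal)
  ultimately show ?case using pure by (simp add: coord_pure)
next
  case (add s t)
  then show ?case
    using K.pure_add_l[of "coord [] 0 s" "coord [] 0 t" 1 0] one_W0[of 1]
    by (simp add: coord_add coord_closed)
qed

text \<open>\<open>A \<otimes> V\<close> is free on the generators, and the coordinates are the values of the functionals
  \<open>coord\<close>.\<close>

lemma K1_coord: "t \<in> carrier (K.MN 1) ==> t = (\<Oplus>\<^sub>(K.MN 1)x\<in>X. K.pt 1 (coord [x] 1 t) (gen x))"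
proof (induction rule: K.tensor_induct)
  case (pure a w)
  have w: "w \<in> tens_pow X 1" using W_pow[of w 1] pure(2) by simp
  let ?c = "\<lambda>x. coef w [x]"
  have cl: "K.pt 1 (?c x \<odot>\<^sub>U a) (gen x) \<in> carrier (K.MN 1)" if "x \<in> X" for x
    by (intro K.pure_closed) (use pure(1) gen_W1[OF that] in auto)
  have eq: "K.pt 1 (?c x \<odot>\<^sub>U a) (gen x) = K.pt 1 a (scal (?c x) * gen x)" if "x \<in> X" for x
    using K.pure_smult[of a "gen x" 1] pure(1) gen_W1[OF that] by (simp add: tscale_scal)
  have sumW: "(\<Sum>x\<in>Y. scal (?c x) * gen x) \<in> W 1 \<and>
      K.pt 1 a (\<Sum>x\<in>Y. scal (?c x) * gen x) = (\<Oplus>\<^sub>(K.MN 1)x\<in>Y. K.pt 1 (?c x \<odot>\<^sub>U a) (gen x))"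
    if "finite Y" "Y \<subseteq> X" for Y
    using that
  proof (induction Y)
    case empty
    then show ?case using W_subspace(1)[of 1] K.pure_zero_r[of a 1] pure(1) by simp
  next
    case (insert y Y)
    then have y: "y \<in> X" "scal (?c y) * gen y \<in> W 1" using W_subspace(3)[OF gen_W1] by auto
    have c: "(\<lambda>x. K.pt 1 (?c x \<odot>\<^sub>U a) (gen x)) \<in> Y \<rightarrow> carrier (K.MN 1)" using insert.prems cl by auto
    show ?case
      using insert y c cl[OF y(1)] eq[OF y(1)] W_subspace(2)[of _ 1]
        K.pure_add_r[of a "scal (?c y) * gen y" 1 "\<Sum>x\<in>Y. scal (?c x) * gen x"] pure(1)
      by (simp add: K.MN.finsum_insert)
  qed
  have "K.pt 1 a w = (\<Oplus>\<^sub>(K.MN 1)x\<in>X. K.pt 1 (?c x \<odot>\<^sub>U a) (gen x))"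
    using sumW[of X] tens_pow_1[OF w] by simp
  also have "\<dots> = (\<Oplus>\<^sub>(K.MN 1)x\<in>X. K.pt 1 (coord [x] 1 (K.pt 1 a w)) (gen x))"
    using pure by (simp add: coord_pure)
  finally show ?case .
next
  case (add s t)
  have cl: "K.pt 1 (coord [x] 1 t) (gen x) \<in> carrier (K.MN 1)" if "t \<in> carrier (K.MN 1)" "x \<in> X" for t x
    by (intro K.pure_closed) (use coord_closed[OF that(1)] gen_W1[OF that(2)] in auto)
  have "s \<oplus>\<^sub>(K.MN 1) t = (\<Oplus>\<^sub>(K.MN 1)x\<in>X. K.pt 1 (coord [x] 1 s) (gen x)) \<oplus>\<^sub>(K.MN 1)
      (\<Oplus>\<^sub>(K.MN 1)x\<in>X. K.pt 1 (coord [x] 1 t) (gen x))"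
    by (rule arg_cong2[OF add(3,4)])
  also have "\<dots> = (\<Oplus>\<^sub>(K.MN 1)x\<in>X. K.pt 1 (coord [x] 1 s) (gen x) \<oplus>\<^sub>(K.MN 1) K.pt 1 (coord [x] 1 t) (gen x))"
    by (rule K.MN.finsum_addf[symmetric]) (use cl add(1,2) in auto)
  also have "\<dots> = (\<Oplus>\<^sub>(K.MN 1)x\<in>X. K.pt 1 (coord [x] 1 (s \<oplus>\<^sub>(K.MN 1) t)) (gen x))"
  proof (intro K.MN.finsum_cong' refl funcsetI cl K.MN.a_closed add(1,2))
    fix x assume x: "x \<in> X"
    show "K.pt 1 (coord [x] 1 s) (gen x) \<oplus>\<^sub>(K.MN 1) K.pt 1 (coord [x] 1 t) (gen x) =
        K.pt 1 (coord [x] 1 (s \<oplus>\<^sub>(K.MN 1) t)) (gen x)"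
      using K.pure_add_l[of "coord [x] 1 s" "coord [x] 1 t" "gen x" 1] gen_W1[OF x] add(1,2)
      by (simp add: coord_add coord_closed)
  qed
  finally show ?case .
qed

lemma K1_eqI:
  assumes s: "s \<in> carrier (K.MN 1)" and t: "t \<in> carrier (K.MN 1)"
    and "!!x. x \<in> X ==> coord [x] 1 s = coord [x] 1 t"
  shows "s = t"
proof -
  have "s = (\<Oplus>\<^sub>(K.MN 1)x\<in>X. K.pt 1 (coord [x] 1 s) (gen x))" by (rule K1_coord[OF s])
  also have "\<dots> = (\<Oplus>\<^sub>(K.MN 1)x\<in>X. K.pt 1 (coord [x] 1 t) (gen x))"
    by (intro K.MN.finsum_cong' refl funcsetI K.pure_closed)
      (use assms(3) coord_closed[OF t] gen_W1 in auto)
  also have "\<dots> = t" by (rule K1_coord[OF t, symmetric])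
  finally show ?thesis .
qed

lemma K2_pure: "t \<in> carrier (K.MN 2) ==> \<exists>a\<in>carrier U. t = K.pt 2 a rel0"
proof (induction rule: K.tensor_induct)
  case (pure a w)
  obtain c where c: "w = scal c * rel0" using pure(2) unfolding Wm_simps unfolding W_2 Prel_iff by blast
  have "rel0 \<in> W 2" unfolding W_2 Prel_iff by (rule exI[of _ 1]) simp
  then show ?case
    using K.pure_smult[of a rel0 2 c] pure(1) by (intro bexI[of _ "c \<odot>\<^sub>U a"]) (simp_all add: c tscale_scal)
next
  case (add s t)
  then obtain a b where ab: "a \<in> carrier U" "b \<in> carrier U" "s = K.pt 2 a rel0" "t = K.pt 2 b rel0" by blast
  have "rel0 \<in> W 2" unfolding W_2 Prel_iff by (rule exI[of _ 1]) simp
  then show ?case using ab K.pure_add_l[of a b rel0 2] by (intro bexI[of _ "a \<oplus>\<^sub>U b"]) simp_all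
qed

lemma K_high: "i \<ge> 3 ==> carrier (K.MN i) = {\<zero>\<^sub>(K.MN i)}"
proof (intro equalityI subsetI)
  fix t assume i: "i \<ge> 3" and t: "t \<in> carrier (K.MN i)"
  from t have "t = \<zero>\<^sub>(K.MN i)"
  proof (induction rule: K.tensor_induct)
    case (pure a w)
    then show ?case using W_high[OF i, of w] K.pure_zero_r[of a i] by simp
  qed simp
  then show "t \<in> {\<zero>\<^sub>(K.MN i)}" by simp
qed simp

end

context symplectic
begin

lemma rel0_W: "rel0 \<in> W 2" unfolding W_2 Prel_iff by (rule exI[of _ 1]) simp

lemma coord_bd:
  assumes "a \<in> carrier U" "w \<in> W (Suc i)"
  shows "coord u i (bd i a w) = (\<Oplus>\<^sub>U x\<in>X. coef w (x # u) \<odot>\<^sub>U (a \<otimes>\<^sub>U cls (gen x)))"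
proof -
  have "coord u i (bd i a w) = (\<Oplus>\<^sub>U x\<in>X. coord u i (K.pt i (a \<otimes>\<^sub>U cls (gen x)) (lstrip x w)))"
    unfolding bd_def by (rule coord_finsum) (simp, intro funcsetI bd_term assms(1) lstrip_W[OF assms(2)])
  also have "\<dots> = (\<Oplus>\<^sub>U x\<in>X. coef w (x # u) \<odot>\<^sub>U (a \<otimes>\<^sub>U cls (gen x)))"
  proof (intro A.finsum_cong' refl funcsetI A.smult_closed A.m_closed assms(1) cls_gen)
    fix x assume "x \<in> X"
    then show "coord u i (K.pt i (a \<otimes>\<^sub>U cls (gen x)) (lstrip x w)) =
        coef w (x # u) \<odot>\<^sub>U (a \<otimes>\<^sub>U cls (gen x))"
      using coord_pure[OF A.m_closed[OF assms(1) cls_gen] lstrip_W[OF assms(2)]]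
      by (simp add: lookup_lstrip)
  qed
  finally show ?thesis .
qed

lemma coord_dK0:
  "t \<in> carrier (K.MN (Suc 0)) ==>
    coord [] 0 (dK 0 t) = (\<Oplus>\<^sub>U x\<in>X. coord [x] (Suc 0) t \<otimes>\<^sub>U cls (gen x))"
proof (induction rule: K.tensor_induct)
  case (pure a w)
  then have w: "w \<in> W (Suc 0)" by simp
  show ?case
    unfolding dK_pure[OF pure(1) w] coord_bd[OF pure(1) w]
  proof (intro A.finsum_cong' refl funcsetI A.m_closed cls_gen)
    fix x assume x: "x \<in> X"
    show "coord [x] (Suc 0) (K.pt (Suc 0) a w) \<in> carrier U"
      unfolding coord_pure[OF pure(1) w] by (rule A.smult_closed[OF pure(1)])
    show "coef w [x] \<odot>\<^sub>U (a \<otimes>\<^sub>U cls (gen x)) =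
        coord [x] (Suc 0) (K.pt (Suc 0) a w) \<otimes>\<^sub>U cls (gen x)"
      unfolding coord_pure[OF pure(1) w] by (rule A.smult_mult_l[OF pure(1) cls_gen[OF x], symmetric])
  qed
next
  case (add s t)
  have cl: "coord [x] (Suc 0) s \<otimes>\<^sub>U cls (gen x) \<in> carrier U" "coord [x] (Suc 0) t \<otimes>\<^sub>U cls (gen x) \<in> carrier U"
    if "x \<in> X" for x
    using coord_closed[OF add(1)] coord_closed[OF add(2)] cls_gen[OF that] by auto
  have "coord [] 0 (dK 0 (s \<oplus>\<^sub>(K.MN (Suc 0)) t)) =
      (\<Oplus>\<^sub>U x\<in>X. coord [x] (Suc 0) s \<otimes>\<^sub>U cls (gen x)) \<oplus>\<^sub>U (\<Oplus>\<^sub>U x\<in>X. coord [x] (Suc 0) t \<otimes>\<^sub>U cls (gen x))"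
    unfolding dK_add[OF add(1,2)] coord_add[OF dK_closed[OF add(1)] dK_closed[OF add(2)]] add(3,4) ..
  also have "\<dots> = (\<Oplus>\<^sub>U x\<in>X. coord [x] (Suc 0) s \<otimes>\<^sub>U cls (gen x) \<oplus>\<^sub>U coord [x] (Suc 0) t \<otimes>\<^sub>U cls (gen x))"
    by (rule A.finsum_addf[symmetric]) (use cl in auto)
  also have "\<dots> = (\<Oplus>\<^sub>U x\<in>X. coord [x] (Suc 0) (s \<oplus>\<^sub>(K.MN (Suc 0)) t) \<otimes>\<^sub>U cls (gen x))"
  proof (intro A.finsum_cong' refl funcsetI A.m_closed cls_gen coord_closed K.MN.a_closed add(1,2))
    fix x assume x: "x \<in> X"
    show "coord [x] (Suc 0) s \<otimes>\<^sub>U cls (gen x) \<oplus>\<^sub>U coord [x] (Suc 0) t \<otimes>\<^sub>U cls (gen x) =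
        coord [x] (Suc 0) (s \<oplus>\<^sub>(K.MN (Suc 0)) t) \<otimes>\<^sub>U cls (gen x)"
      unfolding coord_add[OF add(1,2)]
      by (rule A.l_distr[OF coord_closed[OF add(1)] coord_closed[OF add(2)] cls_gen[OF x], symmetric])
  qed
  finally show ?case .
qed

lemma dK0_zero_iff:
  assumes t: "t \<in> carrier (K.MN (Suc 0))"
  shows "dK 0 t = \<zero>\<^sub>(K.MN 0) \<longleftrightarrow> (\<Oplus>\<^sub>U x\<in>X. coord [x] (Suc 0) t \<otimes>\<^sub>U cls (gen x)) = \<zero>\<^sub>U"
proof
  assume "dK 0 t = \<zero>\<^sub>(K.MN 0)"
  then show "(\<Oplus>\<^sub>U x\<in>X. coord [x] (Suc 0) t \<otimes>\<^sub>U cls (gen x)) = \<zero>\<^sub>U"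
    using coord_dK0[OF t] by (simp add: coord_zero)
next
  assume "(\<Oplus>\<^sub>U x\<in>X. coord [x] (Suc 0) t \<otimes>\<^sub>U cls (gen x)) = \<zero>\<^sub>U"
  then have "coord [] 0 (dK 0 t) = \<zero>\<^sub>U" using coord_dK0[OF t] by simp
  then have "dK 0 t = K.pt 0 \<zero>\<^sub>U 1" using K0_coord[OF dK_closed[OF t]] by simp
  then show "dK 0 t = \<zero>\<^sub>(K.MN 0)" using K.pure_zero_l[of 1 0] one_W0[of 1] by simp
qed

lemma coord_dK1:
  assumes a: "a \<in> carrier U" and c: "c \<in> X"
  shows "coord [c] (Suc 0) (dK (Suc 0) (K.pt 2 a rel0)) = a \<otimes>\<^sub>U cls (rstrip c rel0)"
proof -
  have r: "rel0 \<in> W (Suc (Suc 0))" using rel0_W by (simp add: numeral_2_eq_2)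
  have p: "pa c \<in> X" by (rule pa(1)[OF c])
  let ?z = "- sg c \<odot>\<^sub>U (a \<otimes>\<^sub>U cls (gen (pa c)))"
  have z: "?z \<in> carrier U" by (intro A.smult_closed A.m_closed a cls_gen p)
  have "coord [c] (Suc 0) (dK (Suc 0) (K.pt 2 a rel0)) =
      (\<Oplus>\<^sub>U x\<in>X. coef rel0 [x, c] \<odot>\<^sub>U (a \<otimes>\<^sub>U cls (gen x)))"
    using dK_pure[OF a r] coord_bd[OF a r, of "[c]"] by (simp add: numeral_2_eq_2)
  also have "\<dots> = (\<Oplus>\<^sub>U x\<in>X. if pa c = x then ?z else \<zero>\<^sub>U)"
  proof (intro A.finsum_cong' refl funcsetI)
    show "(if pa c = x then ?z else \<zero>\<^sub>U) \<in> carrier U" for x using z by auto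
    show "coef rel0 [x, c] \<odot>\<^sub>U (a \<otimes>\<^sub>U cls (gen x)) = (if pa c = x then ?z else \<zero>\<^sub>U)"
      if x: "x \<in> X" for x
      using A.smult_zero_l[OF A.m_closed[OF a cls_gen[OF x]]] x c pa_eq_iff[OF x c] pa_eq_iff[OF c x] pa(3)[OF c]
      by (auto simp: lookup_rel0)
  qed
  also have "\<dots> = ?z" by (rule A.finsum_singleton[OF p]) (use z in auto)
  also have "\<dots> = a \<otimes>\<^sub>U cls (rstrip c rel0)"
    unfolding rstrip_rel0[OF c] cls_smult[OF gen_T[OF p], symmetric]
    by (rule A.smult_mult_r[OF a cls_gen[OF p], symmetric])
  finally show ?thesis .
qed

text \<open>The conditions \<open>q \<in> I\<close> and zero constant term are carried along to make the set an ideal: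
  stripping a product \<open>q p\<close> leaves \<open>q\<close> times a strip of \<open>p\<close>, plus the constant term of \<open>p\<close> times
  the strip of \<open>q\<close>.\<close>

lemma ideal_rstrip:
  assumes "q \<in> I" shows "\<exists>b\<in>tens_space X. \<forall>j\<in>X. rstrip j q - b * rstrip j rel0 \<in> I"
proof -
  have rs: "rstrip j p \<in> tens_space X" if "p \<in> tens_space X" for j p
    unfolding rstrip_def by (rule tens_space_lin[OF that]) (auto intro!: tens_space_single dest: in_set_butlastD)
  let ?J = "{q \<in> I. coef q [] = 0 \<and> (\<exists>b\<in>tens_space X. \<forall>j\<in>X. rstrip j q - b * rstrip j rel0 \<in> I)}"
  have "I \<subseteq> ?J"
  proof (rule I_subset_rel)
    show "?J \<subseteq> tens_space X" using I_in by auto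
    have l: "coef rel [] = 0"
      unfolding rel_rel0 unfolding rel0_def lookup_sum
      by (rule sum.neutral) (simp add: lookup_mult_Nil gen_def lookup_single)
    have e: "rstrip j rel - 1 * rstrip j rel0 = 0" for j by (simp add: rel_rel0)
    show "rel \<in> ?J"
      by (intro CollectI conjI bexI[of _ 1] ballI rel_I tens_space_one l) (simp only: e I_zero)
    show "0 \<in> ?J"
      by (intro CollectI conjI bexI[of _ 0] ballI I_zero tens_space_zero) (simp_all add: rstrip_linear)
  next
    fix p q assume "p \<in> ?J" "q \<in> ?J"
    then obtain b b' where p: "p \<in> I" "q \<in> I" "coef p [] = 0" "coef q [] = 0"
      and b: "b \<in> tens_space X" "b' \<in> tens_space X"
        "!!j. j \<in> X ==> rstrip j p - b * rstrip j rel0 \<in> I" "!!j. j \<in> X ==> rstrip j q - b' * rstrip j rel0 \<in> I"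
      by blast
    have "rstrip j (p + q) - (b + b') * rstrip j rel0 \<in> I" if "j \<in> X" for j
      using I_add[OF b(3,4)[OF that]] by (simp add: rstrip_linear algebra_simps)
    then show "p + q \<in> ?J"
      by (intro CollectI conjI bexI[of _ "b + b'"] ballI I_add tens_space_add p b(1,2))
        (simp_all only: lookup_add p(3,4) add_0_left)
  next
    fix p q :: "(nat, 'k) tens" assume pT: "p \<in> tens_space X" and "q \<in> ?J"
    then obtain b where q: "q \<in> I" "coef q [] = 0" and b: "b \<in> tens_space X"
        "!!j. j \<in> X ==> rstrip j q - b * rstrip j rel0 \<in> I"
      by blast
    have "rstrip j (p * q) - (p * b) * rstrip j rel0 \<in> I" if "j \<in> X" for j
      using I_left[OF b(2)[OF that] pT] q(2) by (simp add: rstrip_mult algebra_simps)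
    then show "p * q \<in> ?J"
      by (intro CollectI conjI bexI[of _ "p * b"] ballI I_left tens_space_mult q(1) pT b(1))
        (simp_all only: lookup_mult_Nil q(2) mult_zero_right)
    have "rstrip j (q * p) - (scal (coef p []) * b) * rstrip j rel0 \<in> I" if "j \<in> X" for j
    proof -
      have "q * rstrip j p + scal (coef p []) * (rstrip j q - b * rstrip j rel0) \<in> I"
        by (intro I_add I_right[OF q(1) rs[OF pT]] I_left[OF b(2)[OF that]] tens_space_scal)
      then show ?thesis by (simp add: rstrip_mult algebra_simps)
    qed
    then show "q * p \<in> ?J"
      by (intro CollectI conjI bexI[of _ "scal (coef p []) * b"] ballI
          I_right tens_space_mult tens_space_scal q(1) pT b(1))
        (simp_all only: lookup_mult_Nil q(2) mult_zero_left)
  qed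
  then show ?thesis using assms by blast
qed

lemma degree_one_eqI:
  assumes "s \<in> carrier (K.MN i)" "t \<in> carrier (K.MN i)" "!!x. x \<in> X ==> coord [x] i s = coord [x] i t"
    and "i = 1"
  shows "s = t"
  using assms(1-3) unfolding assms(4) by (rule K1_eqI)

text \<open>In coordinates a cycle is a family with \<open>\<Sum> a\<^sub>x x = 0\<close> in \<open>A\<close>. Lifting it to an element \<open>\<Sum>
  p\<^sub>x x\<close> of the ideal and stripping the last letters recovers the \<open>p\<^sub>x\<close> as multiples of the strips
  of the relator, which is a boundary.\<close>

lemma exact_1: "{t \<in> carrier (K.MN (Suc 0)). dK 0 t = \<zero>\<^sub>(K.MN 0)} = dK (Suc 0) ` carrier (K.MN 2)"
proof (intro equalityI subsetI)
  fix t assume "t \<in> {t \<in> carrier (K.MN (Suc 0)). dK 0 t = \<zero>\<^sub>(K.MN 0)}"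
  then have t: "t \<in> carrier (K.MN (Suc 0))" and 0: "(\<Oplus>\<^sub>U x\<in>X. coord [x] (Suc 0) t \<otimes>\<^sub>U cls (gen x)) = \<zero>\<^sub>U"
    using dK0_zero_iff by auto
  have "\<forall>x. \<exists>p. p \<in> tens_space X \<and> coord [x] (Suc 0) t = cls p"
    using coord_closed[OF t] A_obtain by metis
  then obtain p where p: "!!x. p x \<in> tens_space X" "!!x. coord [x] (Suc 0) t = cls (p x)" by metis
  define q where "q = (\<Sum>x\<in>X. p x * gen x)"
  have pg: "p x * gen x \<in> tens_space X" if "x \<in> X" for x
    by (rule tens_space_mult[OF p(1) gen_T[OF that]])
  then have qT: "q \<in> tens_space X" unfolding q_def by (rule tens_space_sum)
  have "cls q = (\<Oplus>\<^sub>U x\<in>X. cls (p x * gen x))" unfolding q_def by (rule cls_sum) (rule pg)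
  also have "\<dots> = (\<Oplus>\<^sub>U x\<in>X. coord [x] (Suc 0) t \<otimes>\<^sub>U cls (gen x))"
  proof (intro A.finsum_cong' refl funcsetI A.m_closed coord_closed[OF t] cls_gen)
    fix x assume "x \<in> X"
    then show "cls (p x * gen x) = coord [x] (Suc 0) t \<otimes>\<^sub>U cls (gen x)"
      unfolding p(2) by (intro cls_mult[symmetric] p(1) gen_T)
  qed
  finally have qI: "q \<in> I" using 0 cls_zero_iff[OF qT] by simp
  obtain b where b: "b \<in> tens_space X" "\<forall>j\<in>X. rstrip j q - b * rstrip j rel0 \<in> I"
    by (rule bexE[OF ideal_rstrip[OF qI]])
  have rq: "rstrip j q = p j" if "j \<in> X" for j
    unfolding q_def rstrip_linear using that by (simp add: sum.delta)
  let ?s = "K.pt 2 (cls b) rel0"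
  have s: "?s \<in> carrier (K.MN 2)" by (rule K.pure_closed) (use b(1) rel0_W in auto)
  have s': "?s \<in> carrier (K.MN (Suc (Suc 0)))" using s by (simp only: numeral_2_eq_2)
  have "t = dK (Suc 0) ?s"
  proof (rule degree_one_eqI[OF t dK_closed[OF s'] _ One_nat_def[symmetric]])
    fix x assume x: "x \<in> X"
    have r: "rstrip x rel0 \<in> tens_space X"
      unfolding rstrip_rel0[OF x] by (intro tens_space_mult tens_space_scal gen_T pa(1) x)
    have "coord [x] (Suc 0) t = cls (b * rstrip x rel0)"
      using cls_eq_iff[OF p(1) tens_space_mult[OF b(1) r]] bspec[OF b(2) x]
      unfolding p(2) rq[OF x] by blast
    then show "coord [x] (Suc 0) t = coord [x] (Suc 0) (dK (Suc 0) ?s)"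
      unfolding coord_dK1[OF cls_closed[OF b(1)] x] cls_mult[OF b(1) r] .
  qed
  then show "t \<in> dK (Suc 0) ` carrier (K.MN 2)" using s by blast
next
  fix t assume "t \<in> dK (Suc 0) ` carrier (K.MN 2)"
  then obtain s where s: "s \<in> carrier (K.MN 2)" "t = dK (Suc 0) s" by blast
  obtain a where a: "a \<in> carrier U" "s = K.pt 2 a rel0" using K2_pure[OF s(1)] by blast
  have t: "t \<in> carrier (K.MN (Suc 0))"
    unfolding s(2) by (rule dK_closed) (use s(1) in \<open>simp only: numeral_2_eq_2\<close>)
  have rT: "rstrip x rel0 * gen x \<in> tens_space X" "rstrip x rel0 \<in> tens_space X" if x: "x \<in> X" for x
    unfolding rstrip_rel0[OF x] by (intro tens_space_mult tens_space_scal gen_T pa(1) x)+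
  have rc: "cls (rstrip x rel0 * gen x) \<in> carrier U" if "x \<in> X" for x
    by (rule cls_closed[OF rT(1)[OF that]])
  have "(\<Oplus>\<^sub>U x\<in>X. coord [x] (Suc 0) t \<otimes>\<^sub>U cls (gen x)) = (\<Oplus>\<^sub>U x\<in>X. a \<otimes>\<^sub>U cls (rstrip x rel0 * gen x))"
  proof (intro A.finsum_cong' refl funcsetI A.m_closed a(1) rc)
    fix x assume x: "x \<in> X"
    show "coord [x] (Suc 0) t \<otimes>\<^sub>U cls (gen x) = a \<otimes>\<^sub>U cls (rstrip x rel0 * gen x)"
      unfolding s(2) a(2) coord_dK1[OF a(1) x] cls_mult[OF rT(2)[OF x] gen_T[OF x], symmetric]
      by (rule A.m_assoc[OF a(1) cls_closed[OF rT(2)[OF x]] cls_gen[OF x]])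
  qed
  also have "\<dots> = a \<otimes>\<^sub>U (\<Oplus>\<^sub>U x\<in>X. cls (rstrip x rel0 * gen x))"
    by (rule A.finsum_rdistr[symmetric]) (use a(1) rc in auto)
  also have "(\<Oplus>\<^sub>U x\<in>X. cls (rstrip x rel0 * gen x)) = cls (\<Sum>x\<in>X. rstrip x rel0 * gen x)"
    by (rule cls_sum[symmetric]) (rule rT(1))
  also have "(\<Sum>x\<in>X. rstrip x rel0 * gen x) = rel0"
  proof -
    have "(\<Sum>x\<in>X. rstrip x rel0 * gen x) = (\<Sum>x\<in>X. scal (- sg x) * (gen (pa x) * gen x))"
      by (rule sum.cong) (simp_all only: rstrip_rel0 mult.assoc)
    also have "\<dots> = (\<Sum>x\<in>X. scal (sg (pa x)) * (gen (pa x) * gen (pa (pa x))))"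
      by (rule sum.cong) (simp_all only: pa(2,3))
    also have "\<dots> = (\<Sum>x\<in>X. scal (sg x) * (gen x * gen (pa x)))"
      by (rule sum.reindex_bij_betw[OF bij_pa])
    also have "\<dots> = rel0" unfolding rel0_def ..
    finally show "(\<Sum>x\<in>X. rstrip x rel0 * gen x) = rel0" .
  qed
  also have "a \<otimes>\<^sub>U cls rel0 = \<zero>\<^sub>U"
    using rel_I cls_zero_iff[OF rel0_in] A.r_null[OF a(1)] unfolding rel_rel0 by simp
  finally have "dK 0 t = \<zero>\<^sub>(K.MN 0)" using dK0_zero_iff[OF t] by simp
  then show "t \<in> {t \<in> carrier (K.MN (Suc 0)). dK 0 t = \<zero>\<^sub>(K.MN 0)}" using t by simp
qed

lemma mult_gen1_injective:
  assumes a: "a \<in> carrier U" and 0: "a \<otimes>\<^sub>U cls (gen 1) = \<zero>\<^sub>U"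
  shows "a = \<zero>\<^sub>U"
proof -
  obtain p where p: "p \<in> tens_space X" "a = cls p" by (rule A_obtain[OF a])
  have g: "gen 1 \<in> tens_space X" by (rule gen_T[OF one_X(1)])
  have pg: "p * gen 1 \<in> tens_space X" by (rule tens_space_mult[OF p(1) g])
  have "p * gen 1 \<in> I" using 0 unfolding p(2) cls_mult[OF p(1) g] cls_zero_iff[OF pg] .
  then have "N p * gen 1 = 0" using I_iff_N[OF pg] N_mult_gen1 by simp
  then have "N p = 0" using rstrip_mult_gen[of 1 "N p" 1] by (simp add: rstrip_linear)
  then show ?thesis using I_iff_N[OF p(1)] cls_zero_iff[OF p(1)] p(2) by simp
qed

lemma exact_2:
  assumes t: "t \<in> carrier (K.MN 2)" and 0: "dK (Suc 0) t = \<zero>\<^sub>(K.MN (Suc 0))"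
  shows "t = \<zero>\<^sub>(K.MN 2)"
proof -
  obtain a where a: "a \<in> carrier U" "t = K.pt 2 a rel0" using K2_pure[OF t] by blast
  have g: "gen 1 \<in> tens_space X" by (rule gen_T[OF one_X(1)])
  have "rstrip (m + 1) rel0 = gen 1"
    using rstrip_rel0[OF one_X(4)] m by (simp add: pa(6) sg_def)
  then have "a \<otimes>\<^sub>U cls (gen 1) = \<zero>\<^sub>U"
    using coord_dK1[OF a(1) one_X(4)] 0 a(2) by (simp add: coord_zero)
  then have "a = \<zero>\<^sub>U" by (rule mult_gen1_injective[OF a(1)])
  then show ?thesis using K.pure_zero_l[of rel0 2] rel0_W a(2) by simp
qed

theorem koszul: "N_koszul X 2 Prel"
  unfolding N_koszul_def
proof (intro conjI allI impI)
  show "Prel \<subseteq> tens_pow X 2" using W_2 W_pow[of _ 2] by auto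
  fix i :: nat assume "0 < i"
  then obtain i' where i: "i = Suc i'" by (cases i) auto
  have eqs: "{t \<in> carrier (K.MN i). koszul_diff X 2 Prel i t = \<zero>\<^sub>(K.MN i')} =
      {t \<in> carrier (K.MN i). dK i' t = \<zero>\<^sub>(K.MN i')}"
    "koszul_diff X 2 Prel (Suc i) ` carrier (K.MN (Suc i)) = dK i ` carrier (K.MN (Suc i))"
    using koszul_diff_eq[of _ i'] koszul_diff_eq[of _ i] unfolding i by auto
  have "{t \<in> carrier (K.MN i). dK i' t = \<zero>\<^sub>(K.MN i')} = dK i ` carrier (K.MN (Suc i))"
  proof (cases "i' = 0")
    case True
    then show ?thesis using exact_1 by (simp add: i numeral_2_eq_2)
  next
    case False
    then have im: "dK i ` carrier (K.MN (Suc i)) = {\<zero>\<^sub>(K.MN i)}"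
      using K_high[of "Suc i"] dK_zero[of i] i by simp
    show ?thesis
    proof (cases "i' = 1")
      case True
      then have i2: "i = 2" "i' = Suc 0" using i by simp_all
      have "{t \<in> carrier (K.MN 2). dK (Suc 0) t = \<zero>\<^sub>(K.MN (Suc 0))} = {\<zero>\<^sub>(K.MN 2)}"
        using exact_2 dK_zero[of "Suc 0", folded numeral_2_eq_2] by auto
      then show ?thesis unfolding im unfolding i2 .
    next
      case F: False
      then show ?thesis using False K_high[of i] dK_zero[of i'] unfolding im by (auto simp: i)
    qed
  qed
  then show "{t \<in> carrier (koszul_K X 2 Prel i). koszul_diff X 2 Prel i t = \<zero>\<^sub>(koszul_K X 2 Prel (i - 1))} =
      koszul_diff X 2 Prel (i + 1) ` carrier (koszul_K X 2 Prel (i + 1))"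
    using eqs by (simp add: K_eq i flip: Suc_eq_plus1)
qed simp_all

end

section \<open>The associated graded algebra\<close>

lemma lookup_tens_proj: "coef (tens_proj d p) w = (if length w = d then coef p w else 0)"
proof -
  have "coef (tens_proj d p) w =
      (\<Sum>u\<in>{u \<in> supp p. length u = d}. if u = w then coef p w else 0)"
    unfolding tens_proj_def lookup_sum by (rule sum.cong) (auto simp: lookup_single when_def)
  then show ?thesis by (auto simp: in_keys_iff)
qed

lemma tens_proj_linear:
  "tens_proj d 0 = 0" "tens_proj d (p + q) = tens_proj d p + tens_proj d q"
  "tens_proj d (p - q) = tens_proj d p - tens_proj d q" "tens_proj d (scal c * p) = scal c * tens_proj d p"
  "tens_proj d (\<Sum>i\<in>K. f i) = (\<Sum>i\<in>K. tens_proj d (f i))"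
  by (rule poly_mapping_eqI; simp add: lookup_tens_proj lookup_add lookup_minus lookup_sum)+

lemma tens_proj_single: "tens_proj d (monomial w c) = (if length w = d then monomial w c else 0)"
  by (rule poly_mapping_eqI) (auto simp: lookup_tens_proj lookup_single when_def)

lemma tens_proj_in: "p \<in> tens_space X ==> tens_proj d p \<in> tens_space X"
  by (induction rule: tens_space_induct) (auto simp: tens_proj_linear tens_proj_single intro: tens_space_add tens_space_single)

lemma tens_proj_pow: "p \<in> tens_pow X e ==> tens_proj d p = (if d = e then p else 0)"
  by (induction rule: tens_pow_induct) (auto simp: tens_proj_linear tens_proj_single)

lemma tens_proj_proj: "tens_proj d (tens_proj e p) = (if d = e then tens_proj d p else 0)"
  by (rule poly_mapping_eqI) (auto simp: lookup_tens_proj)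

lemma tens_proj_mult: "tens_proj d (p * q) = (\<Sum>i\<le>d. tens_proj i p * tens_proj (d - i) q)"
proof (induction p rule: tens_induct)
  case (single w c)
  show ?case
  proof (induction q rule: tens_induct)
    case (single u e)
    have "(\<Sum>i\<le>d. tens_proj i (monomial w c) * tens_proj (d - i) (monomial u e)) =
        (\<Sum>i\<le>d. if i = length w then tens_proj d (monomial w c * monomial u e) else 0)"
      by (rule sum.cong) (auto simp: tens_proj_single)
    then show ?case by (auto simp: tens_proj_single)
  qed (simp add: distrib_left tens_proj_linear sum.distrib)
qed (simp add: distrib_right tens_proj_linear sum.distrib)

lemma tens_proj_sum: "(\<Sum>d\<in>length ` supp p. tens_proj d p) = p"
  by (rule poly_mapping_eqI) (auto simp: lookup_sum lookup_tens_proj in_keys_iff)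

text \<open>Degree smaller than \<open>d\<close>; for \<open>d = 0\<close> this leaves only zero, in accordance with \<open>F\<^sup>-\<^sup>1 = 0\<close>.\<close>

definition low :: "nat => ('x, 'k::field) tens => bool"
  where "low d p \<longleftrightarrow> (\<forall>w. d \<le> length w --> coef p w = 0)"

lemma low_simps [simp]: "low d 0" "low 0 p \<longleftrightarrow> p = 0"
  by (auto simp: low_def intro: poly_mapping_eqI)

lemma low_add: "low d p ==> low d q ==> low d (p + q)"
  and low_diff: "low d p ==> low d q ==> low d (p - q)"
  and low_uminus: "low d p ==> low d (- p)"
  and low_scal: "low d p ==> low d (scal c * p)"
  and low_mono: "low d p ==> d \<le> e ==> low e p"
  and low_single: "length w < d ==> low d (monomial w c)"
  by (auto simp: low_def lookup_add lookup_minus lookup_single when_def)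

lemma low_sum: "(!!i. i \<in> K ==> low d (f i)) ==> low d (\<Sum>i\<in>K. f i)"
  by (auto simp: low_def lookup_sum)

lemma low_keys: "low d p \<longleftrightarrow> (\<forall>w\<in>supp p. length w < d)"
  unfolding low_def by (metis in_keys_iff not_less)

lemma low_mult: "low a p ==> low (Suc b) q ==> low (a + b) (p * q)"
  and low_mult': "low (Suc a) p ==> low b q ==> low (a + b) (p * q)"
  using keys_mult[of p q] by (fastforce simp: low_keys plus_list_def)+

lemma low_gen: "low d p ==> low (Suc d) (gen x * p)"
  using low_mult'[of 1 "gen x" d p] low_single[of "[x]" 2 1] by (simp add: gen_def numeral_2_eq_2 One_nat_def)

lemma tens_pow_low: "p \<in> tens_pow X d ==> low (Suc d) p"
  by (auto simp: tens_pow_def low_keys)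

lemma tens_pow_low_zero: "p \<in> tens_pow X d ==> low d p ==> p = 0"
  by (auto simp: tens_pow_def low_keys)

lemma tens_proj_low: "low (Suc d) (tens_proj d p)" "low (Suc d) p ==> low d (p - tens_proj d p)"
  by (auto simp: low_def lookup_tens_proj lookup_minus)

lemma tens_proj_in_pow: "p \<in> tens_space X ==> tens_proj d p \<in> tens_pow X d"
  unfolding tens_pow_def using tens_proj_in[of p X d]
  by (auto simp: in_keys_iff lookup_tens_proj split: if_splits)

lemma tens_filt_low: "tens_filt X d = {p \<in> tens_space X. low (Suc d) p}"
  by (auto simp: tens_filt_def low_keys less_Suc_eq_le)

lemma tens_pow_lin: "p \<in> tens_pow X d ==> (!!w. set w \<subseteq> X ==> length w = d ==> f w \<in> tens_pow X e) ==> lin f p \<in> tens_pow X e"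
  by (induction rule: tens_pow_induct) (auto simp: lin_add intro: tens_pow_add tens_pow_scal)

lemma nonemptyI: "x \<in> A ==> A \<noteq> {}" by auto

lemma UN_const2:
  assumes "A \<noteq> {}" "B \<noteq> {}" "!!u w. u \<in> A ==> w \<in> B ==> f u w = c"
  shows "(\<Union>u\<in>A. \<Union>w\<in>B. f u w) = c"
  using assms by auto

locale pbw = weyl m vc l + G: symplectic m c0 l0
  for m :: nat and vc :: "nat => 'k::field" and l :: 'k and c0 :: "nat => 'k" and l0 :: 'k
begin

text \<open>The homogeneous relation rewrites within one degree, and the terms contributed by the linear
  part and the constant have smaller degree.\<close>

lemma A1_graded:
  "set w \<subseteq> X ==> G.A1 w \<in> tens_pow X (Suc (length w)) \<and> low (Suc (length w)) (A1 w - G.A1 w)"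
proof (induction w)
  case Nil
  have "(wd [1] :: (nat, 'k) tens) \<in> tens_pow X (Suc 0)" using one_X by (intro tens_pow_single) auto
  then show ?case by simp
next
  case (Cons a w)
  then have IH: "G.A1 w \<in> tens_pow X (Suc (length w))" "low (Suc (length w)) (A1 w - G.A1 w)"
    and aw: "a \<in> X" "set w \<subseteq> X" by auto
  show ?case
  proof (cases "a = m + 1")
    case True
    let ?s = "\<Sum>j\<in>X - {1, m + 1}. scal (sg j) * wd (j # pa j # w) :: (nat, 'k) tens"
    let ?v = "(\<Sum>j\<in>X. scal (vc j) * (if j = 1 then A1 w else wd (j # w))) + scal l * wd w"
    have G: "G.A1 (a # w) = gen (m + 1) * G.A1 w - ?s"
    proof -
      have c: "scal (c0 j) = (0 :: (nat, 'k) tens)" for j by (simp add: G.vc_zero)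
      have "scal l0 = (0 :: (nat, 'k) tens)" by (simp add: G.l_zero)
      then show ?thesis unfolding G.A1.simps using True by (simp only: c if_True) simp
    qed
    have s: "?s \<in> tens_pow X (Suc (length (a # w)))"
      by (intro tens_pow_sum tens_pow_scal tens_pow_single) (use aw pa(1) in auto)
    have g: "gen (m + 1) * G.A1 w \<in> tens_pow X (Suc (length (a # w)))"
      using tens_pow_mult[OF tens_pow_gen[OF one_X(4)] IH(1)] by (simp add: plus_1_eq_Suc)
    have "gen (m + 1) * G.A1 w + scal (- 1) * ?s \<in> tens_pow X (Suc (length (a # w)))"
      by (intro tens_pow_add tens_pow_scal g s)
    then have 1: "G.A1 (a # w) \<in> tens_pow X (Suc (length (a # w)))" unfolding G by simp
    have A1: "A1 w = (A1 w - G.A1 w) + G.A1 w" by simp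
    have "low (Suc (Suc (length w))) (A1 w)"
      by (subst A1, intro low_add[OF low_mono[OF IH(2)] tens_pow_low[OF IH(1)]]) simp
    then have "low (Suc (Suc (length w))) (?v + gen (m + 1) * (A1 w - G.A1 w))"
      by (intro low_add low_sum low_scal low_gen IH(2)) (auto intro!: low_scal low_single)
    moreover have "A1 (a # w) - G.A1 (a # w) = ?v + gen (m + 1) * (A1 w - G.A1 w)"
      unfolding G using True by (simp add: right_diff_distrib)
    ultimately show ?thesis using 1 by simp
  next
    case False
    have "(wd (1 # a # w) :: (nat, 'k) tens) \<in> tens_pow X (Suc (length (a # w)))"
      using one_X aw by (intro tens_pow_single) auto
    then show ?thesis using False by simp
  qed
qed

lemma act_graded:
  assumes "j \<in> X" "p \<in> tens_pow X d"
  shows "G.act j p \<in> tens_pow X (Suc d)" "low (Suc d) (act j p - G.act j p)"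
proof -
  show "G.act j p \<in> tens_pow X (Suc d)"
  proof (cases "j = 1")
    case True
    then show ?thesis unfolding G.act_def using A1_graded by (auto intro!: tens_pow_lin[OF assms(2)])
  next
    case False
    then show ?thesis unfolding G.act_def using tens_pow_mult[OF tens_pow_gen[OF assms(1)] assms(2)] by (simp add: plus_1_eq_Suc)
  qed
  show "low (Suc d) (act j p - G.act j p)"
  proof (cases "j = 1")
    case True
    have "low (Suc d) (lin A1 p - lin G.A1 p)" using assms(2)
    proof (induction rule: tens_pow_induct)
      case (single w c)
      then have "low (Suc d) (scal c * (A1 w - G.A1 w))" using A1_graded[of w] by (auto intro: low_scal)
      then show ?case by (simp add: right_diff_distrib)
    next
      case (add p q)
      have e: "lin A1 (p + q) - lin G.A1 (p + q) = (lin A1 p - lin G.A1 p) + (lin A1 q - lin G.A1 q)"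
        by (simp add: lin_add)
      show ?case unfolding e by (rule low_add[OF add(3,4)])
    qed simp
    then show ?thesis using True by (simp add: act_def G.act_def)
  qed (simp add: act_def G.act_def)
qed

lemma act_low:
  assumes j: "j \<in> X" and p: "p \<in> tens_space X" "low d p"
  shows "low (Suc d) (act j p)"
proof (cases "j = 1")
  case True
  have "low (Suc d) (lin A1 p)"
    unfolding lin_def
  proof (intro low_sum low_scal)
    fix w assume "w \<in> supp p"
    then have w: "set w \<subseteq> X" "length w < d" using p by (auto simp: tens_space_def low_keys)
    have A1: "A1 w = (A1 w - G.A1 w) + G.A1 w" by simp
    have "low (Suc (Suc (length w))) (A1 w)"
      by (subst A1, intro low_add[OF low_mono[OF conjunct2[OF A1_graded[OF w(1)]]]
        tens_pow_low[OF conjunct1[OF A1_graded[OF w(1)]]]]) simp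
    then show "low (Suc d) (A1 w)" using w(2) by (auto intro: low_mono)
  qed
  then show ?thesis using True by (simp add: act_def)
qed (use p(2) in \<open>simp add: act_def low_gen\<close>)

lemma N_word:
  "set w \<subseteq> X ==> G.N (wd w) \<in> tens_pow X (length w) \<and> low (length w) (N (wd w) - G.N (wd w))"
proof (induction w)
  case Nil
  have "(1 :: (nat, 'k) tens) \<in> tens_pow X 0" unfolding one_wd by (rule tens_pow_single) auto
  then show ?case by (simp add: N_def G.N_def actp_def G.actp_def)
next
  case (Cons j w)
  then have j: "j \<in> X" "set w \<subseteq> X" and IH: "G.N (wd w) \<in> tens_pow X (length w)" "low (length w) (N (wd w) - G.N (wd w))"
    by auto
  have e: "N (wd (j # w)) = act j (N (wd w))" "G.N (wd (j # w)) = G.act j (G.N (wd w))"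
    by (simp_all add: N_def G.N_def actp_def G.actp_def)
  have d: "act j (N (wd w)) - G.act j (G.N (wd w)) =
      act j (N (wd w) - G.N (wd w)) + (act j (G.N (wd w)) - G.act j (G.N (wd w)))"
    using act_add[of j "N (wd w) - G.N (wd w)" "G.N (wd w)"] by simp
  have T: "N (wd w) - G.N (wd w) \<in> tens_space X"
    by (intro tens_space_diff N_in G.N_in tens_space_single j(2))
  show ?case
    unfolding e d using act_graded[OF j(1) IH(1)] act_low[OF j(1) T IH(2)] by (auto intro: low_add)
qed

lemma N_graded:
  "p \<in> tens_pow X d ==> G.N p \<in> tens_pow X d \<and> low d (N p - G.N p)"
proof (induction rule: tens_pow_induct)
  case (single w c)
  have e: "N (scal c * wd w) = scal c * N (wd w)" "G.N (scal c * wd w) = scal c * G.N (wd w)"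
    by (rule N_scal G.N_scal)+
  show ?case using N_word[of w] single unfolding e[unfolded scal_wd] right_diff_distrib[symmetric]
    by (auto intro: tens_pow_scal low_scal)
next
  case (add p q)
  have e: "N (p + q) - G.N (p + q) = (N p - G.N p) + (N q - G.N q)" by (simp add: N_add G.N_add)
  show ?case unfolding e unfolding G.N_add using add(3,4) by (auto intro: tens_pow_add low_add)
qed (simp add: N_def G.N_def actp_def G.actp_def)

lemma N_sum: "N (\<Sum>i\<in>K. f i) = (\<Sum>i\<in>K. N (f i))"
  by (induction K rule: infinite_finite_induct) (simp_all add: N_add)

lemma N_low: "p \<in> tens_space X ==> low d p ==> low d (N p)"
proof -
  assume p: "p \<in> tens_space X" "low d p"
  have "N p = (\<Sum>e\<in>length ` supp p. N (tens_proj e p))"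
    by (simp only: N_sum[symmetric] tens_proj_sum)
  moreover have "low d (N (tens_proj e p))" if "e \<in> length ` supp p" for e
  proof -
    have e: "e < d" using that p(2) by (auto simp: low_keys)
    let ?q = "tens_proj e p"
    have q: "N ?q = (N ?q - G.N ?q) + G.N ?q" by simp
    show ?thesis
      by (subst q, intro low_add low_mono[OF conjunct2[OF N_graded[OF tens_proj_in_pow[OF p(1)]]]]
        low_mono[OF tens_pow_low[OF conjunct1[OF N_graded[OF tens_proj_in_pow[OF p(1)]]]]]) (use e in auto)
  qed
  ultimately show ?thesis by (simp add: low_sum)
qed

text \<open>Both normal forms of \<open>h\<close> agree up to degree \<open>d - 1\<close>, and so does the normal form of \<open>g\<close>;
  hence the part of degree \<open>d\<close>, which is the graded normal form, vanishes.\<close>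

lemma homogeneous_in_graded_ideal:
  assumes h: "h \<in> tens_pow X d" and g: "g \<in> tens_space X" "low d g" and hg: "cls h = cls g"
  shows "h \<in> G.I"
proof -
  have hT: "h \<in> tens_space X" by (rule tens_pow_space[OF h])
  have "N h = N g" using hg cls_eq_N[OF hT g(1)] by blast
  then have "low d (N h)" using N_low[OF g] by simp
  moreover have "G.N h = N h - (N h - G.N h)" by simp
  ultimately have "low d (G.N h)" using N_graded[OF h] low_diff by metis
  then have "G.N h = 0" using N_graded[OF h] by (intro tens_pow_low_zero) auto
  then show ?thesis using G.I_iff_N[OF hT] by simp
qed

abbreviation "F \<equiv> quot_filt X Prel"
abbreviation "gr \<equiv> gr_ring U F"

lemma filt_eq: "F d = cls ` {q \<in> tens_space X. low (Suc d) q}"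
  by (simp add: quot_filt_def tens_filt_low)

lemma below_eq: "filt_below U F d = cls ` {q \<in> tens_space X. low d q}"
proof (cases d)
  case 0
  have "{q :: (nat, 'k) tens. q \<in> tens_space X \<and> low 0 q} = {0}" by auto
  then show ?thesis using 0 by (simp add: filt_below_def A_simps(2))
qed (simp add: filt_below_def filt_eq)

text \<open>The coset of \<open>p\<close> in \<open>F\<^sup>d / F\<^sup>d\<^sup>-\<^sup>1\<close>, when \<open>p\<close> has degree at most \<open>d\<close>.\<close>

definition co :: "nat => (nat, 'k) tens => (nat, 'k) tens set set"
  where "co d p = filt_below U F d +>\<^sub>U cls p"

lemma co_eq: "p \<in> tens_space X ==> co d p = cls ` {q \<in> tens_space X. low d (q - p)}"
proof -
  assume p: "p \<in> tens_space X"
  have 1: "co d p = (\<lambda>g. cls g \<oplus>\<^sub>U cls p) ` {g \<in> tens_space X. low d g}"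
    unfolding co_def a_r_coset_def' below_eq by auto
  also have "\<dots> = (\<lambda>g. cls (g + p)) ` {g \<in> tens_space X. low d g}"
    by (rule image_cong) (use cls_add p in auto)
  also have "\<dots> = cls ` {q \<in> tens_space X. low d (q - p)}"
  proof (intro equalityI subsetI)
    fix x assume "x \<in> (\<lambda>g. cls (g + p)) ` {g \<in> tens_space X. low d g}"
    then obtain g where "g \<in> tens_space X" "low d g" "x = cls (g + p)" by blast
    then show "x \<in> cls ` {q \<in> tens_space X. low d (q - p)}"
      using p by (intro image_eqI[of _ _ "g + p"]) (auto intro: tens_space_add)
  next
    fix x assume "x \<in> cls ` {q \<in> tens_space X. low d (q - p)}"
    then obtain q where "q \<in> tens_space X" "low d (q - p)" "x = cls q" by blast
    then show "x \<in> (\<lambda>g. cls (g + p)) ` {g \<in> tens_space X. low d g}"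
      using p by (intro image_eqI[of _ _ "q - p"]) (auto intro: tens_space_diff)
  qed
  finally show ?thesis .
qed

lemma co_zero: "co d 0 = filt_below U F d"
  by (simp add: co_eq below_eq)

lemma co_cong:
  assumes "p \<in> tens_space X" "q \<in> tens_space X" "low d (p - q)" shows "co d p = co d q"
proof -
  have "low d (x - p) \<longleftrightarrow> low d (x - q)" for x
    using low_add[OF assms(3), of "x - p"] low_diff[of d "x - q" "p - q"] assms(3) by auto
  then show ?thesis using assms by (simp add: co_eq)
qed

lemma co_eqD:
  assumes "p \<in> tens_space X" "q \<in> tens_space X" "co d p = co d q"
  shows "\<exists>g\<in>tens_space X. low d g \<and> cls (p - q) = cls g"
proof -
  have "cls p \<in> co d p" unfolding co_eq[OF assms(1)] using assms(1) by auto
  then obtain x where x: "x \<in> tens_space X" "low d (x - q)" "cls p = cls x"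
    unfolding assms(3) co_eq[OF assms(2)] by auto
  have "p - x \<in> I" using x cls_eq_iff assms(1) by blast
  then have "cls (p - q) = cls (x - q)"
    using x assms(1,2) cls_eq_iff[of "p - q" "x - q"] by (simp add: tens_space_diff)
  then show ?thesis using x assms(2) by (intro bexI[of _ "x - q"]) (auto intro: tens_space_diff)
qed

lemma co_cong_cls:
  assumes "p \<in> tens_space X" "q \<in> tens_space X" "g \<in> tens_space X" "low d g" "cls (p - q) = cls g"
  shows "co d p = co d q"
proof -
  have T: "p - q \<in> tens_space X" "q + g \<in> tens_space X"
    using assms(1-3) by (auto intro: tens_space_diff tens_space_add)
  have "p - (q + g) \<in> I" using cls_eq_iff[OF T(1) assms(3)] assms(5) by (simp add: diff_diff_eq)
  then have "cls p = cls (q + g)" using cls_eq_iff[OF assms(1) T(2)] by blast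
  then have "co d p = co d (q + g)" by (simp add: co_def)
  also have "\<dots> = co d q" by (rule co_cong[OF T(2) assms(2)]) (use assms(4) in simp)
  finally show ?thesis .
qed

definition symb :: "(nat, 'k) tens => nat => (nat, 'k) tens set set"
  where "symb p d = co d (tens_proj d p)"

lemma co_mem: "p \<in> tens_space X ==> cls p \<in> co d p"
  by (auto simp: co_eq)

lemma co_memD: "x \<in> co d p ==> p \<in> tens_space X ==> \<exists>q. q \<in> tens_space X \<and> low d (q - p) \<and> x = cls q"
  unfolding co_eq by (erule imageE) blast

text \<open>The product in the associated graded ring is a union over all choices of representatives;
  each choice changes the sum of products only in smaller degree, so that all the cosets
  coincide.\<close>

lemma symb_mult:
  assumes p: "p \<in> tens_space X" and q: "q \<in> tens_space X"
  shows "symb p \<otimes>\<^sub>gr symb q = symb (p * q)"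
proof (rule ext)
  fix d
  let ?u = "{u. \<forall>i\<le>d. u i \<in> symb p i}" and ?w = "{w. \<forall>i\<le>d. w i \<in> symb q i}"
  have "(\<Union>u\<in>?u. \<Union>w\<in>?w. filt_below U F d +>\<^sub>U (\<Oplus>\<^sub>U i\<in>{..d}. u i \<otimes>\<^sub>U w (d - i))) = symb (p * q) d"
  proof (rule UN_const2)
    have mem: "(\<lambda>i. cls (tens_proj i p)) \<in> ?u" "(\<lambda>i. cls (tens_proj i q)) \<in> ?w"
      by (simp_all add: symb_def co_mem[OF tens_proj_in[OF p]] co_mem[OF tens_proj_in[OF q]])
    show "?u \<noteq> {}" by (rule nonemptyI[OF mem(1)])
    show "?w \<noteq> {}" by (rule nonemptyI[OF mem(2)])
    fix u w assume u: "u \<in> ?u" and w: "w \<in> ?w"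
    have exP: "\<exists>x. x \<in> tens_space X \<and> low i (x - tens_proj i p) \<and> u i = cls x" if "i \<le> d" for i
    proof -
      have "u i \<in> symb p i" by (rule CollectD[OF u, THEN spec, THEN mp, OF that])
      then show ?thesis unfolding symb_def by (rule co_memD[OF _ tens_proj_in[OF p]])
    qed
    define P where "P i = (SOME x. x \<in> tens_space X \<and> low i (x - tens_proj i p) \<and> u i = cls x)" for i
    have P': "P i \<in> tens_space X \<and> low i (P i - tens_proj i p) \<and> u i = cls (P i)" if "i \<le> d" for i
      unfolding P_def by (rule someI_ex[OF exP[OF that]])
    have P: "i \<le> d ==> P i \<in> tens_space X" "i \<le> d ==> low i (P i - tens_proj i p)" "i \<le> d ==> u i = cls (P i)" for i
      using P'[of i] by blast+
    have exQ: "\<exists>x. x \<in> tens_space X \<and> low i (x - tens_proj i q) \<and> w i = cls x" if "i \<le> d" for i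
    proof -
      have "w i \<in> symb q i" by (rule CollectD[OF w, THEN spec, THEN mp, OF that])
      then show ?thesis unfolding symb_def by (rule co_memD[OF _ tens_proj_in[OF q]])
    qed
    define Q where "Q i = (SOME x. x \<in> tens_space X \<and> low i (x - tens_proj i q) \<and> w i = cls x)" for i
    have Q': "Q i \<in> tens_space X \<and> low i (Q i - tens_proj i q) \<and> w i = cls (Q i)" if "i \<le> d" for i
      unfolding Q_def by (rule someI_ex[OF exQ[OF that]])
    have Q: "i \<le> d ==> Q i \<in> tens_space X" "i \<le> d ==> low i (Q i - tens_proj i q)" "i \<le> d ==> w i = cls (Q i)" for i
      using Q'[of i] by blast+
    have PQ: "P i * Q (d - i) \<in> tens_space X" if "i \<in> {..d}" for i
      using that by (intro tens_space_mult P(1) Q(1)) auto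
    have "(\<Oplus>\<^sub>U i\<in>{..d}. u i \<otimes>\<^sub>U w (d - i)) = (\<Oplus>\<^sub>U i\<in>{..d}. cls (P i * Q (d - i)))"
      by (intro A.finsum_cong' refl) (use PQ P Q in \<open>auto simp: cls_mult\<close>)
    also have "\<dots> = cls (\<Sum>i\<le>d. P i * Q (d - i))" by (rule cls_sum[symmetric]) (rule PQ)
    finally have "filt_below U F d +>\<^sub>U (\<Oplus>\<^sub>U i\<in>{..d}. u i \<otimes>\<^sub>U w (d - i)) = co d (\<Sum>i\<le>d. P i * Q (d - i))"
      by (simp add: co_def)
    also have "\<dots> = co d (tens_proj d (p * q))"
    proof (rule co_cong)
      show "(\<Sum>i\<le>d. P i * Q (d - i)) \<in> tens_space X" by (rule tens_space_sum[OF PQ])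
      show "tens_proj d (p * q) \<in> tens_space X" by (intro tens_proj_in tens_space_mult p q)
      have "low d (P i * Q (d - i) - tens_proj i p * tens_proj (d - i) q)" if i: "i \<in> {..d}" for i
      proof -
        have id: "i + (d - i) = d" "i \<le> d" "d - i \<le> d" using i by auto
        have Qi: "low (Suc (d - i)) (Q (d - i))"
        proof -
          have "low (Suc (d - i)) ((Q (d - i) - tens_proj (d - i) q) + tens_proj (d - i) q)"
            by (intro low_add low_mono[OF Q(2)[OF id(3)]] tens_proj_low(1)) simp
          then show ?thesis by simp
        qed
        have "low (i + (d - i)) ((P i - tens_proj i p) * Q (d - i) +
            tens_proj i p * (Q (d - i) - tens_proj (d - i) q))"
          by (rule low_add[OF low_mult[OF P(2)[OF id(2)] Qi] low_mult'[OF tens_proj_low(1) Q(2)[OF id(3)]]])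
        then show ?thesis unfolding id(1) by (simp add: algebra_simps)
      qed
      then show "low d ((\<Sum>i\<le>d. P i * Q (d - i)) - tens_proj d (p * q))"
        unfolding tens_proj_mult sum_subtractf[symmetric] by (rule low_sum)
    qed
    finally show "filt_below U F d +>\<^sub>U (\<Oplus>\<^sub>U i\<in>{..d}. u i \<otimes>\<^sub>U w (d - i)) = symb (p * q) d"
      unfolding symb_def .
  qed
  then show "(symb p \<otimes>\<^sub>gr symb q) d = symb (p * q) d" by (simp add: gr_ring_def)
qed

lemma symb_add:
  assumes p: "p \<in> tens_space X" and q: "q \<in> tens_space X"
  shows "symb p \<oplus>\<^sub>gr symb q = symb (p + q)"
proof (rule ext)
  fix d
  let ?p = "tens_proj d p" and ?q = "tens_proj d q"
  have T: "?p \<in> tens_space X" "?q \<in> tens_space X" "?p + ?q \<in> tens_space X"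
    using p q by (auto intro: tens_proj_in tens_space_add)
  have "co d ?p <+>\<^sub>U co d ?q = co d (?p + ?q)"
  proof (intro equalityI subsetI)
    fix x assume "x \<in> co d ?p <+>\<^sub>U co d ?q"
    then obtain a b where ab: "a \<in> tens_space X" "b \<in> tens_space X" "low d (a - ?p)" "low d (b - ?q)"
      "x = cls a \<oplus>\<^sub>U cls b"
      unfolding set_add_def' co_eq[OF T(1)] co_eq[OF T(2)] by auto
    show "x \<in> co d (?p + ?q)"
      unfolding co_eq[OF T(3)] ab(5) cls_add[OF ab(1,2)] 
      by (intro imageI CollectI conjI tens_space_add ab(1,2)) (use low_add[OF ab(3,4)] in \<open>simp only: add_diff_eq diff_add_eq diff_diff_eq add.commute[of ?q ?p]\<close>)
  next
    fix x assume "x \<in> co d (?p + ?q)"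
    then obtain z where z: "z \<in> tens_space X" "low d (z - (?p + ?q))" "x = cls z"
      unfolding co_eq[OF T(3)] by auto
    have zq: "z - ?q \<in> tens_space X" by (intro tens_space_diff z(1) T)
    have "low d (z - ?q - ?p)" using z(2) by (simp only: diff_diff_eq add.commute[of ?q ?p])
    then have "cls (z - ?q) \<in> co d ?p" unfolding co_eq[OF T(1)] using zq by blast
    moreover have "cls ?q \<in> co d ?q" by (rule co_mem[OF T(2)])
    moreover have "x = cls (z - ?q) \<oplus>\<^sub>U cls ?q" using z(3) cls_add[OF zq T(2)] by simp
    ultimately show "x \<in> co d ?p <+>\<^sub>U co d ?q" unfolding set_add_def' by blast
  qed
  then show "(symb p \<oplus>\<^sub>gr symb q) d = symb (p + q) d"
    by (simp add: gr_ring_def symb_def tens_proj_linear)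
qed

lemma symb_one: "symb 1 = \<one>\<^sub>gr"
proof (rule ext)
  fix d
  show "symb 1 d = \<one>\<^sub>gr d"
    by (simp add: symb_def gr_ring_def one_wd tens_proj_single co_zero A_simps(3) co_def[symmetric])
qed

lemma symb_closed:
  assumes p: "p \<in> tens_space X" shows "symb p \<in> carrier gr"
proof -
  have "\<exists>u\<in>F d. symb p d = filt_below U F d +>\<^sub>U u" for d
    unfolding symb_def co_def filt_eq
    by (intro bexI[of _ "cls (tens_proj d p)"] refl imageI CollectI conjI tens_proj_in[OF p] tens_proj_low(1))
  moreover have "{d. symb p d \<noteq> filt_below U F d} \<subseteq> length ` supp p"
  proof
    fix d assume d: "d \<in> {d. symb p d \<noteq> filt_below U F d}"
    have "tens_proj d p = 0" if "d \<notin> length ` supp p"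
      by (rule poly_mapping_eqI) (use that in \<open>auto simp: lookup_tens_proj in_keys_iff image_iff\<close>)
    then show "d \<in> length ` supp p" using d by (auto simp: symb_def co_zero)
  qed
  then have "finite {d. symb p d \<noteq> filt_below U F d}" by (rule finite_subset) simp
  ultimately show ?thesis by (simp add: gr_ring_def)
qed

lemma symb_onto:
  assumes s: "s \<in> carrier gr" shows "\<exists>p\<in>tens_space X. s = symb p"
proof -
  let ?D = "{d. s d \<noteq> filt_below U F d}"
  have fin: "finite ?D" using s by (simp add: gr_ring_def)
  have "\<forall>d. \<exists>g. g \<in> tens_space X \<and> low (Suc d) g \<and> s d = co d g"
    using s unfolding gr_ring_def co_def filt_eq by fastforce
  then obtain g where g: "!!d. g d \<in> tens_space X" "!!d. low (Suc d) (g d)" "!!d. s d = co d (g d)"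
    by metis
  let ?p = "\<Sum>d\<in>?D. tens_proj d (g d)"
  have p: "?p \<in> tens_space X" by (intro tens_space_sum tens_proj_in g)
  have "s d = symb ?p d" for d
  proof -
    have "tens_proj d ?p = (\<Sum>e\<in>?D. if e = d then tens_proj d (g d) else 0)"
      unfolding tens_proj_linear by (rule sum.cong) (auto simp: tens_proj_proj)
    then have e: "tens_proj d ?p = (if d \<in> ?D then tens_proj d (g d) else 0)" using fin by simp
    show ?thesis
    proof (cases "d \<in> ?D")
      case True
      have "co d (g d) = co d (tens_proj d (g d))"
        by (rule co_cong[OF g(1) tens_proj_in[OF g(1)] tens_proj_low(2)[OF g(2)]])
      then show ?thesis using e True g(3) by (simp add: symb_def)
    next
      case False
      then have "s d = filt_below U F d" by simp
      then show ?thesis unfolding symb_def e using False by (simp add: co_zero)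
    qed
  qed
  then have "s = symb ?p" by (rule ext)
  then show ?thesis using p by (rule bexI)
qed

text \<open>From right to left, the elements whose symbol vanishes form an ideal containing the
  homogeneous relator, since in \<open>U\<close> the latter equals an element of degree at most 1.\<close>

lemma symb_eq_iff:
  assumes p: "p \<in> tens_space X" and q: "q \<in> tens_space X"
  shows "symb p = symb q \<longleftrightarrow> p - q \<in> G.I"
proof
  assume pq: "symb p = symb q"
  have d: "tens_proj d (p - q) \<in> G.I" for d
  proof -
    have "co d (tens_proj d p) = co d (tens_proj d q)" using fun_cong[OF pq, of d] by (simp add: symb_def)
    from co_eqD[OF tens_proj_in[OF p] tens_proj_in[OF q] this]
    obtain g where "g \<in> tens_space X" "low d g" "cls (tens_proj d (p - q)) = cls g"
      by (auto simp: tens_proj_linear)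
    then show ?thesis
      by (rule homogeneous_in_graded_ideal[OF tens_proj_in_pow[OF tens_space_diff[OF p q]]])
  qed
  have "(\<Sum>d\<in>K. tens_proj d (p - q)) \<in> G.I" for K
    by (induction K rule: infinite_finite_induct) (simp_all add: G.I_add d)
  from this[of "length ` supp (p - q)"] show "p - q \<in> G.I" unfolding tens_proj_sum .
next
  let ?J = "{r \<in> tens_space X. \<forall>d. \<exists>g\<in>tens_space X. low d g \<and> cls (tens_proj d r) = cls g}"
  have JI: "r \<in> ?J \<longleftrightarrow> r \<in> tens_space X \<and> symb r = symb 0" for r
  proof
    assume r: "r \<in> ?J"
    have "symb r d = symb 0 d" for d
    proof -
      obtain g where g: "g \<in> tens_space X" "low d g" "cls (tens_proj d r) = cls g" using r by blast
      show ?thesis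
        unfolding symb_def
        by (rule co_cong_cls[OF tens_proj_in tens_proj_in g(1,2)]) (use r g(3) in \<open>auto simp: tens_proj_linear\<close>)
    qed
    then show "r \<in> tens_space X \<and> symb r = symb 0" using r by auto
  next
    assume r: "r \<in> tens_space X \<and> symb r = symb 0"
    have "\<exists>g\<in>tens_space X. low d g \<and> cls (tens_proj d r - tens_proj d 0) = cls g" for d
      by (rule co_eqD[OF tens_proj_in tens_proj_in]) (use r in \<open>auto simp: symb_def dest: fun_cong[of _ _ d]\<close>)
    then show "r \<in> ?J" using r by (simp add: tens_proj_linear)
  qed
  have zz: "symb r = symb 0 ==> r \<in> tens_space X ==> p \<in> tens_space X ==> symb (p * r) = symb 0 \<and> symb (r * p) = symb 0"
    for r p
    using symb_mult[of p r] symb_mult[of r p] symb_mult[of p 0] symb_mult[of 0 p] by simp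
  have sub: "G.I \<subseteq> {r. r \<in> tens_space X \<and> symb r = symb 0}"
  proof (rule G.I_subset_rel, goal_cases)
    case 2
    have r0: "G.rel = rel + (vec + scal l)" unfolding G.rel_rel0 by (simp add: rel_def)
    have vl: "vec + scal l \<in> tens_space X" by (intro tens_space_add vec_in tens_space_scal)
    have low2: "low 2 (vec + scal l)"
      unfolding vec_def by (intro low_add low_sum low_scal) (auto simp: gen_def scal_def intro: low_single)
    have "cls (rel0 - 0) = cls (vec + scal l)"
      using cls_eq_iff[OF rel0_in vl] rel_I by (simp add: diff_diff_eq[symmetric] rel_def[symmetric])
    then have 2: "co 2 rel0 = co 2 0"
      by (intro co_cong_cls[OF rel0_in _ vl low2]) simp_all
    have "symb rel0 d = symb 0 d" for d
      using 2 tens_proj_pow[OF G.rel0_pow, of d] by (auto simp: symb_def tens_proj_linear)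
    then show ?case using rel0_in by (auto simp: G.rel_rel0)
  next
    case (4 p q)
    then show ?case using symb_add[of p q] symb_add[of 0 0] by (auto intro: tens_space_add)
  next
    case (5 p q)
    then show ?case using zz[of q p] by (auto intro: tens_space_mult)
  next
    case (6 p q)
    then show ?case using zz[of q p] by (auto intro: tens_space_mult)
  qed auto
  assume "p - q \<in> G.I"
  then have "symb (p - q) = symb 0" using sub by blast
  then have "symb (p - q) \<oplus>\<^sub>gr symb q = symb 0 \<oplus>\<^sub>gr symb q" by simp
  then show "symb p = symb q" using p q by (simp add: symb_add tens_space_diff)
qed

definition grmap :: "(nat, 'k) tens set => nat => (nat, 'k) tens set set"
  where "grmap a = symb (SOME p. p \<in> tens_space X \<and> G.cls p = a)"

lemma grmap_cls: "p \<in> tens_space X ==> grmap (G.cls p) = symb p"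
proof -
  assume p: "p \<in> tens_space X"
  have q: "(SOME q. q \<in> tens_space X \<and> G.cls q = G.cls p) \<in> tens_space X \<and>
      G.cls (SOME q. q \<in> tens_space X \<and> G.cls q = G.cls p) = G.cls p"
    by (rule someI[of _ p]) (use p in simp)
  then show ?thesis unfolding grmap_def using G.cls_eq_iff[of _ p] symb_eq_iff[of _ p] p by blast
qed

lemma grmap_iso: "grmap \<in> ring_iso G.U gr"
  unfolding ring_iso_def
proof (intro CollectI conjI)
  show "grmap \<in> ring_hom G.U gr"
  proof (rule ring_hom_memI)
    fix a assume "a \<in> carrier G.U"
    then obtain p where p: "p \<in> tens_space X" "a = G.cls p" by (rule G.A_obtain)
    show "grmap a \<in> carrier gr" using p by (simp add: grmap_cls symb_closed)
    fix b assume "b \<in> carrier G.U"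
    then obtain q where q: "q \<in> tens_space X" "b = G.cls q" by (rule G.A_obtain)
    show "grmap (a \<otimes>\<^sub>(G.U) b) = grmap a \<otimes>\<^sub>gr grmap b"
      using p q by (simp add: G.cls_mult grmap_cls symb_mult tens_space_mult)
    show "grmap (a \<oplus>\<^sub>(G.U) b) = grmap a \<oplus>\<^sub>gr grmap b"
      using p q by (simp add: G.cls_add grmap_cls symb_add tens_space_add)
  next
    show "grmap \<one>\<^sub>(G.U) = \<one>\<^sub>gr" unfolding G.A_simps(3) by (simp add: grmap_cls symb_one)
  qed
  show "bij_betw grmap (carrier G.U) (carrier gr)"
  proof (rule bij_betwI')
    fix a b assume "a \<in> carrier G.U" "b \<in> carrier G.U"
    then obtain p q where p: "p \<in> tens_space X" "a = G.cls p" and q: "q \<in> tens_space X" "b = G.cls q"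
      by (elim G.A_obtain) blast
    then show "grmap a = grmap b \<longleftrightarrow> a = b" by (simp add: grmap_cls symb_eq_iff G.cls_eq_iff)
  next
    fix a assume "a \<in> carrier G.U"
    then obtain p where p: "p \<in> tens_space X" "a = G.cls p" by (rule G.A_obtain)
    then show "grmap a \<in> carrier gr" by (simp add: grmap_cls symb_closed)
  next
    fix s assume "s \<in> carrier gr"
    then obtain p where p: "p \<in> tens_space X" "s = symb p" using symb_onto by blast
    then show "\<exists>a\<in>carrier G.U. s = grmap a"
      by (intro bexI[of _ "G.cls p"]) (simp_all add: grmap_cls)
  qed
qed

lemma pbw: "pbw_deformation X 2 G.Prel Prel"
  unfolding pbw_deformation_def
proof (intro conjI)
  let ?c = "\<lambda>r. coef r [1, m + 1] :: 'k"
  let ?f = "\<lambda>r. scal (?c r) * (vec + scal l)"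
  have vl: "vec + scal l \<in> tens_filt X 1"
    unfolding tens_filt_low
    by (intro CollectI conjI tens_space_add vec_in tens_space_scal)
      (unfold vec_def, intro low_add low_sum low_scal, auto simp: gen_def scal_def intro: low_single)
  have c: "?c (scal k * rel0) = k" for k
    using G.lookup_rel0[of 1 "m + 1"] one_X by (simp add: pa(5) sg_def m)
  have "Prel = (\<lambda>r. r - ?f r) ` G.Prel"
  proof -
    have e: "scal k * rel0 - ?f (scal k * rel0) = scal k * rel" for k
      unfolding c by (simp add: rel_def algebra_simps)
    show ?thesis
      unfolding P_range G.P_range unfolding G.rel_rel0 image_image by (simp only: e)
  qed
  moreover have "?f \<in> G.Prel \<rightarrow> tens_filt X (2 - 1)"
    using vl by (auto simp: tens_filt_low numeral_2_eq_2 One_nat_def intro!: tens_space_mult low_scal)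
  ultimately show "\<exists>\<phi>. \<phi> \<in> G.Prel \<rightarrow> tens_filt X (2 - 1) \<and>
      (\<forall>r\<in>G.Prel. \<forall>s\<in>G.Prel. \<phi> (r + s) = \<phi> r + \<phi> s) \<and>
      (\<forall>c. \<forall>r\<in>G.Prel. \<phi> (tscale c r) = tscale c (\<phi> r)) \<and> Prel = (\<lambda>r. r - \<phi> r) ` G.Prel"
    by (intro exI[of _ ?f] conjI) (auto simp: lookup_add scal_add distrib_right tscale_scal scal_mult mult.assoc)
  have "grmap (G.cls p) = gr_symbol U F d (cls p)" if p: "p \<in> tens_pow X d" for p d
  proof -
    have "symb p = gr_symbol U F d (cls p)"
      by (rule ext) (simp add: symb_def gr_symbol_def tens_proj_pow[OF p] co_zero[unfolded co_def] co_def)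
    then show ?thesis using grmap_cls[OF tens_pow_space[OF p]] by simp
  qed
  then show "\<exists>\<Phi>\<in>ring_iso G.U gr. \<forall>d. \<forall>p\<in>tens_pow X d. \<Phi> (G.cls p) = gr_symbol U F d (cls p)"
    by (intro bexI[OF _ grmap_iso]) blast
qed

theorem koszul_filtered: "koszul_filtered X Prel"
proof -
  have v: "tens_proj 2 vec = 0" "tens_proj 2 (scal l) = (0 :: (nat, 'k) tens)"
    by (simp_all add: vec_def tens_proj_linear gen_def scal_def tens_proj_single)
  have "tens_proj 2 rel = rel0"
    unfolding rel_def tens_proj_linear v using tens_proj_pow[OF G.rel0_pow, of 2] by simp
  then have e: "tens_proj 2 (scal k * rel) = scal k * rel0" for k
    by (simp add: tens_proj_linear)
  have R: "tens_proj 2 ` Prel = G.Prel"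
    unfolding P_range G.P_range unfolding G.rel_rel0 image_image by (simp only: e)
  have "low 3 rel"
    unfolding rel_def vec_def
    by (intro low_diff low_sum low_scal low_mono[OF tens_pow_low[OF G.rel0_pow]])
      (auto simp: gen_def scal_def intro: low_single)
  then have "Prel \<subseteq> tens_filt X 2"
    unfolding P_range tens_filt_low using rel_in
    by (auto intro!: tens_space_mult low_scal simp: numeral_2_eq_2 numeral_3_eq_3)
  then show ?thesis
    unfolding koszul_filtered_def using G.koszul pbw R by (intro conjI exI[of _ 2]) simp_all
qed

end

section \<open>The enveloping algebra\<close>

context weyl
begin

sublocale E: tensor_algs U "opp U"
  by (rule tensor_algs.intro[OF A_kalg opp_kalg[OF A_kalg]])

abbreviation "E \<equiv> tensor U (opp U)"

definition e :: "(nat, 'k) tens => (nat, 'k) tens => (nat, 'k) tens set env"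
  where "e p q = pure_tensor U (opp U) (cls p) (cls q)"

abbreviation "T \<equiv> tens_space X :: (nat, 'k) tens set"

lemma E_eq: "env_alg U = E" by (simp add: env_alg_def)

lemma e_closed [simp, intro]: "p \<in> T ==> q \<in> T ==> e p q \<in> carrier E"
  unfolding e_def by (rule E.pure_closed) simp_all

lemma e_add_l: "p \<in> T ==> p' \<in> T ==> q \<in> T ==> e (p + p') q = e p q \<oplus>\<^sub>E e p' q"
  unfolding e_def cls_add[symmetric] by (rule E.pure_add_l) simp_all

lemma e_add_r: "p \<in> T ==> q \<in> T ==> q' \<in> T ==> e p (q + q') = e p q \<oplus>\<^sub>E e p q'"
  unfolding e_def using E.pure_add_r[of "cls p" "cls q" "cls q'"] by (simp add: cls_add)

lemma T_scal: "p \<in> T ==> scal c * p \<in> T"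
  by (rule tens_space_mult[OF tens_space_scal])

lemma e_scal: "p \<in> T ==> q \<in> T ==> e (scal c * p) q = e p (scal c * q)"
  unfolding e_def using E.pure_smult[of "cls p" "cls q" c] by (simp add: cls_smult)

lemma e_mult:
  "p \<in> T ==> q \<in> T ==> p' \<in> T ==> q' \<in> T ==> e p q \<otimes>\<^sub>E e p' q' = e (p * p') (q' * q)"
  unfolding e_def by (subst E.pure_mult) (simp_all add: cls_mult)

lemma e_one: "\<one>\<^sub>E = e 1 1"
  unfolding e_def E.tensor_one by (simp add: A_simps)

lemma e_I: "p \<in> I ==> q \<in> T ==> e p q = \<zero>\<^sub>E" "q \<in> I ==> p \<in> T ==> e p q = \<zero>\<^sub>E"
  unfolding e_def using E.pure_zero_l[of "cls q"] E.pure_zero_r[of "cls p"]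
  by (simp_all add: cls_zero_iff[THEN iffD2] I_in)

lemma e_zero: "q \<in> T ==> e 0 q = \<zero>\<^sub>E" "p \<in> T ==> e p 0 = \<zero>\<^sub>E"
  by (simp_all add: e_I)

lemma e_N: "p \<in> T ==> e (N p) q = e p q"
  unfolding e_def by (simp add: cls_N)

lemma E_induct [consumes 1, case_names pure add]:
  assumes "t \<in> carrier E" "!!p q. p \<in> T ==> q \<in> T ==> P (e p q)"
    "!!s t. s \<in> carrier E ==> t \<in> carrier E ==> P s ==> P t ==> P (s \<oplus>\<^sub>E t)"
  shows "P t"
  using assms(1)
proof (induction rule: E.tensor_induct)
  case (pure a b)
  then obtain p q where "p \<in> T" "a = cls p" "q \<in> T" "b = cls q"
    by (metis A_obtain opp_simps(1))
  then show ?case using assms(2)[of p q] by (simp add: e_def)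
qed (use assms(3) in blast)

definition \<kappa> :: "'k => (nat, 'k) tens set env" where "\<kappa> c = e (scal c) 1"

lemma \<kappa>_closed [simp, intro]: "\<kappa> c \<in> carrier E" by (simp add: \<kappa>_def)

lemma \<kappa>_add: "\<kappa> (c + d) = \<kappa> c \<oplus>\<^sub>E \<kappa> d" by (simp add: \<kappa>_def scal_add e_add_l)

lemma \<kappa>_mult: "\<kappa> (c * d) = \<kappa> c \<otimes>\<^sub>E \<kappa> d" by (simp add: \<kappa>_def scal_mult e_mult)

lemma \<kappa>_simps [simp]: "\<kappa> 0 = \<zero>\<^sub>E" "\<kappa> 1 = \<one>\<^sub>E"
  by (simp_all add: \<kappa>_def e_zero e_one)

lemma \<kappa>_uminus: "\<kappa> (- c) = \<ominus>\<^sub>E \<kappa> c"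
  using \<kappa>_add[of "- c" c] by (intro E.MN.minus_equality[symmetric]) auto

lemma \<kappa>_e: "p \<in> T ==> q \<in> T ==> \<kappa> c \<otimes>\<^sub>E e p q = e (scal c * p) q"
  unfolding \<kappa>_def by (simp add: e_mult)

lemma \<kappa>_e': "p \<in> T ==> q \<in> T ==> \<kappa> c \<otimes>\<^sub>E e p q = e p (scal c * q)"
  by (simp add: \<kappa>_e e_scal)

lemma \<kappa>_central: "t \<in> carrier E ==> \<kappa> c \<otimes>\<^sub>E t = t \<otimes>\<^sub>E \<kappa> c"
proof (induction rule: E_induct)
  case (pure p q)
  then show ?case unfolding \<kappa>_def by (simp add: e_mult scal_central)
next
  case (add s t)
  then show ?case by (simp add: E.MN.r_distr E.MN.l_distr)
qed

lemma \<kappa>_alt: "\<kappa> c = e 1 (scal c)"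
  unfolding \<kappa>_def using e_scal[of 1 1 c] by simp

lemma E_action: "scalar_action E (\<lambda>c t. \<kappa> c \<otimes>\<^sub>E t)"
  by unfold_locales (auto simp: \<kappa>_add E.MN.l_distr)

definition sec :: "(nat, 'k) tens set => (nat, 'k) tens"
  where "sec a = N (SOME p. p \<in> T \<and> cls p = a)"

lemma sec_cls: "p \<in> T ==> sec (cls p) = N p"
proof -
  assume p: "p \<in> T"
  have "(SOME p'. p' \<in> T \<and> cls p' = cls p) \<in> T \<and> cls (SOME p'. p' \<in> T \<and> cls p' = cls p) = cls p"
    by (rule someI[of _ p]) (use p in simp)
  then show ?thesis unfolding sec_def using cls_eq_N p by blast
qed

lemma balanced_clsI:
  assumes "!!p q. p \<in> T ==> q \<in> T ==> h (cls p) (cls q) \<in> carrier G"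
    "!!p p' q. p \<in> T ==> p' \<in> T ==> q \<in> T ==> h (cls (p + p')) (cls q) = h (cls p) (cls q) \<oplus>\<^sub>G h (cls p') (cls q)"
    "!!p q q'. p \<in> T ==> q \<in> T ==> q' \<in> T ==> h (cls p) (cls (q + q')) = h (cls p) (cls q) \<oplus>\<^sub>G h (cls p) (cls q')"
    "!!p q c. p \<in> T ==> q \<in> T ==> h (cls (scal c * p)) (cls q) = h (cls p) (cls (scal c * q))"
  shows "balanced U (opp U) G h"
  unfolding balanced_def opp_simps opp_smult
proof (intro conjI ballI allI)
  fix a b assume ab: "a \<in> carrier U" "b \<in> carrier U"
  obtain p where p: "p \<in> T" "a = cls p" by (rule A_obtain[OF ab(1)])
  obtain q where q: "q \<in> T" "b = cls q" by (rule A_obtain[OF ab(2)])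
  show "h a b \<in> carrier G" using assms(1) p q by simp
  show "h (c \<odot>\<^sub>U a) b = h a (c \<odot>\<^sub>U b)" for c using assms(4) p q by (simp add: cls_smult)
  fix b' assume b': "b' \<in> carrier U"
  obtain q' where q': "q' \<in> T" "b' = cls q'" by (rule A_obtain[OF b'])
  show "h a (b \<oplus>\<^sub>U b') = h a b \<oplus>\<^sub>G h a b'" using assms(3) p q q' by (simp add: cls_add)
next
  fix a a' b assume ab: "a \<in> carrier U" "a' \<in> carrier U" "b \<in> carrier U"
  obtain p where p: "p \<in> T" "a = cls p" by (rule A_obtain[OF ab(1)])
  obtain p' where p': "p' \<in> T" "a' = cls p'" by (rule A_obtain[OF ab(2)])
  obtain q where q: "q \<in> T" "b = cls q" by (rule A_obtain[OF ab(3)])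
  show "h (a \<oplus>\<^sub>U a') b = h a b \<oplus>\<^sub>G h a' b" using assms(2) p p' q by (simp add: cls_add)
qed

lemma lift_e:
  assumes "abelian_group G" "balanced U (opp U) G h" "p \<in> T" "q \<in> T"
  shows "tensor_lift G h (e p q) = h (cls p) (cls q)"
  unfolding e_def by (rule E.tensor_lift_pure[OF assms(1,2)]) (use assms(3,4) in simp_all)

lemma lift_finsum:
  assumes G: "abelian_group G" and h: "balanced U (opp U) G h" and f: "f \<in> K \<rightarrow> carrier E"
  shows "tensor_lift G h (\<Oplus>\<^sub>E i\<in>K. f i) = (\<Oplus>\<^sub>G i\<in>K. tensor_lift G h (f i))"
proof -
  interpret G: abelian_group G by fact
  from f show ?thesis
  proof (induction K rule: infinite_finite_induct)
    case (insert i K)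
    then have "f i \<in> carrier E" "f \<in> K \<rightarrow> carrier E" "(\<Oplus>\<^sub>E i\<in>K. f i) \<in> carrier E" by auto
    moreover have "tensor_lift G h (f i) \<in> carrier G" "(\<lambda>i. tensor_lift G h (f i)) \<in> K \<rightarrow> carrier G"
      using insert.prems by (auto intro!: E.tensor_lift_closed[OF G h])
    ultimately show ?case using insert by (simp add: E.tensor_lift_add[OF G h])
  qed (simp_all add: E.tensor_lift_zero[OF G h])
qed

subsection \<open>The swap\<close>

definition \<tau> :: "(nat, 'k) tens set env => (nat, 'k) tens set env"
  where "\<tau> = tensor_lift E (\<lambda>a b. pure_tensor U (opp U) b a)"

lemma \<tau>_balanced: "balanced U (opp U) E (\<lambda>a b. pure_tensor U (opp U) b a)"
  by (rule balanced_clsI) (simp_all add: e_add_l e_add_r e_scal flip: e_def)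

lemmas E_group = E.MN.abelian_group_axioms

lemma \<tau>_closed: "t \<in> carrier E ==> \<tau> t \<in> carrier E"
  unfolding \<tau>_def by (rule E.tensor_lift_closed[OF E_group \<tau>_balanced])

lemma \<tau>_add: "s \<in> carrier E ==> t \<in> carrier E ==> \<tau> (s \<oplus>\<^sub>E t) = \<tau> s \<oplus>\<^sub>E \<tau> t"
  unfolding \<tau>_def by (rule E.tensor_lift_add[OF E_group \<tau>_balanced])

lemma \<tau>_zero: "\<tau> \<zero>\<^sub>E = \<zero>\<^sub>E"
  unfolding \<tau>_def by (rule E.tensor_lift_zero[OF E_group \<tau>_balanced])

lemma \<tau>_e: "p \<in> T ==> q \<in> T ==> \<tau> (e p q) = e q p"
  unfolding \<tau>_def by (subst lift_e[OF E_group \<tau>_balanced]) (simp_all add: e_def)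

lemma \<tau>_finsum: "f \<in> K \<rightarrow> carrier E ==> \<tau> (\<Oplus>\<^sub>E i\<in>K. f i) = (\<Oplus>\<^sub>E i\<in>K. \<tau> (f i))"
  unfolding \<tau>_def by (rule lift_finsum[OF E_group \<tau>_balanced])

lemma \<tau>_uminus: "t \<in> carrier E ==> \<tau> (\<ominus>\<^sub>E t) = \<ominus>\<^sub>E \<tau> t"
  using \<tau>_add[of "\<ominus>\<^sub>E t" t] by (intro E.MN.minus_equality[symmetric]) (auto simp: \<tau>_zero E.MN.l_neg \<tau>_closed)

lemma \<tau>_minus: "s \<in> carrier E ==> t \<in> carrier E ==> \<tau> (s \<ominus>\<^sub>E t) = \<tau> s \<ominus>\<^sub>E \<tau> t"
  by (simp add: a_minus_def \<tau>_add \<tau>_uminus)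

lemma \<tau>_\<tau>: "t \<in> carrier E ==> \<tau> (\<tau> t) = t"
proof (induction rule: E_induct)
  case (pure p q)
  then show ?case by (simp add: \<tau>_e)
next
  case (add s t)
  then show ?case by (simp add: \<tau>_add \<tau>_closed)
qed

lemma \<tau>_mult: "s \<in> carrier E ==> t \<in> carrier E ==> \<tau> (s \<otimes>\<^sub>E t) = \<tau> t \<otimes>\<^sub>E \<tau> s"
proof (induction s rule: E_induct)
  case (pure p q)
  from \<open>t \<in> carrier E\<close> show ?case
  proof (induction t rule: E_induct)
    case (pure p' q')
    then show ?case using \<open>p \<in> T\<close> \<open>q \<in> T\<close> by (simp add: e_mult \<tau>_e tens_space_mult)
  next
    case (add s t)
    then show ?case using \<open>p \<in> T\<close> \<open>q \<in> T\<close>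
      by (simp add: E.MN.r_distr E.MN.l_distr \<tau>_add \<tau>_closed)
  qed
next
  case (add s s')
  then show ?case by (simp add: E.MN.r_distr E.MN.l_distr \<tau>_add \<tau>_closed)
qed

lemma \<tau>_\<kappa>: "\<tau> (\<kappa> c) = \<kappa> c"
  unfolding \<kappa>_def by (simp add: \<tau>_e) (simp flip: \<kappa>_alt \<kappa>_def)

subsection \<open>Injectivity\<close>

definition C :: "nat list => (nat, 'k) tens set env => (nat, 'k) tens set"
  where "C w = tensor_lift U (\<lambda>a b. coef (sec a) w \<odot>\<^sub>U b)"

lemma C_balanced: "balanced U (opp U) U (\<lambda>a b. coef (sec a) w \<odot>\<^sub>U b)"
proof (rule balanced_clsI)
  fix p q assume p: "p \<in> T" and q: "q \<in> T"
  show "coef (sec (cls p)) w \<odot>\<^sub>U cls q \<in> carrier U" using q by simp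
  show "coef (sec (cls (scal c * p))) w \<odot>\<^sub>U cls q =
      coef (sec (cls p)) w \<odot>\<^sub>U cls (scal c * q)" for c
    using p q by (simp add: sec_cls T_scal N_scal cls_smult[OF q, symmetric] A.smult_assoc
        mult.commute[where 'a = 'k])
  show "coef (sec (cls p)) w \<odot>\<^sub>U cls (q + q') =
      coef (sec (cls p)) w \<odot>\<^sub>U cls q \<oplus>\<^sub>U coef (sec (cls p)) w \<odot>\<^sub>U cls q'"
    if "q' \<in> T" for q'
    using q that by (simp add: cls_add[OF q that, symmetric] A.smult_r_distr)
next
  fix p p' q assume "p \<in> T" "p' \<in> T" "q \<in> T"
  then show "coef (sec (cls (p + p'))) w \<odot>\<^sub>U cls q =
      coef (sec (cls p)) w \<odot>\<^sub>U cls q \<oplus>\<^sub>U coef (sec (cls p')) w \<odot>\<^sub>U cls q"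
    by (simp add: sec_cls tens_space_add N_add lookup_add A.smult_l_distr)
qed

lemmas U_group = A.abelian_group_axioms

lemma C_closed: "t \<in> carrier E ==> C w t \<in> carrier U"
  unfolding C_def by (rule E.tensor_lift_closed[OF U_group C_balanced])

lemma C_add: "s \<in> carrier E ==> t \<in> carrier E ==> C w (s \<oplus>\<^sub>E t) = C w s \<oplus>\<^sub>U C w t"
  unfolding C_def by (rule E.tensor_lift_add[OF U_group C_balanced])

lemma C_e: "p \<in> T ==> q \<in> T ==> C w (e p q) = coef (N p) w \<odot>\<^sub>U cls q"
  unfolding C_def by (subst lift_e[OF U_group C_balanced]) (simp_all add: sec_cls)

lemma one_le [simp]: "1 \<le> 2 * m" using m by linarith

lemma gen1_T: "gen 1 \<in> T" by simp

lemma C_mult_L: "t \<in> carrier E ==> C (w @ [1]) (t \<otimes>\<^sub>E e (gen 1) 1) = C w t"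
proof (induction rule: E_induct)
  case (pure p q)
  then show ?case by (simp add: e_mult C_e N_mult_gen1 tens_space_mult)
next
  case (add s t)
  then show ?case by (simp add: E.MN.l_distr C_add)
qed

lemma C_mult_R: "t \<in> carrier E ==> r \<in> T ==> C w (t \<otimes>\<^sub>E e 1 r) = cls r \<otimes>\<^sub>U C w t"
proof (induction rule: E_induct)
  case (pure p q)
  then show ?case by (simp add: e_mult C_e tens_space_mult A.smult_mult_r cls_mult)
next
  case (add s t)
  then show ?case by (simp add: E.MN.l_distr C_add A.r_distr C_closed)
qed

lemma wd_pure_closed:
  assumes "set w \<subseteq> X" "b \<in> carrier U" shows "pure_tensor U (opp U) (cls (wd w)) b \<in> carrier E"
  by (rule E.pure_closed[OF cls_closed[OF tens_space_single[OF assms(1)]]]) (simp add: assms(2))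

lemma wd_pure_zero:
  assumes "set w \<subseteq> X" shows "pure_tensor U (opp U) (cls (wd w)) \<zero>\<^sub>U = \<zero>\<^sub>E"
  using E.pure_zero_r[OF cls_closed[OF tens_space_single[OF assms, of 1]]] by simp

lemma C_expansion:
  assumes "t \<in> carrier E"
  shows "\<exists>K. finite K \<and> (\<forall>w\<in>K. set w \<subseteq> X) \<and> (\<forall>w. w \<notin> K --> C w t = \<zero>\<^sub>U) \<and>
    t = (\<Oplus>\<^sub>E w\<in>K. pure_tensor U (opp U) (cls (wd w)) (C w t))"
  using assms
proof (induction rule: E_induct)
  case (pure p q)
  let ?K = "supp (N p)"
  have Np: "N p \<in> T" by (rule N_in[OF pure(1)])
  then have K: "set w \<subseteq> X" if "w \<in> ?K" for w using that by (auto simp: tens_space_def)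
  have "e p q = e (N p) q" using e_N pure by simp
  also have "\<dots> = e (\<Sum>w\<in>?K. monomial w (coef (N p) w)) q"
    using pm_sum_singles[of "N p"] by simp
  also have "\<dots> = (\<Oplus>\<^sub>E w\<in>?K. e (monomial w (coef (N p) w)) q)"
  proof -
    have sum_e: "finite L ==> (\<forall>w\<in>L. set w \<subseteq> X) ==>
      e (\<Sum>w\<in>L. monomial w (f w)) q = (\<Oplus>\<^sub>E w\<in>L. e (monomial w (f w)) q)" for L f
    proof (induction L rule: finite_induct)
      case (insert w L)
      have "monomial w (f w) \<in> T" "(\<Sum>w\<in>L. monomial w (f w)) \<in> T"
        "(\<lambda>w. e (monomial w (f w)) q) \<in> L \<rightarrow> carrier E"
        using insert.prems pure(2) by (auto intro!: tens_space_single tens_space_sum e_closed)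
      then show ?case using insert pure(2) by (simp add: e_add_l)
    qed (simp add: e_zero pure(2))
    show ?thesis by (rule sum_e[OF finite_keys]) (use K in blast)
  qed
  also have "\<dots> = (\<Oplus>\<^sub>E w\<in>?K. pure_tensor U (opp U) (cls (wd w)) (C w (e p q)))"
  proof (intro E.MN.finsum_cong' refl)
    show "(\<lambda>w. pure_tensor U (opp U) (cls (wd w)) (C w (e p q))) \<in> ?K \<rightarrow> carrier E"
      by (rule funcsetI, rule wd_pure_closed, erule K, rule C_closed, rule e_closed[OF pure])
    fix w assume w: "w \<in> ?K"
    have "wd w \<in> T" by (rule tens_space_single[OF K[OF w]])
    then show "e (monomial w (coef (N p) w)) q =
        pure_tensor U (opp U) (cls (wd w)) (C w (e p q))"
    proof -
      have 1: "e (monomial w c) q = e (wd w) (scal c * q)" for c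
        using e_scal[OF \<open>wd w \<in> T\<close> pure(2), of c] by simp
      have 2: "C w (e p q) = cls (scal (coef (N p) w) * q)"
        using pure by (simp only: C_e cls_smult)
      show ?thesis unfolding 1 2 by (simp only: e_def)
    qed
  qed
  finally have eq: "e p q = (\<Oplus>\<^sub>E w\<in>?K. pure_tensor U (opp U) (cls (wd w)) (C w (e p q)))" .
  have z: "C w (e p q) = \<zero>\<^sub>U" if "w \<notin> ?K" for w
    using that pure by (simp add: C_e in_keys_iff)
  show ?case
    by (rule exI[of _ ?K], intro conjI ballI allI impI finite_keys K z eq; assumption)
next
  case (add s t)
  then obtain K L where K: "finite K" "\<forall>w\<in>K. set w \<subseteq> X" "\<forall>w. w \<notin> K --> C w s = \<zero>\<^sub>U"
      "s = (\<Oplus>\<^sub>E w\<in>K. pure_tensor U (opp U) (cls (wd w)) (C w s))"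
    and L: "finite L" "\<forall>w\<in>L. set w \<subseteq> X" "\<forall>w. w \<notin> L --> C w t = \<zero>\<^sub>U"
      "t = (\<Oplus>\<^sub>E w\<in>L. pure_tensor U (opp U) (cls (wd w)) (C w t))"
    by blast
  let ?f = "\<lambda>u w. pure_tensor U (opp U) (cls (wd w)) (C w u)"
  have X: "\<forall>w\<in>K \<union> L. set w \<subseteq> X" using K L by blast
  have cl: "?f u w \<in> carrier E" if "u \<in> carrier E" "w \<in> K \<union> L" for u w
    using X that by (intro wd_pure_closed C_closed) blast+
  have z: "?f u w = \<zero>\<^sub>E" if "C w u = \<zero>\<^sub>U" "w \<in> K \<union> L" for u w
    unfolding that(1) using X that(2) by (intro wd_pure_zero) blast
  have s_eq: "s = (\<Oplus>\<^sub>E w\<in>K \<union> L. ?f s w)"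
    by (subst K(4), rule E.MN.add.finprod_mono_neutral_cong_left) (use K L z cl add in auto)
  have t_eq: "t = (\<Oplus>\<^sub>E w\<in>K \<union> L. ?f t w)"
    by (subst L(4), rule E.MN.add.finprod_mono_neutral_cong_left) (use K L z cl add in auto)
  have sum_eq: "(\<Oplus>\<^sub>E w\<in>K \<union> L. ?f (s \<oplus>\<^sub>E t) w) = (\<Oplus>\<^sub>E w\<in>K \<union> L. ?f s w) \<oplus>\<^sub>E (\<Oplus>\<^sub>E w\<in>K \<union> L. ?f t w)"
  proof (subst E.MN.finsum_addf[symmetric])
    show "?f s \<in> K \<union> L \<rightarrow> carrier E" "?f t \<in> K \<union> L \<rightarrow> carrier E" using cl add by auto
    show "(\<Oplus>\<^sub>E w\<in>K \<union> L. ?f (s \<oplus>\<^sub>E t) w) = (\<Oplus>\<^sub>E w\<in>K \<union> L. ?f s w \<oplus>\<^sub>E ?f t w)"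
    proof (rule E.MN.finsum_cong'[OF refl])
      show "(\<lambda>w. ?f s w \<oplus>\<^sub>E ?f t w) \<in> K \<union> L \<rightarrow> carrier E" using cl add by auto
      fix w assume w: "w \<in> K \<union> L"
      have "cls (wd w) \<in> carrier U" using X w by (intro cls_closed tens_space_single) blast
      then show "?f (s \<oplus>\<^sub>E t) w = ?f s w \<oplus>\<^sub>E ?f t w"
        using E.pure_add_r[of "cls (wd w)" "C w s" "C w t"] C_closed add by (simp add: C_add)
    qed
  qed
  have eq: "s \<oplus>\<^sub>E t = (\<Oplus>\<^sub>E w\<in>K \<union> L. ?f (s \<oplus>\<^sub>E t) w)"
    unfolding sum_eq by (rule arg_cong2[OF s_eq t_eq])
  have z: "C w (s \<oplus>\<^sub>E t) = \<zero>\<^sub>U" if "w \<notin> K \<union> L" for w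
    using that K(3) L(3) add(1,2) by (simp add: C_add)
  have KL: "finite (K \<union> L)" using K(1) L(1) by blast
  show ?case
    by (rule exI[of _ "K \<union> L"], intro conjI allI impI KL X z eq; assumption)
qed

text \<open>Comparing coefficients of normal forms in \<open>t (x\<^sub>1 \<otimes> 1) = t (1 \<otimes> r)\<close> gives \<open>C w t = r C (w
  x\<^sub>1) t\<close> for all words. Iterating, every coefficient is a multiple of one at an arbitrarily long
  word, and these vanish.\<close>

lemma shift_injective:
  assumes t: "t \<in> carrier E" and 0: "t \<otimes>\<^sub>E (e (gen 1) 1 \<ominus>\<^sub>E e 1 (gen 1) \<ominus>\<^sub>E \<kappa> a) = \<zero>\<^sub>E"
  shows "t = \<zero>\<^sub>E"
proof -
  let ?r = "gen 1 + scal a"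
  have r: "?r \<in> T" by (intro tens_space_add gen1_T tens_space_scal)
  have "e (gen 1) 1 \<ominus>\<^sub>E e 1 (gen 1) \<ominus>\<^sub>E \<kappa> a = e (gen 1) 1 \<ominus>\<^sub>E e 1 ?r"
    by (simp add: e_add_r \<kappa>_alt a_minus_def E.MN.minus_add E.MN.a_assoc)
  then have "t \<otimes>\<^sub>E e (gen 1) 1 \<ominus>\<^sub>E t \<otimes>\<^sub>E e 1 ?r = \<zero>\<^sub>E"
    using 0 t r by (simp add: a_minus_def E.MN.r_distr E.MN.r_minus)
  then have eq: "t \<otimes>\<^sub>E e (gen 1) 1 = t \<otimes>\<^sub>E e 1 ?r"
    using abelian_group_minus_eq_zero[OF E_group, of "t \<otimes>\<^sub>E e (gen 1) 1" "t \<otimes>\<^sub>E e 1 ?r"] t r by simp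
  have step: "C w t = cls ?r \<otimes>\<^sub>U C (w @ [1]) t" for w
    using C_mult_L[OF t, of w] C_mult_R[OF t r, of "w @ [1]"] eq by simp
  obtain K where K: "finite K" "\<forall>w. w \<notin> K --> C w t = \<zero>\<^sub>U"
      "t = (\<Oplus>\<^sub>E w\<in>K. pure_tensor U (opp U) (cls (wd w)) (C w t))" "\<forall>w\<in>K. set w \<subseteq> X"
    using C_expansion[OF t] by blast
  obtain b where b: "\<forall>w\<in>K. length w < b"
    using K(1) by (metis finite_nat_set_iff_bounded finite_imageI imageI)
  have "length w + k \<ge> b ==> C w t = \<zero>\<^sub>U" for k w
  proof (induction k arbitrary: w)
    case 0
    then have "w \<notin> K" using b by (auto dest: bspec[of _ _ w])
    then show ?case using K(2) by blast
  next
    case (Suc k)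
    then have "C (w @ [1]) t = \<zero>\<^sub>U" by simp
    then show ?case using step[of w] r by simp
  qed
  then have C0: "C w t = \<zero>\<^sub>U" for w by (metis le_add2)
  have "(\<Oplus>\<^sub>E w\<in>K. pure_tensor U (opp U) (cls (wd w)) (C w t)) = (\<Oplus>\<^sub>E w\<in>K. \<zero>\<^sub>E)"
  proof (rule E.MN.finsum_cong'[OF refl])
    show "pure_tensor U (opp U) (cls (wd w)) (C w t) = \<zero>\<^sub>E" if "w \<in> K" for w
      unfolding C0 using K(4) that by (intro wd_pure_zero) blast
  qed simp
  then show ?thesis using K(3) by simp
qed

end

context weyl
begin

subsection \<open>Twisted derivations and exactness in the middle\<close>

lemma sg_sum:
  "(\<Sum>j\<in>X. scal (sg j) * f j) = (\<Sum>i\<in>{1..m}. f i - (f (i + m) :: (nat, 'k) tens))"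
proof -
  have "X = {1..m} \<union> (\<lambda>i. i + m) ` {1..m}" "{1..m} \<inter> (\<lambda>i. i + m) ` {1..m} = {}"
    unfolding image_add_atLeastAtMost' by auto
  then have "(\<Sum>j\<in>X. scal (sg j) * f j) =
      (\<Sum>j\<in>{1..m}. scal (sg j) * f j) + (\<Sum>j\<in>(\<lambda>i. i + m) ` {1..m}. scal (sg j) * f j)"
    by (simp add: sum.union_disjoint)
  also have "(\<Sum>j\<in>(\<lambda>i. i + m) ` {1..m}. scal (sg j) * f j) = (\<Sum>i\<in>{1..m}. - f (i + m))"
    by (subst sum.reindex) (auto simp: inj_on_def sg_def intro!: sum.cong)
  also have "(\<Sum>j\<in>{1..m}. scal (sg j) * f j) = (\<Sum>i\<in>{1..m}. f i)"
    by (rule sum.cong) (auto simp: sg_def)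
  finally show ?thesis by (simp add: sum_subtractf sum_negf)
qed

lemma sg_sum_sym:
  assumes "!!j. j \<in> X ==> f (pa j) = (f j :: (nat, 'k) tens)"
  shows "(\<Sum>j\<in>X. scal (sg j) * f j) = 0"
  unfolding sg_sum
proof (rule sum.neutral, rule ballI)
  fix i assume "i \<in> {1..m}"
  then have "i \<in> X" "pa i = i + m" by (auto simp: pa_def)
  then show "f i - f (i + m) = 0" using assms[of i] by simp
qed

end

text \<open>A substitution \<open>x\<^sub>j \<mapsto> x\<^sub>j + c\<^sub>j\<close> that is compatible with the relation. The case \<open>c = 0\<close>
  serves for the resolution, another one for its dual.\<close>

locale weyl_twist = weyl +
  fixes cf :: "nat => 'a"
  assumes cf: "(\<Sum>j\<in>X. scal (vc j) * scal (cf j)) = (0 :: (nat, 'a) tens)"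
begin

definition \<rho> :: "(nat, 'a) tens => (nat, 'a) tens" where "\<rho> = evalT (\<lambda>j. gen j + scal (cf j))"

lemma \<rho>_simps: "\<rho> (gen j) = gen j + scal (cf j)" "\<rho> (p * q) = \<rho> p * \<rho> q" "\<rho> (p + q) = \<rho> p + \<rho> q"
  "\<rho> (scal c) = scal c" "\<rho> 1 = 1" "\<rho> 0 = 0" "\<rho> (scal c * p) = scal c * \<rho> p"
  "\<rho> (p - q) = \<rho> p - \<rho> q" "\<rho> (\<Sum>i\<in>K. f i) = (\<Sum>i\<in>K. \<rho> (f i))"
  by (simp_all add: \<rho>_def evalT_mult evalT_add evalT_scal evalT_diff evalT_sum)

lemma \<rho>_T [simp]: "p \<in> T ==> \<rho> p \<in> T"
  unfolding \<rho>_def by (erule tens_space_evalT) (auto intro: tens_space_add)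

lemma gen_T [simp]: "j \<in> X ==> gen j \<in> T" by simp

text \<open>The substitution fixes the relator: the linear terms it creates cancel in pairs.\<close>

lemma \<rho>_rel: "\<rho> rel = rel"
proof -
  let ?f = "\<lambda>j. scal (cf j) * gen (pa j) + scal (cf (pa j)) * gen j + scal (cf j) * scal (cf (pa j)) :: (nat, 'a) tens"
  have comm: "scal a * scal b = (scal b * scal a :: (nat, 'a) tens)" for a b
    by (rule scal_central)
  have sym: "(\<Sum>j\<in>X. scal (sg j) * ?f j) = 0"
    by (rule sg_sum_sym) (simp add: pa(2) comm add_ac)
  have "\<rho> rel0 = (\<Sum>j\<in>X. scal (sg j) * (gen j * gen (pa j) + ?f j))"
    unfolding rel0_def \<rho>_simps
    by (rule sum.cong) (simp_all add: distrib_left distrib_right scal_central[of "gen _"] add_ac)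
  also have "\<dots> = rel0"
    using sym unfolding rel0_def by (simp only: distrib_left sum.distrib) simp
  finally have 1: "\<rho> rel0 = rel0" .
  have "\<rho> vec = vec + (\<Sum>j\<in>X. scal (vc j) * scal (cf j))"
    unfolding vec_def \<rho>_simps by (simp add: distrib_left sum.distrib)
  then show ?thesis unfolding rel_def \<rho>_simps 1 using cf by simp
qed

definition Dw :: "nat => nat list => (nat, 'a) tens set env"
  where "Dw j = rec_list \<zero>\<^sub>E (\<lambda>x w d. e (gen x) 1 \<otimes>\<^sub>E d \<oplus>\<^sub>E (if x = j then e 1 (\<rho> (wd w)) else \<zero>\<^sub>E))"

lemma Dw_simps: "Dw j [] = \<zero>\<^sub>E"
  "Dw j (x # w) = e (gen x) 1 \<otimes>\<^sub>E Dw j w \<oplus>\<^sub>E (if x = j then e 1 (\<rho> (wd w)) else \<zero>\<^sub>E)"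
  by (simp_all add: Dw_def)

text \<open>The left factor of \<open>D\<close> is untwisted and the right one is twisted by \<open>\<rho>\<close>: this is the
  derivation that sends \<open>x\<^sub>j\<close> to 1 and the other generators to 0, where \<open>E\<close> is a bimodule with
  right action through \<open>\<rho>\<close>.\<close>

definition D :: "nat => (nat, 'a) tens => (nat, 'a) tens set env"
  where "D j = pm_ext E (\<lambda>c t. \<kappa> c \<otimes>\<^sub>E t) (Dw j)"

lemma Dw_closed: "set w \<subseteq> X ==> Dw j w \<in> carrier E"
proof (induction w)
  case (Cons x w)
  then have "\<rho> (wd w) \<in> T" "gen x \<in> T" by (auto intro!: \<rho>_T tens_space_single)
  then show ?case using Cons by (simp add: Dw_simps)
qed (simp add: Dw_simps)

sublocale EA: scalar_action E "\<lambda>c t. \<kappa> c \<otimes>\<^sub>E t" by (rule E_action)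

lemma T_keys: "p \<in> T ==> supp p \<subseteq> {w. set w \<subseteq> X}"
  by (auto simp: tens_space_def)

lemma D_closed [simp]: "p \<in> T ==> D j p \<in> carrier E"
  unfolding D_def by (rule EA.pm_ext_closed[OF _ T_keys]) (auto intro: Dw_closed)

lemma D_add: "p \<in> T ==> q \<in> T ==> D j (p + q) = D j p \<oplus>\<^sub>E D j q"
  unfolding D_def by (rule EA.pm_ext_add[OF _ T_keys T_keys]) (auto intro: Dw_closed)

lemma D_single: "set w \<subseteq> X ==> D j (monomial w c) = \<kappa> c \<otimes>\<^sub>E Dw j w"
  unfolding D_def by (rule EA.pm_ext_single) (rule Dw_closed)

lemma D_zero [simp]: "D j 0 = \<zero>\<^sub>E" by (simp add: D_def)

lemma D_one [simp]: "D j 1 = \<zero>\<^sub>E"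
  unfolding one_wd by (simp add: D_single Dw_simps)

lemma D_scal: "p \<in> T ==> D j (scal c * p) = \<kappa> c \<otimes>\<^sub>E D j p"
proof (induction rule: tens_space_induct)
  case (single w d)
  have "D j (scal c * monomial w d) = \<kappa> (c * d) \<otimes>\<^sub>E Dw j w"
    using D_single[OF single, of j "c * d"] by (simp add: scal_def)
  then show ?case using D_single[OF single] Dw_closed[OF single] by (simp add: \<kappa>_mult E.MN.m_assoc)
next
  case (add p q)
  then show ?case by (simp add: distrib_left D_add T_scal E.MN.r_distr)
qed

lemma D_gen: "x \<in> X ==> p \<in> T ==>
  D j (gen x * p) = e (gen x) 1 \<otimes>\<^sub>E D j p \<oplus>\<^sub>E (if x = j then e 1 (\<rho> p) else \<zero>\<^sub>E)"
proof -
  assume x: "x \<in> X" and p: "p \<in> T"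
  have gx: "gen x \<in> T" by (rule gen_T[OF x])
  have gxc: "e (gen x) 1 \<in> carrier E" by (rule e_closed[OF gx tens_space_one])
  from p show ?thesis
  proof (induction rule: tens_space_induct)
    case (single w c)
    have w: "wd w \<in> T" by (rule tens_space_single[OF single])
    have Dc: "Dw j w \<in> carrier E" by (rule Dw_closed[OF single])
    have xw: "set (x # w) \<subseteq> X" using x single by simp
    have "D j (gen x * monomial w c) = \<kappa> c \<otimes>\<^sub>E Dw j (x # w)"
      using D_single[OF xw] by simp
    also have "\<dots> = \<kappa> c \<otimes>\<^sub>E (e (gen x) 1 \<otimes>\<^sub>E Dw j w) \<oplus>\<^sub>E \<kappa> c \<otimes>\<^sub>E (if x = j then e 1 (\<rho> (wd w)) else \<zero>\<^sub>E)"
      unfolding Dw_simps by (rule E.MN.r_distr) (use gxc Dc w in auto)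
    also have "\<kappa> c \<otimes>\<^sub>E (e (gen x) 1 \<otimes>\<^sub>E Dw j w) = e (gen x) 1 \<otimes>\<^sub>E D j (monomial w c)"
      unfolding D_single[OF single] using gxc Dc \<kappa>_central[OF gxc, of c]
      by (metis E.MN.m_assoc \<kappa>_closed)
    also have "\<kappa> c \<otimes>\<^sub>E (if x = j then e 1 (\<rho> (wd w)) else \<zero>\<^sub>E) =
        (if x = j then e 1 (\<rho> (monomial w c)) else \<zero>\<^sub>E)"
      using w \<rho>_simps(7)[of c "wd w"] by (simp add: \<kappa>_e')
    finally show ?case .
  next
    case (add p q)
    have pq: "gen x * p \<in> T" "gen x * q \<in> T" using gx add by (auto intro: tens_space_mult)
    show ?case
      using add gxc pq
      by (cases "x = j") (simp_all add: distrib_left D_add E.MN.r_distr \<rho>_simps e_add_r E.MN.a_ac)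
  qed
qed

lemma D_gen1: "x \<in> X ==> D j (gen x) = (if x = j then \<one>\<^sub>E else \<zero>\<^sub>E)"
  using D_gen[of x 1 j] e_closed[OF gen_T[of x] tens_space_one] by (simp add: \<rho>_simps e_one)

lemma D_mult:
  assumes p: "p \<in> T" and q: "q \<in> T"
  shows "D j (p * q) = e p 1 \<otimes>\<^sub>E D j q \<oplus>\<^sub>E e 1 (\<rho> q) \<otimes>\<^sub>E D j p"
  using p
proof (induction rule: tens_space_gen_induct)
  case zero
  then show ?case using q by (simp add: e_zero)
next
  case (add p p')
  then show ?case using q
    by (simp add: distrib_right D_add tens_space_mult tens_space_add e_add_l E.MN.l_distr E.MN.r_distr E.MN.a_ac)
next
  case (scal c p)
  have c: "e p 1 \<in> carrier E" "e 1 (\<rho> q) \<in> carrier E" using scal q by auto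
  have "D j (scal c * p * q) = \<kappa> c \<otimes>\<^sub>E (e p 1 \<otimes>\<^sub>E D j q \<oplus>\<^sub>E e 1 (\<rho> q) \<otimes>\<^sub>E D j p)"
    using scal q by (simp add: mult.assoc D_scal tens_space_mult)
  also have "\<dots> = (\<kappa> c \<otimes>\<^sub>E e p 1) \<otimes>\<^sub>E D j q \<oplus>\<^sub>E (\<kappa> c \<otimes>\<^sub>E e 1 (\<rho> q)) \<otimes>\<^sub>E D j p"
    using scal q c by (simp add: E.MN.r_distr E.MN.m_assoc)
  also have "\<kappa> c \<otimes>\<^sub>E e p 1 = e (scal c * p) 1" using scal by (simp add: \<kappa>_e)
  also have "\<kappa> c \<otimes>\<^sub>E e 1 (\<rho> q) = e 1 (\<rho> q) \<otimes>\<^sub>E \<kappa> c" by (rule \<kappa>_central[OF c(2)])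
  also have "(e 1 (\<rho> q) \<otimes>\<^sub>E \<kappa> c) \<otimes>\<^sub>E D j p = e 1 (\<rho> q) \<otimes>\<^sub>E D j (scal c * p)"
    using scal c by (simp add: D_scal E.MN.m_assoc)
  finally show ?case .
next
  case one
  then show ?case using q by (simp add: e_one[symmetric])
next
  case (gen x p)
  have gx: "gen x \<in> T" by (rule gen_T[OF gen(1)])
  have c: "e p 1 \<in> carrier E" "e 1 (\<rho> q) \<in> carrier E" "e (gen x) 1 \<in> carrier E" "e 1 (\<rho> p) \<in> carrier E"
    using gen(2) q gx by (simp_all del: tens_space_gen)
  let ?d = "\<lambda>t. if x = j then t else \<zero>\<^sub>E"
  have pq: "p * q \<in> T" using gen(2) q by (rule tens_space_mult)
  have "D j (gen x * p * q) = e (gen x) 1 \<otimes>\<^sub>E (e p 1 \<otimes>\<^sub>E D j q \<oplus>\<^sub>E e 1 (\<rho> q) \<otimes>\<^sub>E D j p) \<oplus>\<^sub>E ?d (e 1 (\<rho> (p * q)))"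
    unfolding mult.assoc D_gen[OF gen(1) pq] gen(3) ..
  also have "\<dots> = (e (gen x) 1 \<otimes>\<^sub>E e p 1) \<otimes>\<^sub>E D j q \<oplus>\<^sub>E
      ((e (gen x) 1 \<otimes>\<^sub>E e 1 (\<rho> q)) \<otimes>\<^sub>E D j p \<oplus>\<^sub>E ?d (e 1 (\<rho> (p * q))))"
    using c gen(2) q pq by (simp add: E.MN.r_distr E.MN.m_assoc E.MN.a_assoc)
  also have "e (gen x) 1 \<otimes>\<^sub>E e p 1 = e (gen x * p) 1"
    using gx gen(2) by (simp add: e_mult del: tens_space_gen)
  also have "e (gen x) 1 \<otimes>\<^sub>E e 1 (\<rho> q) = e 1 (\<rho> q) \<otimes>\<^sub>E e (gen x) 1"
    using gx q by (simp add: e_mult del: tens_space_gen)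
  also have "?d (e 1 (\<rho> (p * q))) = e 1 (\<rho> q) \<otimes>\<^sub>E ?d (e 1 (\<rho> p))"
    using gen(2) q c by (simp add: e_mult \<rho>_simps)
  also have "(e 1 (\<rho> q) \<otimes>\<^sub>E e (gen x) 1) \<otimes>\<^sub>E D j p \<oplus>\<^sub>E e 1 (\<rho> q) \<otimes>\<^sub>E ?d (e 1 (\<rho> p)) =
      e 1 (\<rho> q) \<otimes>\<^sub>E D j (gen x * p)"
    using c gen(2) by (simp add: D_gen[OF gen(1,2)] E.MN.r_distr E.MN.m_assoc)
  finally show ?case .
qed

lemma D_sum: "(!!i. i \<in> K ==> f i \<in> T) ==> D j (\<Sum>i\<in>K. f i) = (\<Oplus>\<^sub>E i\<in>K. D j (f i))"
proof (induction K rule: infinite_finite_induct)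
  case (insert i K)
  then have "f i \<in> T" "(\<Sum>i\<in>K. f i) \<in> T" "(\<lambda>i. D j (f i)) \<in> K \<rightarrow> carrier E"
    by (auto intro!: tens_space_sum)
  then show ?case using insert by (simp add: D_add)
qed simp_all

lemma D_uminus: "p \<in> T ==> D j (- p) = \<ominus>\<^sub>E D j p"
  using D_add[of "- p" p j] by (intro E.MN.minus_equality[symmetric]) (auto simp: tens_space_uminus)

lemma D_minus: "p \<in> T ==> q \<in> T ==> D j (p - q) = D j p \<ominus>\<^sub>E D j q"
  using D_add[of p "- q" j] by (simp add: D_uminus tens_space_uminus a_minus_def)

text \<open>The fundamental identity of the free differential calculus.\<close>

definition Y :: "nat => (nat, 'a) tens set env" where "Y j = e (gen j) 1 \<ominus>\<^sub>E e 1 (\<rho> (gen j))"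

lemma Y_closed [simp]: "j \<in> X ==> Y j \<in> carrier E"
  unfolding Y_def by (intro E.MN.minus_closed e_closed gen_T \<rho>_T tens_space_one)

lemma fundamental:
  assumes "p \<in> T" shows "(\<Oplus>\<^sub>E j\<in>X. D j p \<otimes>\<^sub>E Y j) = e p 1 \<ominus>\<^sub>E e 1 (\<rho> p)"
  using assms
proof (induction rule: tens_space_gen_induct)
  case zero
  have "(\<Oplus>\<^sub>E j\<in>X. D j 0 \<otimes>\<^sub>E Y j) = (\<Oplus>\<^sub>E j\<in>X. \<zero>\<^sub>E)"
    by (intro E.MN.finsum_cong') auto
  then show ?case by (simp add: e_zero \<rho>_simps a_minus_def)
next
  case (add p q)
  have "(\<Oplus>\<^sub>E j\<in>X. D j (p + q) \<otimes>\<^sub>E Y j) = (\<Oplus>\<^sub>E j\<in>X. D j p \<otimes>\<^sub>E Y j \<oplus>\<^sub>E D j q \<otimes>\<^sub>E Y j)"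
    by (intro E.MN.finsum_cong') (use add in \<open>auto simp: D_add E.MN.l_distr\<close>)
  also have "\<dots> = (\<Oplus>\<^sub>E j\<in>X. D j p \<otimes>\<^sub>E Y j) \<oplus>\<^sub>E (\<Oplus>\<^sub>E j\<in>X. D j q \<otimes>\<^sub>E Y j)"
    by (rule E.MN.finsum_addf) (use add in auto)
  finally show ?case using add
    by (simp add: e_add_l e_add_r \<rho>_simps a_minus_def E.MN.minus_add E.MN.a_ac)
next
  case (scal c p)
  have "(\<Oplus>\<^sub>E j\<in>X. D j (scal c * p) \<otimes>\<^sub>E Y j) = (\<Oplus>\<^sub>E j\<in>X. \<kappa> c \<otimes>\<^sub>E (D j p \<otimes>\<^sub>E Y j))"
    by (intro E.MN.finsum_cong') (use scal in \<open>auto simp: D_scal E.MN.m_assoc\<close>)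
  also have "\<dots> = \<kappa> c \<otimes>\<^sub>E (\<Oplus>\<^sub>E j\<in>X. D j p \<otimes>\<^sub>E Y j)"
    by (rule E.MN.finsum_rdistr[symmetric]) (use scal in auto)
  finally show ?case using scal e_scal[of 1 "\<rho> p" c]
    by (simp add: a_minus_def E.MN.r_distr E.MN.r_minus \<kappa>_e \<rho>_simps(7))
next
  case one
  have "(\<Oplus>\<^sub>E j\<in>X. D j 1 \<otimes>\<^sub>E Y j) = (\<Oplus>\<^sub>E j\<in>X. \<zero>\<^sub>E)"
    by (intro E.MN.finsum_cong') auto
  then show ?case by (simp add: \<rho>_simps a_minus_def E.MN.r_neg)
next
  case (gen x p)
  have gx: "gen x \<in> T" by (rule gen_T[OF gen(1)])
  have c: "e p 1 \<in> carrier E" "e (gen x) 1 \<in> carrier E" "e 1 (\<rho> p) \<in> carrier E" "e 1 (\<rho> (gen x)) \<in> carrier E"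
    using gen(2) gx by (simp_all del: tens_space_gen)
  have "(\<Oplus>\<^sub>E j\<in>X. D j (gen x * p) \<otimes>\<^sub>E Y j) =
      (\<Oplus>\<^sub>E j\<in>X. e (gen x) 1 \<otimes>\<^sub>E (D j p \<otimes>\<^sub>E Y j) \<oplus>\<^sub>E (if x = j then e 1 (\<rho> p) \<otimes>\<^sub>E Y j else \<zero>\<^sub>E))"
    by (intro E.MN.finsum_cong') (use gen(1,2) c in \<open>auto simp: D_gen E.MN.m_assoc E.MN.l_distr\<close>)
  also have "\<dots> = (\<Oplus>\<^sub>E j\<in>X. e (gen x) 1 \<otimes>\<^sub>E (D j p \<otimes>\<^sub>E Y j)) \<oplus>\<^sub>E
      (\<Oplus>\<^sub>E j\<in>X. if x = j then e 1 (\<rho> p) \<otimes>\<^sub>E Y j else \<zero>\<^sub>E)"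
    by (rule E.MN.finsum_addf) (use gen(2) c in auto)
  also have "(\<Oplus>\<^sub>E j\<in>X. e (gen x) 1 \<otimes>\<^sub>E (D j p \<otimes>\<^sub>E Y j)) = e (gen x) 1 \<otimes>\<^sub>E (e p 1 \<ominus>\<^sub>E e 1 (\<rho> p))"
    unfolding gen(3)[symmetric] by (rule E.MN.finsum_rdistr[symmetric]) (use gen(2) c in auto)
  also have "(\<Oplus>\<^sub>E j\<in>X. if x = j then e 1 (\<rho> p) \<otimes>\<^sub>E Y j else \<zero>\<^sub>E) = e 1 (\<rho> p) \<otimes>\<^sub>E Y x"
    by (rule E.MN.add.finprod_singleton[OF gen(1)]) (use c in auto)
  also have "e (gen x) 1 \<otimes>\<^sub>E (e p 1 \<ominus>\<^sub>E e 1 (\<rho> p)) = e (gen x * p) 1 \<ominus>\<^sub>E e (gen x) (\<rho> p)"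
    using gx gen(2) c by (simp add: a_minus_def E.MN.r_distr E.MN.r_minus e_mult del: tens_space_gen)
  also have "e 1 (\<rho> p) \<otimes>\<^sub>E Y x = e (gen x) (\<rho> p) \<ominus>\<^sub>E e 1 (\<rho> (gen x * p))"
    unfolding Y_def \<rho>_simps(2)
    using gx gen(2) c by (simp add: a_minus_def E.MN.r_distr E.MN.r_minus e_mult del: tens_space_gen \<rho>_simps)
  also have "e (gen x * p) 1 \<ominus>\<^sub>E e (gen x) (\<rho> p) \<oplus>\<^sub>E (e (gen x) (\<rho> p) \<ominus>\<^sub>E e 1 (\<rho> (gen x * p))) =
      e (gen x * p) 1 \<ominus>\<^sub>E e 1 (\<rho> (gen x * p))"
    using e_closed[OF tens_space_mult[OF gx gen(2)] tens_space_one] e_closed[OF gx \<rho>_T[OF gen(2)]]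
      e_closed[OF tens_space_one \<rho>_T[OF tens_space_mult[OF gx gen(2)]]]
    by (simp add: a_minus_def E.MN.a_assoc E.MN.r_neg1)
  finally show ?case .
qed

definition \<Delta> :: "nat => (nat, 'a) tens set env"
  where "\<Delta> j = (\<ominus>\<^sub>E (\<kappa> (sg j) \<otimes>\<^sub>E Y (pa j))) \<ominus>\<^sub>E \<kappa> (vc j)"

lemma \<Delta>_closed [simp]: "j \<in> X ==> \<Delta> j \<in> carrier E"
  unfolding \<Delta>_def using pa(1) by (intro E.MN.minus_closed E.MN.a_inv_closed E.MN.m_closed \<kappa>_closed Y_closed)

lemma D_scalar: "D j (scal c) = \<zero>\<^sub>E"
  using D_scal[of 1 j c] by simp

text \<open>The partial derivative of the relator by \<open>x\<^sub>j\<close> consists of the two quadratic terms that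
  contain \<open>x\<^sub>j\<close> and of the linear term \<open>v\<^sub>j\<close>.\<close>

lemma D_rel: "j \<in> X ==> D j rel = \<Delta> j"
proof -
  assume j: "j \<in> X"
  let ?j = "pa j"
  have pj: "?j \<in> X" by (rule pa(1)[OF j])
  have gT: "gen i \<in> T" if "i \<in> X" for i by (rule gen_T[OF that])
  have vec: "D j vec = \<kappa> (vc j)"
  proof -
    have "D j vec = (\<Oplus>\<^sub>E i\<in>X. D j (scal (vc i) * gen i))"
      unfolding vec_def by (rule D_sum) (intro T_scal gT)
    also have "\<dots> = (\<Oplus>\<^sub>E i\<in>X. if j = i then \<kappa> (vc i) else \<zero>\<^sub>E)"
    proof (intro E.MN.finsum_cong' refl)
      fix i assume "i \<in> X"
      then show "D j (scal (vc i) * gen i) = (if j = i then \<kappa> (vc i) else \<zero>\<^sub>E)"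
        using D_scal[OF gT, of i j "vc i"] D_gen1[of i j] by simp
    qed auto
    also have "\<dots> = \<kappa> (vc j)" by (rule E.MN.add.finprod_singleton[OF j]) auto
    finally show ?thesis .
  qed
  let ?a = "\<kappa> (sg j) \<otimes>\<^sub>E e 1 (\<rho> (gen ?j))" and ?b = "\<kappa> (sg ?j) \<otimes>\<^sub>E e (gen ?j) 1"
  have ac: "?a \<in> carrier E" "?b \<in> carrier E"
    using pj by (intro E.MN.m_closed \<kappa>_closed e_closed tens_space_one \<rho>_T gT; assumption)+
  have r0: "D j rel0 = ?a \<oplus>\<^sub>E ?b"
  proof -
    have "D j rel0 = (\<Oplus>\<^sub>E i\<in>X. D j (scal (sg i) * (gen i * gen (pa i))))"
      unfolding rel0_def by (rule D_sum) (intro T_scal tens_space_mult gT pa(1))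
    also have "\<dots> = (\<Oplus>\<^sub>E i\<in>X. (if j = i then ?a else \<zero>\<^sub>E) \<oplus>\<^sub>E (if ?j = i then ?b else \<zero>\<^sub>E))"
    proof (intro E.MN.finsum_cong' refl)
      show "(\<lambda>i. (if j = i then ?a else \<zero>\<^sub>E) \<oplus>\<^sub>E (if ?j = i then ?b else \<zero>\<^sub>E)) \<in> X \<rightarrow> carrier E"
        using ac by auto
      fix i assume i: "i \<in> X"
      have pi: "pa i \<in> X" by (rule pa(1)[OF i])
      have c: "e (gen i) 1 \<in> carrier E" "e 1 (\<rho> (gen (pa i))) \<in> carrier E"
        using gT[OF i] gT[OF pi] by (simp_all del: tens_space_gen)
      have iff: "pa i = j \<longleftrightarrow> ?j = i" using pa_eq_iff[OF i j] by metis
      have "D j (scal (sg i) * (gen i * gen (pa i))) = \<kappa> (sg i) \<otimes>\<^sub>E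
          (e (gen i) 1 \<otimes>\<^sub>E D j (gen (pa i)) \<oplus>\<^sub>E e 1 (\<rho> (gen (pa i))) \<otimes>\<^sub>E D j (gen i))"
        using D_scal[OF tens_space_mult[OF gT[OF i] gT[OF pi]]] D_mult[OF gT[OF i] gT[OF pi]] by simp
      also have "\<dots> = (if j = i then ?a else \<zero>\<^sub>E) \<oplus>\<^sub>E (if ?j = i then ?b else \<zero>\<^sub>E)"
        unfolding D_gen1[OF i] D_gen1[OF pi] iff using c ac pa(7)[OF j] by auto
      finally show "D j (scal (sg i) * (gen i * gen (pa i))) =
          (if j = i then ?a else \<zero>\<^sub>E) \<oplus>\<^sub>E (if ?j = i then ?b else \<zero>\<^sub>E)" .
    qed
    also have "\<dots> = (\<Oplus>\<^sub>E i\<in>X. if j = i then ?a else \<zero>\<^sub>E) \<oplus>\<^sub>E (\<Oplus>\<^sub>E i\<in>X. if ?j = i then ?b else \<zero>\<^sub>E)"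
      by (rule E.MN.finsum_addf) (use ac in auto)
    also have "(\<Oplus>\<^sub>E i\<in>X. if j = i then ?a else \<zero>\<^sub>E) = ?a"
      by (rule E.MN.add.finprod_singleton[OF j]) (use ac in auto)
    also have "(\<Oplus>\<^sub>E i\<in>X. if ?j = i then ?b else \<zero>\<^sub>E) = ?b"
      by (rule E.MN.add.finprod_singleton[OF pj]) (use ac in auto)
    finally show ?thesis .
  qed
  have c: "e (gen ?j) 1 \<in> carrier E" "e 1 (\<rho> (gen ?j)) \<in> carrier E"
    using pj by (intro e_closed tens_space_one \<rho>_T gT; assumption)+
  have "D j rel = D j (rel0 - vec - scal l)" by (rule arg_cong[OF rel_def])
  also have "\<dots> = D j rel0 \<ominus>\<^sub>E \<kappa> (vc j) \<ominus>\<^sub>E \<zero>\<^sub>E"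
    using D_minus[OF rel0_in vec_in] D_minus[OF tens_space_diff[OF rel0_in vec_in] tens_space_scal]
    by (simp add: vec D_scalar)
  also have "\<dots> = \<Delta> j"
    unfolding r0 \<Delta>_def Y_def pa(3)[OF j] \<kappa>_uminus using c
    by (simp add: a_minus_def E.MN.r_distr E.MN.r_minus E.MN.l_minus E.MN.minus_add E.MN.a_comm)
  finally show ?thesis .
qed

text \<open>On a product with a factor in the ideal one of the two terms of the Leibniz rule vanishes in
  \<open>E\<close>; so the property of the relator spreads to the ideal.\<close>

lemma D_I: "p \<in> I ==> \<exists>t\<in>carrier E. \<forall>j\<in>X. D j p = t \<otimes>\<^sub>E \<Delta> j"
proof -
  let ?J = "{p \<in> T. p \<in> I \<and> \<rho> p \<in> I \<and> (\<exists>t\<in>carrier E. \<forall>j\<in>X. D j p = t \<otimes>\<^sub>E \<Delta> j)}"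
  have "I \<subseteq> ?J"
  proof (rule I_subset_rel)
    show "rel \<in> ?J"
      using rel_in rel_I \<rho>_rel D_rel by (auto intro!: bexI[of _ "\<one>\<^sub>E"])
    show "0 \<in> ?J" by (auto simp: \<rho>_simps intro!: bexI[of _ "\<zero>\<^sub>E"])
    fix p q
    { assume "p \<in> ?J" "q \<in> ?J"
      then obtain t u where "t \<in> carrier E" "\<forall>j\<in>X. D j p = t \<otimes>\<^sub>E \<Delta> j" "u \<in> carrier E" "\<forall>j\<in>X. D j q = u \<otimes>\<^sub>E \<Delta> j"
        and pq: "p \<in> T" "q \<in> T" "p \<in> I" "q \<in> I" "\<rho> p \<in> I" "\<rho> q \<in> I" by blast
      then have "\<forall>j\<in>X. D j (p + q) = (t \<oplus>\<^sub>E u) \<otimes>\<^sub>E \<Delta> j" "t \<oplus>\<^sub>E u \<in> carrier E"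
        by (simp_all add: D_add E.MN.l_distr)
      then have "\<exists>t\<in>carrier E. \<forall>j\<in>X. D j (p + q) = t \<otimes>\<^sub>E \<Delta> j" by blast
      then show "p + q \<in> ?J"
        using pq by (simp add: I_add \<rho>_simps tens_space_add) }
    assume p: "p \<in> T" and "q \<in> ?J"
    then obtain t where t: "t \<in> carrier E" "\<forall>j\<in>X. D j q = t \<otimes>\<^sub>E \<Delta> j"
      and q: "q \<in> T" "q \<in> I" "\<rho> q \<in> I" by blast
    have "\<forall>j\<in>X. D j (p * q) = (e p 1 \<otimes>\<^sub>E t) \<otimes>\<^sub>E \<Delta> j" "e p 1 \<otimes>\<^sub>E t \<in> carrier E"
      using t q p by (simp_all add: D_mult e_I(2)[OF q(3)] E.MN.m_assoc)
    then have 1: "\<exists>t\<in>carrier E. \<forall>j\<in>X. D j (p * q) = t \<otimes>\<^sub>E \<Delta> j" by blast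
    show "p * q \<in> ?J"
      using p q 1 by (simp add: I_left \<rho>_simps tens_space_mult)
    have "\<forall>j\<in>X. D j (q * p) = (e 1 (\<rho> p) \<otimes>\<^sub>E t) \<otimes>\<^sub>E \<Delta> j" "e 1 (\<rho> p) \<otimes>\<^sub>E t \<in> carrier E"
      using t q p by (simp_all add: D_mult e_I(1)[OF q(2)] E.MN.m_assoc)
    then have 2: "\<exists>t\<in>carrier E. \<forall>j\<in>X. D j (q * p) = t \<otimes>\<^sub>E \<Delta> j" by blast
    show "q * p \<in> ?J"
      using p q 2 by (simp add: I_right \<rho>_simps tens_space_mult)
  qed auto
  then show "p \<in> I ==> \<exists>t\<in>carrier E. \<forall>j\<in>X. D j p = t \<otimes>\<^sub>E \<Delta> j" by blast
qed

text \<open>\<open>D\<close> does not descend to \<open>U\<close>, but composed with the normal form section it becomes a map on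
  \<open>E\<close>, linear over the right factor.\<close>

definition \<psi> :: "nat => (nat, 'a) tens set env => (nat, 'a) tens set env"
  where "\<psi> j = tensor_lift E (\<lambda>a b. pure_tensor U (opp U) \<one>\<^sub>U b \<otimes>\<^sub>E D j (sec a))"

lemma pure_one: "pure_tensor U (opp U) \<one>\<^sub>U (cls q) = e 1 q"
  by (simp add: e_def A_simps)

lemma \<psi>_balanced: "balanced U (opp U) E (\<lambda>a b. pure_tensor U (opp U) \<one>\<^sub>U b \<otimes>\<^sub>E D j (sec a))"
proof (rule balanced_clsI, unfold pure_one)
  fix p q assume p: "p \<in> T" and q: "q \<in> T"
  have Np: "N p \<in> T" by (rule N_in[OF p])
  have eq: "e 1 q \<in> carrier E" using q by simp
  show "e 1 q \<otimes>\<^sub>E D j (sec (cls p)) \<in> carrier E"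
    using Np eq by (simp add: sec_cls[OF p])
  show "e 1 (q + q') \<otimes>\<^sub>E D j (sec (cls p)) = e 1 q \<otimes>\<^sub>E D j (sec (cls p)) \<oplus>\<^sub>E e 1 q' \<otimes>\<^sub>E D j (sec (cls p))"
    if "q' \<in> T" for q'
    using Np q that by (simp add: sec_cls[OF p] e_add_r E.MN.l_distr)
  show "e 1 q \<otimes>\<^sub>E D j (sec (cls (scal c * p))) = e 1 (scal c * q) \<otimes>\<^sub>E D j (sec (cls p))" for c
  proof -
    have "e 1 q \<otimes>\<^sub>E D j (sec (cls (scal c * p))) = e 1 q \<otimes>\<^sub>E (\<kappa> c \<otimes>\<^sub>E D j (N p))"
      using Np p by (simp add: sec_cls T_scal N_scal D_scal)
    also have "\<dots> = (\<kappa> c \<otimes>\<^sub>E e 1 q) \<otimes>\<^sub>E D j (N p)"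
      unfolding \<kappa>_central[OF eq] using eq Np by (simp add: E.MN.m_assoc)
    finally show ?thesis using q by (simp add: \<kappa>_e' sec_cls[OF p])
  qed
next
  fix p p' q assume "p \<in> T" "p' \<in> T" "q \<in> T"
  then show "e 1 q \<otimes>\<^sub>E D j (sec (cls (p + p'))) = e 1 q \<otimes>\<^sub>E D j (sec (cls p)) \<oplus>\<^sub>E e 1 q \<otimes>\<^sub>E D j (sec (cls p'))"
    by (simp add: sec_cls tens_space_add N_add D_add N_in E.MN.r_distr)
qed

lemma \<psi>_e: "p \<in> T ==> q \<in> T ==> \<psi> j (e p q) = e 1 q \<otimes>\<^sub>E D j (N p)"
  unfolding \<psi>_def by (subst lift_e[OF E_group \<psi>_balanced]) (simp_all add: pure_one sec_cls)

lemma \<psi>_closed: "t \<in> carrier E ==> \<psi> j t \<in> carrier E"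
  unfolding \<psi>_def by (rule E.tensor_lift_closed[OF E_group \<psi>_balanced])

lemma \<psi>_add: "s \<in> carrier E ==> t \<in> carrier E ==> \<psi> j (s \<oplus>\<^sub>E t) = \<psi> j s \<oplus>\<^sub>E \<psi> j t"
  unfolding \<psi>_def by (rule E.tensor_lift_add[OF E_group \<psi>_balanced])

lemma \<psi>_zero: "\<psi> j \<zero>\<^sub>E = \<zero>\<^sub>E"
  unfolding \<psi>_def by (rule E.tensor_lift_zero[OF E_group \<psi>_balanced])

lemma \<psi>_uminus: "t \<in> carrier E ==> \<psi> j (\<ominus>\<^sub>E t) = \<ominus>\<^sub>E \<psi> j t"
  using \<psi>_add[of "\<ominus>\<^sub>E t" t j] by (intro E.MN.minus_equality[symmetric]) (auto simp: \<psi>_zero E.MN.l_neg \<psi>_closed)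

lemma \<psi>_finsum: "f \<in> K \<rightarrow> carrier E ==> \<psi> j (\<Oplus>\<^sub>E i\<in>K. f i) = (\<Oplus>\<^sub>E i\<in>K. \<psi> j (f i))"
  unfolding \<psi>_def by (rule lift_finsum[OF E_group \<psi>_balanced])

lemma \<psi>_Y:
  assumes s: "s \<in> carrier E" and i: "i \<in> X"
  shows "\<exists>t\<in>carrier E. \<forall>j\<in>X. \<psi> j (s \<otimes>\<^sub>E Y i) = (if i = j then s else \<zero>\<^sub>E) \<oplus>\<^sub>E t \<otimes>\<^sub>E \<Delta> j"
  using s
proof (induction rule: E_induct)
  case (pure p q)
  note gT = gen_T[OF i]
  have Np: "N p \<in> T" by (rule N_in[OF pure(1)])
  let ?g = "gen i :: (nat, 'a) tens"
  have rg: "\<rho> ?g \<in> T" by (rule \<rho>_T[OF gT])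
  have pg: "p * ?g \<in> T" "N p * ?g \<in> T" "\<rho> ?g * q \<in> T"
    by (rule tens_space_mult[OF pure(1) gT] tens_space_mult[OF Np gT] tens_space_mult[OF rg pure(2)])+
  have zI: "N (p * ?g) - N p * ?g \<in> I"
  proof -
    have "N (p * ?g) - N p * ?g = (p - N p) * ?g - (p * ?g - N (p * ?g))" by (simp add: algebra_simps)
    also have "\<dots> \<in> I" by (intro I_diff I_right diff_N_I pure(1) gT pg)
    finally show ?thesis .
  qed
  then obtain t where t: "t \<in> carrier E" "\<forall>j\<in>X. D j (N (p * ?g) - N p * ?g) = t \<otimes>\<^sub>E \<Delta> j"
    using D_I by blast
  have eq: "e 1 q \<in> carrier E" using pure(2) by simp
  have "\<psi> j (e p q \<otimes>\<^sub>E Y i) = (if i = j then e p q else \<zero>\<^sub>E) \<oplus>\<^sub>E (e 1 q \<otimes>\<^sub>E t) \<otimes>\<^sub>E \<Delta> j"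
    if j: "j \<in> X" for j
  proof -
    let ?D = "D j (N p)" and ?d = "if i = j then \<one>\<^sub>E else \<zero>\<^sub>E"
    have c: "e p q \<in> carrier E" "e (N p) 1 \<in> carrier E" "e 1 (\<rho> ?g) \<in> carrier E" "e ?g 1 \<in> carrier E"
      "e 1 (\<rho> ?g * q) \<in> carrier E" "e (p * ?g) q \<in> carrier E" "e p (\<rho> ?g * q) \<in> carrier E"
      by (rule e_closed pure Np tens_space_one rg gT pg)+
    have dc: "?D \<in> carrier E" "D j (N p * ?g) \<in> carrier E" "D j (N (p * ?g)) \<in> carrier E" "\<Delta> j \<in> carrier E"
      by (rule D_closed \<Delta>_closed Np pg N_in j)+
    have "e p q \<otimes>\<^sub>E Y i = e (p * ?g) q \<ominus>\<^sub>E e p (\<rho> ?g * q)"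
      unfolding Y_def a_minus_def using c
      by (simp add: E.MN.r_distr E.MN.r_minus e_mult[OF pure gT tens_space_one] e_mult[OF pure tens_space_one rg])
    then have "\<psi> j (e p q \<otimes>\<^sub>E Y i) = e 1 q \<otimes>\<^sub>E D j (N (p * ?g)) \<ominus>\<^sub>E e 1 (\<rho> ?g * q) \<otimes>\<^sub>E ?D"
      using c by (simp add: a_minus_def \<psi>_add \<psi>_uminus \<psi>_e[OF pg(1) pure(2)] \<psi>_e[OF pure(1) pg(3)])
    also have "D j (N (p * ?g)) = D j (N p * ?g) \<oplus>\<^sub>E t \<otimes>\<^sub>E \<Delta> j"
      using D_add[OF pg(2) I_in[OF zI], of j] t(2) j by simp
    also have "D j (N p * ?g) = e (N p) 1 \<otimes>\<^sub>E ?d \<oplus>\<^sub>E e 1 (\<rho> ?g) \<otimes>\<^sub>E ?D"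
      unfolding D_mult[OF Np gT] D_gen1[OF i] ..
    also have "e 1 (\<rho> ?g * q) = e 1 q \<otimes>\<^sub>E e 1 (\<rho> ?g)"
      using e_mult[OF tens_space_one pure(2) tens_space_one rg] by simp
    also have "e 1 q \<otimes>\<^sub>E (e (N p) 1 \<otimes>\<^sub>E ?d \<oplus>\<^sub>E e 1 (\<rho> ?g) \<otimes>\<^sub>E ?D \<oplus>\<^sub>E t \<otimes>\<^sub>E \<Delta> j) \<ominus>\<^sub>E
        e 1 q \<otimes>\<^sub>E e 1 (\<rho> ?g) \<otimes>\<^sub>E ?D = (e 1 q \<otimes>\<^sub>E e (N p) 1) \<otimes>\<^sub>E ?d \<oplus>\<^sub>E (e 1 q \<otimes>\<^sub>E t) \<otimes>\<^sub>E \<Delta> j"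
    proof -
      have d: "?d \<in> carrier E" by simp
      define u v w where "u = (e 1 q \<otimes>\<^sub>E e (N p) 1) \<otimes>\<^sub>E ?d" and "v = (e 1 q \<otimes>\<^sub>E e 1 (\<rho> ?g)) \<otimes>\<^sub>E ?D"
        and "w = (e 1 q \<otimes>\<^sub>E t) \<otimes>\<^sub>E \<Delta> j"
      have uvw: "u \<in> carrier E" "v \<in> carrier E" "w \<in> carrier E"
        unfolding u_def v_def w_def using c dc d eq t(1)
        by (simp_all only: E.MN.m_closed)
      have "e 1 q \<otimes>\<^sub>E (e (N p) 1 \<otimes>\<^sub>E ?d \<oplus>\<^sub>E e 1 (\<rho> ?g) \<otimes>\<^sub>E ?D \<oplus>\<^sub>E t \<otimes>\<^sub>E \<Delta> j) = u \<oplus>\<^sub>E v \<oplus>\<^sub>E w"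
        unfolding u_def v_def w_def using c dc d eq t(1)
        by (simp only: E.MN.r_distr E.MN.m_assoc E.MN.m_closed E.MN.a_closed)
      moreover have "(u \<oplus>\<^sub>E v \<oplus>\<^sub>E w) \<ominus>\<^sub>E v = u \<oplus>\<^sub>E w"
        using uvw E.MN.a_lcomm[of v w "\<ominus>\<^sub>E v"] by (simp add: a_minus_def E.MN.a_assoc E.MN.r_neg)
      ultimately show ?thesis unfolding u_def v_def w_def by simp
    qed
    also have "e 1 q \<otimes>\<^sub>E e (N p) 1 = e p q"
      using e_mult[OF tens_space_one pure(2) Np tens_space_one] e_N[OF pure(1)] by simp
    finally show ?thesis using c by simp
  qed
  moreover have "e 1 q \<otimes>\<^sub>E t \<in> carrier E" using eq t(1) by simp
  ultimately show ?case by blast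
next
  case (add s s')
  then obtain t t' where t: "t \<in> carrier E" "\<forall>j\<in>X. \<psi> j (s \<otimes>\<^sub>E Y i) = (if i = j then s else \<zero>\<^sub>E) \<oplus>\<^sub>E t \<otimes>\<^sub>E \<Delta> j"
    and t': "t' \<in> carrier E" "\<forall>j\<in>X. \<psi> j (s' \<otimes>\<^sub>E Y i) = (if i = j then s' else \<zero>\<^sub>E) \<oplus>\<^sub>E t' \<otimes>\<^sub>E \<Delta> j"
    by blast
  have "\<psi> j ((s \<oplus>\<^sub>E s') \<otimes>\<^sub>E Y i) = (if i = j then s \<oplus>\<^sub>E s' else \<zero>\<^sub>E) \<oplus>\<^sub>E (t \<oplus>\<^sub>E t') \<otimes>\<^sub>E \<Delta> j" if j: "j \<in> X" for j
    using t t' add(1,2) j i \<Delta>_closed[OF j] by (simp add: E.MN.l_distr \<psi>_add E.MN.a_ac)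
  then show ?case using t(1) t'(1) by blast
qed

text \<open>The maps \<open>\<psi>\<^sub>j\<close> form a contraction up to multiples of \<open>\<Delta>\<^sub>j\<close>: applied to \<open>\<Sum>\<^sub>i s\<^sub>i Y\<^sub>i = 0\<close>
  they give back \<open>s\<^sub>j\<close> up to such a multiple, with the same factor for all \<open>j\<close>.\<close>

theorem middle_exact:
  assumes s: "s \<in> X \<rightarrow> carrier E" and 0: "(\<Oplus>\<^sub>E i\<in>X. s i \<otimes>\<^sub>E Y i) = \<zero>\<^sub>E"
  shows "\<exists>t\<in>carrier E. \<forall>j\<in>X. s j = t \<otimes>\<^sub>E \<Delta> j"
proof -
  have sc: "s i \<in> carrier E" if "i \<in> X" for i using s that by blast
  have "\<forall>i\<in>X. \<exists>t\<in>carrier E. \<forall>j\<in>X. \<psi> j (s i \<otimes>\<^sub>E Y i) = (if i = j then s i else \<zero>\<^sub>E) \<oplus>\<^sub>E t \<otimes>\<^sub>E \<Delta> j"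
    using \<psi>_Y sc by blast
  then obtain t where t: "!!i. i \<in> X ==> t i \<in> carrier E"
    "!!i j. i \<in> X ==> j \<in> X ==> \<psi> j (s i \<otimes>\<^sub>E Y i) = (if i = j then s i else \<zero>\<^sub>E) \<oplus>\<^sub>E t i \<otimes>\<^sub>E \<Delta> j"
    by metis
  let ?t = "\<Oplus>\<^sub>E i\<in>X. t i"
  have tc: "?t \<in> carrier E" by (rule E.MN.finsum_closed) (use t(1) in blast)
  have "s j = (\<ominus>\<^sub>E ?t) \<otimes>\<^sub>E \<Delta> j" if j: "j \<in> X" for j
  proof -
    have "\<zero>\<^sub>E = \<psi> j (\<Oplus>\<^sub>E i\<in>X. s i \<otimes>\<^sub>E Y i)" by (simp only: 0 \<psi>_zero)
    also have "\<dots> = (\<Oplus>\<^sub>E i\<in>X. \<psi> j (s i \<otimes>\<^sub>E Y i))"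
      by (rule \<psi>_finsum) (intro funcsetI E.MN.m_closed sc Y_closed)
    also have "\<dots> = (\<Oplus>\<^sub>E i\<in>X. (if j = i then s i else \<zero>\<^sub>E) \<oplus>\<^sub>E t i \<otimes>\<^sub>E \<Delta> j)"
      by (intro E.MN.finsum_cong' refl) (use t sc j \<Delta>_closed[OF j] in auto)
    also have "\<dots> = (\<Oplus>\<^sub>E i\<in>X. if j = i then s i else \<zero>\<^sub>E) \<oplus>\<^sub>E (\<Oplus>\<^sub>E i\<in>X. t i \<otimes>\<^sub>E \<Delta> j)"
      by (rule E.MN.finsum_addf) (use t(1) sc \<Delta>_closed[OF j] in auto)
    also have "(\<Oplus>\<^sub>E i\<in>X. if j = i then s i else \<zero>\<^sub>E) = s j"
      by (rule E.MN.add.finprod_singleton[OF j]) (use sc in auto)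
    also have "(\<Oplus>\<^sub>E i\<in>X. t i \<otimes>\<^sub>E \<Delta> j) = ?t \<otimes>\<^sub>E \<Delta> j"
      by (rule E.MN.finsum_ldistr[symmetric]) (use t(1) \<Delta>_closed[OF j] in auto)
    finally have "s j \<oplus>\<^sub>E ?t \<otimes>\<^sub>E \<Delta> j = \<zero>\<^sub>E" by simp
    then show ?thesis using tc sc[OF j] \<Delta>_closed[OF j]
      by (metis E.MN.l_minus E.MN.m_closed E.MN.minus_equality)
  qed
  then show ?thesis using tc by blast
qed

end

lemma evalT_gen:
  fixes p :: "('x, 'k::field) tens"
  shows "evalT gen p = p"
proof -
  have "prod_list (map gen w) = (wd w :: ('x, 'k) tens)" for w
    by (induction w) (simp_all add: one_wd)
  then show ?thesis unfolding evalT_def by (simp add: lin_wd)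
qed

context weyl
begin

subsection \<open>The two complexes\<close>

definition y :: "nat => (nat, 'k) tens set env" where "y j = e (gen j) 1 \<ominus>\<^sub>E e 1 (gen j)"

definition \<delta> :: "nat => (nat, 'k) tens set env"
  where "\<delta> j = (\<ominus>\<^sub>E (\<kappa> (sg j) \<otimes>\<^sub>E y (pa j))) \<ominus>\<^sub>E \<kappa> (vc j)"

lemma gen_in: "j \<in> X ==> gen j \<in> T" by simp

lemma gen_e: "j \<in> X ==> e (gen j) 1 \<in> carrier E" "j \<in> X ==> e 1 (gen j) \<in> carrier E"
  by (rule e_closed; simp)+

lemma y_closed: "j \<in> X ==> y j \<in> carrier E"
  unfolding y_def by (intro E.MN.minus_closed gen_e)

lemma \<delta>_closed: "j \<in> X ==> \<delta> j \<in> carrier E"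
  unfolding \<delta>_def by (intro E.MN.minus_closed E.MN.a_inv_closed E.MN.m_closed \<kappa>_closed y_closed pa(1))

lemma twist0: "weyl_twist m vc (\<lambda>_. 0)"
  by (intro weyl_twist.intro weyl_twist_axioms.intro weyl_axioms) simp

lemma \<rho>0: "weyl_twist.\<rho> (\<lambda>_. 0) p = (p :: (nat, 'k) tens)"
  by (simp add: weyl_twist.\<rho>_def[OF twist0] evalT_gen)

lemma Y0: "weyl_twist.Y m vc l (\<lambda>_. 0) j = y j"
  by (simp add: weyl_twist.Y_def[OF twist0] \<rho>0 y_def)

lemma \<Delta>0: "weyl_twist.\<Delta> m vc l (\<lambda>_. 0) j = \<delta> j"
  by (simp add: weyl_twist.\<Delta>_def[OF twist0] Y0 \<delta>_def)

lemma \<kappa>_sg: "\<kappa> (sg j) \<otimes>\<^sub>E (\<kappa> (sg j) \<otimes>\<^sub>E t) = t" if "t \<in> carrier E"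
  using that by (simp add: E.MN.m_assoc[symmetric] \<kappa>_mult[symmetric] pa(4))

text \<open>A formal derivative of the relator in the second variable is obtained from the twist by
  the linear term, which turns the dual complex into the original one.\<close>

definition dual_cf :: "nat => 'k" where "dual_cf j = - sg j * vc (pa j)"

lemma twist1: "weyl_twist m vc dual_cf"
proof (intro weyl_twist.intro weyl_twist_axioms.intro weyl_axioms)
  have "(\<Sum>j\<in>X. scal (vc j) * scal (dual_cf j)) = - (\<Sum>j\<in>X. scal (sg j) * scal (vc j * vc (pa j)) :: (nat, 'k) tens)"
    unfolding sum_negf[symmetric]
    by (rule sum.cong) (simp_all add: dual_cf_def scal_mult[symmetric] mult_ac)
  also have "\<dots> = 0"
    by (subst sg_sum_sym) (simp_all add: pa(2) mult.commute[where 'a = 'k])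
  finally show "(\<Sum>j\<in>X. scal (vc j) * scal (dual_cf j)) = (0 :: (nat, 'k) tens)" .
qed

lemma Y1: "j \<in> X ==> weyl_twist.Y m vc l dual_cf j = y j \<ominus>\<^sub>E \<kappa> (dual_cf j)"
  using gen_in[of j] gen_e[of j]
  by (simp add: weyl_twist.Y_def[OF twist1] weyl_twist.\<rho>_simps[OF twist1] y_def e_add_r \<kappa>_alt
      a_minus_def E.MN.minus_add E.MN.a_assoc del: tens_space_gen)

lemma dual_cf_pa: "j \<in> X ==> dual_cf (pa j) = sg j * vc j"
  by (simp add: dual_cf_def pa(2,3))

lemma \<kappa>_Y1:
  assumes j: "j \<in> X"
  shows "\<kappa> (sg j) \<otimes>\<^sub>E weyl_twist.Y m vc l dual_cf (pa j) = \<kappa> (sg j) \<otimes>\<^sub>E y (pa j) \<ominus>\<^sub>E \<kappa> (vc j)"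
proof -
  have "\<kappa> (sg j) \<otimes>\<^sub>E \<kappa> (sg j * vc j) = \<kappa> (vc j)"
    using \<kappa>_sg[OF \<kappa>_closed, of j "vc j"] by (simp add: \<kappa>_mult)
  then show ?thesis
    unfolding Y1[OF pa(1)[OF j]] dual_cf_pa[OF j]
    using y_closed[OF pa(1)[OF j]] by (simp add: a_minus_def E.MN.r_distr E.MN.r_minus)
qed

lemma \<Delta>1: "j \<in> X ==> weyl_twist.\<Delta> m vc l dual_cf j = \<ominus>\<^sub>E (\<kappa> (sg j) \<otimes>\<^sub>E y (pa j))"
  unfolding weyl_twist.\<Delta>_def[OF twist1] \<kappa>_Y1
  using y_closed[OF pa(1)] by (simp add: a_minus_def E.MN.minus_add E.MN.a_assoc E.MN.l_neg E.MN.r_neg)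

lemma \<tau>_y: "j \<in> X ==> \<tau> (y j) = \<ominus>\<^sub>E y j"
  unfolding y_def using gen_in[of j] gen_e[of j]
  by (simp add: \<tau>_add \<tau>_uminus \<tau>_e a_minus_def E.MN.minus_add E.MN.a_comm del: tens_space_gen)

lemma \<tau>_\<delta>: "j \<in> X ==> \<tau> (\<delta> j) = \<kappa> (sg j) \<otimes>\<^sub>E y (pa j) \<ominus>\<^sub>E \<kappa> (vc j)"
  unfolding \<delta>_def using y_closed[OF pa(1), of j] pa(1)[of j] \<kappa>_central[OF y_closed[OF pa(1)], of j "sg j"]
  by (simp add: \<tau>_minus \<tau>_uminus \<tau>_mult \<tau>_\<kappa> \<tau>_y E.MN.l_minus E.MN.r_minus)

lemma y_exact:
  assumes s: "s \<in> X \<rightarrow> carrier E"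
  shows "(\<Oplus>\<^sub>E j\<in>X. s j \<otimes>\<^sub>E y j) = \<zero>\<^sub>E \<longleftrightarrow> (\<exists>t\<in>carrier E. \<forall>j\<in>X. s j = t \<otimes>\<^sub>E \<delta> j)"
proof
  assume "(\<Oplus>\<^sub>E j\<in>X. s j \<otimes>\<^sub>E y j) = \<zero>\<^sub>E"
  then show "\<exists>t\<in>carrier E. \<forall>j\<in>X. s j = t \<otimes>\<^sub>E \<delta> j"
    using weyl_twist.middle_exact[OF twist0 s] unfolding Y0 \<Delta>0 by blast
next
  assume "\<exists>t\<in>carrier E. \<forall>j\<in>X. s j = t \<otimes>\<^sub>E \<delta> j"
  then obtain t where t: "t \<in> carrier E" "\<forall>j\<in>X. s j = t \<otimes>\<^sub>E \<delta> j" by blast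
  have "(\<Oplus>\<^sub>E j\<in>X. \<delta> j \<otimes>\<^sub>E y j) = (\<Oplus>\<^sub>E j\<in>X. weyl_twist.D m vc l (\<lambda>_. 0) j rel \<otimes>\<^sub>E y j)"
    by (intro E.MN.finsum_cong' refl)
      (use weyl_twist.D_rel[OF twist0] \<delta>_closed y_closed in \<open>auto simp: \<Delta>0\<close>)
  also have "\<dots> = \<zero>\<^sub>E"
    using weyl_twist.fundamental[OF twist0, where l = l, OF rel_in] unfolding Y0 \<rho>0
    by (simp add: e_I rel_I a_minus_def)
  finally have 0: "(\<Oplus>\<^sub>E j\<in>X. \<delta> j \<otimes>\<^sub>E y j) = \<zero>\<^sub>E" .
  have "(\<Oplus>\<^sub>E j\<in>X. s j \<otimes>\<^sub>E y j) = (\<Oplus>\<^sub>E j\<in>X. t \<otimes>\<^sub>E (\<delta> j \<otimes>\<^sub>E y j))"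
    by (intro E.MN.finsum_cong' refl) (use t \<delta>_closed y_closed in \<open>auto simp: E.MN.m_assoc\<close>)
  also have "\<dots> = t \<otimes>\<^sub>E (\<Oplus>\<^sub>E j\<in>X. \<delta> j \<otimes>\<^sub>E y j)"
    by (rule E.MN.finsum_rdistr[symmetric]) (use t \<delta>_closed y_closed in auto)
  finally show "(\<Oplus>\<^sub>E j\<in>X. s j \<otimes>\<^sub>E y j) = \<zero>\<^sub>E" using 0 t by simp
qed

lemma sg_pa1: "sg (m + 1) = - 1" by (simp add: sg_def)

lemma \<delta>_injective:
  assumes t: "t \<in> carrier E" and 0: "!!j. j \<in> X ==> t \<otimes>\<^sub>E \<delta> j = \<zero>\<^sub>E"
  shows "t = \<zero>\<^sub>E"
proof (rule shift_injective[OF t])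
  have y1: "y 1 \<in> carrier E" by (rule y_closed[OF one_X(1)])
  have "\<delta> (m + 1) = y 1 \<ominus>\<^sub>E \<kappa> (vc (m + 1))"
    unfolding \<delta>_def sg_pa1 pa(6) using y1 by (simp add: \<kappa>_uminus E.MN.l_minus)
  then show "t \<otimes>\<^sub>E (e (gen 1) 1 \<ominus>\<^sub>E e 1 (gen 1) \<ominus>\<^sub>E \<kappa> (vc (m + 1))) = \<zero>\<^sub>E"
    using 0[OF one_X(4)] by (simp add: y_def)
qed

lemma y_dual_injective:
  assumes t: "t \<in> carrier E" and 0: "!!j. j \<in> X ==> y j \<otimes>\<^sub>E t = \<zero>\<^sub>E"
  shows "t = \<zero>\<^sub>E"
proof -
  have y1: "y 1 \<in> carrier E" by (rule y_closed[OF one_X(1)])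
  have tc: "\<tau> t \<in> carrier E" by (rule \<tau>_closed[OF t])
  have "\<tau> (y 1 \<otimes>\<^sub>E t) = \<ominus>\<^sub>E (\<tau> t \<otimes>\<^sub>E y 1)"
    using y1 t tc \<tau>_y[OF one_X(1)] by (simp add: \<tau>_mult E.MN.r_minus)
  then have "\<ominus>\<^sub>E (\<tau> t \<otimes>\<^sub>E y 1) = \<zero>\<^sub>E" using 0[OF one_X(1)] by (simp add: \<tau>_zero)
  then have "\<tau> t \<otimes>\<^sub>E y 1 = \<zero>\<^sub>E" using y1 tc by (metis E.MN.m_closed E.MN.minus_minus E.MN.minus_zero)
  then have "\<tau> t \<otimes>\<^sub>E (e (gen 1) 1 \<ominus>\<^sub>E e 1 (gen 1) \<ominus>\<^sub>E \<kappa> 0) = \<zero>\<^sub>E"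
    using y1 unfolding y_def by (simp add: a_minus_def)
  then have "\<tau> t = \<zero>\<^sub>E" by (rule shift_injective[OF tc])
  then show ?thesis using \<tau>_\<tau>[OF t] \<tau>_zero by simp
qed

lemma pa_image: "pa ` X = X" using bij_pa by (rule bij_betw_imp_surj_on)
lemma pa_inj: "inj_on pa X" using bij_pa by (rule bij_betw_imp_inj_on)

lemma reindex_pa: "f \<in> X \<rightarrow> carrier E ==> (\<Oplus>\<^sub>E j\<in>X. f (pa j)) = (\<Oplus>\<^sub>E j\<in>X. f j)"
  using E.MN.finsum_reindex[of f pa X] pa_inj unfolding pa_image by simp

text \<open>The swap reverses products, so it turns the statement about right multiples into one about
  left multiples. There the \<open>\<delta>\<^sub>j\<close> become the twisted \<open>Y\<^sub>j\<close>, up to sign and reindexing, and the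
  \<open>y\<^sub>j\<close> become the \<open>\<Delta>\<^sub>j\<close>.\<close>

lemma dual_exact:
  assumes s: "s \<in> X \<rightarrow> carrier E" and 0: "(\<Oplus>\<^sub>E j\<in>X. \<delta> j \<otimes>\<^sub>E s j) = \<zero>\<^sub>E"
  shows "\<exists>t\<in>carrier E. \<forall>j\<in>X. s j = y j \<otimes>\<^sub>E t"
proof -
  let ?Y = "weyl_twist.Y m vc l dual_cf"
  have sc: "s j \<in> carrier E" if "j \<in> X" for j using s that by blast
  have Yc: "?Y j \<in> carrier E" if "j \<in> X" for j by (rule weyl_twist.Y_closed[OF twist1 that])
  define S where "S i = \<tau> (s (pa i)) \<otimes>\<^sub>E \<kappa> (sg (pa i))" for i
  have Sc: "S i \<in> carrier E" if "i \<in> X" for i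
    unfolding S_def by (intro E.MN.m_closed \<tau>_closed sc pa(1) that \<kappa>_closed)
  have Sp: "S (pa j) \<otimes>\<^sub>E ?Y (pa j) = \<tau> (\<delta> j \<otimes>\<^sub>E s j)" if j: "j \<in> X" for j
    unfolding S_def pa(2)[OF j] \<tau>_mult[OF \<delta>_closed[OF j] sc[OF j]] \<tau>_\<delta>[OF j] \<kappa>_Y1[OF j, symmetric]
    by (rule E.MN.m_assoc[OF \<tau>_closed[OF sc[OF j]] \<kappa>_closed Yc[OF pa(1)[OF j]]])
  have "(\<Oplus>\<^sub>E i\<in>X. S i \<otimes>\<^sub>E ?Y i) = (\<Oplus>\<^sub>E j\<in>X. S (pa j) \<otimes>\<^sub>E ?Y (pa j))"
    by (rule reindex_pa[symmetric]) (use Sc Yc in auto)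
  also have "\<dots> = (\<Oplus>\<^sub>E j\<in>X. \<tau> (\<delta> j \<otimes>\<^sub>E s j))"
    by (intro E.MN.finsum_cong' refl funcsetI Sp \<tau>_closed E.MN.m_closed \<delta>_closed sc)
  also have "\<dots> = \<tau> (\<Oplus>\<^sub>E j\<in>X. \<delta> j \<otimes>\<^sub>E s j)"
    by (rule \<tau>_finsum[symmetric]) (intro funcsetI E.MN.m_closed \<delta>_closed sc)
  finally have "(\<Oplus>\<^sub>E i\<in>X. S i \<otimes>\<^sub>E ?Y i) = \<zero>\<^sub>E" by (simp only: 0 \<tau>_zero)
  moreover have "S \<in> X \<rightarrow> carrier E" using Sc by blast
  ultimately obtain t where t: "t \<in> carrier E" "\<forall>i\<in>X. S i = t \<otimes>\<^sub>E weyl_twist.\<Delta> m vc l dual_cf i"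
    using weyl_twist.middle_exact[OF twist1] by blast
  have tc: "\<tau> t \<in> carrier E" by (rule \<tau>_closed[OF t(1)])
  have "s j = y j \<otimes>\<^sub>E (\<ominus>\<^sub>E \<tau> t)" if j: "j \<in> X" for j
  proof -
    have pj: "pa j \<in> X" by (rule pa(1)[OF j])
    have yj: "y j \<in> carrier E" by (rule y_closed[OF j])
    have sj: "\<tau> (s j) \<in> carrier E" by (rule \<tau>_closed[OF sc[OF j]])
    have "\<tau> (s j) \<otimes>\<^sub>E \<kappa> (sg j) = t \<otimes>\<^sub>E (\<ominus>\<^sub>E (\<kappa> (sg (pa j)) \<otimes>\<^sub>E y j))"
      using t(2)[rule_format, OF pj] \<Delta>1[OF pj] unfolding S_def pa(2)[OF j] by simp
    also have "\<dots> = (t \<otimes>\<^sub>E y j) \<otimes>\<^sub>E \<kappa> (sg j)"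
      unfolding pa(3)[OF j] \<kappa>_uminus using t(1) yj
      by (simp add: E.MN.l_minus E.MN.r_minus E.MN.m_assoc \<kappa>_central)
    finally have "\<tau> (s j) \<otimes>\<^sub>E \<kappa> (sg j) \<otimes>\<^sub>E \<kappa> (sg j) = (t \<otimes>\<^sub>E y j) \<otimes>\<^sub>E \<kappa> (sg j) \<otimes>\<^sub>E \<kappa> (sg j)" by simp
    then have "\<tau> (s j) = t \<otimes>\<^sub>E y j"
      using sj t(1) yj by (simp add: E.MN.m_assoc \<kappa>_mult[symmetric] pa(4))
    then have "s j = \<tau> (t \<otimes>\<^sub>E y j)" using \<tau>_\<tau>[OF sc[OF j]] by simp
    also have "\<dots> = y j \<otimes>\<^sub>E (\<ominus>\<^sub>E \<tau> t)"
      using t(1) yj tc by (simp add: \<tau>_mult \<tau>_y[OF j] E.MN.l_minus E.MN.r_minus)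
    finally show ?thesis .
  qed
  then show ?thesis using tc by blast
qed

subsection \<open>The bimodule \<open>U\<close>\<close>

definition lact :: "(nat, 'k) tens set env => (nat, 'k) tens set => (nat, 'k) tens set"
  where "lact t b = tensor_lift U (\<lambda>x z. x \<otimes>\<^sub>U b \<otimes>\<^sub>U z) t"

lemma lact_balanced: "b \<in> carrier U ==> balanced U (opp U) U (\<lambda>x z. x \<otimes>\<^sub>U b \<otimes>\<^sub>U z)"
  by (auto simp: balanced_def A.l_distr A.r_distr A.smult_mult_l A.smult_mult_r)

lemma lact_closed: "t \<in> carrier E ==> b \<in> carrier U ==> lact t b \<in> carrier U"
  unfolding lact_def by (rule E.tensor_lift_closed[OF U_group lact_balanced])

lemma lact_add: "s \<in> carrier E ==> t \<in> carrier E ==> b \<in> carrier U ==> lact (s \<oplus>\<^sub>E t) b = lact s b \<oplus>\<^sub>U lact t b"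
  unfolding lact_def by (rule E.tensor_lift_add[OF U_group lact_balanced])

lemma lact_e: "p \<in> T ==> q \<in> T ==> r \<in> T ==> lact (e p q) (cls r) = cls (p * r * q)"
  unfolding lact_def by (subst lift_e[OF U_group lact_balanced]) (simp_all add: cls_mult tens_space_mult)

lemma lact_e': "p \<in> T ==> q \<in> T ==> b \<in> carrier U ==> lact (e p q) b = cls p \<otimes>\<^sub>U b \<otimes>\<^sub>U cls q"
  unfolding lact_def by (subst lift_e[OF U_group lact_balanced]) simp_all

lemma lact_add_r: "t \<in> carrier E ==> b \<in> carrier U ==> c \<in> carrier U ==> lact t (b \<oplus>\<^sub>U c) = lact t b \<oplus>\<^sub>U lact t c"
proof (induction rule: E_induct)
  case (pure p q)
  then show ?case by (simp add: lact_e' A.l_distr A.r_distr)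
next
  case (add s t)
  then show ?case by (simp add: lact_add lact_closed A.a_ac)
qed

lemma lact_mult: "s \<in> carrier E ==> t \<in> carrier E ==> b \<in> carrier U ==> lact (s \<otimes>\<^sub>E t) b = lact s (lact t b)"
proof (induction s rule: E_induct)
  case (pure p q)
  from \<open>t \<in> carrier E\<close> \<open>b \<in> carrier U\<close> show ?case
  proof (induction t rule: E_induct)
    case (pure p' q')
    then show ?case using \<open>p \<in> T\<close> \<open>q \<in> T\<close>
      by (simp add: e_mult lact_e' tens_space_mult cls_mult[symmetric] A.m_assoc)
  next
    case (add s t)
    then show ?case using \<open>p \<in> T\<close> \<open>q \<in> T\<close>
      by (simp add: E.MN.r_distr lact_add lact_add_r lact_closed)
  qed
next
  case (add s s')
  then show ?case by (simp add: E.MN.l_distr lact_add lact_closed)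
qed

lemma lact_one: "b \<in> carrier U ==> lact \<one>\<^sub>E b = b"
  unfolding e_one by (simp add: lact_e' A_simps(3)[symmetric])

lemma env_left_simps [simp]: "carrier (env_left U) = carrier U" "add (env_left U) = add U"
  "zero (env_left U) = zero U" "smult (env_left U) = lact"
  by (simp_all add: env_left_def lact_def fun_eq_iff)

lemma env_left_module: "left_module E (env_left U)"
  by (intro left_module.intro left_module_axioms.intro E.MN.ring_axioms
      abelian_group_cong[OF U_group])
    (simp_all add: lact_closed lact_add lact_add_r lact_mult lact_one)

lemma ract_balanced: "b \<in> carrier U ==> balanced U (opp U) U (\<lambda>x z. z \<otimes>\<^sub>U b \<otimes>\<^sub>U x)"
  by (auto simp: balanced_def A.l_distr A.r_distr A.smult_mult_l A.smult_mult_r)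

lemma ract: "t \<in> carrier E ==> b \<in> carrier U ==> tensor_lift U (\<lambda>x z. z \<otimes>\<^sub>U b \<otimes>\<^sub>U x) t = lact (\<tau> t) b"
proof (induction rule: E_induct)
  case (pure p q)
  then show ?case using lift_e[OF U_group ract_balanced] by (simp add: \<tau>_e lact_e')
next
  case (add s t)
  then show ?case
    using E.tensor_lift_add[OF U_group ract_balanced] by (simp add: \<tau>_add lact_add \<tau>_closed)
qed

lemma env_right_simps [simp]: "carrier (env_right U) = carrier U" "add (env_right U) = add U"
  "zero (env_right U) = zero U"
  by (simp_all add: env_right_def)

lemma env_right_smult: "t \<in> carrier E ==> b \<in> carrier U ==> t \<odot>\<^sub>(env_right U) b = lact (\<tau> t) b"
  by (simp add: env_right_def ract)

lemma \<tau>_one: "\<tau> \<one>\<^sub>E = \<one>\<^sub>E" unfolding e_one by (simp add: \<tau>_e)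

lemma env_right_module: "left_module (opp E) (env_right U)"
  by (intro left_module.intro left_module_axioms.intro opp_ring[OF E.MN.ring_axioms]
      abelian_group_cong[OF U_group])
    (simp_all add: env_right_smult lact_closed lact_add lact_add_r lact_mult lact_one \<tau>_closed \<tau>_add \<tau>_mult \<tau>_one)

lemma U_one: "\<one>\<^sub>U \<in> carrier U" by simp

lemma lact_zero: "b \<in> carrier U ==> lact \<zero>\<^sub>E b = \<zero>\<^sub>U"
  unfolding lact_def by (rule E.tensor_lift_zero[OF U_group lact_balanced])

lemma lact_finsum: "f \<in> K \<rightarrow> carrier E ==> b \<in> carrier U ==> lact (\<Oplus>\<^sub>E i\<in>K. f i) b = (\<Oplus>\<^sub>U i\<in>K. lact (f i) b)"
  unfolding lact_def by (rule lift_finsum[OF U_group lact_balanced])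

lemma lact_uminus: "t \<in> carrier E ==> b \<in> carrier U ==> lact (\<ominus>\<^sub>E t) b = \<ominus>\<^sub>U lact t b"
  using lact_add[of "\<ominus>\<^sub>E t" t b]
  by (intro A.minus_equality[symmetric]) (auto simp: lact_closed lact_zero E.MN.l_neg)

lemma lact_y: "j \<in> X ==> b \<in> carrier U ==> lact (y j) b = cls (gen j) \<otimes>\<^sub>U b \<ominus>\<^sub>U b \<otimes>\<^sub>U cls (gen j)"
  unfolding y_def using gen_in[of j] gen_e[of j]
  by (simp add: a_minus_def lact_add lact_uminus lact_e' A_simps(3)[symmetric] del: tens_space_gen)

lemma lact_y_one: "j \<in> X ==> lact (y j) \<one>\<^sub>U = \<zero>\<^sub>U"
  using gen_in[of j] by (simp add: lact_y a_minus_def A.r_neg del: tens_space_gen)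

lemma lact_zero_r: "t \<in> carrier E ==> lact t \<zero>\<^sub>U = \<zero>\<^sub>U"
  using left_module.lsmult_r_null[OF env_left_module, of t] by simp

text \<open>Modulo the left ideal generated by the \<open>y\<^sub>j\<close> every letter can be moved to the right factor.\<close>

lemma y_generate:
  assumes "t \<in> carrier E"
  shows "\<exists>s\<in>X \<rightarrow> carrier E. t = pure_tensor U (opp U) \<one>\<^sub>U (lact t \<one>\<^sub>U) \<oplus>\<^sub>E (\<Oplus>\<^sub>E j\<in>X. s j \<otimes>\<^sub>E y j)"
  using assms
proof (induction rule: E_induct)
  case (pure p q)
  let ?D = "weyl_twist.D m vc l (\<lambda>_. 0)"
  have Dc: "?D j p \<in> carrier E" for j by (rule weyl_twist.D_closed[OF twist0 pure(1)])
  have c: "e 1 q \<in> carrier E" "e p 1 \<in> carrier E" "e 1 p \<in> carrier E" "e p q \<in> carrier E" "e 1 (p * q) \<in> carrier E"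
    using pure by (auto intro: tens_space_mult)
  have "(\<Oplus>\<^sub>E j\<in>X. (e 1 q \<otimes>\<^sub>E ?D j p) \<otimes>\<^sub>E y j) = (\<Oplus>\<^sub>E j\<in>X. e 1 q \<otimes>\<^sub>E (?D j p \<otimes>\<^sub>E y j))"
    by (intro E.MN.finsum_cong' refl) (use c Dc y_closed in \<open>auto simp: E.MN.m_assoc\<close>)
  also have "\<dots> = e 1 q \<otimes>\<^sub>E (\<Oplus>\<^sub>E j\<in>X. ?D j p \<otimes>\<^sub>E y j)"
    by (rule E.MN.finsum_rdistr[symmetric]) (use c Dc y_closed in auto)
  also have "(\<Oplus>\<^sub>E j\<in>X. ?D j p \<otimes>\<^sub>E y j) = e p 1 \<ominus>\<^sub>E e 1 p"
    using weyl_twist.fundamental[OF twist0, where l = l, OF pure(1)] unfolding Y0 \<rho>0 .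
  also have "e 1 q \<otimes>\<^sub>E (e p 1 \<ominus>\<^sub>E e 1 p) = e p q \<ominus>\<^sub>E e 1 (p * q)"
    using c pure by (simp add: a_minus_def E.MN.r_distr E.MN.r_minus e_mult)
  finally have "e p q = e 1 (p * q) \<oplus>\<^sub>E (\<Oplus>\<^sub>E j\<in>X. (e 1 q \<otimes>\<^sub>E ?D j p) \<otimes>\<^sub>E y j)"
    using c E.MN.a_lcomm[of "e 1 (p * q)" "e p q" "\<ominus>\<^sub>E e 1 (p * q)"] by (simp add: a_minus_def E.MN.r_neg)
  moreover have "pure_tensor U (opp U) \<one>\<^sub>U (lact (e p q) \<one>\<^sub>U) = e 1 (p * q)"
    using pure lact_e[of p q 1] by (simp add: A_simps(3) e_def)
  moreover have "(\<lambda>j. e 1 q \<otimes>\<^sub>E ?D j p) \<in> X \<rightarrow> carrier E" using c Dc by auto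
  ultimately show ?case by (intro bexI[of _ "\<lambda>j. e 1 q \<otimes>\<^sub>E ?D j p"]) simp_all
next
  case (add t u)
  then obtain s s' where s: "s \<in> X \<rightarrow> carrier E" "s' \<in> X \<rightarrow> carrier E"
    and t: "t = pure_tensor U (opp U) \<one>\<^sub>U (lact t \<one>\<^sub>U) \<oplus>\<^sub>E (\<Oplus>\<^sub>E j\<in>X. s j \<otimes>\<^sub>E y j)"
    and u: "u = pure_tensor U (opp U) \<one>\<^sub>U (lact u \<one>\<^sub>U) \<oplus>\<^sub>E (\<Oplus>\<^sub>E j\<in>X. s' j \<otimes>\<^sub>E y j)" by blast
  have sy: "(\<lambda>j. s j \<otimes>\<^sub>E y j) \<in> X \<rightarrow> carrier E" "(\<lambda>j. s' j \<otimes>\<^sub>E y j) \<in> X \<rightarrow> carrier E"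
    using s y_closed by auto
  have "(\<Oplus>\<^sub>E j\<in>X. (s j \<oplus>\<^sub>E s' j) \<otimes>\<^sub>E y j) = (\<Oplus>\<^sub>E j\<in>X. s j \<otimes>\<^sub>E y j \<oplus>\<^sub>E s' j \<otimes>\<^sub>E y j)"
  proof (intro E.MN.finsum_cong' refl)
    fix j assume "j \<in> X"
    then show "(s j \<oplus>\<^sub>E s' j) \<otimes>\<^sub>E y j = s j \<otimes>\<^sub>E y j \<oplus>\<^sub>E s' j \<otimes>\<^sub>E y j"
      using s y_closed[of j] by (intro E.MN.l_distr) blast+
  qed (use sy in auto)
  also have "\<dots> = (\<Oplus>\<^sub>E j\<in>X. s j \<otimes>\<^sub>E y j) \<oplus>\<^sub>E (\<Oplus>\<^sub>E j\<in>X. s' j \<otimes>\<^sub>E y j)"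
    by (rule E.MN.finsum_addf[OF sy])
  finally have 1: "(\<Oplus>\<^sub>E j\<in>X. (s j \<oplus>\<^sub>E s' j) \<otimes>\<^sub>E y j) = (\<Oplus>\<^sub>E j\<in>X. s j \<otimes>\<^sub>E y j) \<oplus>\<^sub>E (\<Oplus>\<^sub>E j\<in>X. s' j \<otimes>\<^sub>E y j)" .
  let ?q = "\<lambda>t. pure_tensor U (opp U) \<one>\<^sub>U (lact t \<one>\<^sub>U)"
  have 2: "?q (t \<oplus>\<^sub>E u) = ?q t \<oplus>\<^sub>E ?q u"
    using E.pure_add_r[of "\<one>\<^sub>U" "lact t \<one>\<^sub>U" "lact u \<one>\<^sub>U"] lact_closed[OF _ U_one] add(1,2)
    by (simp add: lact_add)
  have c: "?q t \<in> carrier E" "?q u \<in> carrier E"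
    using E.pure_closed[OF U_one] lact_closed[OF _ U_one] add(1,2) by auto
  have d: "(\<Oplus>\<^sub>E j\<in>X. s j \<otimes>\<^sub>E y j) \<in> carrier E" "(\<Oplus>\<^sub>E j\<in>X. s' j \<otimes>\<^sub>E y j) \<in> carrier E"
    by (rule E.MN.finsum_closed[OF sy(1)] E.MN.finsum_closed[OF sy(2)])+
  have "t \<oplus>\<^sub>E u = (?q t \<oplus>\<^sub>E (\<Oplus>\<^sub>E j\<in>X. s j \<otimes>\<^sub>E y j)) \<oplus>\<^sub>E (?q u \<oplus>\<^sub>E (\<Oplus>\<^sub>E j\<in>X. s' j \<otimes>\<^sub>E y j))"
    by (rule arg_cong2[OF t u])
  also have "\<dots> = ?q (t \<oplus>\<^sub>E u) \<oplus>\<^sub>E (\<Oplus>\<^sub>E j\<in>X. (s j \<oplus>\<^sub>E s' j) \<otimes>\<^sub>E y j)"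
    unfolding 1 2 using c d by (simp add: E.MN.a_ac)
  finally have "t \<oplus>\<^sub>E u = ?q (t \<oplus>\<^sub>E u) \<oplus>\<^sub>E (\<Oplus>\<^sub>E j\<in>X. (s j \<oplus>\<^sub>E s' j) \<otimes>\<^sub>E y j)" .
  moreover have "(\<lambda>j. s j \<oplus>\<^sub>E s' j) \<in> X \<rightarrow> carrier E" using s by auto
  ultimately show ?case by (intro bexI[of _ "\<lambda>j. s j \<oplus>\<^sub>E s' j"])
qed

lemma y_kernel:
  assumes r: "r \<in> carrier E"
  shows "lact r \<one>\<^sub>U = \<zero>\<^sub>U \<longleftrightarrow> (\<exists>s\<in>X \<rightarrow> carrier E. r = (\<Oplus>\<^sub>E j\<in>X. s j \<otimes>\<^sub>E y j))"
proof
  assume 0: "lact r \<one>\<^sub>U = \<zero>\<^sub>U"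
  obtain s where s: "s \<in> X \<rightarrow> carrier E"
    "r = pure_tensor U (opp U) \<one>\<^sub>U (lact r \<one>\<^sub>U) \<oplus>\<^sub>E (\<Oplus>\<^sub>E j\<in>X. s j \<otimes>\<^sub>E y j)"
    using y_generate[OF r] by blast
  have "(\<Oplus>\<^sub>E j\<in>X. s j \<otimes>\<^sub>E y j) \<in> carrier E"
    by (rule E.MN.finsum_closed) (use s(1) y_closed in auto)
  then have "r = (\<Oplus>\<^sub>E j\<in>X. s j \<otimes>\<^sub>E y j)"
    using s(2) E.pure_zero_r[OF U_one] unfolding 0 by simp
  then show "\<exists>s\<in>X \<rightarrow> carrier E. r = (\<Oplus>\<^sub>E j\<in>X. s j \<otimes>\<^sub>E y j)" using s(1) by blast
next
  assume "\<exists>s\<in>X \<rightarrow> carrier E. r = (\<Oplus>\<^sub>E j\<in>X. s j \<otimes>\<^sub>E y j)"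
  then obtain s where s: "s \<in> X \<rightarrow> carrier E" "r = (\<Oplus>\<^sub>E j\<in>X. s j \<otimes>\<^sub>E y j)" by blast
  have "lact r \<one>\<^sub>U = (\<Oplus>\<^sub>U j\<in>X. lact (s j \<otimes>\<^sub>E y j) \<one>\<^sub>U)"
    unfolding s(2) by (rule lact_finsum[OF _ U_one]) (use s(1) y_closed in auto)
  also have "\<dots> = (\<Oplus>\<^sub>U j\<in>X. \<zero>\<^sub>U)"
  proof (intro A.finsum_cong' refl)
    fix j assume j: "j \<in> X"
    then have sj: "s j \<in> carrier E" using s(1) by blast
    show "lact (s j \<otimes>\<^sub>E y j) \<one>\<^sub>U = \<zero>\<^sub>U"
      by (simp only: lact_mult[OF sj y_closed[OF j] U_one] lact_y_one[OF j] lact_zero_r[OF sj])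
  qed auto
  finally show "lact r \<one>\<^sub>U = \<zero>\<^sub>U" by simp
qed

lemma E_nontrivial: "\<one>\<^sub>E \<noteq> \<zero>\<^sub>E"
proof
  assume "\<one>\<^sub>E = \<zero>\<^sub>E"
  then have "lact \<one>\<^sub>E \<one>\<^sub>U = lact \<zero>\<^sub>E \<one>\<^sub>U" by simp
  then show False using U_nontrivial by (simp add: lact_one lact_zero)
qed

end

section \<open>Hochschild cohomology and the Calabi-Yau property\<close>

lemma chosen_resolution_resolves:
  fixes R :: "('r, 'z) ring_scheme" and M :: "('r, 'm) module"
    and Q :: "nat => ('r, ('r, 'm) res) module"
  assumes "projective_resolution R M Q d \<epsilon>"
  obtains P d' \<epsilon>' where "chosen_resolution R M = (P, d')" "projective_resolution R M P d' \<epsilon>'"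
proof -
  let ?S = "\<lambda>(P, d). \<exists>\<epsilon>. projective_resolution R M P d \<epsilon>"
  have "?S (Q, d)" using assms by blast
  then have "?S (chosen_resolution R M)" unfolding chosen_resolution_def by (rule someI[of ?S])
  then show thesis using that by (cases "chosen_resolution R M") auto
qed

lemma dual_cohomology_closed:
  fixes i :: nat
  assumes P: "projective_resolution R M P d \<epsilon>"
  defines "H \<equiv> dual_cohomology R P d i"
  shows "\<zero>\<^sub>H \<in> carrier H" "x \<in> carrier H ==> x' \<in> carrier H ==> x \<oplus>\<^sub>H x' \<in> carrier H"
    "r \<in> carrier (opp R) ==> x \<in> carrier H ==> r \<odot>\<^sub>H x \<in> carrier H"
proof -
  note p = projective_resolutionD[OF P]
  let ?D = "ldual R (P i)" and ?Z = "cocycles R P d i" and ?C = "coboundaries R P d i"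
  have D: "left_module (opp R) ?D" by (rule ldual_left_module[OF p(2)])
  have Z: "submod (opp R) ?D ?Z" and C: "submod (opp R) ?D ?C"
    by (rule cocycles_submod coboundaries_submod, rule p, rule p)+
  have H: "H = subquot ?D ?Z ?C" unfolding H_def by (rule dual_cohomology_subquot)
  have car: "carrier H = (\<lambda>f. ?C +>\<^sub>(?D) f) ` ?Z" by (simp add: H subquot_def)
  interpret abelian_subgroup ?C ?D by (rule submod_abelian_subgroup[OF D C])
  have z: "\<zero>\<^sub>(?D) \<in> ?Z" "\<zero>\<^sub>(?D) \<in> ?C" using Z C by (simp_all only: submod_def)
  have "?C +>\<^sub>(?D) \<zero>\<^sub>(?D) = ?C" by (rule a_rcos_const[OF z(2)])
  then show "\<zero>\<^sub>H \<in> carrier H" using z(1) unfolding car by (auto simp: H subquot_def simp del: ldual_simps)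
  assume "x \<in> carrier H"
  then obtain f where f: "f \<in> ?Z" "x = ?C +>\<^sub>(?D) f" unfolding car by blast
  { assume "x' \<in> carrier H"
    then obtain g where g: "g \<in> ?Z" "x' = ?C +>\<^sub>(?D) g" unfolding car by blast
    have "f \<oplus>\<^sub>(?D) g \<in> ?Z" using Z f(1) g(1) by (simp only: submod_def)
    then show "x \<oplus>\<^sub>H x' \<in> carrier H"
      unfolding f(2) g(2) H subquot_add[OF D C Z f(1) g(1)] unfolding H[symmetric] car by (rule imageI) }
  { assume r: "r \<in> carrier (opp R)"
    then have "r \<odot>\<^sub>(?D) f \<in> ?Z" using Z f(1) by (simp only: submod_def)
    then show "r \<odot>\<^sub>H x \<in> carrier H"
      unfolding f(2) H subquot_smult[OF D C Z f(1) r] unfolding H[symmetric] car by (rule imageI) }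
qed

lemma lmod_isomorphic_trans:
  assumes HK: "lmod_isomorphic S H K" and KN: "lmod_isomorphic S K N"
    and "!!x y. x \<in> carrier H ==> y \<in> carrier H ==> x \<oplus>\<^sub>H y \<in> carrier H"
    and "!!r x. r \<in> carrier S ==> x \<in> carrier H ==> r \<odot>\<^sub>H x \<in> carrier H"
  shows "lmod_isomorphic S H N"
proof -
  obtain f where f: "f \<in> lhom S H K" "bij_betw f (carrier H) (carrier K)"
    using HK by (auto simp: lmod_isomorphic_def)
  obtain g where g: "g \<in> lhom S K N" "bij_betw g (carrier K) (carrier N)"
    using KN by (auto simp: lmod_isomorphic_def)
  let ?h = "\<lambda>x\<in>carrier H. g (f x)"
  have "?h \<in> lhom S H N"
    unfolding lhom_def
    using assms(3,4) lhom_closed[OF f(1)] lhom_closed[OF g(1)] lhom_add[OF f(1)] lhom_add[OF g(1)]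
      lhom_smult[OF f(1)] lhom_smult[OF g(1)] by simp
  moreover have "bij_betw ?h (carrier H) (carrier N)"
    using bij_betw_trans[OF f(2) g(2)] by (rule bij_betw_cong[THEN iffD1, rotated]) simp
  ultimately show ?thesis unfolding lmod_isomorphic_def by blast
qed

context weyl
begin

text \<open>The basis indices \<open>j\<close> as elements of the index type in which resolutions are chosen; only
  distinctness matters.\<close>

definition lab :: "nat => 'z list" where "lab j = replicate j undefined"

lemma length_lab [simp]: "length (lab j) = j" by (simp add: lab_def)

lemma inj_lab: "inj_on lab X" by (rule inj_on_inverseI[of _ length]) simp

lemma lab_sum:
  assumes "f \<in> lab ` X \<rightarrow> carrier E"
  shows "(\<Oplus>\<^sub>E b\<in>lab ` X. f b) = (\<Oplus>\<^sub>E j\<in>X. f (lab j))"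
  by (rule E.MN.finsum_reindex[OF assms inj_lab])

lemma lab_sum_y:
  assumes s: "s \<in> lab ` X \<rightarrow> carrier E" and z: "!!j. j \<in> X ==> z j \<in> carrier E"
  shows "(\<Oplus>\<^sub>E b\<in>lab ` X. s b \<otimes>\<^sub>E z (length b)) = (\<Oplus>\<^sub>E j\<in>X. s (lab j) \<otimes>\<^sub>E z j)"
    "(\<Oplus>\<^sub>E b\<in>lab ` X. z (length b) \<otimes>\<^sub>E s b) = (\<Oplus>\<^sub>E j\<in>X. z j \<otimes>\<^sub>E s (lab j))"
  by (subst lab_sum; use s z in \<open>auto simp: Pi_iff\<close>)+

lemma lab_ex:
  assumes "!!s s'. s \<in> lab ` X \<rightarrow> carrier E ==> s' \<in> X \<rightarrow> carrier E ==>
    (!!j. j \<in> X ==> s (lab j) = s' j) ==> P s \<longleftrightarrow> P' s'"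
  shows "(\<exists>s\<in>lab ` X \<rightarrow> carrier E. P s) \<longleftrightarrow> (\<exists>s\<in>X \<rightarrow> carrier E. P' s)"
proof
  assume "\<exists>s\<in>lab ` X \<rightarrow> carrier E. P s"
  then obtain s where s: "s \<in> lab ` X \<rightarrow> carrier E" "P s" by blast
  then have s': "(\<lambda>j. s (lab j)) \<in> X \<rightarrow> carrier E" by auto
  show "\<exists>s\<in>X \<rightarrow> carrier E. P' s" by (rule bexI[OF _ s']) (use assms[OF s(1) s'] s(2) in blast)
next
  assume "\<exists>s\<in>X \<rightarrow> carrier E. P' s"
  then obtain s where s: "s \<in> X \<rightarrow> carrier E" "P' s" by blast
  then have s': "(\<lambda>b. s (length b)) \<in> lab ` X \<rightarrow> carrier E" by auto
  show "\<exists>s\<in>lab ` X \<rightarrow> carrier E. P s" by (rule bexI[OF _ s']) (use assms[OF s' s(1)] s(2) in simp)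
qed

lemma two_step_U:
  "two_step E (env_left U) \<one>\<^sub>U (lab ` X :: 'z list set) (\<lambda>b. y (length b)) (\<lambda>b. \<delta> (length b))"
proof (intro two_step.intro env_left_module two_step_axioms.intro E_nontrivial)
  show "\<one>\<^sub>U \<in> carrier (env_left U)" by simp
  show "finite (lab ` X)" by simp
  show "y (length j) \<in> carrier E" "\<delta> (length j) \<in> carrier E" if "j \<in> lab ` X" for j
    using that y_closed \<delta>_closed by auto
  show "\<exists>r\<in>carrier E. x = r \<odot>\<^sub>(env_left U) \<one>\<^sub>U" if x: "x \<in> carrier (env_left U)" for x
  proof -
    have "x \<in> carrier U" using x by simp
    then obtain p where p: "p \<in> T" "x = cls p" by (rule A_obtain)
    then show ?thesis using lact_e[of p 1 1] by (intro bexI[of _ "e p 1"]) (simp_all add: A_simps(3))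
  qed
  show "r \<odot>\<^sub>(env_left U) \<one>\<^sub>U = \<zero>\<^sub>(env_left U) \<longleftrightarrow>
      (\<exists>s\<in>(lab ` X :: 'z list set) \<rightarrow> carrier E. r = (\<Oplus>\<^sub>E j\<in>lab ` X. s j \<otimes>\<^sub>E y (length j)))"
    if r: "r \<in> carrier E" for r
  proof -
    have "(\<exists>s\<in>(lab ` X :: 'z list set) \<rightarrow> carrier E. r = (\<Oplus>\<^sub>E j\<in>lab ` X. s j \<otimes>\<^sub>E y (length j))) \<longleftrightarrow>
        (\<exists>s\<in>X \<rightarrow> carrier E. r = (\<Oplus>\<^sub>E j\<in>X. s j \<otimes>\<^sub>E y j))"
    proof (rule lab_ex)
      fix s :: "'z list => _" and s' assume s: "s \<in> lab ` X \<rightarrow> carrier E" "s' \<in> X \<rightarrow> carrier E"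
        "!!j. j \<in> X ==> s (lab j) = s' j"
      have "(\<Oplus>\<^sub>E j\<in>X. s (lab j) \<otimes>\<^sub>E y j) = (\<Oplus>\<^sub>E j\<in>X. s' j \<otimes>\<^sub>E y j)"
        by (intro E.MN.finsum_cong' refl) (use s y_closed in auto)
      then show "r = (\<Oplus>\<^sub>E j\<in>lab ` X. s j \<otimes>\<^sub>E y (length j)) \<longleftrightarrow> r = (\<Oplus>\<^sub>E j\<in>X. s' j \<otimes>\<^sub>E y j)"
        using lab_sum_y(1)[where z = y, OF s(1) y_closed] by simp
    qed
    then show ?thesis using y_kernel[OF r] by simp
  qed
  fix s :: "'z list => _" assume s: "s \<in> lab ` X \<rightarrow> carrier E"
  have s': "(\<lambda>j. s (lab j)) \<in> X \<rightarrow> carrier E" using s by auto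
  show "(\<Oplus>\<^sub>E j\<in>lab ` X. s j \<otimes>\<^sub>E y (length j)) = \<zero>\<^sub>E \<longleftrightarrow>
      (\<exists>t\<in>carrier E. \<forall>j\<in>lab ` X. s j = t \<otimes>\<^sub>E \<delta> (length j))"
    using y_exact[OF s'] lab_sum_y(1)[where z = y, OF s y_closed] by simp
  show "\<exists>t\<in>carrier E. \<forall>j\<in>lab ` X. s j = y (length j) \<otimes>\<^sub>E t"
    if "(\<Oplus>\<^sub>E j\<in>lab ` X. \<delta> (length j) \<otimes>\<^sub>E s j) = \<zero>\<^sub>E"
    using dual_exact[OF s'] lab_sum_y(2)[where z = \<delta>, OF s \<delta>_closed] that by simp
next
  fix t assume t: "t \<in> carrier E"
  { assume "!!j. j \<in> lab ` X ==> t \<otimes>\<^sub>E \<delta> (length j) = \<zero>\<^sub>E"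
    from this[OF imageI] show "t = \<zero>\<^sub>E" by (intro \<delta>_injective[OF t]) simp }
  { assume "!!j. j \<in> lab ` X ==> y (length j) \<otimes>\<^sub>E t = \<zero>\<^sub>E"
    from this[OF imageI] show "t = \<zero>\<^sub>E" by (intro y_dual_injective[OF t]) simp }
qed

lemma HH_iso:
  obtains Q :: "nat => (_, ((nat, 'k) tens set env, (nat, 'k) tens set) res) module" and d \<epsilon>
    where "projective_resolution E (env_left U) Q d \<epsilon>"
    "!!i. finite_type E (Q i)" "!!i. i > 2 ==> zero_module (Q i)"
    "!!i. lmod_isomorphic (opp E) (HH_env U i) (dual_cohomology E Q d i)"
    "!!i. lmod_isomorphic (opp E) (dual_cohomology E Q d i) (HH_env U i)"
    "!!i. \<zero>\<^sub>(HH_env U i) \<in> carrier (HH_env U i)" 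
    "!!i. i \<noteq> 2 ==> zero_module (dual_cohomology E Q d i)"
    "two_step.Q E (lab ` X) [] = Q" "two_step.d E (lab ` X) [] (\<lambda>b. y (length b)) (\<lambda>b. \<delta> (length b)) = d"
proof -
  interpret S: two_step E "env_left U" "\<one>\<^sub>U" "lab ` X" "[] :: ((nat, 'k) tens set env + (nat, 'k) tens set) list"
      "\<lambda>b. y (length b)" "\<lambda>b. \<delta> (length b)"
    by (rule two_step_U)
  obtain P d' \<epsilon>' where ch: "chosen_resolution E (env_left U) = (P, d')"
    and P: "projective_resolution E (env_left U) P d' \<epsilon>'"
    by (rule chosen_resolution_resolves[OF S.resolution])
  have HH: "HH_env U i = dual_cohomology E P d' i" for i
    unfolding HH_env_def Ext_reg_def E_eq ch by simp
  show thesis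
  proof (rule that[of S.Q S.d S.\<epsilon>])
    show "lmod_isomorphic (opp E) (HH_env U i) (dual_cohomology E S.Q S.d i)" for i
      unfolding HH by (rule dual_cohomology_independent[OF P S.resolution env_left_module])
    show "lmod_isomorphic (opp E) (dual_cohomology E S.Q S.d i) (HH_env U i)" for i
      unfolding HH by (rule dual_cohomology_independent[OF S.resolution P env_left_module])
    show "\<zero>\<^sub>(HH_env U i) \<in> carrier (HH_env U i)" for i
      unfolding HH by (rule dual_cohomology_closed(1)[OF P])
  qed (rule S.resolution S.resolution_finite S.cohomology_zero refl; assumption?)+
qed

theorem HH_zero: "i \<noteq> 2 ==> zero_module (HH_env U i)"
  by (rule HH_iso) (rule lmod_isomorphic_zero_module)

text \<open>The right action of \<open>E\<close> on the bimodule \<open>U\<close> at \<open>1\<close>; for \<open>v = 0\<close> its kernel is the right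
  ideal generated by the \<open>\<delta>\<^sub>j\<close>.\<close>

definition gact :: "(nat, 'k) tens set env => (nat, 'k) tens set" where "gact r = lact (\<tau> r) \<one>\<^sub>U"

lemma \<tau>_y_sum:
  "s \<in> X \<rightarrow> carrier E ==> \<tau> (\<Oplus>\<^sub>E j\<in>X. s j \<otimes>\<^sub>E y j) = (\<Oplus>\<^sub>E j\<in>X. y j \<otimes>\<^sub>E (\<ominus>\<^sub>E \<tau> (s j)))"
proof -
  assume s: "s \<in> X \<rightarrow> carrier E"
  have sc: "s j \<in> carrier E" if "j \<in> X" for j using s that by blast
  have "\<tau> (\<Oplus>\<^sub>E j\<in>X. s j \<otimes>\<^sub>E y j) = (\<Oplus>\<^sub>E j\<in>X. \<tau> (s j \<otimes>\<^sub>E y j))"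
    by (rule \<tau>_finsum) (intro funcsetI E.MN.m_closed sc y_closed)
  also have "\<dots> = (\<Oplus>\<^sub>E j\<in>X. y j \<otimes>\<^sub>E (\<ominus>\<^sub>E \<tau> (s j)))"
  proof (intro E.MN.finsum_cong' refl)
    show "(\<lambda>j. y j \<otimes>\<^sub>E (\<ominus>\<^sub>E \<tau> (s j))) \<in> X \<rightarrow> carrier E"
      by (intro funcsetI E.MN.m_closed E.MN.a_inv_closed \<tau>_closed sc y_closed)
    show "\<tau> (s j \<otimes>\<^sub>E y j) = y j \<otimes>\<^sub>E (\<ominus>\<^sub>E \<tau> (s j))" if j: "j \<in> X" for j
      using y_closed[OF j] \<tau>_closed[OF sc[OF j]]
      by (simp add: \<tau>_mult[OF sc[OF j] y_closed[OF j]] \<tau>_y[OF j] E.MN.l_minus E.MN.r_minus)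
  qed
  finally show ?thesis .
qed

lemma gact_kernel:
  assumes v0: "!!j. j \<in> X ==> vc j = 0" and r: "r \<in> carrier E"
  shows "gact r = \<zero>\<^sub>U \<longleftrightarrow> (\<exists>s\<in>X \<rightarrow> carrier E. r = (\<Oplus>\<^sub>E j\<in>X. \<delta> j \<otimes>\<^sub>E s j))"
proof
  have \<delta>0: "\<delta> j = \<ominus>\<^sub>E (\<kappa> (sg j) \<otimes>\<^sub>E y (pa j))" if "j \<in> X" for j
    using that y_closed[OF pa(1)[OF that]] by (simp add: \<delta>_def v0 a_minus_def)
  { assume "gact r = \<zero>\<^sub>U"
    then obtain s where s: "s \<in> X \<rightarrow> carrier E" "\<tau> r = (\<Oplus>\<^sub>E j\<in>X. s j \<otimes>\<^sub>E y j)"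
      unfolding gact_def using y_kernel[OF \<tau>_closed[OF r]] by blast
    have sc: "s j \<in> carrier E" if "j \<in> X" for j using s that by blast
    let ?u = "\<lambda>j. \<ominus>\<^sub>E \<tau> (s j)"
    have uc: "?u j \<in> carrier E" if "j \<in> X" for j by (intro E.MN.a_inv_closed \<tau>_closed sc that)
    let ?s = "\<lambda>i. \<kappa> (sg (pa i)) \<otimes>\<^sub>E ?u (pa i)"
    have "r = \<tau> (\<tau> r)" by (rule \<tau>_\<tau>[OF r, symmetric])
    also have "\<dots> = (\<Oplus>\<^sub>E j\<in>X. y j \<otimes>\<^sub>E ?u j)" unfolding s(2) by (rule \<tau>_y_sum[OF s(1)])
    also have "\<dots> = (\<Oplus>\<^sub>E j\<in>X. y (pa j) \<otimes>\<^sub>E ?u (pa j))"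
      by (rule reindex_pa[symmetric]) (intro funcsetI E.MN.m_closed y_closed uc)
    also have "\<dots> = (\<Oplus>\<^sub>E j\<in>X. \<delta> j \<otimes>\<^sub>E ?s j)"
    proof (intro E.MN.finsum_cong' refl)
      show "(\<lambda>j. \<delta> j \<otimes>\<^sub>E ?s j) \<in> X \<rightarrow> carrier E"
        by (intro funcsetI E.MN.m_closed \<delta>_closed \<kappa>_closed uc pa(1))
      fix j assume j: "j \<in> X"
      have c: "y (pa j) \<in> carrier E" "?u (pa j) \<in> carrier E"
        using y_closed[OF pa(1)[OF j]] uc[OF pa(1)[OF j]] by auto
      have "\<delta> j \<otimes>\<^sub>E ?s j = (\<kappa> (sg j) \<otimes>\<^sub>E y (pa j)) \<otimes>\<^sub>E (\<kappa> (sg j) \<otimes>\<^sub>E ?u (pa j))"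
        unfolding \<delta>0[OF j] pa(3)[OF j] \<kappa>_uminus using c by (simp add: E.MN.l_minus E.MN.r_minus)
      also have "\<dots> = y (pa j) \<otimes>\<^sub>E (\<kappa> (sg j) \<otimes>\<^sub>E (\<kappa> (sg j) \<otimes>\<^sub>E ?u (pa j)))"
        unfolding \<kappa>_central[OF c(1)] using c by (simp add: E.MN.m_assoc)
      also have "\<dots> = y (pa j) \<otimes>\<^sub>E ?u (pa j)" using \<kappa>_sg[OF c(2)] by simp
      finally show "y (pa j) \<otimes>\<^sub>E ?u (pa j) = \<delta> j \<otimes>\<^sub>E ?s j" ..
    qed
    finally have "r = (\<Oplus>\<^sub>E j\<in>X. \<delta> j \<otimes>\<^sub>E ?s j)" .
    moreover have "?s \<in> X \<rightarrow> carrier E" by (intro funcsetI E.MN.m_closed \<kappa>_closed uc pa(1))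
    ultimately show "\<exists>s\<in>X \<rightarrow> carrier E. r = (\<Oplus>\<^sub>E j\<in>X. \<delta> j \<otimes>\<^sub>E s j)" by (intro bexI[of _ ?s]) }
  assume "\<exists>s\<in>X \<rightarrow> carrier E. r = (\<Oplus>\<^sub>E j\<in>X. \<delta> j \<otimes>\<^sub>E s j)"
  then obtain s where s: "s \<in> X \<rightarrow> carrier E" "r = (\<Oplus>\<^sub>E j\<in>X. \<delta> j \<otimes>\<^sub>E s j)" by blast
  have sc: "s j \<in> carrier E" if "j \<in> X" for j using s that by blast
  have ds: "\<delta> j \<otimes>\<^sub>E s j \<in> carrier E" if "j \<in> X" for j by (intro E.MN.m_closed \<delta>_closed sc that)
  have "gact r = lact (\<Oplus>\<^sub>E j\<in>X. \<tau> (\<delta> j \<otimes>\<^sub>E s j)) \<one>\<^sub>U"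
    unfolding gact_def s(2) by (subst \<tau>_finsum) (use ds in auto)
  also have "\<dots> = (\<Oplus>\<^sub>U j\<in>X. lact (\<tau> (\<delta> j \<otimes>\<^sub>E s j)) \<one>\<^sub>U)"
    by (rule lact_finsum[OF _ U_one]) (intro funcsetI \<tau>_closed ds)
  also have "\<dots> = (\<Oplus>\<^sub>U j\<in>X. \<zero>\<^sub>U)"
  proof (intro A.finsum_cong' refl)
    fix j assume j: "j \<in> X"
    have c: "y (pa j) \<in> carrier E" "\<tau> (s j) \<in> carrier E"
      using y_closed[OF pa(1)[OF j]] \<tau>_closed[OF sc[OF j]] by auto
    have "\<tau> (\<delta> j) = \<kappa> (sg j) \<otimes>\<^sub>E y (pa j)"
      unfolding \<tau>_\<delta>[OF j] using c by (simp add: v0[OF j] a_minus_def)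
    then have "lact (\<tau> (\<delta> j \<otimes>\<^sub>E s j)) \<one>\<^sub>U = lact (\<tau> (s j)) (lact (\<kappa> (sg j)) (lact (y (pa j)) \<one>\<^sub>U))"
      using c by (simp add: \<tau>_mult[OF \<delta>_closed[OF j] sc[OF j]] lact_mult lact_closed)
    then show "lact (\<tau> (\<delta> j \<otimes>\<^sub>E s j)) \<one>\<^sub>U = \<zero>\<^sub>U"
      using c lact_y_one[OF pa(1)[OF j]] by (simp add: lact_zero_r)
  qed auto
  finally show "gact r = \<zero>\<^sub>U" by simp
qed

lemma CY_if:
  assumes v0: "!!j. j \<in> X ==> vc j = 0"
  shows "calabi_yau 2 U"
proof (rule HH_iso)
  fix Q :: "nat => (_, ((nat, 'k) tens set env, (nat, 'k) tens set) res) module" and d \<epsilon>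
  assume res: "projective_resolution E (env_left U) Q d \<epsilon>"
    and fin: "!!i. finite_type E (Q i)" "!!i. i > 2 ==> zero_module (Q i)"
    and iso: "!!i. lmod_isomorphic (opp E) (HH_env U i) (dual_cohomology E Q d i)"
    and Q: "two_step.Q E (lab ` X) [] = Q" and d: "two_step.d E (lab ` X) [] (\<lambda>b. y (length b)) (\<lambda>b. \<delta> (length b)) = d"
  interpret S: two_step E "env_left U" "\<one>\<^sub>U" "lab ` X" "[] :: ((nat, 'k) tens set env + (nat, 'k) tens set) list"
      "\<lambda>b. y (length b)" "\<lambda>b. \<delta> (length b)"
    by (rule two_step_U)
  have N: "abelian_group (env_right U)" by (rule abelian_group_cong[OF U_group]) simp_all
  have "lmod_isomorphic (opp E) (dual_cohomology E S.Q S.d 2) (env_right U)"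
  proof (rule S.cohomology_two_iso[OF N, where G = gact])
    fix r s assume r: "r \<in> carrier E"
    show "gact r \<in> carrier (env_right U)" using r by (simp add: gact_def lact_closed \<tau>_closed)
    show "gact r = \<zero>\<^sub>(env_right U) \<longleftrightarrow> (\<exists>s\<in>(lab ` X :: ((nat, 'k) tens set env + (nat, 'k) tens set) list set) \<rightarrow> carrier E. r = (\<Oplus>\<^sub>E j\<in>lab ` X. \<delta> (length j) \<otimes>\<^sub>E s j))"
    proof -
      have "(\<exists>s\<in>(lab ` X :: ((nat, 'k) tens set env + (nat, 'k) tens set) list set) \<rightarrow> carrier E. r = (\<Oplus>\<^sub>E j\<in>lab ` X. \<delta> (length j) \<otimes>\<^sub>E s j)) \<longleftrightarrow>
          (\<exists>s\<in>X \<rightarrow> carrier E. r = (\<Oplus>\<^sub>E j\<in>X. \<delta> j \<otimes>\<^sub>E s j))"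
      proof (rule lab_ex)
        fix s :: "_ list => _" and s' assume s: "s \<in> lab ` X \<rightarrow> carrier E" "s' \<in> X \<rightarrow> carrier E"
          "!!j. j \<in> X ==> s (lab j) = s' j"
        have "(\<Oplus>\<^sub>E j\<in>X. \<delta> j \<otimes>\<^sub>E s (lab j)) = (\<Oplus>\<^sub>E j\<in>X. \<delta> j \<otimes>\<^sub>E s' j)"
          by (intro E.MN.finsum_cong' refl) (use s \<delta>_closed in auto)
        then show "r = (\<Oplus>\<^sub>E j\<in>lab ` X. \<delta> (length j) \<otimes>\<^sub>E s j) \<longleftrightarrow> r = (\<Oplus>\<^sub>E j\<in>X. \<delta> j \<otimes>\<^sub>E s' j)"
          using lab_sum_y(2)[where z = \<delta>, OF s(1) \<delta>_closed] by simp
      qed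
      then show ?thesis using gact_kernel[OF v0 r] by simp
    qed
    assume s: "s \<in> carrier E"
    show "gact (r \<oplus>\<^sub>E s) = gact r \<oplus>\<^sub>(env_right U) gact s"
      using r s by (simp add: gact_def \<tau>_add \<tau>_closed lact_add)
    show "gact (r \<otimes>\<^sub>E s) = s \<odot>\<^sub>(env_right U) gact r"
      using r s by (simp add: gact_def \<tau>_mult \<tau>_closed lact_mult lact_closed env_right_smult)
  next
    fix z assume "z \<in> carrier (env_right U)"
    then have "z \<in> carrier U" by simp
    then obtain p where p: "p \<in> T" "z = cls p" by (rule A_obtain)
    have "gact (e 1 p) = z"
      using p lact_e[of p 1 1] by (simp add: gact_def \<tau>_e A_simps(3))
    then show "\<exists>r\<in>carrier E. gact r = z" using p by (intro bexI[of _ "e 1 p"]) simp_all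
  qed
  then have "lmod_isomorphic (opp E) (dual_cohomology E Q d 2) (env_right U)"
    unfolding Q d .
  then have CY2: "lmod_isomorphic (opp E) (HH_env U 2) (env_right U)"
  proof -
    obtain P d' \<epsilon>' where ch: "chosen_resolution E (env_left U) = (P, d')"
      and P: "projective_resolution E (env_left U) P d' \<epsilon>'"
      by (rule chosen_resolution_resolves[OF res])
    have HH: "HH_env U 2 = dual_cohomology E P d' 2"
      unfolding HH_env_def Ext_reg_def E_eq ch by simp
    show ?thesis
      unfolding HH by (rule lmod_isomorphic_trans[OF iso[of 2, unfolded HH]
        \<open>lmod_isomorphic (opp E) (dual_cohomology E Q d 2) (env_right U)\<close>
        dual_cohomology_closed(2)[OF P] dual_cohomology_closed(3)[OF P]])
  qed
  show "calabi_yau 2 U"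
    unfolding calabi_yau_def E_eq
  proof (intro conjI allI impI HH_zero CY2)
    show "\<exists>(P :: nat => (_, ((nat, 'k) tens set env, (nat, 'k) tens set) res) module) \<delta> \<epsilon> l.
        projective_resolution E (env_left U) P \<delta> \<epsilon> \<and> (\<forall>i. finite_type E (P i)) \<and> (\<forall>i>l. zero_module (P i))"
      by (rule exI[of _ Q], rule exI[of _ d], rule exI[of _ \<epsilon>], rule exI[of _ 2])
        (intro conjI allI impI res fin; assumption)
  qed simp_all
qed

text \<open>As some \<open>v\<^sub>j\<close> is nonzero, \<open>U\<close> has a character \<open>\<chi>\<close>: it sends \<open>x\<^sub>j\<close> to \<open>- \<lambda> / v\<^sub>j\<close> and the
  other generators to zero. It does not vanish at \<open>u\<close>, because \<open>u\<close> generates the unit ideal, but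
  it kills the commutator in \<open>s\<^sub>j [x\<^sub>j\<^sub>', u] = v\<^sub>j u\<close>.\<close>

lemma no_intertwiner:
  assumes u: "u \<in> carrier U" and 0: "!!j. j \<in> X ==> lact (\<tau> (\<delta> j)) u = \<zero>\<^sub>U"
    and gen: "!!z. z \<in> carrier U ==> \<exists>t\<in>carrier E. z = lact (\<tau> t) u" and j: "j \<in> X"
  shows "vc j = 0"
proof (rule ccontr)
  assume nz: "vc j \<noteq> 0"
  define \<alpha> where "\<alpha> i = (if i = j then - l / vc j else 0)" for i
  define \<chi> where "\<chi> = evalT (\<lambda>i. scal (\<alpha> i) :: (nat, 'k) tens)"
  have \<chi>_simps: "\<chi> (gen i) = scal (\<alpha> i)" "\<chi> (p * q) = \<chi> p * \<chi> q" "\<chi> (p + q) = \<chi> p + \<chi> q"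
    "\<chi> (scal c) = scal c" "\<chi> 1 = 1" "\<chi> 0 = 0" "\<chi> (p - q) = \<chi> p - \<chi> q" "\<chi> (\<Sum>i\<in>K. f i) = (\<Sum>i\<in>K. \<chi> (f i))"
    for i p q c K f
    by (simp_all add: \<chi>_def evalT_mult evalT_add evalT_diff evalT_sum)
  have comm: "scal a * scal b = (scal b * scal a :: (nat, 'k) tens)" for a b by (rule scal_central)
  have rng: "\<exists>c. \<chi> p = scal c" for p
  proof (induction p rule: tens_induct)
    case (single w c)
    have "\<exists>c. prod_list (map (\<lambda>i. scal (\<alpha> i) :: (nat, 'k) tens) w) = scal c"
      by (induction w) (auto simp: scal_mult[symmetric] intro: exI[of _ 1])
    then show ?case by (auto simp: \<chi>_def evalT_def scal_mult[symmetric])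
  qed (auto simp: \<chi>_simps scal_add[symmetric])
  have \<chi>_rel: "\<chi> rel = 0"
  proof -
    have "\<chi> rel0 = 0"
      unfolding rel0_def \<chi>_simps by (rule sg_sum_sym) (simp add: pa(2) comm)
    moreover have "\<chi> vec = (\<Sum>i\<in>X. if i = j then - scal l else 0)"
      unfolding vec_def \<chi>_simps
      by (rule sum.cong) (auto simp: \<alpha>_def scal_mult[symmetric] nz)
    then have "\<chi> vec = - scal l" using j by (simp add: sum.delta)
    ultimately show ?thesis unfolding rel_def \<chi>_simps by simp
  qed
  have \<chi>_I: "\<chi> p = 0" if "p \<in> I" for p
  proof -
    have "I \<subseteq> {p \<in> T. \<chi> p = 0}"
      by (rule I_subset_rel)
        (auto simp: \<chi>_rel \<chi>_simps rel_in intro: tens_space_add tens_space_mult)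
    then show ?thesis using that by blast
  qed
  obtain p where p: "p \<in> T" "u = cls p" by (rule A_obtain[OF u])
  have \<chi>p: "\<chi> p \<noteq> 0"
  proof
    assume p0: "\<chi> p = 0"
    have "\<exists>q\<in>T. lact t u = cls q \<and> \<chi> q = 0" if "t \<in> carrier E" for t
      using that
    proof (induction rule: E_induct)
      case (pure a b)
      then show ?case using p p0
        by (intro bexI[of _ "a * p * b"]) (simp_all add: lact_e \<chi>_simps tens_space_mult)
    next
      case (add s t)
      then obtain q q' where "q \<in> T" "lact s u = cls q" "\<chi> q = 0" "q' \<in> T" "lact t u = cls q'" "\<chi> q' = 0"
        by blast
      then show ?case using add(1,2) u
        by (intro bexI[of _ "q + q'"]) (simp_all add: lact_add cls_add \<chi>_simps tens_space_add)
    qed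
    moreover obtain t where "t \<in> carrier E" "\<one>\<^sub>U = lact (\<tau> t) u" using gen[OF U_one] by blast
    ultimately obtain q where q: "q \<in> T" "cls 1 = cls q" "\<chi> q = 0"
      using \<tau>_closed unfolding A_simps by metis
    have "1 - q \<in> I" using cls_eq_iff[OF tens_space_one q(1)] q(2) by blast
    then have "\<chi> (1 - q) = 0" by (rule \<chi>_I)
    then show False using q(3) by (simp add: \<chi>_simps)
  qed
  let ?g = "gen (pa j) :: (nat, 'k) tens"
  have pj: "pa j \<in> X" by (rule pa(1)[OF j])
  have g: "?g \<in> T" by (rule gen_in[OF pj])
  have yc: "y (pa j) \<in> carrier E" by (rule y_closed[OF pj])
  let ?q = "scal (sg j) * (?g * p - p * ?g) - scal (vc j) * p"
  have gp: "?g * p \<in> T" "p * ?g \<in> T" "?g * p - p * ?g \<in> T"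
    using g p(1) by (auto intro!: tens_space_mult tens_space_diff simp del: tens_space_gen)
  have qT: "?q \<in> T" by (intro tens_space_diff T_scal gp p(1))
  have ly: "lact (y (pa j)) (cls p) = cls (?g * p - p * ?g)"
    unfolding lact_y[OF pj cls_closed[OF p(1)]]
    by (simp only: cls_mult[OF g p(1)] cls_mult[OF p(1) g] cls_minus[OF gp(1,2)])
  have l\<kappa>: "lact (\<kappa> c) (cls r) = cls (scal c * r)" if "r \<in> T" for c r
    unfolding \<kappa>_def using lact_e[OF tens_space_scal tens_space_one that] by simp
  have "lact (\<tau> (\<delta> j)) u = lact (\<kappa> (sg j)) (lact (y (pa j)) u) \<ominus>\<^sub>U lact (\<kappa> (vc j)) u"
    unfolding \<tau>_\<delta>[OF j] using yc u by (simp add: a_minus_def lact_add lact_uminus lact_mult)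
  also have "\<dots> = cls ?q"
    unfolding p(2) ly l\<kappa>[OF gp(3)] l\<kappa>[OF p(1)] by (rule cls_minus) (intro T_scal gp p(1))+
  finally have "cls ?q = \<zero>\<^sub>U" using 0[OF j] by simp
  then have "?q \<in> I" using cls_zero_iff[OF qT] by blast
  then have "\<chi> ?q = 0" by (rule \<chi>_I)
  moreover obtain c where c: "\<chi> p = scal c" using rng by blast
  ultimately have "scal (vc j * c) = (0 :: (nat, 'k) tens)"
    by (simp add: \<chi>_simps comm scal_mult)
  then have "coef (scal (vc j * c) :: (nat, 'k) tens) [] = 0" by simp
  then have "vc j * c = 0" by (simp add: scal_def)
  then show False using nz \<chi>p c by simp
qed

theorem CY_iff: "calabi_yau 2 U \<longleftrightarrow> (\<forall>j\<in>X. vc j = 0)"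
proof
  assume cy: "calabi_yau 2 U"
  then have cy2: "lmod_isomorphic (opp E) (HH_env U 2) (env_right U)"
    by (simp add: calabi_yau_def E_eq)
  show "\<forall>j\<in>X. vc j = 0"
  proof (rule HH_iso)
    fix Q :: "nat => (_, ((nat, 'k) tens set env, (nat, 'k) tens set) res) module" and d \<epsilon>
    assume res: "projective_resolution E (env_left U) Q d \<epsilon>"
      and iso: "!!i. lmod_isomorphic (opp E) (dual_cohomology E Q d i) (HH_env U i)"
      and Q: "two_step.Q E (lab ` X) [] = Q" and d: "two_step.d E (lab ` X) [] (\<lambda>b. y (length b)) (\<lambda>b. \<delta> (length b)) = d"
    interpret S: two_step E "env_left U" "\<one>\<^sub>U" "lab ` X" "[] :: ((nat, 'k) tens set env + (nat, 'k) tens set) list"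
        "\<lambda>b. y (length b)" "\<lambda>b. \<delta> (length b)"
      by (rule two_step_U)
    have "lmod_isomorphic (opp E) (dual_cohomology E Q d 2) (env_right U)"
      by (rule lmod_isomorphic_trans[OF iso cy2 dual_cohomology_closed(2)[OF res]
          dual_cohomology_closed(3)[OF res]])
    then have i: "lmod_isomorphic (opp E) (dual_cohomology E S.Q S.d 2) (env_right U)"
      unfolding Q d .
    obtain u where u: "u \<in> carrier (env_right U)"
      "!!b. b \<in> (lab ` X :: ((nat, 'k) tens set env + (nat, 'k) tens set) list set) ==> \<delta> (length b) \<odot>\<^sub>(env_right U) u = \<zero>\<^sub>(env_right U)"
      "!!z. z \<in> carrier (env_right U) ==> \<exists>t\<in>carrier E. z = t \<odot>\<^sub>(env_right U) u"
      by (rule S.cohomology_two_generator[OF env_right_module i], rule that)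
    have uU: "u \<in> carrier U" using u(1) by simp
    show "\<forall>j\<in>X. vc j = 0"
    proof (intro ballI no_intertwiner[OF uU])
      show "lact (\<tau> (\<delta> j)) u = \<zero>\<^sub>U" if "j \<in> X" for j
        using u(2)[OF imageI[OF that]] env_right_smult[OF \<delta>_closed[OF that] uU] by simp
      show "\<exists>t\<in>carrier E. z = lact (\<tau> t) u" if "z \<in> carrier U" for z
        using u(3)[of z] that env_right_smult[OF _ uU] by auto
    qed
  qed
next
  assume "\<forall>j\<in>X. vc j = 0"
  then show "calabi_yau 2 U" by (intro CY_if) blast
qed

end

section \<open>The theorem\<close>

lemma linear_form_coordinates:
  fixes v :: "('x, 'k::field) tens"
  assumes "v \<in> tspan (gen ` X)" "finite X"
  shows "v = (\<Sum>x\<in>X. scal (coef v [x]) * gen x)"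
proof -
  have "tspan (gen ` X) \<subseteq> (tens_pow X 1 :: ('x, 'k) tens set)"
    by (rule tens.span_minimal) (auto intro: tens_subspaceI tens_pow_add tens_pow_scal)
  then show ?thesis using assms by (intro tens_pow_1) auto
qed

theorem theorem6p4:
  fixes n :: nat and v :: "(nat, 'k::field) tens" and l :: 'k
  assumes "even n" and "n \<ge> 2"
    and "v \<in> tspan (gen ` {1..n})"
  shows "koszul_filtered {1..n} (relator_space n v l) \<and>
    (\<forall>i. i \<noteq> 2 --> zero_module (HH_env (U_alg n v l) i)) \<and>
    (calabi_yau 2 (U_alg n v l) \<longleftrightarrow> v = 0)"
proof -
  obtain m where n: "n = 2 * m" using assms(1) by (rule evenE)
  have m: "m \<ge> 1" using assms(2) n by simp
  define vc where "vc j = coef v [j]" for j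
  interpret pbw m vc l "\<lambda>_. 0" 0
    by unfold_locales (use m in auto)
  have vec: "vec = v"
    unfolding vec_def vc_def
    by (rule linear_form_coordinates[symmetric]) (use assms(3) n in auto)
  have "relator n v l = rel"
    unfolding relator_def rel_def rel0_alt vec by (simp add: n)
  then have R: "relator_space n v l = Prel" by (simp add: relator_space_def)
  have U: "U_alg n v l = U" by (simp only: U_alg_def R) (simp add: n)
  have v0: "v = 0 \<longleftrightarrow> (\<forall>j\<in>X. vc j = 0)"
  proof
    assume "\<forall>j\<in>X. vc j = 0"
    then have "vec = 0" unfolding vec_def by (intro sum.neutral) simp
    then show "v = 0" by (simp only: vec)
  qed (simp add: vc_def)
  show ?thesis
    unfolding U R v0 using koszul_filtered HH_zero CY_iff by (simp add: n)
qed

end
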